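(* Let $p>1$ and let $f\in L^p(\nu)$ be such that $\mathbb{E}_\nu\left[(|f|+1)e^{-f}\right]<\infty$. Then $$-\log\mathbb{E}_\nu\left[e^{-f}\right]=\inf_{u\in\mathcal{D}^i}\mathbb{E}_\nu\left[f\circ W^u+\frac12|u|_H^2\right].$$
   Context: Notation. Let $n\ge 1$, $\mathbb{W}=C([0,1],\mathbb{R}^n)$, $H=\{\int_0^\cdot\dot h(s)ds:\dot h\in L^2([0,1],\mathbb{R}^n)\}$ with $|h|_H^2=\int_0^1|\dot h(s)|^2ds$. $W=(W(t))_{t\in[0,1]}$ is the coordinate process on $\mathbb{W}$ (so, as a map, $W=I_{\mathbb{W}}$, the identity). $\nu$ is a probability measure on $\mathbb{W}$; all filtrations are completed with respect to $\nu$, and $(\mathcal{F}_t)$ is the filtration of $W$. For $p\ge 0$, $L^p_a(\nu,H)$ is the set of $u\in L^p(\nu,H)$ whose density $\dot u$ is $(\mathcal{F}_t)$-adapted ($L^0$: all measurable maps). $\mathcal{D}=\{u\in L^0_a(\nu,H):\dot u \text{ is } d\nu\times dt\text{-a.s. bounded}\}$. For a $\nu$-Brownian motion $\beta$, $\delta_\beta u=\int_0^1\dot u(s)d\beta(s)$ and $\rho(-\delta_\beta u)=\exp\left(-\int_0^1\dot u(s)d\beta(s)-\frac12\int_0^1|\dot u(s)|^2ds\right)$. $U\nu$ denotes the image measure of $\nu$ under $U$. Standing assumption. There are an $\mathbb{R}^n$-valued $\nu$-Brownian motion $\beta$ defined on $\mathbb{W}$ and a family $(W^u)_{u\in\mathcal{D}}$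 of continuous processes on $\mathbb{W}$ (i.e. measurable maps $W^u:\mathbb{W}\to\mathbb{W}$) such that: (i) the canonical (completed) filtration of $\beta$ equals that of $W$; (ii) $W^0=W$; (iii) for every $u\in\mathcal{D}$, the law of $W^u$ under $\tilde\nu^u$, where $\frac{d\tilde\nu^u}{d\nu}=\rho(-\delta_\beta u)$, equals the law of $W$ under $\nu$; (iv) for every $u\in\mathcal{D}$, $\beta\circ W^u=\beta+u$ $\nu$-a.s.; (v) for all $u,v\in\mathcal{D}$, $W^u\circ W^v=W^{v+u\circ W^v}$ $\nu$-a.s. A measurable map $U:\mathbb{W}\to\mathbb{W}$ with $U\nu\sim\nu$ is called $\nu$-a.s. invertible if there is a measurable $V:\mathbb{W}\to\mathbb{W}$ with $V\nu\ll\nu$ and $V\circ U=I_{\mathbb{W}}$ $\nu$-a.s. (then also $U\circ V=I_{\mathbb{W}}$ $\nu$-a.s.). $\mathcal{D}^i=\{u\in\mathcal{D}: W^u\text{ is }\nu\text{-a.s. invertible}\}$. *)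

theory Defs
  imports "HOL-Probability.Probability"
begin

text \<open>
  The path space \<open>C([0,1], \<real>\<^sup>n)\<close>: a path is a function on \<open>{0..1}\<close> (set to \<open>undefined\<close>
  elsewhere, so that equality of paths is equality on \<open>{0..1}\<close>). The sigma-algebra is the one
  generated by the evaluations, which is the Borel sigma-algebra of the uniform norm.
\<close>

definition path_space :: "(real \<Rightarrow> real ^ 'n) measure" where
  "path_space = restrict_space (Pi\<^sub>M {0..1} (\<lambda>_. borel)) {w. continuous_on {0..1} w}"

definition path_add :: "(real \<Rightarrow> real ^ 'n) \<Rightarrow> (real \<Rightarrow> real ^ 'n) \<Rightarrow> real \<Rightarrow> real ^ 'n" where
  "path_add h k = (\<lambda>t\<in>{0..1}. h t + k t)"

definition path_zero :: "real \<Rightarrow> real ^ 'n" where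
  "path_zero = (\<lambda>t\<in>{0..1}. 0)"

abbreviation leb01 :: "real measure" where
  "leb01 \<equiv> restrict_space lborel {0..1}"

definition cm_density :: "(real \<Rightarrow> real ^ 'n) \<Rightarrow> (real \<Rightarrow> real ^ 'n) \<Rightarrow> bool" where
  "cm_density h g \<longleftrightarrow>
     g \<in> borel_measurable leb01 \<and>
     integrable leb01 (\<lambda>s. (norm (g s))\<^sup>2) \<and>
     (\<forall>t\<in>{0..1}. h t = (LINT s:{0..t}|leb01. g s))"

definition cameron_martin :: "(real \<Rightarrow> real ^ 'n) set" where
  "cameron_martin = {h \<in> space path_space. \<exists>g. cm_density h g}"

text \<open>The density of \<open>h \<in> cameron_martin\<close> is unique up to null sets, so the choice is immaterial.\<close>

definition cm_norm_sq :: "(real \<Rightarrow> real ^ 'n) \<Rightarrow> real" where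
  "cm_norm_sq h = (\<integral>s. (norm ((SOME g. cm_density h g) s))\<^sup>2 \<partial>leb01)"

text \<open>The filtration generated by the process \<open>X\<close>, augmented by all \<open>M\<close>-negligible sets.\<close>

definition completed_filtration ::
    "'a measure \<Rightarrow> ('a \<Rightarrow> real \<Rightarrow> real ^ 'n) \<Rightarrow> real \<Rightarrow> 'a measure" where
  "completed_filtration M X t =
     sigma (space M)
       ({(\<lambda>w. X w s) -` A \<inter> space M | s A. s \<in> {0..t} \<and> A \<in> sets borel}
        \<union> null_sets (completion M))"

definition brownian_motion :: "'a measure \<Rightarrow> ('a \<Rightarrow> real \<Rightarrow> real ^ 'n) \<Rightarrow> bool" where
  "brownian_motion M B \<longleftrightarrow>
     B \<in> measurable M path_space \<and>
     (AE w in M. B w 0 = 0) \<and>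
     (\<forall>s t. 0 \<le> s \<and> s < t \<and> t \<le> 1 \<longrightarrow>
        distributed M lborel (\<lambda>w. B w t - B w s)
          (\<lambda>x. ennreal (\<Prod>i\<in>UNIV. normal_density 0 (sqrt (t - s)) (x $ i)))) \<and>
     (\<forall>(k::nat) \<tau>. (\<forall>i\<le>k. \<tau> i \<in> {0..1}) \<and> (\<forall>i<k. \<tau> i \<le> \<tau> (Suc i)) \<longrightarrow>
        prob_space.indep_vars M (\<lambda>_. borel)
          (\<lambda>i w. B w (\<tau> (Suc i)) - B w (\<tau> i)) {..<k})"

text \<open>
  Ito integral over \<open>[0,1]\<close> with respect to \<open>B\<close>, as the \<open>L\<^sup>2\<close>-limit of integrals of simple
  processes \<open>\<Sum>i<k. 1\<^bsub>(\<tau> i, \<tau> (i + 1)]\<^esub> \<xi> i\<close>, where \<open>\<xi> i\<close> is bounded and measurable with respect to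
  \<open>F (\<tau> i)\<close>. Since \<open>F\<close> may contain \<open>M\<close>-negligible sets that are not in \<open>sets M\<close>, the
  \<open>L\<^sup>2\<close>-distances are taken over the completion of \<open>M\<close>.
\<close>

definition simple_process ::
    "'a measure \<Rightarrow> (real \<Rightarrow> 'a measure) \<Rightarrow> nat \<Rightarrow> (nat \<Rightarrow> real) \<Rightarrow> (nat \<Rightarrow> 'a \<Rightarrow> real ^ 'n) \<Rightarrow> bool"
where
  "simple_process M F k \<tau> \<xi> \<longleftrightarrow>
     (\<forall>i\<le>k. \<tau> i \<in> {0..1}) \<and> (\<forall>i<k. \<tau> i \<le> \<tau> (Suc i)) \<and>
     (\<forall>i<k. \<xi> i \<in> borel_measurable (F (\<tau> i)) \<and> (\<exists>C. \<forall>w\<in>space M. norm (\<xi> i w) \<le> C))"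

definition simple_value ::
    "nat \<Rightarrow> (nat \<Rightarrow> real) \<Rightarrow> (nat \<Rightarrow> 'a \<Rightarrow> real ^ 'n) \<Rightarrow> real \<Rightarrow> 'a \<Rightarrow> real ^ 'n" where
  "simple_value k \<tau> \<xi> t w = (\<Sum>i<k. indicator {\<tau> i<..\<tau> (Suc i)} t *\<^sub>R \<xi> i w)"

definition simple_ito ::
    "('a \<Rightarrow> real \<Rightarrow> real ^ 'n) \<Rightarrow> nat \<Rightarrow> (nat \<Rightarrow> real) \<Rightarrow> (nat \<Rightarrow> 'a \<Rightarrow> real ^ 'n) \<Rightarrow> 'a \<Rightarrow> real" where
  "simple_ito B k \<tau> \<xi> w = (\<Sum>i<k. \<xi> i w \<bullet> (B w (\<tau> (Suc i)) - B w (\<tau> i)))"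

definition has_ito_integral ::
    "'a measure \<Rightarrow> (real \<Rightarrow> 'a measure) \<Rightarrow> ('a \<Rightarrow> real \<Rightarrow> real ^ 'n) \<Rightarrow>
     (real \<Rightarrow> 'a \<Rightarrow> real ^ 'n) \<Rightarrow> ('a \<Rightarrow> real) \<Rightarrow> bool" where
  "has_ito_integral M F B g X \<longleftrightarrow>
     X \<in> borel_measurable M \<and>
     (\<exists>k \<tau> \<xi>. (\<forall>m::nat. simple_process M F (k m) (\<tau> m) (\<xi> m)) \<and>
        (\<lambda>m. \<integral>\<^sup>+ (t, w). ennreal ((norm (g t w - simple_value (k m) (\<tau> m) (\<xi> m) t w))\<^sup>2)
               \<partial>(leb01 \<Otimes>\<^sub>M completion M)) \<longlonglongrightarrow> 0 \<and>
        (\<lambda>m. \<integral>\<^sup>+ w. ennreal ((X w - simple_ito B (k m) (\<tau> m) (\<xi> m) w)\<^sup>2)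
               \<partial>(completion M)) \<longlonglongrightarrow> 0)"

text \<open>
  \<open>(\<F>\<^sub>t)\<close> is the completed filtration of the coordinate process, which is the identity map of the
  path space.
\<close>

abbreviation coord_filtration ::
    "(real \<Rightarrow> real ^ 'n) measure \<Rightarrow> real \<Rightarrow> (real \<Rightarrow> real ^ 'n) measure" where
  "coord_filtration \<nu> \<equiv> completed_filtration \<nu> (\<lambda>w. w)"

definition adapted_density ::
    "(real \<Rightarrow> real ^ 'n) measure \<Rightarrow> ((real \<Rightarrow> real ^ 'n) \<Rightarrow> real \<Rightarrow> real ^ 'n) \<Rightarrow>
     (real \<Rightarrow> (real \<Rightarrow> real ^ 'n) \<Rightarrow> real ^ 'n) \<Rightarrow> bool" where
  "adapted_density \<nu> u d \<longleftrightarrow>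
     (\<lambda>(t, w). d t w) \<in> borel_measurable (leb01 \<Otimes>\<^sub>M \<nu>) \<and>
     (\<forall>w\<in>space \<nu>. cm_density (u w) (\<lambda>t. d t w)) \<and>
     (\<forall>t\<in>{0..1}. d t \<in> borel_measurable (coord_filtration \<nu> t))"

text \<open>
  \<open>L\<^sup>0\<^sub>a(\<nu>, H)\<close> and \<open>\<D>\<close>. Elements are maps rather than classes modulo \<open>\<nu>\<close>-a.s. equality; every
  class has a representative with values in \<open>cameron_martin\<close> everywhere.
\<close>

definition L0_adapted ::
    "(real \<Rightarrow> real ^ 'n) measure \<Rightarrow> ((real \<Rightarrow> real ^ 'n) \<Rightarrow> real \<Rightarrow> real ^ 'n) set" where
  "L0_adapted \<nu> =
     {u \<in> measurable \<nu> path_space.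
        (\<forall>w\<in>space \<nu>. u w \<in> cameron_martin) \<and> (\<exists>d. adapted_density \<nu> u d)}"

definition bounded_drifts ::
    "(real \<Rightarrow> real ^ 'n) measure \<Rightarrow> ((real \<Rightarrow> real ^ 'n) \<Rightarrow> real \<Rightarrow> real ^ 'n) set" where
  "bounded_drifts \<nu> =
     {u \<in> L0_adapted \<nu>. \<exists>d C. adapted_density \<nu> u d \<and>
        (AE (t, w) in leb01 \<Otimes>\<^sub>M \<nu>. norm (d t w) \<le> C)}"

text \<open>
  \<open>\<delta>\<^sub>\<beta> u\<close>. Both the density and the Ito integral are unique up to null sets, so
  any two choices agree \<open>\<nu>\<close>-a.s.
\<close>

definition wiener_div ::
    "(real \<Rightarrow> real ^ 'n) measure \<Rightarrow> ((real \<Rightarrow> real ^ 'n) \<Rightarrow> real \<Rightarrow> real ^ 'n) \<Rightarrow>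
     ((real \<Rightarrow> real ^ 'n) \<Rightarrow> real \<Rightarrow> real ^ 'n) \<Rightarrow> (real \<Rightarrow> real ^ 'n) \<Rightarrow> real" where
  "wiener_div \<nu> \<beta> u =
     (SOME X. \<exists>d. adapted_density \<nu> u d \<and> has_ito_integral \<nu> (coord_filtration \<nu>) \<beta> d X)"

definition girsanov_density ::
    "(real \<Rightarrow> real ^ 'n) measure \<Rightarrow> ((real \<Rightarrow> real ^ 'n) \<Rightarrow> real \<Rightarrow> real ^ 'n) \<Rightarrow>
     ((real \<Rightarrow> real ^ 'n) \<Rightarrow> real \<Rightarrow> real ^ 'n) \<Rightarrow> (real \<Rightarrow> real ^ 'n) \<Rightarrow> real" where
  "girsanov_density \<nu> \<beta> u w = exp (- wiener_div \<nu> \<beta> u w - cm_norm_sq (u w) / 2)"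

text \<open>Note that \<open>absolutely_continuous M N\<close> means \<open>N \<lless> M\<close>.\<close>

definition as_invertible ::
    "(real \<Rightarrow> real ^ 'n) measure \<Rightarrow> ((real \<Rightarrow> real ^ 'n) \<Rightarrow> real \<Rightarrow> real ^ 'n) \<Rightarrow> bool" where
  "as_invertible \<nu> U \<longleftrightarrow>
     U \<in> measurable \<nu> path_space \<and>
     absolutely_continuous \<nu> (distr \<nu> path_space U) \<and>
     absolutely_continuous (distr \<nu> path_space U) \<nu> \<and>
     (\<exists>V \<in> measurable \<nu> path_space.
        absolutely_continuous \<nu> (distr \<nu> path_space V) \<and> (AE w in \<nu>. V (U w) = w))"

definition invertible_drifts ::
    "(real \<Rightarrow> real ^ 'n) measure \<Rightarrow>
     (((real \<Rightarrow> real ^ 'n) \<Rightarrow> real \<Rightarrow> real ^ 'n) \<Rightarrow> (real \<Rightarrow> real ^ 'n) \<Rightarrow> real \<Rightarrow> real ^ 'n) \<Rightarrow>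
     ((real \<Rightarrow> real ^ 'n) \<Rightarrow> real \<Rightarrow> real ^ 'n) set" where
  "invertible_drifts \<nu> W = {u \<in> bounded_drifts \<nu>. as_invertible \<nu> (W u)}"

end

theory Submission
 imports Defs "HOL-Probability.Probability"
begin

text \<open>
 The lower bound is entropic: Jensen's inequality under the Girsanov change of measure bounds
 \<open>- ln E exp (- f)\<close> by \<open>E (f (W u))\<close> plus half the energy. To avoid stochastic integration, a drift
 is delayed by one step of a grid, where it becomes predictable and Girsanov's formula is a finite
 product of Gaussian integrals; the delay disappears in the limit for trigonometric functions of
 the increments of \<open>\<beta>\<close>, and these are dense because \<open>\<beta>\<close> generates the sigma-algebra of the paths.
 The same formula bounds moments of \<open>f (W u)\<close>, which gives integrability.

 For the upper bound the density \<open>exp (- f) / E exp (- f)\<close> is approximated in \<open>L\<^sup>r\<close> by Girsanov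
 densities \<open>\<rho>\<close> of piecewise constant predictable drifts: a positive trigonometric function is a
 martingale along the grid with explicit increments, which is compared step by step with the
 exponential martingale having the same logarithmic derivative. A predictable grid drift can be
 inverted recursively, so it yields an invertible \<open>W u\<close> under which \<open>\<nu>\<close> has image \<open>\<rho> \<nu>\<close>, and its
 cost is \<open>E (\<rho> f + \<rho> ln \<rho>)\<close>.
\<close>

text \<open>The path \<open>\<beta>\<close> generates the coordinate filtration only up to null
  sets, so nothing can be read off from \<open>\<beta>\<close> pathwise: almost sure identities must
  be carried along the maps \<open>W u\<close>, and that needs image laws absolutely continuous with
  respect to \<nu>. For grid controls this follows from the positivity of the Girsanov density; for
  invertible drifts it is part of invertibility. Two principles then replace uniqueness theorems: an
  absolutely continuous law is determined by its trigonometric integrals, and a map with absolutely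
  continuous image that fixes \<open>\<beta>\<close> almost surely is the identity almost surely.
  The function f is unbounded on both sides. Clamping it at level R costs at most
  \<open>exp (- R)\<close> times the mean of \<bar>f\<bar>, because only large positive values
  contribute. The exponent r arises from pairing f in L^p with the error of the density, so it is at
  least p / (p - 1), and at least 2 for the quadratic error of x ln x. The approximating density
  carries its own scaling constant M; the cost then contains - ln M, and M has the right
  limit.\<close>

abbreviation seq_space :: "(nat \<Rightarrow> 'a :: topological_space) measure" where
 "seq_space \<equiv> PiM UNIV (\<lambda>_. borel)"

section \<open>Gaussian increments\<close>

text \<open>The law of a Brownian increment over a time span \<open>h\<close>. The density has the
  form used in \<open>brownian_motion\<close>, so that \<open>distributed\<close> yields this
  measure directly.\<close>

definition gauss :: "real \<Rightarrow> (real ^ 'n) measure" where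
 "gauss h = density lborel (\<lambda>x. ennreal (\<Prod>i\<in>UNIV. normal_density 0 (sqrt h) (x $ i)))"

lemma measurable_cis [measurable]: "cis \<in> borel_measurable borel"
 by (intro borel_measurable_continuous_onI continuous_intros)

lemma prod_Basis_vec: "(\<Prod>b\<in>Basis. F (x \<bullet> b)) = (\<Prod>i\<in>UNIV. F ((x :: real ^ 'n) $ i))"
proof -
 have B: "(Basis :: (real ^ 'n) set) = (\<lambda>i. axis i 1) ` UNIV"
  by (auto simp: Basis_vec_def)
 have inj: "inj (\<lambda>i. axis i 1 :: real ^ 'n)"
  by (auto simp: inj_on_def axis_eq_axis)
 show ?thesis
  unfolding B by (subst prod.reindex[OF inj]) (simp add: inner_axis o_def)
qed

lemma gauss_density_eq:
 assumes "h > 0"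
 shows "(\<Prod>i\<in>UNIV. normal_density 0 (sqrt h) ((x :: real ^ 'n) $ i))
     = (1 / sqrt (2 * pi * h)) ^ CARD('n) * exp (- (x \<bullet> x) / (2 * h))"
proof -
 have "(\<Prod>i\<in>UNIV. normal_density 0 (sqrt h) (x $ i))
    = (\<Prod>i\<in>UNIV. (1 / sqrt (2 * pi * h)) * exp (- (x $ i)\<^sup>2 / (2 * h)))"
  using assms by (simp add: normal_density_def)
 also have "\<dots> = (1 / sqrt (2 * pi * h)) ^ CARD('n) * exp (\<Sum>i\<in>UNIV. - (x $ i)\<^sup>2 / (2 * h))"
  by (simp only: prod.distrib exp_sum finite_UNIV prod_constant finite)
 also have "(\<Sum>i\<in>UNIV. - (x $ i)\<^sup>2 / (2 * h)) = - (x \<bullet> x) / (2 * h)"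
  by (simp add: inner_vec_def sum_divide_distrib sum_negf power2_eq_square)
 finally show ?thesis .
qed

lemma gauss_density_measurable [measurable]:
 "(\<lambda>x :: real ^ 'n. \<Prod>i\<in>UNIV. normal_density 0 (sqrt h) (x $ i)) \<in> borel_measurable borel"
 by (intro borel_measurable_prod measurable_compose[OF _ borel_measurable_normal_density]) auto

lemma sets_gauss [simp, measurable_cong]: "sets (gauss h) = sets borel"
 and space_gauss [simp]: "space (gauss h) = UNIV"
 by (auto simp: gauss_def)

lemma prob_space_gauss:
 assumes "h > 0" shows "prob_space (gauss h :: (real ^ 'n) measure)"
proof
 have "emeasure (gauss h :: (real ^ 'n) measure) (space (gauss h))
   = (\<integral>\<^sup>+x. (\<Prod>b\<in>Basis. ennreal (normal_density 0 (sqrt h) (x \<bullet> b))) \<partial>(lborel :: (real ^ 'n) measure))"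
  unfolding gauss_def
  by (subst emeasure_density)
    (auto simp: prod_Basis_vec prod_ennreal normal_density_nonneg intro!: nn_integral_cong)
 also have "\<dots> = (\<Prod>b\<in>(Basis :: (real^'n) set). (\<integral>\<^sup>+x. ennreal (normal_density 0 (sqrt h) x) \<partial>lborel))"
  by (rule nn_integral_lborel_prod) auto
 also have "(\<integral>\<^sup>+x. ennreal (normal_density 0 (sqrt h) x) \<partial>lborel) = 1"
  using assms by (subst nn_integral_eq_integral) (auto simp: integral_normal_density normal_density_nonneg)
 finally show "emeasure (gauss h :: (real ^ 'n) measure) (space (gauss h)) = 1" by simp
qed

lemma nn_integral_lborel_plus:
 fixes f :: "'a::euclidean_space \<Rightarrow> ennreal"
 assumes [measurable]: "f \<in> borel_measurable borel"
 shows "(\<integral>\<^sup>+x. f (c + x) \<partial>lborel) = (\<integral>\<^sup>+x. f x \<partial>lborel)"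
 by (subst (2) lborel_distr_plus[of c, symmetric]) (simp add: nn_integral_distr)

text \<open>Completing the square: the weight turns the Gaussian density at \<open>y\<close> into
  the density at \<open>y + h *\<^sub>R c\<close>, and Lebesgue measure is translation invariant.
  This is Girsanov's formula for a single increment.\<close>

lemma nn_integral_gauss_shift:
 fixes g :: "real ^ 'n \<Rightarrow> ennreal"
 assumes h: "h > 0" and [measurable]: "g \<in> borel_measurable borel"
 shows "(\<integral>\<^sup>+y. ennreal (exp (- (c \<bullet> y) - h * (c \<bullet> c) / 2)) * g (y + h *\<^sub>R c) \<partial>gauss h)
     = (\<integral>\<^sup>+y. g y \<partial>gauss h)"
proof -
 let ?d = "\<lambda>x :: real ^ 'n. \<Prod>i\<in>UNIV. normal_density 0 (sqrt h) (x $ i)"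
 have d: "?d y * exp (- (c \<bullet> y) - h * (c \<bullet> c) / 2) = ?d (h *\<^sub>R c + y)" for y
 proof -
  have "exp (- (y \<bullet> y) / (2 * h)) * exp (- (c \<bullet> y) - h * (c \<bullet> c) / 2)
    = exp (- ((h *\<^sub>R c + y) \<bullet> (h *\<^sub>R c + y)) / (2 * h))"
   unfolding exp_add[symmetric] using h
   by (intro arg_cong[where f = exp]) (simp add: inner_simps field_simps inner_commute power2_eq_square)
  then show ?thesis by (simp only: gauss_density_eq[OF h] mult.assoc)
 qed
 have nn: "0 \<le> ?d x" for x by (intro prod_nonneg) (simp add: normal_density_nonneg)
 have "(\<integral>\<^sup>+y. ennreal (exp (- (c \<bullet> y) - h * (c \<bullet> c) / 2)) * g (y + h *\<^sub>R c) \<partial>gauss h)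
   = (\<integral>\<^sup>+y. ennreal (?d y) * (ennreal (exp (- (c \<bullet> y) - h * (c \<bullet> c) / 2)) * g (y + h *\<^sub>R c)) \<partial>lborel)"
  unfolding gauss_def by (subst nn_integral_density) auto
 also have "\<dots> = (\<integral>\<^sup>+y. ennreal (?d (h *\<^sub>R c + y)) * g (h *\<^sub>R c + y) \<partial>lborel)"
  by (intro nn_integral_cong)
    (simp only: d[symmetric] ennreal_mult'[OF nn] mult.assoc add.commute[of _ "h *\<^sub>R c"])
 also have "\<dots> = (\<integral>\<^sup>+y. ennreal (?d y) * g y \<partial>lborel)"
  by (rule nn_integral_lborel_plus) simp
 also have "\<dots> = (\<integral>\<^sup>+y. g y \<partial>gauss h)"
  unfolding gauss_def by (subst nn_integral_density) auto
 finally show ?thesis .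
qed

lemma distr_gauss_uminus:
 assumes "h > 0" shows "distr (gauss h) borel uminus = (gauss h :: (real ^ 'n) measure)"
proof -
 have *: "lborel = distr lborel borel (uminus :: real ^ 'n \<Rightarrow> _)"
  by (subst lborel_affine[of "-1" "0 :: real ^ 'n"]) (auto simp: density_1)
 show ?thesis
 proof (rule measure_eqI)
  fix A assume "A \<in> sets (distr (gauss h) borel (uminus :: real ^ 'n \<Rightarrow> real ^ 'n))"
  then have [measurable]: "A \<in> sets borel" by simp
  let ?d = "\<lambda>x :: real ^ 'n. \<Prod>i\<in>UNIV. normal_density 0 (sqrt h) (x $ i)"
  have [measurable]: "(\<lambda>x. - x) -` A \<in> sets borel"
   using measurable_sets[of "uminus :: real ^ 'n \<Rightarrow> _" borel borel A] by simp
  have "emeasure (distr (gauss h) borel uminus) A = emeasure (gauss h) (uminus -` A)"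
   by (subst emeasure_distr) auto
  also have "\<dots> = (\<integral>\<^sup>+x. ennreal (?d x) * indicator (uminus -` A) x \<partial>lborel)"
   unfolding gauss_def by (subst emeasure_density) auto
  also have "\<dots> = (\<integral>\<^sup>+x. ennreal (?d (-x)) * indicator A (-x) \<partial>lborel)"
   by (intro nn_integral_cong) (simp only: gauss_density_eq[OF assms] indicator_def inner_minus_left inner_minus_right minus_minus vimage_eq)
  also have "\<dots> = (\<integral>\<^sup>+x. ennreal (?d x) * indicator A x \<partial>lborel)"
   by (subst (2) *) (simp add: nn_integral_distr)
  also have "\<dots> = emeasure (gauss h) A"
   unfolding gauss_def by (subst emeasure_density) auto
  finally show "emeasure (distr (gauss h) borel uminus) A = emeasure (gauss h) A" .
 qed auto
qed

lemma integral_gauss_odd: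
 fixes f :: "real ^ 'n \<Rightarrow> real"
 assumes "h > 0" and [measurable]: "f \<in> borel_measurable borel" and odd: "\<And>y. f (- y) = - f y"
 shows "(\<integral>y. f y \<partial>gauss h) = 0"
proof -
 have "(\<integral>y. f y \<partial>gauss h) = (\<integral>y. f y \<partial>distr (gauss h) borel uminus)"
  by (simp only: distr_gauss_uminus[OF assms(1)])
 also have "\<dots> = (\<integral>y. f (- y) \<partial>gauss h)" by (subst integral_distr) auto
 also have "\<dots> = - (\<integral>y. f y \<partial>gauss h)" by (simp add: odd)
 finally show ?thesis by simp
qed

text \<open>The shift formula for the constant 1 and the vector \<open>- c\<close>, solved for the
  exponential moment.\<close>

lemma nn_integral_gauss_exp:
 fixes c :: "real ^ 'n"
 assumes h: "h > 0"
 shows "(\<integral>\<^sup>+y. ennreal (exp (c \<bullet> y)) \<partial>gauss h) = ennreal (exp (h * (c \<bullet> c) / 2))"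
proof -
 interpret prob_space "gauss h :: (real ^ 'n) measure" by (rule prob_space_gauss[OF h])
 have "1 = (\<integral>\<^sup>+y. ennreal (exp (- ((- c) \<bullet> y) - h * ((- c) \<bullet> (- c)) / 2)) * 1 \<partial>gauss h)"
  using nn_integral_gauss_shift[OF h, of "\<lambda>_. 1" "- c"] emeasure_space_1 by simp
 also have "\<dots> = (\<integral>\<^sup>+y. ennreal (exp (- h * (c \<bullet> c) / 2)) * ennreal (exp (c \<bullet> y)) \<partial>gauss h)"
  by (intro nn_integral_cong) (simp add: ennreal_mult'[symmetric] exp_add[symmetric] algebra_simps)
 also have "\<dots> = ennreal (exp (- h * (c \<bullet> c) / 2)) * (\<integral>\<^sup>+y. ennreal (exp (c \<bullet> y)) \<partial>gauss h)"
  by (rule nn_integral_cmult) auto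
 finally have "ennreal (exp (h * (c \<bullet> c) / 2)) * 1 = ennreal (exp (h * (c \<bullet> c) / 2)) *
   (ennreal (exp (- h * (c \<bullet> c) / 2)) * (\<integral>\<^sup>+y. ennreal (exp (c \<bullet> y)) \<partial>gauss h))"
  by simp
 then show ?thesis
  by (simp add: mult.assoc[symmetric] ennreal_mult'[symmetric] exp_add[symmetric])
qed

lemma has_bochner_integral_gauss_exp:
 fixes c :: "real ^ 'n"
 assumes h: "h > 0"
 shows "has_bochner_integral (gauss h) (\<lambda>y. exp (c \<bullet> y)) (exp (h * (c \<bullet> c) / 2))"
 by (rule has_bochner_integral_nn_integral) (auto simp: nn_integral_gauss_exp[OF h])

text \<open>Density and character both factor over the coordinates, and each factor is a standard
  normal characteristic function after rescaling by \<open>sqrt h\<close>. These exact values later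
  make the trigonometric martingale explicit.\<close>

lemma integral_gauss_cis:
 fixes c :: "real ^ 'n"
 assumes h: "h > 0"
 shows "(\<integral>y. cis (c \<bullet> y) \<partial>gauss h) = complex_of_real (exp (- h * (c \<bullet> c) / 2))"
proof -
 have 1: "has_bochner_integral lborel (\<lambda>x. normal_density 0 (sqrt h) x *\<^sub>R cis (t * x))
   (complex_of_real (exp (- h * t\<^sup>2 / 2)))" for t :: real
 proof -
  have i: "integrable lborel (\<lambda>x. normal_density 0 (sqrt h) x *\<^sub>R cis (t * x))"
   by (rule Bochner_Integration.integrable_bound[of _ "normal_density 0 (sqrt h)"])
     (use h in \<open>auto simp: normal_density_nonneg intro!: integrable_normal_density\<close>)
  have "(\<integral>x. normal_density 0 (sqrt h) x *\<^sub>R cis (t * x) \<partial>lborel)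
    = sqrt h *\<^sub>R (\<integral>x. normal_density 0 (sqrt h) (sqrt h * x) *\<^sub>R cis (t * (sqrt h * x)) \<partial>lborel)"
   using h by (subst lborel_integral_real_affine[where c = "sqrt h" and t = 0]) auto
  also have "\<dots> = (\<integral>x. std_normal_density x *\<^sub>R cis (t * sqrt h * x) \<partial>lborel)"
   unfolding integral_scaleR_right[symmetric] using h
   by (intro Bochner_Integration.integral_cong)
     (auto simp: normal_density_def real_sqrt_mult power_mult_distrib mult.assoc)
  also have "\<dots> = char std_normal_distribution (t * sqrt h)"
   unfolding char_def by (subst integral_density) (auto simp: normal_density_nonneg cis_conv_exp mult_ac)
  also have "\<dots> = complex_of_real (exp (- h * t\<^sup>2 / 2))"
   using h by (simp add: char_std_normal_distribution power_mult_distrib mult.commute)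
  finally show ?thesis using i by (simp add: has_bochner_integral_iff)
 qed
 interpret product_sigma_finite "\<lambda>_ :: real ^ 'n. lborel :: real measure" ..
 let ?f = "\<lambda>b t. normal_density 0 (sqrt h) t *\<^sub>R cis ((c \<bullet> b) * t)"
 have pt: "(\<Prod>i\<in>UNIV. normal_density 0 (sqrt h) (x $ i)) *\<^sub>R cis (c \<bullet> x)
    = (\<Prod>b\<in>Basis. ?f b (x \<bullet> b))" for x :: "real ^ 'n"
 proof -
  have "cis (c \<bullet> x) = (\<Prod>b\<in>Basis. cis ((c \<bullet> b) * (x \<bullet> b)))"
   by (simp add: cis_conv_exp exp_sum[symmetric] euclidean_inner[of c x] sum_distrib_left)
  then show ?thesis
   by (simp add: prod_Basis_vec[symmetric] prod.distrib scaleR_conv_of_real)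
 qed
 have "(\<integral>y. cis (c \<bullet> y) \<partial>gauss h)
   = (\<integral>x. (\<Prod>b\<in>Basis. ?f b (x \<bullet> b)) \<partial>(lborel :: (real ^ 'n) measure))"
  unfolding gauss_def pt[symmetric] by (subst integral_density) (auto intro!: prod_nonneg normal_density_nonneg)
 also have "\<dots> = (\<integral>z. (\<Prod>b\<in>Basis. ?f b (z b)) \<partial>(\<Pi>\<^sub>M b\<in>(Basis :: (real ^ 'n) set). lborel))"
  by (subst lborel_eq, subst integral_distr)
    (auto intro!: Bochner_Integration.integral_cong prod.cong simp: inner_sum_left inner_Basis if_distrib sum.delta cong: if_cong)
 also have "\<dots> = (\<Prod>b\<in>Basis. \<integral>t. ?f b t \<partial>lborel)"
  by (rule product_integral_prod) (use 1 in \<open>auto simp: has_bochner_integral_iff\<close>)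
 also have "\<dots> = (\<Prod>b\<in>Basis. complex_of_real (exp (- h * (c \<bullet> b)\<^sup>2 / 2)))"
  by (intro prod.cong refl has_bochner_integral_integral_eq 1)
 also have "\<dots> = complex_of_real (exp (\<Sum>b\<in>Basis. - h * (c \<bullet> b)\<^sup>2 / 2))"
  by (simp add: exp_sum)
 also have "(\<Sum>b\<in>Basis. - h * (c \<bullet> b)\<^sup>2 / 2) = - h * (c \<bullet> c) / 2"
  by (simp add: euclidean_inner[of c c] power2_eq_square sum_divide_distrib sum_distrib_left sum_negf)
 finally show ?thesis .
qed

lemma power4_le_exp: "(s::real) ^ 4 \<le> 24 * (exp s + exp (- s))"
proof -
 have *: "s ^ 4 \<le> 24 * exp s" if "s \<ge> 0" for s :: real
 proof -
  have "(\<lambda>n. s ^ n /\<^sub>R fact n) sums exp s" by (rule exp_converges)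
  \<comment> \<open>The term of degree 4 alone is below the exponential series; 4! = 24.\<close>
  then have "(\<Sum>n\<in>{4}. s ^ n /\<^sub>R fact n) \<le> exp s"
   unfolding sums_iff using that sum_le_suminf[of "\<lambda>n. s ^ n /\<^sub>R fact n" "{4}"] by auto
  then show ?thesis by (simp add: fact_numeral field_simps)
 qed
 show ?thesis
 proof (cases "s \<ge> 0")
  case True
  then show ?thesis using *[of s] exp_gt_zero[of "-s"] by argo
 next
  case False
  then show ?thesis using *[of "-s"] exp_gt_zero[of "s"] by (auto intro: add_increasing)
 qed
qed

text \<open>Only the order \<open>h\<^sup>2\<close> matters later. The constant is crude:
  Cauchy-Schwarz and the sum over coordinates give \<open>CARD('n)\<close> twice,
  \<open>power4_le_exp\<close> gives 24, and the two exponential moments give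
  \<open>2 * exp (1/2) \<le> 4\<close>.\<close>

lemma nn_integral_gauss_norm4:
 assumes h: "h > 0"
 shows "(\<integral>\<^sup>+y. ennreal (norm y ^ 4) \<partial>(gauss h :: (real ^ 'n) measure)) \<le> ennreal (96 * real CARD('n) ^ 2 * h\<^sup>2)"
proof -
 \<comment> \<open>Scaled so that \<open>exp (a i \<bullet> y)\<close> has the Gaussian mean
   \<open>exp (1/2)\<close> for every \<open>h\<close>; undoing the scaling of a fourth power
   produces \<open>h\<^sup>2\<close>.\<close>
 define a :: "'n \<Rightarrow> real ^ 'n" where "a i = axis i (1 / sqrt h)" for i
 have aa: "h * (a i \<bullet> a i) / 2 = 1 / 2" for i
  using h by (simp add: a_def inner_axis_axis)
 have pt: "norm y ^ 4 \<le> (\<Sum>i\<in>UNIV. real CARD('n) * (24 * h\<^sup>2 * (exp (a i \<bullet> y) + exp ((- a i) \<bullet> y))))" for y :: "real ^ 'n"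
 proof -
  have "norm y ^ 4 = (\<Sum>i\<in>UNIV. (y $ i)\<^sup>2)\<^sup>2"
  proof -
   have "norm y ^ 4 = ((norm y)\<^sup>2)\<^sup>2" by simp
   also have "(norm y)\<^sup>2 = (\<Sum>i\<in>UNIV. (y $ i)\<^sup>2)"
    by (simp add: norm_vec_def L2_set_def sum_nonneg)
   finally show ?thesis .
  qed
  also have "\<dots> \<le> real CARD('n) * (\<Sum>i\<in>UNIV. ((y $ i)\<^sup>2)\<^sup>2)"
   using sum_squared_le_sum_of_squares[where I = UNIV and f = "\<lambda>i. (y $ i)\<^sup>2"] by (simp add: mult.commute)
  also have "\<dots> \<le> real CARD('n) * (\<Sum>i\<in>UNIV. 24 * h\<^sup>2 * (exp (a i \<bullet> y) + exp ((- a i) \<bullet> y)))"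
  proof (intro mult_left_mono sum_mono)
   fix i
   have e: "a i \<bullet> y = y $ i / sqrt h" by (simp add: a_def inner_axis' )
   have "((y $ i)\<^sup>2)\<^sup>2 = h\<^sup>2 * (y $ i / sqrt h) ^ 4"
    using h by (simp add: power_divide power4_eq_xxxx power2_eq_square)
   also have "\<dots> \<le> h\<^sup>2 * (24 * (exp (y $ i / sqrt h) + exp (- (y $ i / sqrt h))))"
    by (intro mult_left_mono power4_le_exp) simp
   finally show "((y $ i)\<^sup>2)\<^sup>2 \<le> 24 * h\<^sup>2 * (exp (a i \<bullet> y) + exp ((- a i) \<bullet> y))"
    by (simp add: e mult_ac)
  qed simp
  finally show ?thesis by (simp add: sum_distrib_left)
 qed
 have "(\<integral>\<^sup>+y. ennreal (norm y ^ 4) \<partial>(gauss h :: (real ^ 'n) measure))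
   \<le> (\<integral>\<^sup>+y. (\<Sum>i\<in>UNIV. ennreal (real CARD('n) * 24 * h\<^sup>2) * (ennreal (exp (a i \<bullet> y)) + ennreal (exp ((- a i) \<bullet> y)))) \<partial>gauss h)"
 proof (intro nn_integral_mono order_trans[OF ennreal_leI[OF pt]])
  fix y :: "real ^ 'n"
  have "(\<Sum>i\<in>UNIV. ennreal (real CARD('n) * 24 * h\<^sup>2) * (ennreal (exp (a i \<bullet> y)) + ennreal (exp ((- a i) \<bullet> y))))
    = (\<Sum>i\<in>UNIV. ennreal (real CARD('n) * (24 * h\<^sup>2 * (exp (a i \<bullet> y) + exp ((- a i) \<bullet> y)))))"
   by (intro sum.cong refl) (simp only: ennreal_plus[symmetric] ennreal_mult'[symmetric] exp_ge_zero mult.assoc add_nonneg_nonneg zero_le_power2 of_nat_0_le_iff zero_le_numeral mult_nonneg_nonneg)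
  also have "\<dots> = ennreal (\<Sum>i\<in>UNIV. real CARD('n) * (24 * h\<^sup>2 * (exp (a i \<bullet> y) + exp ((- a i) \<bullet> y))))"
   by (intro sum_ennreal) (auto intro!: mult_nonneg_nonneg add_nonneg_nonneg)
  finally show "ennreal (\<Sum>i\<in>UNIV. real CARD('n) * (24 * h\<^sup>2 * (exp (a i \<bullet> y) + exp ((- a i) \<bullet> y))))
    \<le> (\<Sum>i\<in>UNIV. ennreal (real CARD('n) * 24 * h\<^sup>2) * (ennreal (exp (a i \<bullet> y)) + ennreal (exp ((- a i) \<bullet> y))))"
   by simp
 qed
 also have "\<dots> = (\<Sum>i::'n\<in>UNIV. ennreal (real CARD('n) * 24 * h\<^sup>2) * (ennreal (exp (1/2)) + ennreal (exp (1/2))))"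
 proof -
  have "(\<integral>\<^sup>+y. K * (ennreal (exp (a i \<bullet> y)) + ennreal (exp ((- a i) \<bullet> y))) \<partial>gauss h)
    = K * (ennreal (exp (1/2)) + ennreal (exp (1/2)))" for i K
  proof -
   have "(- a i) \<bullet> (- a i) = a i \<bullet> a i" by simp
   then have "(\<integral>\<^sup>+y. ennreal (exp (a i \<bullet> y)) \<partial>gauss h) = ennreal (exp (1/2))"
     "(\<integral>\<^sup>+y. ennreal (exp ((- a i) \<bullet> y)) \<partial>gauss h) = ennreal (exp (1/2))"
    by (simp_all only: nn_integral_gauss_exp[OF h] aa)
   then show ?thesis
    by (subst nn_integral_cmult, simp, subst nn_integral_add) simp_all
  qed
  then show ?thesis by (subst nn_integral_sum) simp_all
 qed
 also have "\<dots> = ennreal (real CARD('n) ^ 2 * 48 * h\<^sup>2 * exp (1/2))"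
 proof -
  have "(\<Sum>i::'n\<in>UNIV. ennreal (real CARD('n) * 24 * h\<^sup>2) * (ennreal (exp (1/2)) + ennreal (exp (1/2))))
    = (\<Sum>i::'n\<in>UNIV. ennreal (real CARD('n) * 24 * h\<^sup>2 * (exp (1/2) + exp (1/2))))"
   by (intro sum.cong refl) (simp add: ennreal_plus[symmetric] ennreal_mult'[symmetric] del: ennreal_plus)
  also have "\<dots> = ennreal (\<Sum>i::'n\<in>UNIV. real CARD('n) * 24 * h\<^sup>2 * (exp (1/2) + exp (1/2)))"
   by (intro sum_ennreal) (auto intro!: mult_nonneg_nonneg add_nonneg_nonneg)
  also have "(\<Sum>i::'n\<in>UNIV. real CARD('n) * 24 * h\<^sup>2 * (exp (1/2) + exp (1/2))) = real CARD('n) ^ 2 * 48 * h\<^sup>2 * exp (1/2)"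
   by (simp add: power2_eq_square)
  finally show ?thesis .
 qed
 also have "\<dots> \<le> ennreal (96 * real CARD('n) ^ 2 * h\<^sup>2)"
 proof (intro ennreal_leI)
  have "exp (1/2::real) \<le> 2" using exp_bound[of "1/2"] by (simp add: power2_eq_square)
  then have "real CARD('n) ^ 2 * 48 * h\<^sup>2 * exp (1/2) \<le> real CARD('n) ^ 2 * 48 * h\<^sup>2 * 2"
   by (intro mult_left_mono) auto
  then show "real CARD('n) ^ 2 * 48 * h\<^sup>2 * exp (1/2) \<le> 96 * real CARD('n) ^ 2 * h\<^sup>2" by simp
 qed
 finally show ?thesis .
qed

section \<open>Brownian motion and its completed filtration\<close>

locale brownian = prob_space M for M :: "'a measure" +
 fixes B :: "'a \<Rightarrow> real \<Rightarrow> real ^ 'n"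
 assumes bm: "brownian_motion M B"
begin

abbreviation FB :: "real \<Rightarrow> 'a measure" where "FB t \<equiv> completed_filtration M B t"

lemma B_path: "B \<in> measurable M path_space"
 using bm by (simp add: brownian_motion_def)

lemma B_space: "w \<in> space M \<Longrightarrow> B w \<in> space path_space"
 using B_path by (rule measurable_space)

lemma B_measurable: "(\<lambda>w. B w t) \<in> borel_measurable M"
proof (cases "t \<in> {0..1}")
 case True
 have "(\<lambda>b. b t) \<in> borel_measurable path_space"
  unfolding path_space_def by (intro measurable_restrict_space1 measurable_component_singleton True)
 with B_path show ?thesis by (rule measurable_compose)
next
 case False
 have "B w t = undefined" if "w \<in> space M" for w
  using B_space[OF that] False by (auto simp: path_space_def space_restrict_space space_PiM PiE_def extensional_def)
 then show ?thesis by (subst measurable_cong[where g = "\<lambda>_. undefined"]) auto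
qed

lemma B_0: "AE w in M. B w 0 = 0"
 using bm by (simp add: brownian_motion_def)

end

lemma filtration_gen_subset:
 "{(\<lambda>w. X w s) -` A \<inter> space M |s A. s \<in> {0..t} \<and> A \<in> sets borel} \<union> null_sets (completion M) \<subseteq> Pow (space M)"
 using sets.sets_into_space[of _ "completion M"] by (auto simp: null_sets_def)

lemma space_completed_filtration [simp]: "space (completed_filtration M X t) = space M"
 unfolding completed_filtration_def by (rule space_measure_of[OF filtration_gen_subset])

lemma sets_completed_filtration:
 "sets (completed_filtration M X t) = sigma_sets (space M)
   ({(\<lambda>w. X w s) -` A \<inter> space M |s A. s \<in> {0..t} \<and> A \<in> sets borel} \<union> null_sets (completion M))"
 unfolding completed_filtration_def by (rule sets_measure_of[OF filtration_gen_subset])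

lemma filtration_mono:
 assumes "s \<le> t"
 shows "sets (completed_filtration M X s) \<subseteq> sets (completed_filtration M X t)"
 unfolding sets_completed_filtration using assms by (intro sigma_sets_subseteq) fastforce

lemma measurable_filtration_mono:
 assumes "s \<le> t" "f \<in> measurable (completed_filtration M X s) N"
 shows "f \<in> measurable (completed_filtration M X t) N"
 using measurable_mono[OF order_refl refl filtration_mono[OF assms(1)]] assms(2) by auto

lemma filtration_coord_measurable:
 assumes "s \<in> {0..t}"
 shows "(\<lambda>w. X w s) \<in> borel_measurable (completed_filtration M X t)"
 using assms by (intro measurableI) (auto simp: sets_completed_filtration intro!: sigma_sets.Basic)

lemma filtration_subset_completion:
 fixes X :: "'a \<Rightarrow> real \<Rightarrow> real ^ 'n"
 assumes "\<And>s. s \<in> {0..t} \<Longrightarrow> (\<lambda>w. X w s) \<in> borel_measurable M"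
 shows "sets (completed_filtration M X t) \<subseteq> sets (completion M)"
 unfolding sets_completed_filtration
proof (rule sets.sigma_sets_subset[of _ "completion M", unfolded space_completion], safe)
 fix s and A :: "(real ^ 'n) set" assume "s \<in> {0..t}" "A \<in> sets borel"
 then show "(\<lambda>w. X w s) -` A \<inter> space M \<in> sets (completion M)"
  using measurable_sets[OF assms, of s A] by auto
qed auto

text \<open>The events that agree almost surely with an event of the path on \<open>{0..t}\<close>
  form a sigma-algebra; it contains the coordinate events, and the null sets correspond to the empty
  set. Thus the augmented filtration can be traded for the raw one.\<close>

lemma filtration_set_approx:
 fixes X :: "'a \<Rightarrow> real \<Rightarrow> real ^ 'n"
 assumes "E \<in> sets (completed_filtration M X t)"
 shows "\<exists>Z\<in>sets (PiM {0..t} (\<lambda>_. borel)). AE w in M. w \<in> E \<longleftrightarrow> restrict (X w) {0..t} \<in> Z"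
 using assms unfolding sets_completed_filtration
proof (induction rule: sigma_sets.induct)
 case (Basic a)
 then consider s A where "s \<in> {0..t}" "A \<in> sets borel" "a = (\<lambda>w. X w s) -` A \<inter> space M"
  | "a \<in> null_sets (completion M)" by auto
 then show ?case
 proof cases
  case 1
  let ?P = "PiM {0..t} (\<lambda>_. borel) :: (real \<Rightarrow> real ^ 'n) measure"
  have "(\<lambda>z. z s) -` A \<inter> space ?P \<in> sets ?P"
   by (rule measurable_sets[OF measurable_component_singleton[OF 1(1)] 1(2)])
  moreover have "AE w in M. w \<in> a \<longleftrightarrow> restrict (X w) {0..t} \<in> (\<lambda>z. z s) -` A \<inter> space ?P"
   using AE_space by eventually_elim (use 1 in \<open>simp add: space_PiM\<close>)
  ultimately show ?thesis by blast
 next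
  case 2
  then have "AE w in M. w \<notin> a" using AE_not_in[OF 2] by (simp only: AE_completion_iff)
  then show ?thesis by (intro bexI[of _ "{}"]) auto
 qed
next
 case Empty
 then show ?case by (intro bexI[of _ "{}"]) auto
next
 case (Compl a)
 then obtain Z where Z: "Z \<in> sets (PiM {0..t} (\<lambda>_. borel))" "AE w in M. w \<in> a \<longleftrightarrow> restrict (X w) {0..t} \<in> Z" by blast
 show ?case
 proof (rule bexI[of _ "space (PiM {0..t} (\<lambda>_. borel)) - Z"])
  show "AE w in M. w \<in> space M - a \<longleftrightarrow> restrict (X w) {0..t} \<in> space (PiM {0..t} (\<lambda>_. borel)) - Z"
  proof -
   have sp: "restrict (X w) {0..t} \<in> space (PiM {0..t} (\<lambda>_. borel))" for w
    by (simp only: space_PiM restrict_PiE_iff space_borel UNIV_I) blast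
   show ?thesis using Z(2) AE_space by eventually_elim (use sp in blast)
  qed
  show "space (PiM {0..t} (\<lambda>_. borel)) - Z \<in> sets (PiM {0..t} (\<lambda>_. borel))"
   using Z(1) by (rule sets.compl_sets)
 qed
next
 case (Union a)
 then have "\<forall>i. \<exists>Z. Z \<in> sets (PiM {0..t} (\<lambda>_. borel)) \<and> (AE w in M. w \<in> a i \<longleftrightarrow> restrict (X w) {0..t} \<in> Z)"
  by blast
 from choice[OF this] obtain Z where Z: "\<And>i. Z i \<in> sets (PiM {0..t} (\<lambda>_. borel))"
   "\<And>i. AE w in M. w \<in> a i \<longleftrightarrow> restrict (X w) {0..t} \<in> Z i" by blast
 have "AE w in M. \<forall>i. w \<in> a i \<longleftrightarrow> restrict (X w) {0..t} \<in> Z i"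
  unfolding AE_all_countable using Z(2) by blast
 then have "AE w in M. w \<in> (\<Union>i. a i) \<longleftrightarrow> restrict (X w) {0..t} \<in> (\<Union>i. Z i)"
  by eventually_elim blast
 moreover have "(\<Union>i. Z i) \<in> sets (PiM {0..t} (\<lambda>_. borel))"
  using Z(1) by (intro sets.countable_UN) blast
 ultimately show ?case by blast
qed

context brownian
begin

lemma FB_subset: "sets (FB t) \<subseteq> sets (completion M)"
 by (rule filtration_subset_completion) (rule B_measurable)

lemma measurable_FB_completion: "f \<in> measurable (FB t) N \<Longrightarrow> f \<in> measurable (completion M) N"
 using measurable_mono[OF order_refl refl FB_subset] by auto

lemma B_FB: "s \<in> {0..t} \<Longrightarrow> (\<lambda>w. B w s) \<in> borel_measurable (FB t)"
 by (rule filtration_coord_measurable)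

text \<open>The definition of Brownian motion speaks of consecutive increments. Since
  \<open>B\<close> starts at 0 almost surely, values at finitely many past times are partial sums of
  increments, all of which come before the one from \<open>s\<close> to \<open>t\<close>.\<close>

lemma indep_past_finite:
 assumes J: "finite J" "J \<subseteq> {0..s}" and st: "0 \<le> s" "s < t" "t \<le> 1"
  and E: "\<And>j. j \<in> J \<Longrightarrow> E j \<in> sets borel" and C: "C \<in> sets borel"
 shows "prob {w\<in>space M. (\<forall>j\<in>J. B w j \<in> E j) \<and> B w t - B w s \<in> C}
    = prob {w\<in>space M. \<forall>j\<in>J. B w j \<in> E j} * prob {w\<in>space M. B w t - B w s \<in> C}"
proof -
 define xs where "xs = sorted_list_of_set J"
 define m where "m = length xs"
 \<comment> \<open>Starting at 0 makes the partial sums equal to the values of \<open>B\<close>;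
   with \<open>s\<close> and \<open>t\<close> at the end, the increment of index
   \<open>m + 1\<close> is the future one and those below it are the past.\<close>
 define zs where "zs = 0 # xs @ [s, t]"
 define \<tau> where "\<tau> i = (if i < length zs then zs ! i else t)" for i
 have xs: "set xs = J" "sorted xs" using J by (auto simp: xs_def)
 have lz: "length zs = m + 3" by (simp add: zs_def m_def)
 have "sorted zs" unfolding zs_def using xs J st by (auto simp: sorted_append)
 then have mono: "\<tau> i \<le> \<tau> (Suc i)" if "i < m + 2" for i
  using that by (auto simp: \<tau>_def lz intro!: sorted_nth_mono)
 have zs01: "set zs \<subseteq> {0..1}" using xs J st by (auto simp: zs_def)
 have \<tau>01: "\<tau> i \<in> {0..1}" for i
  using zs01 st unfolding \<tau>_def by (auto dest: nth_mem)
 have \<tau>0: "\<tau> 0 = 0" by (simp add: \<tau>_def zs_def)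
 have \<tau>x: "\<tau> (Suc j) = xs ! j" if "j < m" for j
  using that by (simp add: \<tau>_def zs_def m_def nth_append)
 have \<tau>s: "\<tau> (m + 1) = s" "\<tau> (m + 2) = t"
  by (auto simp: \<tau>_def zs_def m_def nth_append)
 define I where "I i w = B w (\<tau> (Suc i)) - B w (\<tau> i)" for i w
 have ind: "indep_vars (\<lambda>_. borel) I {..<m+2}"
  using bm \<tau>01 mono unfolding brownian_motion_def I_def by blast
 have ind2: "indep_var (PiM {..<m+1} (\<lambda>_. borel)) (\<lambda>w. restrict (\<lambda>i. I i w) {..<m+1})
   (PiM {m+1} (\<lambda>_. borel)) (\<lambda>w. restrict (\<lambda>i. I i w) {m+1})"
  by (rule indep_var_restrict[OF ind]) auto
 define G where "G = {z \<in> space (PiM {..<m+1} (\<lambda>_. borel)). \<forall>j<m. (\<Sum>i<Suc j. z i) \<in> E (xs ! j)}"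
 define H where "H = {z \<in> space (PiM {m+1} (\<lambda>_. borel)). z (m+1) \<in> C}"
 have G: "G \<in> sets (PiM {..<m+1} (\<lambda>_. borel))"
 proof -
  let ?P = "PiM {..<m+1} (\<lambda>_. borel :: (real^'n) measure)"
  have 1: "E (xs ! j) \<in> sets borel" if "j < m" for j using that E xs by (auto simp: m_def)
  have 2: "(\<lambda>z. (\<Sum>i<Suc j. z i)) \<in> borel_measurable ?P" if "j < m" for j
   using that by (intro borel_measurable_sum measurable_component_singleton) auto
  have "{z \<in> space ?P. (\<Sum>i<Suc j. z i) \<in> E (xs ! j)} \<in> sets ?P" if "j \<in> {..<m}" for j
   using measurable_sets[OF 2 1, of j j] that by (simp only: vimage_def Int_def lessThan_iff mem_Collect_eq conj_commute)
  then have "{z \<in> space ?P. \<forall>j\<in>{..<m}. (\<Sum>i<Suc j. z i) \<in> E (xs ! j)} \<in> sets ?P"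
   by (intro sets.sets_Collect_finite_All) auto
  then show ?thesis unfolding G_def by (simp only: Ball_def lessThan_iff)
 qed
 have H: "H \<in> sets (PiM {m+1} (\<lambda>_. borel))"
  using measurable_sets[OF measurable_component_singleton[of "m+1" "{m+1}" "\<lambda>_. borel"] C]
  by (simp add: H_def vimage_def Int_def conj_commute)
 have sumI: "(\<Sum>i<Suc j. I i w) = B w (\<tau> (Suc j)) - B w 0" for j w
  by (induction j) (auto simp: I_def \<tau>0)
 have Gw: "restrict (\<lambda>i. I i w) {..<m+1} \<in> G \<longleftrightarrow> (\<forall>j\<in>J. B w j \<in> E j)" if "B w 0 = 0" for w
 proof -
  have "restrict (\<lambda>i. I i w) {..<m+1} \<in> G \<longleftrightarrow> (\<forall>j<m. (\<Sum>i<Suc j. I i w) \<in> E (xs ! j))"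
   unfolding G_def by (auto simp: space_PiM)
  also have "\<dots> \<longleftrightarrow> (\<forall>j<m. B w (xs ! j) \<in> E (xs ! j))"
   unfolding sumI using that \<tau>x by auto
  also have "\<dots> \<longleftrightarrow> (\<forall>j\<in>J. B w j \<in> E j)"
   unfolding xs(1)[symmetric] m_def by (metis in_set_conv_nth)
  finally show ?thesis .
 qed
 have Hw: "restrict (\<lambda>i. I i w) {m+1} \<in> H \<longleftrightarrow> B w t - B w s \<in> C" for w
  unfolding H_def I_def using \<tau>s by (auto simp: space_PiM)
 have rvG: "(\<lambda>w. restrict (\<lambda>i. I i w) {..<m+1}) \<in> measurable M (PiM {..<m+1} (\<lambda>_. borel))"
  by (intro measurable_restrict) (auto simp: I_def intro!: borel_measurable_diff B_measurable)
 have [measurable]: "(\<lambda>w. B w j) \<in> borel_measurable M" for j by (rule B_measurable)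
 have P1: "{w\<in>space M. \<forall>j\<in>J. B w j \<in> E j} \<in> sets M"
 proof (intro sets.sets_Collect_finite_All)
  fix j assume "j \<in> J"
  then show "{w \<in> space M. B w j \<in> E j} \<in> sets M"
   using measurable_sets[OF B_measurable E, of j j] by (simp add: vimage_def Int_def conj_commute)
 qed (rule J)
 have P2: "{w\<in>space M. B w t - B w s \<in> C} \<in> sets M"
  using measurable_sets[OF borel_measurable_diff[OF B_measurable B_measurable] C, of t s]
  by (simp add: vimage_def Int_def conj_commute)
 have "prob {w\<in>space M. (\<forall>j\<in>J. B w j \<in> E j) \<and> B w t - B w s \<in> C}
   = prob ((\<lambda>w. (restrict (\<lambda>i. I i w) {..<m+1}, restrict (\<lambda>i. I i w) {m+1})) -` (G \<times> H) \<inter> space M)"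
 proof (rule measure_eq_AE)
  show "AE w in M. w \<in> {w\<in>space M. (\<forall>j\<in>J. B w j \<in> E j) \<and> B w t - B w s \<in> C} \<longleftrightarrow>
    w \<in> (\<lambda>w. (restrict (\<lambda>i. I i w) {..<m+1}, restrict (\<lambda>i. I i w) {m+1})) -` (G \<times> H) \<inter> space M"
   using B_0 by eventually_elim (use Gw Hw in blast)
  have "{w\<in>space M. (\<forall>j\<in>J. B w j \<in> E j) \<and> B w t - B w s \<in> C}
   = {w\<in>space M. \<forall>j\<in>J. B w j \<in> E j} \<inter> {w\<in>space M. B w t - B w s \<in> C}" by auto
  then show "{w\<in>space M. (\<forall>j\<in>J. B w j \<in> E j) \<and> B w t - B w s \<in> C} \<in> sets M" using P1 P2 by auto
  show "(\<lambda>w. (restrict (\<lambda>i. I i w) {..<m+1}, restrict (\<lambda>i. I i w) {m+1})) -` (G \<times> H) \<inter> space M \<in> sets M"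
   using indep_var_rv1[OF ind2] indep_var_rv2[OF ind2] G H
   by (intro measurable_sets[of _ _ "PiM {..<m+1} (\<lambda>_. borel) \<Otimes>\<^sub>M PiM {m+1} (\<lambda>_. borel)"] measurable_Pair pair_measureI)
 qed
 also have "\<dots> = prob ((\<lambda>w. restrict (\<lambda>i. I i w) {..<m+1}) -` G \<inter> space M) * prob ((\<lambda>w. restrict (\<lambda>i. I i w) {m+1}) -` H \<inter> space M)"
  by (rule indep_varD[OF ind2 G H])
 also have "prob ((\<lambda>w. restrict (\<lambda>i. I i w) {..<m+1}) -` G \<inter> space M) = prob {w\<in>space M. \<forall>j\<in>J. B w j \<in> E j}"
 proof (rule measure_eq_AE)
  show "AE w in M. w \<in> (\<lambda>w. restrict (\<lambda>i. I i w) {..<m+1}) -` G \<inter> space M \<longleftrightarrow> w \<in> {w\<in>space M. \<forall>j\<in>J. B w j \<in> E j}"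
   using B_0 by eventually_elim (use Gw in blast)
 qed (use P1 measurable_sets[OF rvG G] in auto)
 also have "(\<lambda>w. restrict (\<lambda>i. I i w) {m+1}) -` H \<inter> space M = {w\<in>space M. B w t - B w s \<in> C}"
  using Hw by auto
 finally show ?thesis .
qed

text \<open>The cylinder sets are an intersection-stable generator of the past, and so are the
  events of the increment; independence on generators extends to the generated
  sigma-algebras.\<close>

lemma indep_past:
 assumes st: "0 \<le> s" "s < t" "t \<le> 1"
  and Z: "Z \<in> sets (PiM {0..s} (\<lambda>_. borel))" and C: "C \<in> sets borel"
 shows "prob ((\<lambda>w. restrict (B w) {0..s}) -` Z \<inter> space M \<inter> ((\<lambda>w. B w t - B w s) -` C \<inter> space M))
  = prob ((\<lambda>w. restrict (B w) {0..s}) -` Z \<inter> space M) * prob ((\<lambda>w. B w t - B w s) -` C \<inter> space M)"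
proof -
 let ?P = "PiM {0..s} (\<lambda>_. borel :: (real^'n) measure)"
 let ?X = "\<lambda>w. restrict (B w) {0..s}"
 have [measurable]: "(\<lambda>w. B w j) \<in> borel_measurable M" for j by (rule B_measurable)
 have rv1: "?X \<in> measurable M ?P"
  by (intro measurable_restrict) auto
 have rv2: "(\<lambda>w. B w t - B w s) \<in> borel_measurable M" by measurable
 have e1: "{?X -` A \<inter> space M |A. A \<in> sets ?P} = sigma_sets (space M) {?X -` A \<inter> space M |A. A \<in> prod_algebra {0..s} (\<lambda>_. borel)}"
  unfolding sets_PiM by (rule sigma_sets_vimage_commute) (auto simp: space_PiM)
 have e1': "sigma_sets (space M) {?X -` A \<inter> space M |A. A \<in> sets ?P}
   = sigma_sets (space M) {?X -` A \<inter> space M |A. A \<in> prod_algebra {0..s} (\<lambda>_. borel)}"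
  unfolding e1 by (rule sigma_sets_sigma_sets_eq) auto
 have "indep_set (sigma_sets (space M) {?X -` A \<inter> space M |A. A \<in> sets ?P})
   (sigma_sets (space M) {(\<lambda>w. B w t - B w s) -` A \<inter> space M |A. A \<in> sets borel})"
  unfolding e1'
 proof (rule indep_set_sigma_sets)
  show "Int_stable {?X -` A \<inter> space M |A. A \<in> prod_algebra {0..s} (\<lambda>_. borel)}"
   unfolding Int_stable_def
  proof safe
   fix A A' :: "(real \<Rightarrow> real^'n) set" assume "A \<in> prod_algebra {0..s} (\<lambda>_. borel)" "A' \<in> prod_algebra {0..s} (\<lambda>_. borel)"
   then have "A \<inter> A' \<in> prod_algebra {0..s} (\<lambda>_. borel)"
    using Int_stable_prod_algebra unfolding Int_stable_def by blast
   then show "\<exists>Aa. ?X -` A \<inter> space M \<inter> (?X -` A' \<inter> space M) = ?X -` Aa \<inter> space M \<and> Aa \<in> prod_algebra {0..s} (\<lambda>_. borel)"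
    by (intro exI[of _ "A \<inter> A'"]) auto
  qed
  show "Int_stable {(\<lambda>w. B w t - B w s) -` A \<inter> space M |A. A \<in> sets borel}"
   unfolding Int_stable_def
  proof safe
   fix A A' :: "(real^'n) set" assume "A \<in> sets borel" "A' \<in> sets borel"
   then show "\<exists>Aa. (\<lambda>w. B w t - B w s) -` A \<inter> space M \<inter> ((\<lambda>w. B w t - B w s) -` A' \<inter> space M) = (\<lambda>w. B w t - B w s) -` Aa \<inter> space M \<and> Aa \<in> sets borel"
    by (intro exI[of _ "A \<inter> A'"]) auto
  qed
  show "indep_set {?X -` A \<inter> space M |A. A \<in> prod_algebra {0..s} (\<lambda>_. borel)}
   {(\<lambda>w. B w t - B w s) -` A \<inter> space M |A. A \<in> sets borel}"
  proof (rule indep_setI)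
   show "{?X -` A \<inter> space M |A. A \<in> prod_algebra {0..s} (\<lambda>_. borel)} \<subseteq> events"
    using measurable_sets[OF rv1] by (auto simp: sets_PiM)
   show "{(\<lambda>w. B w t - B w s) -` A \<inter> space M |A. A \<in> sets borel} \<subseteq> events"
    using measurable_sets[OF rv2] by auto
   fix a b assume "a \<in> {?X -` A \<inter> space M |A. A \<in> prod_algebra {0..s} (\<lambda>_. borel)}"
    "b \<in> {(\<lambda>w. B w t - B w s) -` A \<inter> space M |A. A \<in> sets borel}"
   then obtain A C where A: "A \<in> prod_algebra {0..s} (\<lambda>_. borel)" "a = ?X -` A \<inter> space M"
    and C: "C \<in> sets borel" "b = (\<lambda>w. B w t - B w s) -` C \<inter> space M" by auto
   from A(1) obtain J E where J: "A = prod_emb {0..s} (\<lambda>_. borel) J (\<Pi>\<^sub>E j\<in>J. E j)"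
    "finite J" "J \<subseteq> {0..s}" "\<And>i. i \<in> J \<Longrightarrow> E i \<in> sets borel" by (elim prod_algebraE) auto
   have a: "a = {w\<in>space M. \<forall>j\<in>J. B w j \<in> E j}"
    unfolding A(2) J(1) using J(3) by (auto simp: prod_emb_def PiE_iff subset_eq)
   have b: "b = {w\<in>space M. B w t - B w s \<in> C}" using C by auto
   have ab: "a \<inter> b = {w\<in>space M. (\<forall>j\<in>J. B w j \<in> E j) \<and> B w t - B w s \<in> C}" unfolding a b by auto
   show "prob (a \<inter> b) = prob a * prob b"
    unfolding ab unfolding a b by (rule indep_past_finite) (use J C st in auto)
  qed
 qed
 then show ?thesis
  unfolding indep_sets2_eq using Z C by (blast intro: sigma_sets.Basic)
qed

lemma distr_increment:
 assumes st: "0 \<le> s" "s < t" "t \<le> 1"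
 shows "distr M borel (\<lambda>w. B w t - B w s) = gauss (t - s)"
proof -
 have "distributed M lborel (\<lambda>w. B w t - B w s)
     (\<lambda>x. ennreal (\<Prod>i\<in>UNIV. normal_density 0 (sqrt (t - s)) (x $ i)))"
  using bm st unfolding brownian_motion_def by blast
 then have "distr M lborel (\<lambda>w. B w t - B w s) = gauss (t - s)"
  unfolding gauss_def by (rule distributed_distr_eq_density)
 moreover have "distr M borel (\<lambda>w. B w t - B w s) = distr M lborel (\<lambda>w. B w t - B w s)"
  by (rule distr_cong) auto
 ultimately show ?thesis by (simp only:)
qed

text \<open>The past is represented by the point \<open>w\<close> itself, seen through
  \<open>FB s\<close>. Fubini then covers every integrand that depends on \<open>w\<close> through
  \<open>FB s\<close> and on the increment. The completion appears because \<open>FB s\<close>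
  contains negligible sets outside \<open>sets M\<close>.\<close>

lemma distr_past_increment:
 assumes st: "0 \<le> s" "s < t" "t \<le> 1"
 shows "distr (completion M) (FB s \<Otimes>\<^sub>M borel) (\<lambda>w. (w, B w t - B w s))
    = distr (completion M) (FB s) (\<lambda>w. w) \<Otimes>\<^sub>M gauss (t - s)"
proof -
 interpret C: prob_space "completion M" by (rule prob_space_completion)
 have id: "(\<lambda>w. w) \<in> measurable (completion M) (FB s)"
  by (rule measurable_FB_completion[of _ s]) simp
 have [measurable]: "(\<lambda>w. B w j) \<in> borel_measurable M" for j by (rule B_measurable)
 have D: "(\<lambda>w. B w t - B w s) \<in> borel_measurable (completion M)"
  by (intro measurable_completion) measurable
 interpret D1: prob_space "distr (completion M) (FB s) (\<lambda>w. w)" by (rule C.prob_space_distr[OF id])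
 interpret D2: prob_space "gauss (t - s) :: (real^'n) measure" by (rule prob_space_gauss) (use st in simp)
 have pm: "(\<lambda>w. (w, B w t - B w s)) \<in> measurable (completion M) (FB s \<Otimes>\<^sub>M borel)"
  by (rule measurable_Pair[OF id D])
 show ?thesis
 proof (rule pair_measure_eqI[symmetric])
  show "sets (distr (completion M) (FB s) (\<lambda>w. w) \<Otimes>\<^sub>M gauss (t - s)) =
    sets (distr (completion M) (FB s \<Otimes>\<^sub>M borel) (\<lambda>w. (w, B w t - B w s)))"
   by (subst sets_pair_measure_cong[OF sets_distr sets_gauss]) simp
  fix E and C :: "(real^'n) set" assume "E \<in> sets (distr (completion M) (FB s) (\<lambda>w. w))" "C \<in> sets (gauss (t - s))"
  then have E: "E \<in> sets (FB s)" and C: "C \<in> sets borel" by auto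
  then have EC: "E \<in> sets (completion M)" using FB_subset by auto
  obtain Z where Z: "Z \<in> sets (PiM {0..s} (\<lambda>_. borel))" "AE w in M. w \<in> E \<longleftrightarrow> restrict (B w) {0..s} \<in> Z"
   using filtration_set_approx[OF E] by auto
  have rv1: "(\<lambda>w. restrict (B w) {0..s}) \<in> measurable M (PiM {0..s} (\<lambda>_. borel))"
   by (intro measurable_restrict) auto
  let ?E = "(\<lambda>w. restrict (B w) {0..s}) -` Z \<inter> space M"
  let ?C = "(\<lambda>w. B w t - B w s) -` C \<inter> space M"
  have sE: "?E \<in> sets M" by (rule measurable_sets[OF rv1 Z(1)])
  have sC: "?C \<in> sets M" using C by (intro measurable_sets[of _ _ borel]) auto
  have "emeasure (distr (completion M) (FB s \<Otimes>\<^sub>M borel) (\<lambda>w. (w, B w t - B w s))) (E \<times> C)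
    = emeasure (completion M) (E \<inter> ?C)"
   using E C sets.sets_into_space[OF EC] by (subst emeasure_distr[OF pm]) (auto intro!: arg_cong2[where f=emeasure])
  also have "\<dots> = emeasure (completion M) (?E \<inter> ?C)"
  proof (rule emeasure_eq_AE)
   show "AE w in completion M. w \<in> E \<inter> ?C \<longleftrightarrow> w \<in> ?E \<inter> ?C"
    using AE_completion[OF Z(2)] AE_space by eventually_elim auto
  qed (use EC sE sC in auto)
  also have "\<dots> = ennreal (prob (?E \<inter> ?C))"
   using sE sC by (simp add: emeasure_eq_measure)
  also have "prob (?E \<inter> ?C) = prob ?E * prob ?C"
   by (rule indep_past[OF st Z(1) C])
  also have "ennreal (prob ?E * prob ?C) = emeasure (completion M) ?E * emeasure M ?C"
   using sE sC by (simp add: emeasure_eq_measure ennreal_mult')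
  also have "emeasure (completion M) ?E = emeasure (completion M) E"
  proof (rule emeasure_eq_AE)
   show "AE w in completion M. w \<in> ?E \<longleftrightarrow> w \<in> E"
    using AE_completion[OF Z(2)] AE_space by eventually_elim auto
  qed (use EC sE in auto)
  also have "\<dots> = emeasure (distr (completion M) (FB s) (\<lambda>w. w)) E"
   using E sets.sets_into_space[OF EC] by (subst emeasure_distr[OF id]) (auto intro!: arg_cong2[where f=emeasure])
  also have "emeasure M ?C = emeasure (gauss (t - s)) C"
   unfolding distr_increment[OF st, symmetric] using C by (subst emeasure_distr) auto
  finally show "emeasure (distr (completion M) (FB s) (\<lambda>w. w)) E * emeasure (gauss (t - s)) C
    = emeasure (distr (completion M) (FB s \<Otimes>\<^sub>M borel) (\<lambda>w. (w, B w t - B w s))) (E \<times> C)" by simp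
 qed (rule D1.sigma_finite_measure_axioms, rule D2.sigma_finite_measure_axioms)
qed

text \<open>Freezing the past and integrating the increment alone; this takes the place of
  conditional expectation given \<open>FB s\<close> in the grid computations.\<close>

lemma nn_integral_increment:
 assumes st: "0 \<le> s" "s < t" "t \<le> 1" and \<phi>: "\<phi> \<in> borel_measurable (FB s \<Otimes>\<^sub>M borel)"
 shows "(\<integral>\<^sup>+w. \<phi> (w, B w t - B w s) \<partial>M) = (\<integral>\<^sup>+w. (\<integral>\<^sup>+y. \<phi> (w, y) \<partial>gauss (t - s)) \<partial>M)"
proof -
 interpret D2: prob_space "gauss (t - s) :: (real^'n) measure" by (rule prob_space_gauss) (use st in simp)
 have id: "(\<lambda>w. w) \<in> measurable (completion M) (FB s)"
  by (rule measurable_FB_completion[of _ s]) simp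
 have [measurable]: "(\<lambda>w. B w j) \<in> borel_measurable M" for j by (rule B_measurable)
 have D: "(\<lambda>w. B w t - B w s) \<in> borel_measurable (completion M)"
  by (intro measurable_completion) measurable
 have \<phi>': "\<phi> \<in> borel_measurable (FB s \<Otimes>\<^sub>M gauss (t - s))"
  using \<phi> by (subst measurable_cong_sets[OF sets_pair_measure_cong[OF refl sets_gauss] refl])
 have \<phi>'': "\<phi> \<in> borel_measurable (distr (completion M) (FB s) (\<lambda>w. w) \<Otimes>\<^sub>M gauss (t - s))"
  using \<phi> by (subst measurable_cong_sets[OF sets_pair_measure_cong[OF sets_distr sets_gauss] refl])
 have "(\<integral>\<^sup>+w. \<phi> (w, B w t - B w s) \<partial>M) = (\<integral>\<^sup>+w. \<phi> (w, B w t - B w s) \<partial>completion M)"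
  by (simp add: nn_integral_completion)
 also have "\<dots> = (\<integral>\<^sup>+z. \<phi> z \<partial>(distr (completion M) (FB s \<Otimes>\<^sub>M borel) (\<lambda>w. (w, B w t - B w s))))"
  by (subst nn_integral_distr) (auto intro!: measurable_Pair id D \<phi>)
 also have "\<dots> = (\<integral>\<^sup>+w. (\<integral>\<^sup>+y. \<phi> (w, y) \<partial>gauss (t - s)) \<partial>distr (completion M) (FB s) (\<lambda>w. w))"
  unfolding distr_past_increment[OF st] by (rule D2.nn_integral_fst[symmetric]) (rule \<phi>'')
 also have "\<dots> = (\<integral>\<^sup>+w. (\<integral>\<^sup>+y. \<phi> (w, y) \<partial>gauss (t - s)) \<partial>completion M)"
  by (intro nn_integral_distr[OF id] D2.borel_measurable_nn_integral_fst \<phi>'')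
 finally show ?thesis by (simp add: nn_integral_completion)
qed

text \<open>Stated over the completion because an \<open>FB s\<close>-measurable integrand need not
  be \<open>M\<close>-measurable, and the Bochner integral of a non-measurable function is 0 by
  convention. Non-negative integrals do not have this problem: they agree over \<open>M\<close> and
  its completion.\<close>

lemma integral_increment:
 fixes \<phi> :: "_ \<Rightarrow> real"
 assumes st: "0 \<le> s" "s < t" "t \<le> 1" and \<phi>: "\<phi> \<in> borel_measurable (FB s \<Otimes>\<^sub>M borel)"
  and int: "integrable (completion M) (\<lambda>w. \<phi> (w, B w t - B w s))"
 shows "(\<integral>w. \<phi> (w, B w t - B w s) \<partial>completion M) = (\<integral>w. (\<integral>y. \<phi> (w, y) \<partial>gauss (t - s)) \<partial>completion M)"
proof -
 interpret C: prob_space "completion M" by (rule prob_space_completion)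
 interpret D2: prob_space "gauss (t - s) :: (real^'n) measure" by (rule prob_space_gauss) (use st in simp)
 have id: "(\<lambda>w. w) \<in> measurable (completion M) (FB s)"
  by (rule measurable_FB_completion[of _ s]) simp
 interpret D1: prob_space "distr (completion M) (FB s) (\<lambda>w. w)" by (rule C.prob_space_distr[OF id])
 interpret P: pair_sigma_finite "distr (completion M) (FB s) (\<lambda>w. w)" "gauss (t - s) :: (real^'n) measure" ..
 have [measurable]: "(\<lambda>w. B w j) \<in> borel_measurable M" for j by (rule B_measurable)
 have D: "(\<lambda>w. B w t - B w s) \<in> borel_measurable (completion M)"
  by (intro measurable_completion) measurable
 have pm: "(\<lambda>w. (w, B w t - B w s)) \<in> measurable (completion M) (FB s \<Otimes>\<^sub>M borel)"
  by (rule measurable_Pair[OF id D])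
 have \<phi>': "\<phi> \<in> borel_measurable (FB s \<Otimes>\<^sub>M gauss (t - s))"
  using \<phi> by (subst measurable_cong_sets[OF sets_pair_measure_cong[OF refl sets_gauss] refl])
 have int': "integrable (distr (completion M) (FB s) (\<lambda>w. w) \<Otimes>\<^sub>M gauss (t - s)) \<phi>"
  unfolding distr_past_increment[OF st, symmetric] using int by (subst integrable_distr_eq[OF pm \<phi>])
 have "(\<integral>w. \<phi> (w, B w t - B w s) \<partial>completion M)
   = (\<integral>z. \<phi> z \<partial>(distr (completion M) (FB s \<Otimes>\<^sub>M borel) (\<lambda>w. (w, B w t - B w s))))"
  by (subst integral_distr[OF pm \<phi>]) simp
 also have "\<dots> = (\<integral>w. (\<integral>y. \<phi> (w, y) \<partial>gauss (t - s)) \<partial>distr (completion M) (FB s) (\<lambda>w. w))"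
  unfolding distr_past_increment[OF st] by (rule P.integral_fst'[symmetric]) (rule int')
 also have "\<dots> = (\<integral>w. (\<integral>y. \<phi> (w, y) \<partial>gauss (t - s)) \<partial>completion M)"
  by (intro integral_distr id D2.borel_measurable_lebesgue_integral) (use \<phi>' in simp)
 finally show ?thesis .
qed

end

section \<open>Trigonometric functions of increments\<close>

text \<open>The default 0 from index \<open>N\<close> on makes the increments on every grid points
  of the single space \<open>seq_space\<close>.\<close>

definition inc :: "nat \<Rightarrow> (real \<Rightarrow> real ^ 'n) \<Rightarrow> nat \<Rightarrow> real ^ 'n" where
 "inc N b s = (if s < N then b ((real s + 1) / real N) - b (real s / real N) else 0)"

definition theta :: "nat \<Rightarrow> (nat \<Rightarrow> real ^ 'n) \<Rightarrow> (nat \<Rightarrow> real ^ 'n) \<Rightarrow> real" where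
 "theta N l x = (\<Sum>s<N. l s \<bullet> x s)"

text \<open>The complex coefficient covers sine and cosine at once. Each term may have its own grid,
  so closure under addition is immediate; \<open>trig_rep\<close> recovers a common grid.\<close>

inductive_set trig :: "((real \<Rightarrow> real ^ 'n) \<Rightarrow> real) set" where
 base: "N > 0 \<Longrightarrow> (\<lambda>b. Re (c * cis (theta N l (inc N b)))) \<in> trig"
| add: "f \<in> trig \<Longrightarrow> g \<in> trig \<Longrightarrow> (\<lambda>b. f b + g b) \<in> trig"

lemma sum_inc_refine:
 assumes "K > 0" "m > 0" "k < K"
 shows "(\<Sum>s = k * m..<k * m + m. inc (K * m) b s) = inc K b k"
proof -
 have "(\<Sum>s = k * m..<k * m + j. inc (K * m) b s)
   = b (real (k * m + j) / real (K * m)) - b (real (k * m) / real (K * m))" if "j \<le> m" for j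
  using that
 proof (induction j)
  case (Suc j)
  have "k * m + j < K * m"
  proof -
   have "k * m + j < Suc k * m" using Suc by simp
   also have "\<dots> \<le> K * m" using assms by (intro mult_right_mono) auto
   finally show ?thesis .
  qed
  then have "inc (K * m) b (k * m + j)
    = b (real (k * m + Suc j) / real (K * m)) - b (real (k * m + j) / real (K * m))"
   by (simp add: inc_def add_ac)
  then show ?case using Suc by simp
 qed simp
 from this[OF order_refl] have "(\<Sum>s = k * m..<k * m + m. inc (K * m) b s)
   = b (real (k * m + m) / real (K * m)) - b (real (k * m) / real (K * m))" .
 moreover have "real (k * m + m) / real (K * m) = (real k + 1) / real K"
  using assms by (simp add: field_simps)
 moreover have "real (k * m) / real (K * m) = real k / real K"
  using assms by simp
 ultimately show ?thesis using assms by (simp add: inc_def)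
qed

lemma theta_refine:
 assumes "K > 0" "m > 0"
 shows "theta (K * m) (\<lambda>s. l (s div m)) (inc (K * m) b) = theta K l (inc K b)"
proof -
 have "theta (K * m) (\<lambda>s. l (s div m)) (inc (K * m) b)
   = (\<Sum>k<K. \<Sum>s = k * m..<k * m + m. l (s div m) \<bullet> inc (K * m) b s)"
  unfolding theta_def by (rule sum.nat_group[symmetric])
 also have "\<dots> = (\<Sum>k<K. l k \<bullet> (\<Sum>s = k * m..<k * m + m. inc (K * m) b s))"
  unfolding inner_sum_right
 proof (intro sum.cong refl)
  fix k s assume "s \<in> {k * m..<k * m + m}"
  then have "s div m = k"
   by (intro div_nat_eqI) (auto simp: mult.commute)
  then show "l (s div m) \<bullet> inc (K * m) b s = l k \<bullet> inc (K * m) b s" by simp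
 qed
 also have "\<dots> = theta K l (inc K b)"
  unfolding theta_def using assms by (intro sum.cong refl) (simp add: sum_inc_refine)
 finally show ?thesis .
qed

lemma trig_rep:
 assumes "f \<in> trig"
 shows "\<exists>K>0. \<exists>xs. \<forall>b. f b = (\<Sum>(c, l)\<leftarrow>xs. Re (c * cis (theta K l (inc K b))))"
 using assms
proof induction
 case (base N c l)
 then show ?case by (intro exI[of _ N] conjI exI[of _ "[(c, l)]"]) auto
next
 case (add f g)
 then obtain K xs K' xs' where K: "K > 0" "K' > 0"
  and f: "\<And>b. f b = (\<Sum>(c, l)\<leftarrow>xs. Re (c * cis (theta K l (inc K b))))"
  and g: "\<And>b. g b = (\<Sum>(c, l)\<leftarrow>xs'. Re (c * cis (theta K' l (inc K' b))))" by metis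
 let ?ys = "map (\<lambda>(c, l). (c, \<lambda>s. l (s div K'))) xs @ map (\<lambda>(c, l). (c, \<lambda>s. l (s div K))) xs'"
 have "f b + g b = (\<Sum>(c, l)\<leftarrow>?ys. Re (c * cis (theta (K * K') l (inc (K * K') b))))" for b
  using theta_refine[OF K(1,2), of _ b] theta_refine[OF K(2,1), of _ b]
  by (simp add: f g o_def case_prod_beta' mult.commute[of K K'])
 then show ?case using K by (intro exI[of _ "K * K'"] conjI exI[of _ ?ys] allI) simp_all
qed

lemma theta_add: "theta N (\<lambda>s. l s + l' s) x = theta N l x + theta N l' x"
 and theta_diff: "theta N (\<lambda>s. l s - l' s) x = theta N l x - theta N l' x"
 by (simp_all add: theta_def inner_add_left inner_diff_left sum.distrib sum_subtractf)

text \<open>On a common grid, the product-to-sum formula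
  \<open>Re z * Re w = Re (z * w / 2) + Re (z * cnj w / 2)\<close> turns the product of two
  characters into characters of the sum and difference of the frequencies.\<close>

lemma trig_mult:
 assumes "f \<in> trig" "g \<in> trig"
 shows "(\<lambda>b. f b * g b) \<in> trig"
 using assms
proof (induction arbitrary: g)
 case (base N c l g)
 note N = base(1)
 from base(2,1) show ?case
 proof induction
  case (base N' c' l')
  define P where "P = N * N'"
  have P: "P > 0" using base by (simp add: P_def)
  define k where "k = (\<lambda>s. l (s div N'))"
  define k' where "k' = (\<lambda>s. l' (s div N))"
  have 1: "theta N l (inc N b) = theta P k (inc P b)" "theta N' l' (inc N' b) = theta P k' (inc P b)" for b
   using theta_refine[of N N' l b] theta_refine[of N' N l' b] base
   by (simp_all add: P_def k_def k'_def mult.commute)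
  have 2: "Re z * Re w = Re (z * w / 2) + Re (z * cnj w / 2)" for z w
   by (simp add: add_divide_distrib diff_divide_distrib)
  have 3: "Re (c * cis s) * Re (c' * cis t)
    = Re ((c * c' / 2) * cis (s + t)) + Re ((c * cnj c' / 2) * cis (s - t))" for s t
  proof -
   have "(c * cis s) * (c' * cis t) / 2 = (c * c' / 2) * cis (s + t)"
    by (subst cis_mult[symmetric]) (simp only: times_divide_eq_left times_divide_eq_right mult_ac)
   moreover have "(c * cis s) * cnj (c' * cis t) / 2 = (c * cnj c' / 2) * cis (s - t)"
    unfolding diff_conv_add_uminus complex_cnj_mult cis_cnj
    by (subst cis_mult[symmetric]) (simp only: times_divide_eq_left times_divide_eq_right mult_ac)
   ultimately show ?thesis using 2[of "c * cis s" "c' * cis t"] by (simp only:)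
  qed
  have "(\<lambda>b. Re (c * cis (theta N l (inc N b))) * Re (c' * cis (theta N' l' (inc N' b))))
    = (\<lambda>b. Re ((c * c' / 2) * cis (theta P (\<lambda>s. k s + k' s) (inc P b)))
       + Re ((c * cnj c' / 2) * cis (theta P (\<lambda>s. k s - k' s) (inc P b))))"
   by (simp only: 1 3 theta_add theta_diff)
  then show ?case
   by (simp only:) (intro trig.add trig.base P)
 next
  case (add f' g')
  from add.IH(1)[OF N] add.IH(2)[OF N] show ?case unfolding distrib_left by (rule trig.add)
 qed
next
 case (add f f')
 from add.IH(1)[OF add.prems] add.IH(2)[OF add.prems] show ?case
  unfolding distrib_right by (rule trig.add)
qed

lemma trig_const: "(\<lambda>b. a) \<in> trig"
 using trig.base[of 1 "complex_of_real a" "\<lambda>_. 0"] by (simp add: theta_def)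

lemma trig_cmult: "f \<in> trig \<Longrightarrow> (\<lambda>b. a * f b) \<in> trig"
 using trig_mult[OF trig_const] .

lemma trig_bounded:
 assumes "f \<in> trig"
 shows "\<exists>C\<ge>0. \<forall>b. \<bar>f b\<bar> \<le> C"
 using assms
proof induction
 case (base N c l)
 have "\<bar>Re (c * cis t)\<bar> \<le> norm c" for t
  using abs_Re_le_cmod[of "c * cis t"] by (simp add: norm_mult)
 then show ?case by (intro exI[of _ "norm c"]) auto
next
 case (add f g)
 then obtain C D where "C \<ge> 0" "D \<ge> 0" "\<And>b. \<bar>f b\<bar> \<le> C" "\<And>b. \<bar>g b\<bar> \<le> D" by metis
 then have "\<bar>f b + g b\<bar> \<le> C + D" for b
  by (meson abs_triangle_ineq add_mono order_trans)
 then show ?case using \<open>C \<ge> 0\<close> \<open>D \<ge> 0\<close> by (intro exI[of _ "C + D"]) auto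
qed

lemma inc_measurable:
 assumes "\<And>t. t \<in> {0..1} \<Longrightarrow> (\<lambda>w. X w t) \<in> borel_measurable M"
 shows "(\<lambda>w. inc N (X w) s) \<in> borel_measurable M"
proof (cases "s < N")
 case True
 then have "(\<lambda>w. X w ((real s + 1) / real N) - X w (real s / real N)) \<in> borel_measurable M"
  by (intro borel_measurable_diff assms) auto
 then show ?thesis using True by (simp add: inc_def)
qed (simp add: inc_def)

lemma trig_measurable:
 assumes "f \<in> trig" and X: "\<And>t. t \<in> {0..1} \<Longrightarrow> (\<lambda>w. X w t) \<in> borel_measurable M"
 shows "(\<lambda>w. f (X w)) \<in> borel_measurable M"
 using assms(1)
proof induction
 case (base N c l)
 have [measurable]: "(\<lambda>w. inc N (X w) s) \<in> borel_measurable M" for s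
  using X by (rule inc_measurable)
 show ?case unfolding theta_def by measurable
qed (rule borel_measurable_add)

lemma path_eval_measurable: "t \<in> {0..1} \<Longrightarrow> (\<lambda>b. b t) \<in> borel_measurable path_space"
 unfolding path_space_def by (intro measurable_restrict_space1 measurable_component_singleton)

lemma trig_poly:
 assumes "real_polynomial_function p" "g \<in> trig"
 shows "(\<lambda>b. p (g b) :: real) \<in> trig"
 using assms(1)
proof induction
 case (linear f)
 then obtain c where "f = (\<lambda>x. x * c)" using real_bounded_linear by blast
 then show ?case using trig_cmult[OF assms(2), of c] by (simp add: mult.commute)
qed (auto intro: trig_const trig.add trig_mult)

lemma trig_sin: "N > 0 \<Longrightarrow> (\<lambda>b. sin (a * theta N l (inc N b))) \<in> trig"
proof -
 assume "N > 0"
 have "(\<lambda>b. Re ((-\<i>) * cis (theta N (\<lambda>s. a *\<^sub>R l s) (inc N b)))) \<in> trig"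
  by (rule trig.base) fact
 then show ?thesis by (simp add: theta_def sum_distrib_left)
qed

lemma abs_add_power_le: "\<bar>a + b\<bar> ^ r \<le> 2 ^ r * (\<bar>a\<bar> ^ r + \<bar>b :: real\<bar> ^ r)"
proof -
 have "\<bar>a + b\<bar> ^ r \<le> (2 * max \<bar>a\<bar> \<bar>b\<bar>) ^ r" by (intro power_mono) auto
 also have "\<dots> \<le> 2 ^ r * (\<bar>a\<bar> ^ r + \<bar>b\<bar> ^ r)"
  by (auto simp: power_mult_distrib max_def intro!: mult_left_mono)
 finally show ?thesis .
qed

text \<open>Recovers an unbounded phase from bounded functions: for a phase x, the function
  \<open>sin (x / m)\<close> belongs to \<open>trig\<close>.\<close>

lemma linear_over_sin_limit: "(\<lambda>m. real (Suc m) * sin (x / real (Suc m))) \<longlonglongrightarrow> x"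
proof -
 have "((\<lambda>h. (sin (0 + h * x) - sin 0) / h) \<longlongrightarrow> cos 0 * x) (at (0::real))"
 proof -
  have "((\<lambda>h. sin (h * x)) has_field_derivative cos (0 * x) * x) (at 0)"
   by (auto intro!: derivative_eq_intros)
  then show ?thesis by (simp add: DERIV_def)
 qed
 then have "((\<lambda>h. sin (h * x) / h) \<longlongrightarrow> x) (at (0::real))" by simp
 then have "(\<lambda>m. sin (inverse (real (Suc m)) * x) / inverse (real (Suc m))) \<longlonglongrightarrow> x"
  by (rule filterlim_compose)
    (intro filterlim_atI LIMSEQ_inverse_real_of_nat, auto)
 then show ?thesis by (simp add: divide_inverse mult.commute)
qed

lemma grid_approx:
 assumes t: "t \<in> {0..1::real}"
 shows "\<exists>j. (\<forall>N. j N \<le> Suc N) \<and> (\<lambda>N. real (j N) / real (Suc N)) \<longlonglongrightarrow> t"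
proof -
 define j where "j N = nat \<lfloor>t * real (Suc N)\<rfloor>" for N
 have jle: "j N \<le> Suc N" for N
 proof -
  have "t * real (Suc N) \<le> 1 * real (Suc N)" using t by (intro mult_right_mono) auto
  then have "\<lfloor>t * real (Suc N)\<rfloor> \<le> int (Suc N)" by (metis floor_mono floor_of_nat mult_1)
  then show ?thesis unfolding j_def by (simp only: nat_le_iff)
 qed
 have j2: "t * real (Suc N) - 1 \<le> real (j N)" "real (j N) \<le> t * real (Suc N)" for N
 proof -
  have "t * real (Suc N) \<ge> 0" using t by simp
  then show "t * real (Suc N) - 1 \<le> real (j N)" "real (j N) \<le> t * real (Suc N)"
   unfolding j_def by linarith+
 qed
 have jlim: "(\<lambda>N. real (j N) / real (Suc N)) \<longlonglongrightarrow> t"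
 proof -
  have "(\<lambda>N. real (j N) / real (Suc N) - t) \<longlonglongrightarrow> 0"
  proof (rule Lim_null_comparison)
   show "\<forall>\<^sub>F N in sequentially. norm (real (j N) / real (Suc N) - t) \<le> inverse (real (Suc N))"
   proof (intro always_eventually allI)
    fix N
    have "real (j N) / real (Suc N) - t = (real (j N) - t * real (Suc N)) / real (Suc N)"
     by (simp add: diff_divide_distrib del: of_nat_Suc)
    moreover have "\<bar>real (j N) - t * real (Suc N)\<bar> \<le> 1" using j2[of N] by linarith
    ultimately show "norm (real (j N) / real (Suc N) - t) \<le> inverse (real (Suc N))"
     unfolding real_norm_def inverse_eq_divide
     by (simp only: abs_divide abs_of_nat) (rule divide_right_mono, auto)
   qed
  qed (rule LIMSEQ_inverse_real_of_nat)
  then show ?thesis by (simp only: LIM_zero_iff)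
 qed
 show ?thesis using jle jlim by blast
qed

section \<open>Density of trigonometric functions in L^r of a law on paths\<close>

locale path_measure = finite_measure \<mu> for \<mu> :: "(real \<Rightarrow> real ^ 'n) measure" +
 fixes r :: nat
 assumes sets_mu: "sets \<mu> = sets path_space" and r: "r > 0" and start0: "AE b in \<mu>. b 0 = 0"
begin

lemma eval_meas: "t \<in> {0..1} \<Longrightarrow> (\<lambda>b. b t) \<in> borel_measurable \<mu>"
 using path_eval_measurable sets_mu by (simp cong: measurable_cong_sets)

lemma trig_meas: "g \<in> trig \<Longrightarrow> g \<in> borel_measurable \<mu>"
 using trig_measurable[of g "\<lambda>b. b" \<mu>] eval_meas by simp

definition bdd :: "((real \<Rightarrow> real ^ 'n) \<Rightarrow> real) \<Rightarrow> bool" where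
 "bdd f \<longleftrightarrow> f \<in> borel_measurable \<mu> \<and> (\<exists>C. \<forall>b\<in>space \<mu>. \<bar>f b\<bar> \<le> C)"

text \<open>The closure of \<open>trig\<close> in L^r, restricted to bounded functions so that it is
  also stable under products.\<close>

definition apx :: "((real \<Rightarrow> real ^ 'n) \<Rightarrow> real) \<Rightarrow> bool" where
 "apx f \<longleftrightarrow> bdd f \<and> (\<forall>\<epsilon>>0. \<exists>g\<in>trig. (\<integral>b. \<bar>f b - g b\<bar> ^ r \<partial>\<mu>) < \<epsilon>)"

lemma apx_bdd: "apx f \<Longrightarrow> bdd f" by (simp add: apx_def)

lemma bdd_trig: "g \<in> trig \<Longrightarrow> bdd g"
 using trig_meas trig_bounded unfolding bdd_def by blast

lemma bdd_add: "bdd f \<Longrightarrow> bdd g \<Longrightarrow> bdd (\<lambda>b. f b + g b)"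
 unfolding bdd_def by (auto, meson abs_triangle_ineq add_mono order_trans)

lemma bdd_diff: "bdd f \<Longrightarrow> bdd g \<Longrightarrow> bdd (\<lambda>b. f b - g b)"
 unfolding bdd_def by (auto, meson abs_triangle_ineq4 add_mono order_trans)

lemma bdd_mult: "bdd f \<Longrightarrow> bdd g \<Longrightarrow> bdd (\<lambda>b. f b * g b)"
 unfolding bdd_def
proof safe
 fix C D assume "\<forall>b\<in>space \<mu>. \<bar>f b\<bar> \<le> C" "\<forall>b\<in>space \<mu>. \<bar>g b\<bar> \<le> D"
 then have "\<bar>f b * g b\<bar> \<le> C * D" if "b \<in> space \<mu>" for b
  unfolding abs_mult using that by (intro mult_mono) (auto intro: order_trans[OF abs_ge_zero])
 then show "\<exists>C. \<forall>b\<in>space \<mu>. \<bar>f b * g b\<bar> \<le> C" by blast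
qed auto

lemma bdd_integrable_power: "bdd f \<Longrightarrow> integrable \<mu> (\<lambda>b. \<bar>f b\<bar> ^ r)"
 unfolding bdd_def
proof safe
 fix C assume "f \<in> borel_measurable \<mu>" and C: "\<forall>b\<in>space \<mu>. \<bar>f b\<bar> \<le> C"
 have "\<bar>\<bar>f b\<bar> ^ r\<bar> \<le> C ^ r" if "b \<in> space \<mu>" for b
  using C that by (simp add: power_abs power_mono)
 then show ?thesis
  using \<open>f \<in> borel_measurable \<mu>\<close> by (intro integrable_const_bound[of _ "C ^ r"]) auto
qed

lemma integral_add_power:
 assumes "bdd f" "bdd g"
 shows "(\<integral>b. \<bar>f b + g b\<bar> ^ r \<partial>\<mu>) \<le> 2 ^ r * ((\<integral>b. \<bar>f b\<bar> ^ r \<partial>\<mu>) + (\<integral>b. \<bar>g b\<bar> ^ r \<partial>\<mu>))"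
proof -
 have "(\<integral>b. \<bar>f b + g b\<bar> ^ r \<partial>\<mu>) \<le> (\<integral>b. 2 ^ r * (\<bar>f b\<bar> ^ r + \<bar>g b\<bar> ^ r) \<partial>\<mu>)"
  by (intro integral_mono abs_add_power_le bdd_integrable_power integrable_mult_right
     Bochner_Integration.integrable_add bdd_add assms)
 also have "\<dots> = 2 ^ r * ((\<integral>b. \<bar>f b\<bar> ^ r \<partial>\<mu>) + (\<integral>b. \<bar>g b\<bar> ^ r \<partial>\<mu>))"
  using bdd_integrable_power assms by simp
 finally show ?thesis .
qed

lemma apx_trig: "g \<in> trig \<Longrightarrow> apx g"
 unfolding apx_def using bdd_trig r by (auto intro!: bexI[of _ g] simp: power_0_left)

lemma apx_approx:
 assumes "bdd f" "\<And>\<epsilon>. \<epsilon> > 0 \<Longrightarrow> \<exists>h. apx h \<and> (\<integral>b. \<bar>f b - h b\<bar> ^ r \<partial>\<mu>) < \<epsilon>"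
 shows "apx f"
 unfolding apx_def
proof (safe, fact)
 fix \<epsilon> :: real assume "\<epsilon> > 0"
 define e where "e = \<epsilon> / 2 ^ r / 2"
 have "e > 0" using \<open>\<epsilon> > 0\<close> by (simp add: e_def)
 obtain h where h: "apx h" "(\<integral>b. \<bar>f b - h b\<bar> ^ r \<partial>\<mu>) < e" using assms(2)[OF \<open>e > 0\<close>] by auto
 obtain g where g: "g \<in> trig" "(\<integral>b. \<bar>h b - g b\<bar> ^ r \<partial>\<mu>) < e"
  using h(1) \<open>e > 0\<close> unfolding apx_def by auto
 have "(\<integral>b. \<bar>f b - g b\<bar> ^ r \<partial>\<mu>) = (\<integral>b. \<bar>(f b - h b) + (h b - g b)\<bar> ^ r \<partial>\<mu>)" by simp
 also have "\<dots> \<le> 2 ^ r * ((\<integral>b. \<bar>f b - h b\<bar> ^ r \<partial>\<mu>) + (\<integral>b. \<bar>h b - g b\<bar> ^ r \<partial>\<mu>))"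
  using assms(1) h(1) g(1) by (intro integral_add_power bdd_diff) (auto intro: apx_bdd bdd_trig)
 also have "\<dots> < 2 ^ r * (e + e)" using h(2) g(2) by (intro mult_strict_left_mono add_strict_mono) auto
 also have "\<dots> = \<epsilon>" by (simp add: e_def)
 finally show "\<exists>g\<in>trig. (\<integral>b. \<bar>f b - g b\<bar> ^ r \<partial>\<mu>) < \<epsilon>" using g(1) by blast
qed

text \<open>Dominated convergence with the constant \<open>R\<close> as bound: the class is closed
  under uniformly bounded almost sure limits, which is what allows a monotone-class
  argument.\<close>

lemma apx_lim:
 assumes f: "f \<in> borel_measurable \<mu>" and h: "\<And>n::nat. apx (h n)"
  and R: "\<And>n b. b \<in> space \<mu> \<Longrightarrow> \<bar>h n b\<bar> \<le> R" "\<And>b. b \<in> space \<mu> \<Longrightarrow> \<bar>f b\<bar> \<le> R"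
  and lim: "AE b in \<mu>. (\<lambda>n. h n b) \<longlonglongrightarrow> f b"
 shows "apx f"
proof (rule apx_approx)
 show bf: "bdd f" using f R by (auto simp: bdd_def)
 have bh: "h n \<in> borel_measurable \<mu>" for n using h[of n] by (simp add: apx_def bdd_def)
 fix \<epsilon> :: real assume "\<epsilon> > 0"
 have "(\<lambda>n. \<integral>b. \<bar>f b - h n b\<bar> ^ r \<partial>\<mu>) \<longlonglongrightarrow> (\<integral>b. 0 \<partial>\<mu>)"
 proof (rule integral_dominated_convergence[where w = "\<lambda>_. (2 * R) ^ r"])
  show "AE b in \<mu>. (\<lambda>n. \<bar>f b - h n b\<bar> ^ r) \<longlonglongrightarrow> 0"
   using lim
  proof eventually_elim
   case (elim b)
   have "(\<lambda>n. \<bar>f b - h n b\<bar> ^ r) \<longlonglongrightarrow> \<bar>f b - f b\<bar> ^ r"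
    by (intro tendsto_intros elim)
   then show ?case using r by (simp add: power_0_left)
  qed
  show "AE b in \<mu>. norm (\<bar>f b - h n b\<bar> ^ r) \<le> (2 * R) ^ r" for n
  proof (rule AE_I2)
   fix b assume "b \<in> space \<mu>"
   then have "\<bar>f b - h n b\<bar> \<le> 2 * R" using R(1)[of b n] R(2)[of b] by linarith
   then show "norm (\<bar>f b - h n b\<bar> ^ r) \<le> (2 * R) ^ r"
    by (simp only: real_norm_def power_abs abs_abs) (rule power_mono, auto)
  qed
 qed (use f bh in auto)
 then have "(\<lambda>n. \<integral>b. \<bar>f b - h n b\<bar> ^ r \<partial>\<mu>) \<longlonglongrightarrow> 0" by simp
 then have "\<forall>\<^sub>F n in sequentially. (\<integral>b. \<bar>f b - h n b\<bar> ^ r \<partial>\<mu>) < \<epsilon>"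
  using \<open>\<epsilon> > 0\<close> by (rule order_tendstoD)
 then obtain n where "(\<integral>b. \<bar>f b - h n b\<bar> ^ r \<partial>\<mu>) < \<epsilon>"
  by (auto simp: eventually_sequentially)
 then show "\<exists>h. apx h \<and> (\<integral>b. \<bar>f b - h b\<bar> ^ r \<partial>\<mu>) < \<epsilon>" using h by blast
qed

lemma apx_add: "apx f \<Longrightarrow> apx g \<Longrightarrow> apx (\<lambda>b. f b + g b)"
proof -
 assume f: "apx f" and g: "apx g"
 show ?thesis
  unfolding apx_def
 proof (safe)
  show "bdd (\<lambda>b. f b + g b)" using f g by (simp add: apx_def bdd_add)
  fix \<epsilon> :: real assume "\<epsilon> > 0"
  define e where "e = \<epsilon> / 2 ^ r / 2"
  have "e > 0" using \<open>\<epsilon> > 0\<close> by (simp add: e_def)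
  obtain f' g' where f': "f' \<in> trig" "(\<integral>b. \<bar>f b - f' b\<bar> ^ r \<partial>\<mu>) < e"
   and g': "g' \<in> trig" "(\<integral>b. \<bar>g b - g' b\<bar> ^ r \<partial>\<mu>) < e"
   using f g \<open>e > 0\<close> unfolding apx_def by meson
  have "(\<integral>b. \<bar>f b + g b - (f' b + g' b)\<bar> ^ r \<partial>\<mu>) = (\<integral>b. \<bar>(f b - f' b) + (g b - g' b)\<bar> ^ r \<partial>\<mu>)"
   by (simp add: algebra_simps)
  also have "\<dots> \<le> 2 ^ r * ((\<integral>b. \<bar>f b - f' b\<bar> ^ r \<partial>\<mu>) + (\<integral>b. \<bar>g b - g' b\<bar> ^ r \<partial>\<mu>))"
   using f g f'(1) g'(1) by (intro integral_add_power bdd_diff) (auto intro: apx_bdd bdd_trig)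
  also have "\<dots> < 2 ^ r * (e + e)" using f'(2) g'(2) by (intro mult_strict_left_mono add_strict_mono) auto
  also have "\<dots> = \<epsilon>" by (simp add: e_def)
  finally show "\<exists>h\<in>trig. (\<integral>b. \<bar>f b + g b - h b\<bar> ^ r \<partial>\<mu>) < \<epsilon>"
   by (intro bexI[OF _ trig.add[OF f'(1) g'(1)]])
 qed
qed

lemma apx_mult_trig:
 assumes f: "apx f" and g: "g \<in> trig" shows "apx (\<lambda>b. f b * g b)"
 unfolding apx_def
proof safe
 show "bdd (\<lambda>b. f b * g b)" using f g by (simp add: apx_def bdd_mult bdd_trig)
 obtain C where C: "C \<ge> 0" "\<And>b. \<bar>g b\<bar> \<le> C" using trig_bounded[OF g] by auto
 fix \<epsilon> :: real assume "\<epsilon> > 0"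
 define e where "e = \<epsilon> / (C ^ r + 1)"
 have p: "C ^ r + 1 > 0" using C by (simp add: add_nonneg_pos)
 then have "e > 0" using \<open>\<epsilon> > 0\<close> by (simp add: e_def)
 then obtain f' where f': "f' \<in> trig" "(\<integral>b. \<bar>f b - f' b\<bar> ^ r \<partial>\<mu>) < e"
  using f unfolding apx_def by meson
 have bd: "bdd (\<lambda>b. f b - f' b)" using f f' by (intro bdd_diff) (auto intro: apx_bdd bdd_trig)
 have "(\<integral>b. \<bar>f b * g b - f' b * g b\<bar> ^ r \<partial>\<mu>) = (\<integral>b. \<bar>(f b - f' b) * g b\<bar> ^ r \<partial>\<mu>)"
  by (simp add: algebra_simps)
 also have "\<dots> \<le> (\<integral>b. C ^ r * \<bar>f b - f' b\<bar> ^ r \<partial>\<mu>)"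
 proof (rule integral_mono)
  show "integrable \<mu> (\<lambda>b. \<bar>(f b - f' b) * g b\<bar> ^ r)"
   by (intro bdd_integrable_power bdd_mult bd bdd_trig[OF g])
  show "integrable \<mu> (\<lambda>b. C ^ r * \<bar>f b - f' b\<bar> ^ r)"
   using bd by (intro integrable_mult_right bdd_integrable_power)
  show "\<bar>(f b - f' b) * g b\<bar> ^ r \<le> C ^ r * \<bar>f b - f' b\<bar> ^ r" for b
   unfolding abs_mult power_mult_distrib mult.commute[of "C ^ r"]
   using C by (intro mult_left_mono power_mono) auto
 qed
 also have "\<dots> = C ^ r * (\<integral>b. \<bar>f b - f' b\<bar> ^ r \<partial>\<mu>)" by simp
 also have "\<dots> \<le> C ^ r * e" using f'(2) C by (intro mult_left_mono) auto
 also have "\<dots> < (C ^ r + 1) * e" using \<open>e > 0\<close> by simp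
 also have "\<dots> = \<epsilon>" using p by (simp add: e_def)
 finally show "\<exists>h\<in>trig. (\<integral>b. \<bar>f b * g b - h b\<bar> ^ r \<partial>\<mu>) < \<epsilon>"
  by (intro bexI[OF _ trig_mult[OF f'(1) g]])
qed

text \<open>One factor is replaced at a time. As \<open>f\<close> is bounded, replacing
  \<open>g\<close> by an element of \<open>trig\<close> costs a factor
  \<open>\<bar>C\<bar> ^ r\<close>; \<open>apx_mult_trig\<close> handles the remaining product. The
  \<open>+ 1\<close> in \<open>e\<close> keeps the denominator positive.\<close>

lemma apx_mult:
 assumes f: "apx f" and g: "apx g" shows "apx (\<lambda>b. f b * g b)"
proof (rule apx_approx)
 show "bdd (\<lambda>b. f b * g b)" using f g by (simp add: apx_def bdd_mult)
 obtain C where C: "\<And>b. b \<in> space \<mu> \<Longrightarrow> \<bar>f b\<bar> \<le> C" using f by (auto simp: apx_def bdd_def)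
 have C': "\<bar>f b\<bar> \<le> \<bar>C\<bar>" if "b \<in> space \<mu>" for b using C[OF that] by linarith
 fix \<epsilon> :: real assume "\<epsilon> > 0"
 define e where "e = \<epsilon> / (\<bar>C\<bar> ^ r + 1)"
 have p: "\<bar>C\<bar> ^ r + 1 > 0" by (simp add: add_nonneg_pos)
 then have "e > 0" using \<open>\<epsilon> > 0\<close> by (simp add: e_def)
 then obtain g' where g': "g' \<in> trig" "(\<integral>b. \<bar>g b - g' b\<bar> ^ r \<partial>\<mu>) < e"
  using g unfolding apx_def by meson
 have bd: "bdd (\<lambda>b. g b - g' b)" using g g' by (intro bdd_diff) (auto intro: apx_bdd bdd_trig)
 have "(\<integral>b. \<bar>f b * g b - f b * g' b\<bar> ^ r \<partial>\<mu>) = (\<integral>b. \<bar>f b * (g b - g' b)\<bar> ^ r \<partial>\<mu>)"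
  by (simp add: algebra_simps)
 also have "\<dots> \<le> (\<integral>b. \<bar>C\<bar> ^ r * \<bar>g b - g' b\<bar> ^ r \<partial>\<mu>)"
 proof (rule integral_mono)
  show "integrable \<mu> (\<lambda>b. \<bar>f b * (g b - g' b)\<bar> ^ r)"
   using bd f by (intro bdd_integrable_power bdd_mult) (auto simp: apx_def)
  show "integrable \<mu> (\<lambda>b. \<bar>C\<bar> ^ r * \<bar>g b - g' b\<bar> ^ r)"
   using bd by (intro integrable_mult_right bdd_integrable_power)
  show "\<bar>f b * (g b - g' b)\<bar> ^ r \<le> \<bar>C\<bar> ^ r * \<bar>g b - g' b\<bar> ^ r" if "b \<in> space \<mu>" for b
   unfolding abs_mult power_mult_distrib
   using C'[OF that] by (intro mult_right_mono power_mono) auto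
 qed
 also have "\<dots> = \<bar>C\<bar> ^ r * (\<integral>b. \<bar>g b - g' b\<bar> ^ r \<partial>\<mu>)" by simp
 also have "\<dots> \<le> \<bar>C\<bar> ^ r * e" using g'(2) by (intro mult_left_mono) auto
 also have "\<dots> < (\<bar>C\<bar> ^ r + 1) * e" using \<open>e > 0\<close> by simp
 also have "\<dots> = \<epsilon>" using p by (simp add: e_def)
 finally show "\<exists>h. apx h \<and> (\<integral>b. \<bar>f b * g b - h b\<bar> ^ r \<partial>\<mu>) < \<epsilon>"
  using apx_mult_trig[OF f g'(1)] by blast
qed

lemma apx_const: "apx (\<lambda>b. c)" by (intro apx_trig trig_const)

lemma apx_cmult: "apx f \<Longrightarrow> apx (\<lambda>b. c * f b)" by (intro apx_mult apx_const)

text \<open>Weierstrass approximation needs a compact range, but the phase is unbounded. It is first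
  replaced by \<open>m * sin (phase / m)\<close>, whose sine lies in \<open>{-1..1}\<close> and in
  \<open>trig\<close>, so that polynomials in it lie in \<open>trig\<close>; then m tends to
  infinity.\<close>

lemma apx_continuous_theta:
 fixes \<phi> :: "real \<Rightarrow> real"
 assumes \<phi>: "continuous_on UNIV \<phi>" "\<And>x. \<bar>\<phi> x\<bar> \<le> R" and N: "N > 0"
 shows "apx (\<lambda>b. \<phi> (theta N l (inc N b)))"
proof -
 let ?X = "\<lambda>b. theta N l (inc N b)"
 have Xm: "?X \<in> borel_measurable \<mu>"
  unfolding theta_def by (intro borel_measurable_sum borel_measurable_inner borel_measurable_const inc_measurable eval_meas)
 have \<phi>m: "\<phi> \<in> borel_measurable borel" using \<phi>(1) by (rule borel_measurable_continuous_onI)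
 have a: "apx (\<lambda>b. \<phi> (real (Suc m) * sin (?X b / real (Suc m))))" for m
 proof -
  let ?\<psi> = "\<lambda>y. \<phi> (real (Suc m) * y)"
  have c: "continuous_on {-1..1} ?\<psi>"
   by (intro continuous_on_compose2[OF \<phi>(1)] continuous_intros) auto
  have "\<exists>p. real_polynomial_function p \<and> (\<forall>x\<in>{-1..1}. \<bar>?\<psi> x - p x\<bar> < inverse (real (Suc k)))" for k
   by (rule Stone_Weierstrass_real_polynomial_function[OF compact_Icc c, of "inverse (real (Suc k))"]) (simp, blast)
  then obtain p where p: "\<And>k. real_polynomial_function (p k)"
   "\<And>k x. x \<in> {-1..1} \<Longrightarrow> \<bar>?\<psi> x - p k x\<bar> < inverse (real (Suc k))" by metis
  let ?s = "\<lambda>b. sin (?X b / real (Suc m))"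
  have st: "?s \<in> trig" using trig_sin[OF N, of "1 / real (Suc m)" l] by simp
  show ?thesis
  proof (rule apx_lim[where h = "\<lambda>k b. p k (?s b)" and R = "R + 1"])
   show "apx (\<lambda>b. p k (?s b))" for k by (rule apx_trig[OF trig_poly[OF p(1) st]])
   show "(\<lambda>b. \<phi> (real (Suc m) * ?s b)) \<in> borel_measurable \<mu>"
    by (rule measurable_compose[OF _ \<phi>m]) (use Xm in measurable)
   show "\<bar>\<phi> (real (Suc m) * ?s b)\<bar> \<le> R + 1" for b
    using \<phi>(2)[of "real (Suc m) * ?s b"] by linarith
   show "\<bar>p k (?s b)\<bar> \<le> R + 1" for k b
   proof -
    have "inverse (real (Suc k)) \<le> 1" by (simp add: field_simps)
    then show ?thesis
     using p(2)[of "?s b" k] \<phi>(2)[of "real (Suc m) * ?s b"] by auto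
   qed
   show "AE b in \<mu>. (\<lambda>k. p k (?s b)) \<longlonglongrightarrow> \<phi> (real (Suc m) * ?s b)"
   proof (rule AE_I2)
    fix b
    have "(\<lambda>k. p k (?s b) - ?\<psi> (?s b)) \<longlonglongrightarrow> 0"
    proof (rule Lim_null_comparison)
     show "\<forall>\<^sub>F k in sequentially. norm (p k (?s b) - ?\<psi> (?s b)) \<le> inverse (real (Suc k))"
      using p(2)[of "?s b"] by (intro always_eventually allI) (auto simp: abs_minus_commute intro: less_imp_le)
    qed (rule LIMSEQ_inverse_real_of_nat)
    then show "(\<lambda>k. p k (?s b)) \<longlonglongrightarrow> ?\<psi> (?s b)" by (simp only: LIM_zero_iff)
   qed
  qed
 qed
 show ?thesis
 proof (rule apx_lim[where h = "\<lambda>m b. \<phi> (real (Suc m) * sin (?X b / real (Suc m)))" and R = R])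
  show "AE b in \<mu>. (\<lambda>m. \<phi> (real (Suc m) * sin (?X b / real (Suc m)))) \<longlonglongrightarrow> \<phi> (?X b)"
  proof (rule AE_I2)
   fix b
   have "isCont \<phi> (?X b)" using \<phi>(1) by (simp add: continuous_on_eq_continuous_at)
   then show "(\<lambda>m. \<phi> (real (Suc m) * sin (?X b / real (Suc m)))) \<longlonglongrightarrow> \<phi> (?X b)"
    by (rule isCont_tendsto_compose) (rule linear_over_sin_limit)
  qed
 qed (use a \<phi> measurable_compose[OF Xm \<phi>m] in auto)
qed

text \<open>A phase with the constant coefficient \<open>e\<close> up to index \<open>j N\<close>
  telescopes to the value at a grid point near \<open>t\<close>, relative to \<open>b 0 = 0\<close>.
  Continuity of the path gives the limit.\<close>

lemma apx_continuous_eval: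
 fixes \<phi> :: "real \<Rightarrow> real"
 assumes \<phi>: "continuous_on UNIV \<phi>" "\<And>x. \<bar>\<phi> x\<bar> \<le> R" and t: "t \<in> {0..1}"
 shows "apx (\<lambda>b. \<phi> (b t \<bullet> e))"
proof -
 have \<phi>m: "\<phi> \<in> borel_measurable borel" using \<phi>(1) by (rule borel_measurable_continuous_onI)
 obtain j where jle: "\<And>N. j N \<le> Suc N" and jlim: "(\<lambda>N. real (j N) / real (Suc N)) \<longlonglongrightarrow> t"
  using grid_approx[OF t] by blast
 define l where "l N s = (if s < j N then e else 0)" for N s :: nat
 have th: "theta (Suc N) (l N) (inc (Suc N) b) = (b (real (j N) / real (Suc N)) - b 0) \<bullet> e" for N b
 proof -
  have tel: "(\<Sum>s<k. inc (Suc N) b s) = b (real k / real (Suc N)) - b 0" if "k \<le> Suc N" for k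
   using that by (induction k) (auto simp: inc_def add_ac)
  have "theta (Suc N) (l N) (inc (Suc N) b) = (\<Sum>s<j N. e \<bullet> inc (Suc N) b s)"
   unfolding theta_def l_def using jle[of N]
   by (intro sum.mono_neutral_cong_right) auto
  also have "\<dots> = (\<Sum>s<j N. inc (Suc N) b s) \<bullet> e" by (simp only: inner_sum_right[symmetric]) (rule inner_commute)
  finally show ?thesis using tel[OF jle] by simp
 qed
 show ?thesis
 proof (rule apx_lim[where h = "\<lambda>N b. \<phi> (theta (Suc N) (l N) (inc (Suc N) b))" and R = R])
  show "apx (\<lambda>b. \<phi> (theta (Suc N) (l N) (inc (Suc N) b)))" for N
   by (rule apx_continuous_theta[OF \<phi>]) simp
  show "(\<lambda>b. \<phi> (b t \<bullet> e)) \<in> borel_measurable \<mu>"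
   by (rule measurable_compose[OF _ \<phi>m]) (use eval_meas[OF t] in measurable)
  show "AE b in \<mu>. (\<lambda>N. \<phi> (theta (Suc N) (l N) (inc (Suc N) b))) \<longlonglongrightarrow> \<phi> (b t \<bullet> e)"
   using start0 AE_space
  proof eventually_elim
   case (elim b)
   have "continuous_on {0..1} b"
    using elim(2) sets_eq_imp_space_eq[OF sets_mu] by (auto simp: path_space_def space_restrict_space)
   then have "(\<lambda>N. b (real (j N) / real (Suc N))) \<longlonglongrightarrow> b t"
   proof (rule continuous_on_tendsto_compose[OF _ jlim t])
    show "\<forall>\<^sub>F N in sequentially. real (j N) / real (Suc N) \<in> {0..1}"
     using jle by (intro always_eventually allI) (auto simp: field_simps simp flip: of_nat_Suc)
   qed
   moreover have "isCont \<phi> (b t \<bullet> e)" using \<phi>(1) by (simp add: continuous_on_eq_continuous_at)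
   ultimately show ?case
    unfolding th elim(1) by (intro isCont_tendsto_compose[of _ \<phi>]) (auto intro!: tendsto_intros)
  qed
 qed (use \<phi> in auto)
qed

lemma apx_halfspace:
 assumes t: "t \<in> {0..1}"
 shows "apx (\<lambda>b. if b t \<bullet> e > a then 1 else 0)"
proof -
 \<comment> \<open>Ramps from 0 at \<open>a\<close> to 1 at \<open>a + 1 / n\<close>, which decrease
   to the indicator of the open half-line in the limit of steep slope only pointwise; boundedness by
   1 suffices for \<open>apx_lim\<close>.\<close>
 let ?\<phi> = "\<lambda>n x. min 1 (max 0 (real n * (x - a)))"
 have [measurable]: "(\<lambda>b. b t) \<in> borel_measurable \<mu>" by (rule eval_meas[OF t])
 have lim: "(\<lambda>n. ?\<phi> n x) \<longlonglongrightarrow> (if x > a then 1 else 0)" for x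
 proof (cases "x > a")
  case True
  obtain n0 :: nat where n0: "real n0 * (x - a) > 1"
   using reals_Archimedean3[of "x - a"] True by auto
  have "?\<phi> n x = 1" if "n \<ge> n0" for n
  proof -
   have "real n0 * (x - a) \<le> real n * (x - a)" using that True by (intro mult_right_mono) auto
   then show ?thesis using n0 by simp
  qed
  then have "(\<lambda>n. ?\<phi> n x) \<longlonglongrightarrow> 1"
   by (intro tendsto_eventually) (auto simp: eventually_sequentially)
  then show ?thesis using True by simp
 next
  case False
  then have "real n * (x - a) \<le> 0" for n by (simp add: mult_nonneg_nonpos)
  then have "?\<phi> n x = 0" for n by (simp add: max_absorb1)
  then show ?thesis using False by simp
 qed
 have bd: "\<bar>?\<phi> n x\<bar> \<le> 1" for n x by simp
 show ?thesis
 proof (rule apx_lim[where h = "\<lambda>n b. ?\<phi> n (b t \<bullet> e)" and R = 1])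
  show "apx (\<lambda>b. ?\<phi> n (b t \<bullet> e))" for n
   by (rule apx_continuous_eval[where R = 1 and \<phi> = "?\<phi> n", OF _ bd t]) (intro continuous_intros)
  show "AE b in \<mu>. (\<lambda>n. ?\<phi> n (b t \<bullet> e)) \<longlonglongrightarrow> (if b t \<bullet> e > a then 1 else 0)"
   by (intro AE_I2 lim)
  show "(\<lambda>b. if b t \<bullet> e > a then 1 else 0 :: real) \<in> borel_measurable \<mu>"
   by measurable
  show "\<bar>?\<phi> n (b t \<bullet> e)\<bar> \<le> 1" for n b by (rule bd)
 qed simp
qed

definition aset :: "(real \<Rightarrow> real ^ 'n) set set" where
 "aset = {E \<in> sets \<mu>. apx (indicator E)}"

lemma aset_Compl: "E \<in> aset \<Longrightarrow> space \<mu> - E \<in> aset"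
proof -
 assume E: "E \<in> aset"
 have "apx (\<lambda>b. 1 + (-1) * indicator E b)"
  using E by (intro apx_add apx_const apx_cmult) (simp add: aset_def)
 then have "apx (\<lambda>b. if b \<in> E then 0 else 1)"
  by (rule back_subst[of apx]) (auto simp: fun_eq_iff indicator_def)
 then have "apx (indicator (space \<mu> - E))"
  by (rule apx_lim[rotated, where R = 1]) (use E in \<open>auto simp: aset_def indicator_def intro!: AE_I2\<close>)
 then show ?thesis using E by (auto simp: aset_def)
qed

lemma aset_Int: "E \<in> aset \<Longrightarrow> F \<in> aset \<Longrightarrow> E \<inter> F \<in> aset"
proof -
 assume EF: "E \<in> aset" "F \<in> aset"
 have "(indicator (E \<inter> F) :: _ \<Rightarrow> real) = (\<lambda>b. indicator E b * indicator F b)"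
  by (auto simp: fun_eq_iff indicator_def)
 then show ?thesis
  using EF apx_mult[of "indicator E" "indicator F"] by (auto simp: aset_def)
qed

lemma aset_subset: "E \<in> aset \<Longrightarrow> E \<subseteq> space \<mu>"
 using sets.sets_into_space by (auto simp: aset_def)

lemma aset_Un: "E \<in> aset \<Longrightarrow> F \<in> aset \<Longrightarrow> E \<union> F \<in> aset"
proof -
 assume EF: "E \<in> aset" "F \<in> aset"
 have "E \<union> F = space \<mu> - ((space \<mu> - E) \<inter> (space \<mu> - F))" using EF aset_subset by auto
 also have "\<dots> \<in> aset" using EF by (intro aset_Compl aset_Int)
 finally show ?thesis .
qed

lemma aset_empty: "{} \<in> aset"
proof -
 have "apx (indicator {})" by (rule back_subst[of apx, OF apx_const[of 0]]) (auto simp: fun_eq_iff)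
 then show ?thesis by (simp add: aset_def)
qed

lemma aset_UN:
 assumes "\<And>i::nat. A i \<in> aset" shows "(\<Union>i. A i) \<in> aset"
proof -
 have fin: "(\<Union>i<n. A i) \<in> aset" for n
  by (induction n) (auto simp: aset_empty lessThan_Suc intro!: aset_Un assms)
 have "apx (indicator (\<Union>i. A i))"
 proof (rule apx_lim[where h = "\<lambda>n. indicator (\<Union>i<n. A i)" and R = 1])
  show "AE b in \<mu>. (\<lambda>n. indicator (\<Union>i<n. A i) b) \<longlonglongrightarrow> (indicator (\<Union>i. A i) b :: real)"
   by (intro AE_I2 LIMSEQ_indicator_UN)
  show "indicator (\<Union>i. A i) \<in> borel_measurable \<mu>"
   using assms by (intro borel_measurable_indicator sets.countable_UN) (auto simp: aset_def)
 qed (use fin assms in \<open>auto simp: aset_def indicator_def\<close>)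
 then show ?thesis using assms by (auto simp: aset_def)
qed

text \<open>The sets with approximable indicator form a sigma-algebra containing the half-space
  events, so all evaluations are measurable for it, and the evaluations generate
  \<open>path_space\<close>.\<close>

lemma aset_eq: "sets path_space \<subseteq> aset"
proof
 interpret S: sigma_algebra "space \<mu>" aset
  unfolding sigma_algebra_iff2
  using aset_Compl aset_empty aset_subset by (auto intro!: aset_UN)
 let ?S = "sigma (space \<mu>) aset"
 have sS: "sets ?S = aset" by simp
 have spS: "space ?S = space \<mu>" by (simp add: S.space_closed)
 have spm: "space \<mu> = space path_space" by (rule sets_eq_imp_space_eq[OF sets_mu])
 have ev: "(\<lambda>b. b t) \<in> borel_measurable ?S" if t: "t \<in> {0..1}" for t
  unfolding borel_measurable_euclidean_space[of "\<lambda>b. b t"]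
 proof
  fix i :: "real ^ 'n"
  show "(\<lambda>b. b t \<bullet> i) \<in> borel_measurable ?S"
   unfolding borel_measurable_iff_greater
  proof
   fix a
   let ?E = "{b \<in> space \<mu>. a < b t \<bullet> i}"
   have [measurable]: "(\<lambda>b. b t) \<in> borel_measurable \<mu>" by (rule eval_meas[OF t])
   have "apx (indicator ?E)"
    by (rule apx_lim[where R = 1, OF _ apx_halfspace[OF t, of a i]])
      (auto simp: indicator_def intro!: AE_I2)
   then have "?E \<in> aset" by (auto simp: aset_def)
   then show "{b \<in> space ?S. a < b t \<bullet> i} \<in> sets ?S" unfolding sS spS .
  qed
 qed
 have "(\<lambda>b. b) \<in> measurable ?S (PiM {0..1} (\<lambda>_. borel))"
 proof (rule measurable_PiM_single')
  show "(\<lambda>b. b) \<in> space ?S \<rightarrow> {0..1} \<rightarrow>\<^sub>E space borel"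
   unfolding spS unfolding spm by (auto simp: path_space_def space_restrict_space space_PiM PiE_def)
 qed (rule ev)
 then have id: "(\<lambda>b. b) \<in> measurable ?S path_space"
  unfolding path_space_def
 proof (intro measurable_restrict_space2 funcsetI)
  fix b assume "b \<in> space ?S"
  then have "b \<in> space path_space" unfolding spS unfolding spm .
  then show "b \<in> {w. continuous_on {0..1} w}" by (simp add: path_space_def space_restrict_space)
 qed
 fix E :: "(real \<Rightarrow> real ^ 'n) set" assume "E \<in> sets path_space"
 then have "(\<lambda>b. b) -` E \<inter> space ?S \<in> sets ?S" by (rule measurable_sets[OF id])
 moreover have "(\<lambda>b. b) -` E \<inter> space ?S = E"
  using sets.sets_into_space[OF \<open>E \<in> sets path_space\<close>] unfolding spS unfolding spm by auto
 ultimately show "E \<in> aset" by simp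
qed

lemma apx_indicator: "E \<in> sets path_space \<Longrightarrow> apx (indicator E)"
 using aset_eq by (auto simp: aset_def)

lemma apx_cong:
 assumes "apx f" "\<And>b. b \<in> space \<mu> \<Longrightarrow> f b = g b"
 shows "apx g"
proof -
 have 1: "g \<in> borel_measurable \<mu>" using assms by (subst measurable_cong[of _ _ f]) (auto simp: apx_def bdd_def)
 obtain C where C: "\<And>b. b \<in> space \<mu> \<Longrightarrow> \<bar>f b\<bar> \<le> C" using assms(1) by (auto simp: apx_def bdd_def)
 show ?thesis
  by (rule apx_lim[where h = "\<lambda>_. f" and R = C]) (use 1 assms C in \<open>auto intro!: AE_I2\<close>)
qed

lemma apx_sum: "finite S \<Longrightarrow> (\<And>y. y \<in> S \<Longrightarrow> apx (h y)) \<Longrightarrow> apx (\<lambda>b. \<Sum>y\<in>S. h y b)"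
 by (induction S rule: finite_induct) (auto intro: apx_const apx_add)

lemma apx_bounded:
 assumes f: "f \<in> borel_measurable path_space" and R: "\<And>b. b \<in> space path_space \<Longrightarrow> \<bar>f b\<bar> \<le> R"
 shows "apx f"
proof -
 have spm: "space \<mu> = space path_space" by (rule sets_eq_imp_space_eq[OF sets_mu])
 have fm: "f \<in> borel_measurable \<mu>" using f sets_mu by (simp cong: measurable_cong_sets)
 from borel_measurable_implies_sequence_metric[OF fm, of 0]
 obtain F where F0: "\<forall>i. simple_function \<mu> (F i)" "\<forall>x\<in>space \<mu>. (\<lambda>i. F i x) \<longlonglongrightarrow> f x"
  "\<forall>i. \<forall>x\<in>space \<mu>. dist (F i x) 0 \<le> 2 * dist (f x) 0"
  by blast
 then have F: "\<And>i. simple_function \<mu> (F i)" "\<And>x. x \<in> space \<mu> \<Longrightarrow> (\<lambda>i. F i x) \<longlonglongrightarrow> f x"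
  "\<And>i x. x \<in> space \<mu> \<Longrightarrow> norm (F i x) \<le> 2 * norm (f x)"
  by auto
 have apF: "apx (F i)" for i
 proof -
  have "apx (\<lambda>b. \<Sum>y\<in>F i ` space \<mu>. y * indicator (F i -` {y} \<inter> space \<mu>) b)"
  proof (intro apx_sum apx_cmult apx_indicator)
   show "finite (F i ` space \<mu>)" using F(1) by (rule simple_functionD)
   show "F i -` {y} \<inter> space \<mu> \<in> sets path_space" for y
    using simple_functionD(2)[OF F(1), of i "{y}"] sets_mu by simp
  qed
  then show ?thesis
  proof (rule apx_cong)
   fix b assume b: "b \<in> space \<mu>"
   have "(\<Sum>y\<in>F i ` space \<mu>. y * indicator (F i -` {y} \<inter> space \<mu>) b) = (\<Sum>y\<in>F i ` space \<mu>. if y = F i b then y else 0)"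
    using b by (intro sum.cong) (auto simp: indicator_def)
   also have "\<dots> = F i b" using b simple_functionD(1)[OF F(1), of i] by simp
   finally show "(\<Sum>y\<in>F i ` space \<mu>. y * indicator (F i -` {y} \<inter> space \<mu>) b) = F i b" .
  qed
 qed
 show ?thesis
 proof (rule apx_lim[where h = F and R = "2 * R"])
  show "\<bar>F n b\<bar> \<le> 2 * R" if "b \<in> space \<mu>" for n b
   using F(3)[OF that, of n] R[of b] that spm by auto
  show "\<bar>f b\<bar> \<le> 2 * R" if "b \<in> space \<mu>" for b
   using R[of b] that spm by auto
 qed (use F(2) apF fm in \<open>auto intro!: AE_I2\<close>)
qed

end

lemma nn_integral_mono_emeasure:
 assumes s: "sets M = sets N" and le: "\<And>A. A \<in> sets M \<Longrightarrow> emeasure M A \<le> emeasure N A"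
 shows "integral\<^sup>N M f \<le> integral\<^sup>N N f"
proof -
 have sp: "space M = space N" using s by (rule sets_eq_imp_space_eq)
 have sf: "simple_function M g \<longleftrightarrow> simple_function N g" for g :: "'a \<Rightarrow> ennreal"
  using s sp by (simp add: simple_function_def)
 show ?thesis
  unfolding nn_integral_def
 proof (rule SUP_mono)
  fix g :: "'a \<Rightarrow> ennreal" assume g: "g \<in> {g. simple_function M g \<and> g \<le> f}"
  then have "integral\<^sup>S M g \<le> integral\<^sup>S N g"
   unfolding simple_integral_def sp[symmetric]
   using simple_functionD(2)[of M g] by (intro sum_mono mult_left_mono le) auto
  then show "\<exists>g'\<in>{g. simple_function N g \<and> g \<le> f}. integral\<^sup>S M g \<le> integral\<^sup>S N g'"
   using g sf by blast
 qed
qed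

text \<open>An approximation in L^r of the sum of two measures is an approximation for both at
  once.\<close>

lemma exists_sum_measure:
 assumes "finite_measure m1" "finite_measure m2" and s: "sets m2 = sets m1"
 shows "\<exists>\<mu>. finite_measure \<mu> \<and> sets \<mu> = sets m1 \<and>
  (\<forall>A\<in>sets m1. emeasure \<mu> A = emeasure m1 A + emeasure m2 A)"
proof -
 interpret m1: finite_measure m1 by fact
 interpret m2: finite_measure m2 by fact
 define \<mu> where "\<mu> = measure_of (space m1) (sets m1) (\<lambda>A. emeasure m1 A + emeasure m2 A)"
 have st: "sets \<mu> = sets m1" and sp: "space \<mu> = space m1"
  unfolding \<mu>_def by (simp_all add: sets.space_closed sets.sigma_sets_eq)
 have e: "emeasure \<mu> A = emeasure m1 A + emeasure m2 A" if "A \<in> sets m1" for A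
  unfolding \<mu>_def
 proof (rule emeasure_measure_of_sigma)
  show "sigma_algebra (space m1) (sets m1)" by (rule sets.sigma_algebra_axioms)
  show "positive (sets m1) (\<lambda>A. emeasure m1 A + emeasure m2 A)" by (simp add: positive_def)
  show "countably_additive (sets m1) (\<lambda>A. emeasure m1 A + emeasure m2 A)"
  proof (rule countably_additiveI)
   fix A :: "nat \<Rightarrow> 'a set"
   assume A: "range A \<subseteq> sets m1" "disjoint_family A"
   then have A2: "range A \<subseteq> sets m2" using s by simp
   have "(\<Sum>i. emeasure m1 (A i) + emeasure m2 (A i)) = (\<Sum>i. emeasure m1 (A i)) + (\<Sum>i. emeasure m2 (A i))"
    by (rule suminf_add[symmetric]) auto
   then show "(\<Sum>i. emeasure m1 (A i) + emeasure m2 (A i)) = emeasure m1 (\<Union>(range A)) + emeasure m2 (\<Union>(range A))"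
    by (simp only: suminf_emeasure[OF A] suminf_emeasure[OF A2 A(2)])
  qed
 qed fact
 have "finite_measure \<mu>"
 proof
  have "emeasure \<mu> (space m1) = emeasure m1 (space m1) + emeasure m2 (space m1)"
   by (rule e) auto
  also have "space m1 = space m2" using s by (rule sets_eq_imp_space_eq[symmetric])
  then have "emeasure m1 (space m1) + emeasure m2 (space m1) \<noteq> \<infinity>"
   using m1.emeasure_finite m2.emeasure_finite by (simp add: ennreal_add_eq_top)
  finally show "emeasure \<mu> (space \<mu>) \<noteq> \<infinity>" unfolding sp .
 qed
 then show ?thesis using st e by blast
qed

section \<open>Events and functions of the path expressed through \<open>\<beta>\<close>\<close>

locale path_brownian = brownian \<nu> \<beta>
 for \<nu> :: "(real \<Rightarrow> real ^ 'n) measure" and \<beta> :: "(real \<Rightarrow> real ^ 'n) \<Rightarrow> real \<Rightarrow> real ^ 'n" +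
 assumes sets_nu: "sets \<nu> = sets path_space"
  and filt: "\<And>t. t \<in> {0..1} \<Longrightarrow>
      sets (completed_filtration \<nu> \<beta> t) = sets (completed_filtration \<nu> (\<lambda>w. w) t)"
begin

lemma space_nu: "space \<nu> = space path_space"
 using sets_nu by (rule sets_eq_imp_space_eq)

lemma path_measurable_nu: "X \<in> measurable \<nu> path_space \<longleftrightarrow> X \<in> measurable \<nu> \<nu>"
 using sets_nu by (simp cong: measurable_cong_sets)

lemma coord_filtration_measurable_eq:
 "t \<in> {0..1} \<Longrightarrow> measurable (completed_filtration \<nu> (\<lambda>w. w) t) N = measurable (FB t) N"
 by (rule measurable_cong_sets[OF filt[symmetric] refl])

lemma path_spaceD:
 assumes "w \<in> space path_space"
 shows "continuous_on {0..1} w" "w \<in> extensional {0..1}"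
 using assms by (auto simp: path_space_def space_restrict_space space_PiM PiE_def)

lemma path_measurableI:
 fixes X :: "'a \<Rightarrow> real \<Rightarrow> real ^ 'm"
 assumes X: "\<And>w. w \<in> space M \<Longrightarrow> X w \<in> space path_space"
  and ev: "\<And>t. t \<in> {0..1} \<Longrightarrow> (\<lambda>w. X w t) \<in> borel_measurable M"
 shows "X \<in> measurable M path_space"
 unfolding path_space_def
proof (rule measurable_restrict_space2)
 show "X \<in> space M \<rightarrow> {w. continuous_on {0..1} w}"
  using X by (auto simp: path_space_def space_restrict_space)
 have "(\<lambda>w t. X w t) \<in> measurable M (PiM {0..1} (\<lambda>_. borel))"
 proof (rule measurable_PiM_single')
  show "(\<lambda>w t. X w t) \<in> space M \<rightarrow> {0..1} \<rightarrow>\<^sub>E space borel"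
  proof
   fix w assume "w \<in> space M"
   from X[OF this] show "X w \<in> {0..1} \<rightarrow>\<^sub>E space borel"
    by (auto simp: path_space_def space_restrict_space space_PiM)
  qed
 qed (rule ev)
 then show "X \<in> measurable M (PiM {0..1} (\<lambda>_. borel))" by simp
qed

text \<open>The identity is measurable for the coordinate filtration at time 1, which equals
  \<open>FB 1\<close>; \<open>filtration_set_approx\<close> then turns the event into one of
  \<open>\<beta>\<close>. Paths are extensional, so restricting \<open>\<beta> w\<close> to
  \<open>{0..1}\<close> changes nothing.\<close>

lemma set_factor:
 assumes E: "E \<in> sets \<nu>"
 shows "\<exists>Z\<in>sets path_space. AE w in \<nu>. w \<in> E \<longleftrightarrow> \<beta> w \<in> Z"
proof -
 let ?F = "completed_filtration \<nu> (\<lambda>w. w) 1"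
 have "(\<lambda>w. w) \<in> measurable ?F path_space"
  by (rule path_measurableI) (auto simp: space_nu intro: filtration_coord_measurable)
 from measurable_sets[OF this] E have "E \<in> sets ?F"
  using sets.sets_into_space[OF E] sets_nu by (auto simp: Int_absorb2)
 then have "E \<in> sets (FB 1)" using filt[of 1] by simp
 from filtration_set_approx[OF this] obtain Z where
  Z: "Z \<in> sets (PiM {0..1} (\<lambda>_. borel))" "AE w in \<nu>. w \<in> E \<longleftrightarrow> restrict (\<beta> w) {0..1} \<in> Z"
  by blast
 show ?thesis
 proof (rule bexI[of _ "{w. continuous_on {0..1} w} \<inter> Z"])
  show "{w. continuous_on {0..1} w} \<inter> Z \<in> sets path_space"
   unfolding path_space_def sets_restrict_space using Z(1) by blast
  show "AE w in \<nu>. w \<in> E \<longleftrightarrow> \<beta> w \<in> {w. continuous_on {0..1} w} \<inter> Z"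
   using Z(2) AE_space
  proof eventually_elim
   case (elim w)
   have "restrict (\<beta> w) {0..1} = \<beta> w"
    using path_spaceD(2)[OF B_space[OF elim(2)]] by (rule extensional_restrict)
   then show ?case using elim path_spaceD(1)[OF B_space[OF elim(2)]] by simp
  qed
 qed
qed

lemma function_factor:
 assumes f: "f \<in> borel_measurable \<nu>" and R: "\<And>w. w \<in> space \<nu> \<Longrightarrow> \<bar>f w :: real\<bar> \<le> R"
 shows "\<exists>f'\<in>borel_measurable path_space. (\<forall>b. \<bar>f' b\<bar> \<le> R) \<and> (AE w in \<nu>. f w = f' (\<beta> w))"
proof -
 from borel_measurable_implies_sequence_metric[OF f, of 0]
 obtain F where F: "\<forall>i. simple_function \<nu> (F i)" "\<forall>x\<in>space \<nu>. (\<lambda>i. F i x) \<longlonglongrightarrow> f x"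
  by blast
 have "\<exists>Z\<in>sets path_space. AE w in \<nu>. w \<in> F i -` {y} \<inter> space \<nu> \<longleftrightarrow> \<beta> w \<in> Z" for i y
  by (rule set_factor) (use F(1) simple_functionD(2) in blast)
 then have ex: "\<exists>Z. Z \<in> sets path_space \<and> (AE w in \<nu>. w \<in> F i -` {y} \<inter> space \<nu> \<longleftrightarrow> \<beta> w \<in> Z)" for i y
  by blast
 define Z where "Z i y = (SOME Z. Z \<in> sets path_space \<and>
   (AE w in \<nu>. w \<in> F i -` {y} \<inter> space \<nu> \<longleftrightarrow> \<beta> w \<in> Z))" for i y
 have Z: "Z i y \<in> sets path_space"
  "AE w in \<nu>. w \<in> F i -` {y} \<inter> space \<nu> \<longleftrightarrow> \<beta> w \<in> Z i y" for i y
  using someI_ex[OF ex[of i y]] unfolding Z_def[symmetric] by blast+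
 define G where "G i b = (\<Sum>y\<in>F i ` space \<nu>. y * indicator (Z i y) b)" for i b
 have fin: "finite (F i ` space \<nu>)" for i using F(1) simple_functionD(1) by blast
 have Gm: "G i \<in> borel_measurable path_space" for i
  unfolding G_def using Z(1) by (intro borel_measurable_sum borel_measurable_times borel_measurable_indicator) auto
 have GF: "AE w in \<nu>. G i (\<beta> w) = F i w" for i
 proof -
  have "AE w in \<nu>. \<forall>y\<in>F i ` space \<nu>. w \<in> F i -` {y} \<inter> space \<nu> \<longleftrightarrow> \<beta> w \<in> Z i y"
   using Z(2) fin by (intro AE_finite_allI) auto
  then show ?thesis using AE_space
  proof eventually_elim
   case (elim w)
   have "G i (\<beta> w) = (\<Sum>y\<in>F i ` space \<nu>. if y = F i w then y else 0)"
    unfolding G_def using elim by (intro sum.cong) (auto simp: indicator_def)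
   then show ?case using elim(2) fin by simp
  qed
 qed
 \<comment> \<open>Off the image of \<open>\<beta>\<close> the sequence may diverge and
   \<open>lim\<close> is arbitrary; clamping keeps the bound \<open>R\<close> at every
   argument.\<close>
 define f' where "f' b = max (- R) (min R (lim (\<lambda>i. G i b)))" for b
 obtain w0 where "w0 \<in> space \<nu>" using not_empty by auto
 from R[OF this] have Rn: "R \<ge> 0" by linarith
 have "f' \<in> borel_measurable path_space"
  unfolding f'_def by (intro borel_measurable_max borel_measurable_min borel_measurable_const borel_measurable_lim_metric Gm)
 moreover have "\<forall>b. \<bar>f' b\<bar> \<le> R" using Rn by (auto simp: f'_def)
 moreover have "AE w in \<nu>. \<forall>i. G i (\<beta> w) = F i w" using GF by (simp add: AE_all_countable)
 then have "AE w in \<nu>. f w = f' (\<beta> w)"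
  using AE_space
 proof eventually_elim
  case (elim w)
  then have "(\<lambda>i. G i (\<beta> w)) \<longlonglongrightarrow> f w" using F(2) by simp
  then have "lim (\<lambda>i. G i (\<beta> w)) = f w" by (rule limI)
  then show ?case using R[OF elim(2)] by (auto simp: f'_def)
 qed
 ultimately show ?thesis by blast
qed

lemma trig_beta_measurable: "g \<in> trig \<Longrightarrow> (\<lambda>w. g (\<beta> w)) \<in> borel_measurable \<nu>"
 by (rule trig_measurable) (auto intro: B_measurable)

text \<open>The second measure will be an image of \<nu> under a controlled map \<open>U\<close>, so
  that a single \<open>g\<close> approximates \<open>f\<close> and, after composition, also
  \<open>f (U w)\<close>. The density theorem is applied to the image under \<open>\<beta>\<close>
  of the sum of both measures; absolute continuity transfers the factorisation of \<open>f\<close>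
  and \<open>\<beta> w 0 = 0\<close>.\<close>

lemma trig_dense:
 assumes m1: "finite_measure m1" "sets m1 = sets \<nu>" "absolutely_continuous \<nu> m1"
  and m2: "finite_measure m2" "sets m2 = sets \<nu>" "absolutely_continuous \<nu> m2"
  and f: "f \<in> borel_measurable \<nu>" "\<And>w. w \<in> space \<nu> \<Longrightarrow> \<bar>f w\<bar> \<le> R" and r: "r > 0" and eps: "\<epsilon> > 0"
 shows "\<exists>g\<in>trig. (\<integral>w. \<bar>f w - g (\<beta> w)\<bar> ^ r \<partial>m1) < \<epsilon> \<and> (\<integral>w. \<bar>f w - g (\<beta> w)\<bar> ^ r \<partial>m2) < \<epsilon>"
proof -
 obtain \<mu> where \<mu>: "finite_measure \<mu>" "sets \<mu> = sets m1"
  and e: "\<And>A. A \<in> sets m1 \<Longrightarrow> emeasure \<mu> A = emeasure m1 A + emeasure m2 A"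
  using exists_sum_measure[OF m1(1) m2(1)] m1(2) m2(2) by auto
 interpret \<mu>: finite_measure \<mu> by fact
 have s\<mu>: "sets \<mu> = sets \<nu>" using \<mu>(2) m1(2) by simp
 have sp\<mu>: "space \<mu> = space \<nu>" using s\<mu> by (rule sets_eq_imp_space_eq)
 have ac: "absolutely_continuous \<nu> \<mu>"
  unfolding absolutely_continuous_def
 proof
  fix A assume A: "A \<in> null_sets \<nu>"
  then have "A \<in> null_sets m1" "A \<in> null_sets m2"
   using m1(3) m2(3) by (auto simp: absolutely_continuous_def)
  then show "A \<in> null_sets \<mu>" using e[of A] s\<mu> m1(2) by (auto simp: null_sets_def)
 qed
 have \<beta>m: "\<beta> \<in> measurable \<mu> path_space" using B_path s\<mu> by (simp cong: measurable_cong_sets)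
 obtain f' where f': "f' \<in> borel_measurable path_space" "\<And>b. \<bar>f' b\<bar> \<le> R" "AE w in \<nu>. f w = f' (\<beta> w)"
  using function_factor[OF f] by blast
 have ff': "AE w in \<mu>. f w = f' (\<beta> w)"
  by (rule absolutely_continuous_AE[OF s\<mu> ac f'(3)])
 interpret P: path_measure "distr \<mu> path_space \<beta>" r
 proof -
  interpret D: finite_measure "distr \<mu> path_space \<beta>" by (rule \<mu>.finite_measure_distr[OF \<beta>m])
  show "path_measure (distr \<mu> path_space \<beta>) r"
  proof (unfold_locales)
   have "AE w in \<mu>. \<beta> w 0 = 0" by (rule absolutely_continuous_AE[OF s\<mu> ac B_0])
   moreover have "{b \<in> space path_space. b 0 = 0} \<in> sets path_space"
    using measurable_sets[OF path_eval_measurable[of 0], of "{0}"]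
    by (simp add: vimage_def Int_def conj_commute)
   ultimately show "AE b in distr \<mu> path_space \<beta>. b 0 = 0"
    by (subst AE_distr_iff[OF \<beta>m])
  qed (auto simp: r)
 qed
 have "P.apx f'" by (rule P.apx_bounded[OF f'(1) f'(2)])
 then obtain g where g: "g \<in> trig" "(\<integral>b. \<bar>f' b - g b\<bar> ^ r \<partial>distr \<mu> path_space \<beta>) < \<epsilon>"
  unfolding P.apx_def using eps by blast
 have gm: "(\<lambda>w. g (\<beta> w)) \<in> borel_measurable \<nu>" by (rule trig_beta_measurable[OF g(1)])
 have gm': "g \<in> borel_measurable path_space" using P.trig_meas[OF g(1)] by simp
 obtain C where C: "\<And>b. \<bar>g b\<bar> \<le> C" using trig_bounded[OF g(1)] by blast
 let ?d = "\<lambda>w. \<bar>f w - g (\<beta> w)\<bar> ^ r"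
 have dm: "?d \<in> borel_measurable \<nu>" using f(1) gm by measurable
 have dm\<mu>: "?d \<in> borel_measurable \<mu>" using dm s\<mu> by (simp cong: measurable_cong_sets)
 have db: "AE w in m. norm (?d w) \<le> (R + C) ^ r" if "sets m = sets \<nu>" for m
 proof (rule AE_I2)
  fix w assume "w \<in> space m"
  then have "w \<in> space \<nu>" using sets_eq_imp_space_eq[OF that] by simp
  then have "\<bar>f w - g (\<beta> w)\<bar> \<le> R + C" using f(2)[of w] C[of "\<beta> w"] by linarith
  then show "norm (?d w) \<le> (R + C) ^ r"
   by (simp only: real_norm_def power_abs abs_abs) (rule power_mono, auto)
 qed
 have int: "integrable m ?d" if "finite_measure m" "sets m = sets \<nu>" for m
 proof -
  interpret finite_measure m by fact
  show ?thesis
   using dm that(2) by (intro integrable_const_bound[OF db]) (auto cong: measurable_cong_sets)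
 qed
 have "(\<integral>w. ?d w \<partial>\<mu>) = (\<integral>w. \<bar>f' (\<beta> w) - g (\<beta> w)\<bar> ^ r \<partial>\<mu>)"
 proof (rule integral_cong_AE)
  show "(\<lambda>w. \<bar>f' (\<beta> w) - g (\<beta> w)\<bar> ^ r) \<in> borel_measurable \<mu>"
   using measurable_compose[OF \<beta>m f'(1)] measurable_compose[OF \<beta>m gm'] by measurable
 qed (use ff' dm\<mu> in auto)
 also have "\<dots> = (\<integral>b. \<bar>f' b - g b\<bar> ^ r \<partial>distr \<mu> path_space \<beta>)"
  by (rule integral_distr[OF \<beta>m, symmetric]) (use f'(1) gm' in measurable)
 finally have lt: "(\<integral>w. ?d w \<partial>\<mu>) < \<epsilon>" using g(2) by simp
 have le: "(\<integral>w. ?d w \<partial>m) \<le> (\<integral>w. ?d w \<partial>\<mu>)"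
  if m: "finite_measure m" "sets m = sets \<nu>" and em: "\<And>A. A \<in> sets m \<Longrightarrow> emeasure m A \<le> emeasure \<mu> A" for m
 proof -
  have "ennreal (\<integral>w. ?d w \<partial>m) = (\<integral>\<^sup>+w. ?d w \<partial>m)"
   by (rule nn_integral_eq_integral[symmetric]) (use int m in auto)
  also have "\<dots> \<le> (\<integral>\<^sup>+w. ?d w \<partial>\<mu>)"
   using m(2) s\<mu> em by (intro nn_integral_mono_emeasure) auto
  also have "\<dots> = ennreal (\<integral>w. ?d w \<partial>\<mu>)"
   by (rule nn_integral_eq_integral) (use int \<mu> s\<mu> in auto)
  finally show ?thesis by (subst (asm) ennreal_le_iff) (auto intro: integral_nonneg)
 qed
 have "(\<integral>w. ?d w \<partial>m1) < \<epsilon>" "(\<integral>w. ?d w \<partial>m2) < \<epsilon>"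
  using le[OF m1(1,2)] le[OF m2(1,2)] e m1(2) m2(2) lt by (force intro: order_le_less_trans)+
 then show ?thesis using g(1) by blast
qed

lemma paths_eqI:
 assumes w: "w \<in> space path_space" "w' \<in> space path_space"
  and eq: "\<And>j N. j \<le> Suc N \<Longrightarrow> w (real j / real (Suc N)) = w' (real j / real (Suc N))"
 shows "w = w'"
proof (rule extensionalityI)
 show "w \<in> extensional {0..1}" "w' \<in> extensional {0..1}" using w path_spaceD by auto
 fix t :: real assume t: "t \<in> {0..1}"
 obtain j where j: "\<And>N. j N \<le> Suc N" "(\<lambda>N. real (j N) / real (Suc N)) \<longlonglongrightarrow> t"
  using grid_approx[OF t] by blast
 have ev: "\<forall>\<^sub>F N in sequentially. real (j N) / real (Suc N) \<in> {0..1}"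
  using j(1) by (intro always_eventually allI) (auto simp: field_simps simp flip: of_nat_Suc)
 have "(\<lambda>N. w (real (j N) / real (Suc N))) \<longlonglongrightarrow> w t"
  by (rule continuous_on_tendsto_compose[OF path_spaceD(1)[OF w(1)] j(2) t ev])
 moreover have "(\<lambda>N. w' (real (j N) / real (Suc N))) \<longlonglongrightarrow> w' t"
  by (rule continuous_on_tendsto_compose[OF path_spaceD(1)[OF w(2)] j(2) t ev])
 ultimately show "w t = w' t" unfolding eq[OF j(1)] by (rule LIMSEQ_unique)
qed

text \<open>Each event of the path is almost surely an event of \<open>\<beta>\<close>. Absolute
  continuity lets this equivalence be evaluated at \<open>\<Theta> w\<close>, and since
  \<open>\<beta>\<close> agrees there, \<open>\<Theta> w\<close> and \<open>w\<close> lie in the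
  same events almost surely.\<close>

lemma identity_of_beta_fixed:
 assumes \<Theta>: "\<Theta> \<in> measurable \<nu> path_space" and ac: "absolutely_continuous \<nu> (distr \<nu> path_space \<Theta>)"
  and fx: "AE w in \<nu>. \<beta> (\<Theta> w) = \<beta> w"
 shows "AE w in \<nu>. \<Theta> w = w"
proof -
 have \<Theta>': "\<Theta> \<in> measurable \<nu> \<nu>" using \<Theta> path_measurable_nu by blast
 have set: "AE w in \<nu>. \<Theta> w \<in> E \<longleftrightarrow> w \<in> E" if E: "E \<in> sets \<nu>" for E
 proof -
  obtain Z where Z: "Z \<in> sets path_space" "AE w in \<nu>. w \<in> E \<longleftrightarrow> \<beta> w \<in> Z"
   using set_factor[OF E] by blast
  have "AE w in distr \<nu> path_space \<Theta>. w \<in> E \<longleftrightarrow> \<beta> w \<in> Z"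
   by (rule absolutely_continuous_AE[OF _ ac Z(2)]) (simp add: sets_nu)
  then have "AE w in \<nu>. \<Theta> w \<in> E \<longleftrightarrow> \<beta> (\<Theta> w) \<in> Z"
   by (rule AE_distrD[OF \<Theta>])
  with fx Z(2) show ?thesis by eventually_elim auto
 qed
 let ?E = "\<lambda>N j i q. {w \<in> space \<nu>. w (real j / real (Suc N)) \<bullet> i < real_of_rat q}"
 have E: "?E N j i q \<in> sets \<nu>" if "j \<le> Suc N" for N j q and i :: "real ^ 'n"
 proof -
  have "real j / real (Suc N) \<in> {0..1}" using that by (auto simp: field_simps simp flip: of_nat_Suc)
  then have "(\<lambda>w. w (real j / real (Suc N))) \<in> borel_measurable path_space"
   by (rule path_eval_measurable)
  then have "(\<lambda>w. w (real j / real (Suc N))) \<in> borel_measurable \<nu>"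
   by (subst measurable_cong_sets[OF sets_nu refl])
  then show ?thesis by measurable
 qed
 \<comment> \<open>Countably many events, so that the exceptional sets can be united: rational
   half-spaces determine a vector, and grid times determine a continuous path.\<close>
 have "AE w in \<nu>. \<forall>N. \<forall>j. \<forall>q. \<forall>i\<in>Basis. j \<le> Suc N \<longrightarrow> (\<Theta> w \<in> ?E N j i q \<longleftrightarrow> w \<in> ?E N j i q)"
  unfolding AE_all_countable
 proof (intro allI AE_finite_allI)
  fix N j q and i :: "real ^ 'n"
  show "AE w in \<nu>. j \<le> Suc N \<longrightarrow> (\<Theta> w \<in> ?E N j i q \<longleftrightarrow> w \<in> ?E N j i q)"
   using set[OF E, of j N i q] by (cases "j \<le> Suc N") auto
 qed simp
 then show ?thesis using AE_space
 proof eventually_elim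
  case (elim w)
  have sp: "\<Theta> w \<in> space \<nu>" using measurable_space[OF \<Theta>' elim(2)] .
  show ?case
  proof (rule paths_eqI)
   show "\<Theta> w \<in> space path_space" "w \<in> space path_space" using sp elim(2) space_nu by auto
   fix j N assume j: "j \<le> Suc N"
   show "\<Theta> w (real j / real (Suc N)) = w (real j / real (Suc N))" (is "?x = ?y")
   proof (rule euclidean_eqI)
    fix i :: "real ^ 'n" assume i: "i \<in> Basis"
    have q: "?x \<bullet> i < real_of_rat q \<longleftrightarrow> ?y \<bullet> i < real_of_rat q" for q
     using elim(1) j i sp elim(2) by blast
    show "?x \<bullet> i = ?y \<bullet> i"
    proof (rule ccontr)
     assume "?x \<bullet> i \<noteq> ?y \<bullet> i"
     then consider "?x \<bullet> i < ?y \<bullet> i" | "?y \<bullet> i < ?x \<bullet> i" by linarith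
     then show False
     proof cases
      case 1
      then obtain q where "?x \<bullet> i < real_of_rat q" "real_of_rat q < ?y \<bullet> i" using of_rat_dense by blast
      then show False using q[of q] by linarith
     next
      case 2
      then obtain q where "?y \<bullet> i < real_of_rat q" "real_of_rat q < ?x \<bullet> i" using of_rat_dense by blast
      then show False using q[of q] by linarith
     qed
    qed
   qed
  qed
 qed
qed

text \<open>The indicator of an event is approximated by one function of \<open>trig\<close>
  simultaneously under both laws, and on \<open>trig\<close> the two integrals agree. Absolute
  continuity is what brings functions of the path within reach of functions of
  \<open>\<beta>\<close>.\<close>

lemma law_eqI:
 assumes m: "finite_measure m" "sets m = sets \<nu>" "absolutely_continuous \<nu> m"
  and eq: "\<And>g. g \<in> trig \<Longrightarrow> (\<integral>w. g (\<beta> w) \<partial>m) = (\<integral>w. g (\<beta> w) \<partial>\<nu>)"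
 shows "m = \<nu>"
proof (rule measure_eqI)
 interpret m: finite_measure m by fact
 show "sets m = sets \<nu>" by fact
 fix E assume "E \<in> sets m"
 then have E: "E \<in> sets \<nu>" using m(2) by simp
 have "\<bar>measure m E - measure \<nu> E\<bar> \<le> 2 * \<epsilon>" if e0: "\<epsilon> > 0" for \<epsilon> :: real
 proof -
  obtain g where g: "g \<in> trig"
   "(\<integral>w. \<bar>indicator E w - g (\<beta> w)\<bar> ^ 1 \<partial>m) < \<epsilon>" "(\<integral>w. \<bar>indicator E w - g (\<beta> w)\<bar> ^ 1 \<partial>\<nu>) < \<epsilon>"
   using trig_dense[OF m finite_measure_axioms refl _ _ _ _ e0, where f = "indicator E" and R = 1 and r = 1] E
   by (auto simp: absolutely_continuous_def indicator_def)
  obtain C where C: "\<And>b. \<bar>g b\<bar> \<le> C" using trig_bounded[OF g(1)] by blast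
  have gm: "(\<lambda>w. g (\<beta> w)) \<in> borel_measurable \<nu>" by (rule trig_beta_measurable[OF g(1)])
  then have gm': "(\<lambda>w. g (\<beta> w)) \<in> borel_measurable m" using m(2) by (simp cong: measurable_cong_sets)
  have ig: "integrable m (\<lambda>w. g (\<beta> w))" "integrable \<nu> (\<lambda>w. g (\<beta> w))"
   using C gm gm' by (auto intro!: m.integrable_const_bound[of _ C] integrable_const_bound[of _ C])
  have iE: "integrable m (indicator E :: _ \<Rightarrow> real)" "integrable \<nu> (indicator E :: _ \<Rightarrow> real)"
   using E m(2) by (auto simp: integrable_indicator_iff m.emeasure_finite less_top[symmetric])
  have "measure m E - (\<integral>w. g (\<beta> w) \<partial>m) = (\<integral>w. indicator E w - g (\<beta> w) \<partial>m)"
   using E m(2) ig iE sets.sets_into_space[OF E] sets_eq_imp_space_eq[OF m(2)] by (simp add: Int_absorb2)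
  also have "\<bar>\<dots>\<bar> \<le> (\<integral>w. \<bar>indicator E w - g (\<beta> w)\<bar> \<partial>m)" by (rule integral_abs_bound)
  finally have 1: "\<bar>measure m E - (\<integral>w. g (\<beta> w) \<partial>m)\<bar> \<le> \<epsilon>" using g(2) by simp
  have "measure \<nu> E - (\<integral>w. g (\<beta> w) \<partial>\<nu>) = (\<integral>w. indicator E w - g (\<beta> w) \<partial>\<nu>)"
   using E ig iE sets.sets_into_space[OF E] by (simp add: Int_absorb2)
  also have "\<bar>\<dots>\<bar> \<le> (\<integral>w. \<bar>indicator E w - g (\<beta> w)\<bar> \<partial>\<nu>)" by (rule integral_abs_bound)
  finally have 2: "\<bar>measure \<nu> E - (\<integral>w. g (\<beta> w) \<partial>\<nu>)\<bar> \<le> \<epsilon>" using g(3) by simp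
  show ?thesis using 1 2 eq[OF g(1)] by linarith
 qed
 \<comment> \<open>With this \<epsilon> the difference is at most half of itself, hence 0.\<close>
 from this[of "\<bar>measure m E - measure \<nu> E\<bar> / 4"] have "measure m E = measure \<nu> E" by auto
 then show "emeasure m E = emeasure \<nu> E" by (simp add: m.emeasure_eq_measure emeasure_eq_measure)
qed

end

section \<open>Girsanov formula on a grid\<close>

lemma distr_gauss_shift:
 fixes c :: "real ^ 'n"
 assumes h: "h > 0"
 shows "distr (density (gauss h) (\<lambda>y. ennreal (exp (- (c \<bullet> y) - h * (c \<bullet> c) / 2)))) borel (\<lambda>y. y + h *\<^sub>R c) = gauss h"
proof (rule measure_eqI)
 fix A assume "A \<in> sets (distr (density (gauss h) (\<lambda>y. ennreal (exp (- (c \<bullet> y) - h * (c \<bullet> c) / 2)))) borel (\<lambda>y. y + h *\<^sub>R c))"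
 then have A [measurable]: "A \<in> sets borel" by simp
 have m [measurable]: "(\<lambda>y. y + h *\<^sub>R c) \<in> borel_measurable borel" by measurable
 have "(\<lambda>y. y + h *\<^sub>R c) -` A \<in> sets borel" using measurable_sets[OF m A] by simp
 then have "emeasure (distr (density (gauss h) (\<lambda>y. ennreal (exp (- (c \<bullet> y) - h * (c \<bullet> c) / 2)))) borel (\<lambda>y. y + h *\<^sub>R c)) A
  = (\<integral>\<^sup>+y. ennreal (exp (- (c \<bullet> y) - h * (c \<bullet> c) / 2)) * indicator A (y + h *\<^sub>R c) \<partial>gauss h)"
  by (subst emeasure_distr) (auto simp: emeasure_density indicator_def intro!: nn_integral_cong)
 also have "\<dots> = emeasure (gauss h) A"
  by (subst nn_integral_gauss_shift[OF h]) auto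
 finally show "emeasure (distr (density (gauss h) (\<lambda>y. ennreal (exp (- (c \<bullet> y) - h * (c \<bullet> c) / 2)))) borel (\<lambda>y. y + h *\<^sub>R c)) A
  = emeasure (gauss h) A" .
qed simp

lemma integral_gauss_shift:
 fixes g :: "real ^ 'n \<Rightarrow> real"
 assumes h: "h > 0" and [measurable]: "g \<in> borel_measurable borel"
 shows "(\<integral>y. exp (- (c \<bullet> y) - h * (c \<bullet> c) / 2) * g (y + h *\<^sub>R c) \<partial>gauss h) = (\<integral>y. g y \<partial>gauss h)"
  and "integrable (gauss h) g \<Longrightarrow> integrable (gauss h) (\<lambda>y. exp (- (c \<bullet> y) - h * (c \<bullet> c) / 2) * g (y + h *\<^sub>R c))"
proof -
 let ?D = "density (gauss h) (\<lambda>y. ennreal (exp (- (c \<bullet> y) - h * (c \<bullet> c) / 2)))"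
 have "(\<integral>y. g y \<partial>gauss h) = (\<integral>y. g y \<partial>distr ?D borel (\<lambda>y. y + h *\<^sub>R c))"
  by (simp only: distr_gauss_shift[OF h])
 also have "\<dots> = (\<integral>y. g (y + h *\<^sub>R c) \<partial>?D)" by (rule integral_distr) auto
 also have "\<dots> = (\<integral>y. exp (- (c \<bullet> y) - h * (c \<bullet> c) / 2) * g (y + h *\<^sub>R c) \<partial>gauss h)"
  by (subst integral_density) auto
 finally show "(\<integral>y. exp (- (c \<bullet> y) - h * (c \<bullet> c) / 2) * g (y + h *\<^sub>R c) \<partial>gauss h) = (\<integral>y. g y \<partial>gauss h)" ..
 assume "integrable (gauss h) g"
 then have "integrable (distr ?D borel (\<lambda>y. y + h *\<^sub>R c)) g" by (simp only: distr_gauss_shift[OF h])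
 then have "integrable ?D (\<lambda>y. g (y + h *\<^sub>R c))" by (subst (asm) integrable_distr_eq) auto
 then show "integrable (gauss h) (\<lambda>y. exp (- (c \<bullet> y) - h * (c \<bullet> c) / 2) * g (y + h *\<^sub>R c))"
  by (subst (asm) integrable_density) auto
qed

lemma abs_le_exp_sum: "\<bar>x\<bar> \<le> exp x + exp (- x :: real)"
 using exp_ge_add_one_self[of x] exp_ge_add_one_self[of "-x"] exp_gt_zero[of x] exp_gt_zero[of "-x"] by linarith

lemma gauss_linear:
 fixes c :: "real ^ 'n"
 assumes h: "h > 0"
 shows "integrable (gauss h) (\<lambda>y. c \<bullet> y)" "(\<integral>y. c \<bullet> y \<partial>gauss h) = 0"
proof -
 have "integrable (gauss h) (\<lambda>y. exp (c \<bullet> y) + exp ((- c) \<bullet> y))"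
  using has_bochner_integral_gauss_exp[OF h] by (intro Bochner_Integration.integrable_add) (auto simp: has_bochner_integral_iff simp del: inner_minus_left)
 then show "integrable (gauss h) (\<lambda>y. c \<bullet> y)"
  by (rule Bochner_Integration.integrable_bound) (use abs_le_exp_sum[of "c \<bullet> _"] in \<open>auto intro!: AE_I2\<close>)
 show "(\<integral>y. c \<bullet> y \<partial>gauss h) = 0"
  by (rule integral_gauss_odd[OF h]) auto
qed

text \<open>Under the one-step Girsanov weight the increment has mean
  \<open>- h *\<^sub>R c\<close>: substitute \<open>y + h *\<^sub>R c\<close> and use that the
  Gaussian mean is 0.\<close>

lemma gauss_exp_weight:
 fixes c :: "real ^ 'n"
 assumes h: "h > 0"
 defines "e \<equiv> \<lambda>y. exp (- (c \<bullet> y) - h * (c \<bullet> c) / 2)"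
 shows "has_bochner_integral (gauss h) e 1"
  "has_bochner_integral (gauss h) (\<lambda>y. e y * (c \<bullet> y)) (- h * (c \<bullet> c))"
proof -
 interpret prob_space "gauss h :: (real ^ 'n) measure" by (rule prob_space_gauss[OF h])
 have u: "prob UNIV = 1" using prob_space by simp
 have 1: "(\<integral>y. e y \<partial>gauss h) = 1" "integrable (gauss h) e"
  using integral_gauss_shift[OF h, of "\<lambda>_. 1" c] u by (auto simp: e_def)
 then show "has_bochner_integral (gauss h) e 1" by (simp add: has_bochner_integral_iff)
 have "integrable (gauss h) (\<lambda>y. c \<bullet> y)" by (rule gauss_linear(1)[OF h])
 from integral_gauss_shift(2)[OF h _ this, of c]
 have i: "integrable (gauss h) (\<lambda>y. e y * (c \<bullet> (y + h *\<^sub>R c)))" by (simp add: e_def)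
 have eq: "e y * (c \<bullet> (y + h *\<^sub>R c)) - e y * (h * (c \<bullet> c)) = e y * (c \<bullet> y)" for y
  by (simp add: inner_simps algebra_simps)
 have i2: "integrable (gauss h) (\<lambda>y. e y * (c \<bullet> (y + h *\<^sub>R c)) - e y * (h * (c \<bullet> c)))"
  using i 1(2) by (intro Bochner_Integration.integrable_diff integrable_mult_left)
 have "(\<integral>y. e y * (c \<bullet> (y + h *\<^sub>R c)) - e y * (h * (c \<bullet> c)) \<partial>gauss h)
   = (\<integral>y. e y * (c \<bullet> (y + h *\<^sub>R c)) \<partial>gauss h) - (\<integral>y. e y * (h * (c \<bullet> c)) \<partial>gauss h)"
  using i 1(2) by (intro Bochner_Integration.integral_diff integrable_mult_left)
 also have "(\<integral>y. e y * (c \<bullet> (y + h *\<^sub>R c)) \<partial>gauss h) = 0"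
  using integral_gauss_shift(1)[OF h, of "\<lambda>y. c \<bullet> y" c] gauss_linear(2)[OF h] by (simp add: e_def)
 also have "(\<integral>y. e y * (h * (c \<bullet> c)) \<partial>gauss h) = h * (c \<bullet> c)" using 1 by simp
 finally show "has_bochner_integral (gauss h) (\<lambda>y. e y * (c \<bullet> y)) (- h * (c \<bullet> c))"
  using i2 unfolding eq by (simp add: has_bochner_integral_iff)
qed

text \<open>The drift \<open>\<xi> s\<close> acts on the cell that starts at \<open>s / N\<close>
  and is known at that time. This is exactly what allows it to be frozen while the increment over
  the cell is integrated.\<close>

locale grid_drift = brownian M B for M :: "'a measure" and B :: "'a \<Rightarrow> real \<Rightarrow> real ^ 'n" +
 fixes N :: nat and \<xi> :: "nat \<Rightarrow> 'a \<Rightarrow> real ^ 'n" and C :: real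
 assumes N: "N > 0" and C: "C \<ge> 0"
  and \<xi>_measurable: "\<And>s. s < N \<Longrightarrow> \<xi> s \<in> borel_measurable (FB (real s / real N))"
  and \<xi>_bound: "\<And>s w. s < N \<Longrightarrow> w \<in> space M \<Longrightarrow> norm (\<xi> s w) \<le> C"
begin

abbreviation h :: real where "h \<equiv> 1 / real N"

definition D :: "nat \<Rightarrow> 'a \<Rightarrow> real ^ 'n" where "D s w = inc N (B w) s"

text \<open>\<open>exp (- A i)\<close> is the Girsanov density after \<open>i\<close> steps, for the
  change of measure that compensates the shift of each increment by
  \<open>h *\<^sub>R \<xi> s\<close>.\<close>

definition A :: "nat \<Rightarrow> 'a \<Rightarrow> real" where
 "A i w = (\<Sum>s<i. \<xi> s w \<bullet> D s w + h * (\<xi> s w \<bullet> \<xi> s w) / 2)"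

lemma h_pos: "h > 0" using N by simp

lemma D_eq: "s < N \<Longrightarrow> D s w = B w (real (Suc s) / real N) - B w (real s / real N)"
 by (simp add: D_def inc_def add.commute)

lemma D_measurable: "Suc s \<le> i \<Longrightarrow> i \<le> N \<Longrightarrow> D s \<in> borel_measurable (FB (real i / real N))"
proof -
 assume "Suc s \<le> i" "i \<le> N"
 then have "(\<lambda>w. B w (real (Suc s) / real N) - B w (real s / real N)) \<in> borel_measurable (FB (real i / real N))"
  using N by (intro borel_measurable_diff B_FB) (auto intro!: divide_right_mono)
 moreover have "D s = (\<lambda>w. B w (real (Suc s) / real N) - B w (real s / real N))"
  using \<open>Suc s \<le> i\<close> \<open>i \<le> N\<close> by (intro ext D_eq) simp
 ultimately show ?thesis by (simp only:)
qed

lemma \<xi>_measurable': "s \<le> i \<Longrightarrow> s < N \<Longrightarrow> \<xi> s \<in> borel_measurable (FB (real i / real N))"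
 using N by (intro measurable_filtration_mono[OF _ \<xi>_measurable]) (auto intro!: divide_right_mono)

lemma A_measurable: "i \<le> N \<Longrightarrow> A i \<in> borel_measurable (FB (real i / real N))"
proof -
 assume i: "i \<le> N"
 have [measurable]: "\<xi> s \<in> borel_measurable (FB (real i / real N))" if "s \<in> {..<i}" for s
  using \<xi>_measurable'[of s i] that i by auto
 have [measurable]: "D s \<in> borel_measurable (FB (real i / real N))" if "s \<in> {..<i}" for s
  using D_measurable[of s i] that i by auto
 have "(\<lambda>w. \<Sum>s\<in>{..<i}. \<xi> s w \<bullet> D s w + h * (\<xi> s w \<bullet> \<xi> s w) / 2) \<in> borel_measurable (FB (real i / real N))"
  by (intro borel_measurable_sum) measurable
 then show ?thesis unfolding A_def .
qed

lemma A_Suc: "A (Suc i) w = A i w + \<xi> i w \<bullet> D i w + h * (\<xi> i w \<bullet> \<xi> i w) / 2"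
 by (simp add: A_def)

lemma time_step: "i < N \<Longrightarrow> 0 \<le> real i / real N \<and> real i / real N < real (Suc i) / real N \<and> real (Suc i) / real N \<le> 1"
 using N by (auto simp: field_simps)

lemma time_diff: "real (Suc i) / real N - real i / real N = h"
 using N by (simp add: field_simps)

lemma nn_step:
 assumes i: "i < N" and \<phi>: "(\<lambda>(w, y). \<phi> w y) \<in> borel_measurable (FB (real i / real N) \<Otimes>\<^sub>M borel)"
 shows "(\<integral>\<^sup>+w. \<phi> w (D i w) \<partial>M) = (\<integral>\<^sup>+w. (\<integral>\<^sup>+y. \<phi> w y \<partial>gauss h) \<partial>M)"
proof -
 have "(\<integral>\<^sup>+w. (case (w, B w (real (Suc i) / real N) - B w (real i / real N)) of (w, y) \<Rightarrow> \<phi> w y) \<partial>M)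
  = (\<integral>\<^sup>+w. (\<integral>\<^sup>+y. (case (w, y) of (w, y) \<Rightarrow> \<phi> w y) \<partial>gauss (real (Suc i) / real N - real i / real N)) \<partial>M)"
  using time_step[OF i] by (intro nn_integral_increment \<phi>) auto
 then show ?thesis unfolding time_diff D_eq[OF i] by simp
qed

lemma real_step:
 fixes \<phi> :: "'a \<Rightarrow> real ^ 'n \<Rightarrow> real"
 assumes i: "i < N" and \<phi>: "(\<lambda>(w, y). \<phi> w y) \<in> borel_measurable (FB (real i / real N) \<Otimes>\<^sub>M borel)"
  and int: "integrable (completion M) (\<lambda>w. \<phi> w (D i w))"
 shows "(\<integral>w. \<phi> w (D i w) \<partial>completion M) = (\<integral>w. (\<integral>y. \<phi> w y \<partial>gauss h) \<partial>completion M)"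
proof -
 have "(\<integral>w. (case (w, B w (real (Suc i) / real N) - B w (real i / real N)) of (w, y) \<Rightarrow> \<phi> w y) \<partial>completion M)
  = (\<integral>w. (\<integral>y. (case (w, y) of (w, y) \<Rightarrow> \<phi> w y) \<partial>gauss (real (Suc i) / real N - real i / real N)) \<partial>completion M)"
  using time_step[OF i] int by (intro integral_increment \<phi>) (auto simp: D_eq[OF i])
 then show ?thesis unfolding time_diff D_eq[OF i] by simp
qed

text \<open>Each step contributes the Gaussian mean \<open>exp (h * (a\<^sup>2 - a) * (\<xi> i w
  \<bullet> \<xi> i w) / 2)\<close>. At \<open>i = N\<close> the bound is free of \<open>N\<close>,
  so all moments of the densities are uniform over the grids.\<close>

lemma nn_integral_exp_A:
 assumes "i \<le> N"
 shows "(\<integral>\<^sup>+w. ennreal (exp (- a * A i w)) \<partial>M) \<le> ennreal (exp (real i * h * (a\<^sup>2 + \<bar>a\<bar>) * C\<^sup>2 / 2))"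
 using assms
proof (induction i)
 case 0
 then show ?case by (simp add: A_def emeasure_space_1)
next
 case (Suc i)
 then have i: "i < N" by simp
 have [measurable]: "A i \<in> borel_measurable (FB (real i / real N))" "\<xi> i \<in> borel_measurable (FB (real i / real N))"
  using A_measurable[of i] \<xi>_measurable[of i] i by auto
 let ?\<phi> = "\<lambda>w y. ennreal (exp (- a * (A i w + \<xi> i w \<bullet> y + h * (\<xi> i w \<bullet> \<xi> i w) / 2)))"
 let ?k = "exp (h * (a\<^sup>2 + \<bar>a\<bar>) * C\<^sup>2 / 2)"
 have "(\<integral>\<^sup>+w. ennreal (exp (- a * A (Suc i) w)) \<partial>M) = (\<integral>\<^sup>+w. ?\<phi> w (D i w) \<partial>M)"
  by (simp only: A_Suc)
 also have "\<dots> = (\<integral>\<^sup>+w. (\<integral>\<^sup>+y. ?\<phi> w y \<partial>gauss h) \<partial>M)"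
  by (rule nn_step[OF i]) measurable
 also have "\<dots> \<le> (\<integral>\<^sup>+w. ennreal (exp (- a * A i w)) * ennreal ?k \<partial>M)"
 proof (rule nn_integral_mono)
  fix w assume w: "w \<in> space M"
  let ?x = "\<xi> i w \<bullet> \<xi> i w"
  have x: "0 \<le> ?x" "?x \<le> C\<^sup>2"
   using \<xi>_bound[OF i w] C by (auto simp: power2_norm_eq_inner[symmetric] intro!: power_mono)
  have "(\<integral>\<^sup>+y. ?\<phi> w y \<partial>gauss h)
   = (\<integral>\<^sup>+y. ennreal (exp (- a * A i w - a * h * ?x / 2)) * ennreal (exp (((- a) *\<^sub>R \<xi> i w) \<bullet> y)) \<partial>gauss h)"
   by (intro nn_integral_cong) (simp add: ennreal_mult'[symmetric] exp_add[symmetric] algebra_simps)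
  also have "\<dots> = ennreal (exp (- a * A i w - a * h * ?x / 2)) * ennreal (exp (h * (((- a) *\<^sub>R \<xi> i w) \<bullet> ((- a) *\<^sub>R \<xi> i w)) / 2))"
   by (subst nn_integral_cmult) (simp_all only: nn_integral_gauss_exp[OF h_pos], measurable)
  also have "\<dots> = ennreal (exp (- a * A i w)) * ennreal (exp (h * ((a\<^sup>2 - a) * ?x) / 2))"
   by (simp add: ennreal_mult'[symmetric] exp_add[symmetric] power2_eq_square algebra_simps diff_divide_distrib)
  also have "\<dots> \<le> ennreal (exp (- a * A i w)) * ennreal ?k"
  proof (intro mult_left_mono ennreal_leI iffD2[OF exp_le_cancel_iff])
   have "(a\<^sup>2 - a) * ?x \<le> (a\<^sup>2 + \<bar>a\<bar>) * C\<^sup>2"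
    using x by (intro order_trans[OF mult_right_mono[of "a\<^sup>2 - a" "a\<^sup>2 + \<bar>a\<bar>"] mult_left_mono]) auto
   then have "h * ((a\<^sup>2 - a) * ?x) \<le> h * ((a\<^sup>2 + \<bar>a\<bar>) * C\<^sup>2)" using h_pos by (intro mult_left_mono) auto
   then show "h * ((a\<^sup>2 - a) * ?x) / 2 \<le> h * (a\<^sup>2 + \<bar>a\<bar>) * C\<^sup>2 / 2" by (simp add: mult.assoc)
  qed simp
  finally show "(\<integral>\<^sup>+y. ?\<phi> w y \<partial>gauss h) \<le> ennreal (exp (- a * A i w)) * ennreal ?k" .
 qed
 \<comment> \<open>\<open>A i\<close> is measurable only for the completion, so the constant factor
   is pulled out there.\<close>
 also have "\<dots> = (\<integral>\<^sup>+w. ennreal (exp (- a * A i w)) \<partial>completion M) * ennreal ?k"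
  unfolding nn_integral_completion[symmetric, of M "\<lambda>w. _ w * _"]
  by (rule nn_integral_multc) (rule measurable_FB_completion[of _ "real i / real N"], measurable)
 also have "\<dots> \<le> ennreal (exp (real i * h * (a\<^sup>2 + \<bar>a\<bar>) * C\<^sup>2 / 2)) * ennreal ?k"
  unfolding nn_integral_completion using Suc by (intro mult_right_mono) auto
 also have "\<dots> = ennreal (exp (real (Suc i) * h * (a\<^sup>2 + \<bar>a\<bar>) * C\<^sup>2 / 2))"
  by (simp add: ennreal_mult'[symmetric] exp_add[symmetric] algebra_simps add_divide_distrib)
 finally show ?case .
qed

lemma A_completion: "i \<le> N \<Longrightarrow> A i \<in> borel_measurable (completion M)"
 by (rule measurable_FB_completion[OF A_measurable])

lemma integrable_exp_A:
 assumes i: "i \<le> N" shows "integrable (completion M) (\<lambda>w. exp (- a * A i w))"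
proof (rule integrableI_nonneg)
 show "(\<lambda>w. exp (- a * A i w)) \<in> borel_measurable (completion M)"
  using A_completion[OF i] by measurable
 show "(\<integral>\<^sup>+w. ennreal (exp (- a * A i w)) \<partial>completion M) < \<infinity>"
  unfolding nn_integral_completion using nn_integral_exp_A[OF i, of a] by (auto intro: order_le_less_trans)
qed simp

lemma integrable_A: "i \<le> N \<Longrightarrow> integrable (completion M) (A i)"
proof -
 assume i: "i \<le> N"
 have "integrable (completion M) (\<lambda>w. exp (- (-1) * A i w) + exp (- 1 * A i w))"
  by (intro Bochner_Integration.integrable_add integrable_exp_A i)
 then show ?thesis
  by (rule Bochner_Integration.integrable_bound)
    (use A_completion[OF i] abs_le_exp_sum[of "A i _"] in \<open>auto intro!: AE_I2\<close>)
qed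

lemma integrable_exp_A_times_A: "i \<le> N \<Longrightarrow> integrable (completion M) (\<lambda>w. exp (- A i w) * A i w)"
proof -
 assume i: "i \<le> N"
 have "integrable (completion M) (\<lambda>w. exp (- 0 * A i w) + exp (- 2 * A i w))"
  by (intro Bochner_Integration.integrable_add integrable_exp_A i)
 then show ?thesis
 proof (rule Bochner_Integration.integrable_bound)
  show "(\<lambda>w. exp (- A i w) * A i w) \<in> borel_measurable (completion M)"
   using A_completion[OF i] by measurable
  have "\<bar>exp (- x) * x\<bar> \<le> exp (- 0 * x) + exp (- 2 * x)" for x :: real
  proof -
   have "exp (- x) * \<bar>x\<bar> \<le> exp (- x) * (exp x + exp (- x))"
    by (intro mult_left_mono abs_le_exp_sum) simp
   also have "\<dots> = exp (- 0 * x) + exp (- 2 * x)"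
    by (simp add: distrib_left exp_add[symmetric])
   finally show ?thesis by (simp add: abs_mult)
  qed
  then show "AE w in completion M. norm (exp (- A i w) * A i w) \<le> norm (exp (- 0 * A i w) + exp (- 2 * A i w))"
   by (intro AE_I2) (simp add: abs_of_pos[OF add_pos_pos])
 qed
qed

definition Q :: "nat \<Rightarrow> 'a \<Rightarrow> real" where "Q i w = (\<Sum>s<i. h * (\<xi> s w \<bullet> \<xi> s w) / 2)"

lemma Q_measurable: "i \<le> N \<Longrightarrow> Q i \<in> borel_measurable (FB (real i / real N))"
proof -
 assume i: "i \<le> N"
 have [measurable]: "\<xi> s \<in> borel_measurable (FB (real i / real N))" if "s \<in> {..<i}" for s
  using \<xi>_measurable'[of s i] that i by auto
 have "(\<lambda>w. \<Sum>s\<in>{..<i}. h * (\<xi> s w \<bullet> \<xi> s w) / 2) \<in> borel_measurable (FB (real i / real N))"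
  by (intro borel_measurable_sum) measurable
 then show ?thesis unfolding Q_def .
qed

lemma Q_bound: "i \<le> N \<Longrightarrow> w \<in> space M \<Longrightarrow> \<bar>Q i w\<bar> \<le> C\<^sup>2 / 2"
proof -
 assume i: "i \<le> N" and w: "w \<in> space M"
 have x: "\<xi> s w \<bullet> \<xi> s w \<le> C\<^sup>2" if "s < i" for s
  using \<xi>_bound[of s w] i w that C by (auto simp: power2_norm_eq_inner[symmetric] intro!: power_mono)
 have "Q i w \<le> (\<Sum>s<i. h * C\<^sup>2 / 2)"
  unfolding Q_def using h_pos by (intro sum_mono divide_right_mono mult_left_mono x) auto
 also have "\<dots> = real i / real N * (C\<^sup>2 / 2)" by simp
 also have "\<dots> \<le> 1 * (C\<^sup>2 / 2)" using i N by (intro mult_right_mono) auto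
 finally have "Q i w \<le> C\<^sup>2 / 2" by simp
 moreover have "0 \<le> Q i w" unfolding Q_def by (intro sum_nonneg) auto
 ultimately show ?thesis by simp
qed

lemma Q_completion: "i \<le> N \<Longrightarrow> Q i \<in> borel_measurable (completion M)"
 by (rule measurable_FB_completion[OF Q_measurable])

lemma integrable_Q:
 assumes i: "i \<le> N" shows "integrable (completion M) (Q i)"
  and "integrable (completion M) (\<lambda>w. exp (- A i w) * Q i w)"
proof -
 interpret C: prob_space "completion M" by (rule prob_space_completion)
 show "integrable (completion M) (Q i)"
  using Q_completion[OF i] Q_bound[OF i] by (intro C.integrable_const_bound[of _ "C\<^sup>2 / 2"]) auto
 have "integrable (completion M) (\<lambda>w. C\<^sup>2 / 2 * exp (- 1 * A i w))"
  by (intro integrable_mult_right integrable_exp_A i)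
 then show "integrable (completion M) (\<lambda>w. exp (- A i w) * Q i w)"
  by (rule Bochner_Integration.integrable_bound)
    (use Q_completion[OF i] A_completion[OF i] Q_bound[OF i] in \<open>auto intro!: AE_I2 simp: abs_mult\<close>)
qed

text \<open>\<open>A i - Q i\<close> is the discrete stochastic integral of \<open>\<xi>\<close>,
  whose steps have mean zero given the past.\<close>

lemma expectation_A: "i \<le> N \<Longrightarrow> (\<integral>w. A i w \<partial>completion M) = (\<integral>w. Q i w \<partial>completion M)"
proof -
 have *: "(\<integral>w. A i w - Q i w \<partial>completion M) = 0" if "i \<le> N" for i
  using that
 proof (induction i)
  case 0
  then show ?case by (simp add: A_def Q_def)
 next
  case (Suc i)
  then have i: "i < N" by simp
  have [measurable]: "A i \<in> borel_measurable (FB (real i / real N))" "\<xi> i \<in> borel_measurable (FB (real i / real N))"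
   "Q i \<in> borel_measurable (FB (real i / real N))"
   using A_measurable[of i] \<xi>_measurable[of i] Q_measurable[of i] i by auto
  let ?\<phi> = "\<lambda>w y. A i w - Q i w + \<xi> i w \<bullet> y"
  have eq: "A (Suc i) w - Q (Suc i) w = ?\<phi> w (D i w)" for w by (simp add: A_Suc Q_def)
  interpret g: prob_space "gauss h :: (real ^ 'n) measure" by (rule prob_space_gauss[OF h_pos])
  have "(\<integral>w. A (Suc i) w - Q (Suc i) w \<partial>completion M) = (\<integral>w. ?\<phi> w (D i w) \<partial>completion M)"
   by (simp only: eq)
  also have "\<dots> = (\<integral>w. (\<integral>y. ?\<phi> w y \<partial>gauss h) \<partial>completion M)"
  proof (rule real_step[OF i])
   show "integrable (completion M) (\<lambda>w. ?\<phi> w (D i w))"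
    unfolding eq[symmetric] using Suc by (intro Bochner_Integration.integrable_diff integrable_A integrable_Q) auto
  qed measurable
  also have "(\<lambda>w. \<integral>y. ?\<phi> w y \<partial>gauss h) = (\<lambda>w. A i w - Q i w)"
  proof
   fix w
   have "(\<integral>y. ?\<phi> w y \<partial>gauss h) = (\<integral>y. A i w - Q i w \<partial>(gauss h :: (real ^ 'n) measure)) + (\<integral>y. \<xi> i w \<bullet> y \<partial>gauss h)"
    using gauss_linear(1)[OF h_pos, of "\<xi> i w"]
     Bochner_Integration.integral_add[of "gauss h" "\<lambda>y. A i w - Q i w" "\<lambda>y. \<xi> i w \<bullet> y"] by simp
   moreover have "g.prob UNIV = 1" using g.prob_space by simp
   ultimately show "(\<integral>y. ?\<phi> w y \<partial>gauss h) = A i w - Q i w"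
    using gauss_linear(2)[OF h_pos] by simp
  qed
  finally show ?case using Suc by simp
 qed
 assume i: "i \<le> N"
 show ?thesis
  using *[OF i] Bochner_Integration.integral_diff[OF integrable_A[OF i] integrable_Q(1)[OF i]] by linarith
qed

text \<open>The left side is the relative entropy of the density \<open>exp (- A i)\<close>. Under
  that density the increment has mean \<open>- h *\<^sub>R \<xi> i\<close>, so
  \<open>\<xi> i w \<bullet> D i w\<close> contributes minus twice the half energy, and
  \<open>A i + Q i\<close> becomes a martingale started at 0.\<close>

lemma entropy_A:
 "i \<le> N \<Longrightarrow> (\<integral>w. exp (- A i w) * (- A i w) \<partial>completion M) = (\<integral>w. exp (- A i w) * Q i w \<partial>completion M)"
proof -
 have int: "integrable (completion M) (\<lambda>w. exp (- A i w) * (A i w + Q i w))" if "i \<le> N" for i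
  unfolding distrib_left using that by (intro Bochner_Integration.integrable_add integrable_exp_A_times_A integrable_Q)
 have *: "(\<integral>w. exp (- A i w) * (A i w + Q i w) \<partial>completion M) = 0" if "i \<le> N" for i
  using that
 proof (induction i)
  case 0
  then show ?case by (simp add: A_def Q_def)
 next
  case (Suc i)
  then have i: "i < N" by simp
  have [measurable]: "A i \<in> borel_measurable (FB (real i / real N))" "\<xi> i \<in> borel_measurable (FB (real i / real N))"
   "Q i \<in> borel_measurable (FB (real i / real N))"
   using A_measurable[of i] \<xi>_measurable[of i] Q_measurable[of i] i by auto
  let ?e = "\<lambda>w y. exp (- (\<xi> i w \<bullet> y) - h * (\<xi> i w \<bullet> \<xi> i w) / 2)"
  let ?\<phi> = "\<lambda>w y. exp (- A i w) * (?e w y * (A i w + Q i w + h * (\<xi> i w \<bullet> \<xi> i w)) + ?e w y * (\<xi> i w \<bullet> y))"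
  have eq: "exp (- A (Suc i) w) * (A (Suc i) w + Q (Suc i) w) = ?\<phi> w (D i w)" for w
  proof -
   have "exp (- A (Suc i) w) = exp (- A i w) * ?e w (D i w)"
    unfolding A_Suc exp_add[symmetric] by (simp add: algebra_simps)
   moreover have "A (Suc i) w + Q (Suc i) w = A i w + Q i w + h * (\<xi> i w \<bullet> \<xi> i w) + \<xi> i w \<bullet> D i w"
    by (simp add: A_Suc Q_def)
   ultimately show ?thesis by (simp only: mult.assoc distrib_left)
  qed
  have "(\<integral>w. exp (- A (Suc i) w) * (A (Suc i) w + Q (Suc i) w) \<partial>completion M) = (\<integral>w. ?\<phi> w (D i w) \<partial>completion M)"
   by (simp only: eq)
  also have "\<dots> = (\<integral>w. (\<integral>y. ?\<phi> w y \<partial>gauss h) \<partial>completion M)"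
  proof (rule real_step[OF i])
   show "integrable (completion M) (\<lambda>w. ?\<phi> w (D i w))"
    unfolding eq[symmetric] using Suc by (intro int)
  qed measurable
  also have "(\<lambda>w. \<integral>y. ?\<phi> w y \<partial>gauss h) = (\<lambda>w. exp (- A i w) * (A i w + Q i w))"
  proof
   fix w
   let ?c = "\<xi> i w"
   have "has_bochner_integral (gauss h) (\<lambda>y. ?\<phi> w y)
     (exp (- A i w) * (1 * (A i w + Q i w + h * (?c \<bullet> ?c)) + (- h * (?c \<bullet> ?c))))"
    by (intro has_bochner_integral_mult_right has_bochner_integral_add has_bochner_integral_mult_left gauss_exp_weight[OF h_pos])
   then show "(\<integral>y. ?\<phi> w y \<partial>gauss h) = exp (- A i w) * (A i w + Q i w)"
    by (simp add: has_bochner_integral_iff)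
  qed
  finally show ?case using Suc by simp
 qed
 assume i: "i \<le> N"
 have "(\<integral>w. exp (- A i w) * A i w \<partial>completion M) + (\<integral>w. exp (- A i w) * Q i w \<partial>completion M) = 0"
  using *[OF i] integrable_exp_A_times_A[OF i] integrable_Q(2)[OF i] by (simp add: distrib_left)
 then show ?thesis by simp
qed

text \<open>Integrates out the last \<open>k\<close> of the \<open>N\<close> coordinates against
  independent Gaussian increments. The drift does not occur in it, so drifts of every kind lead to
  the same number once all coordinates are integrated.\<close>

fun G :: "((nat \<Rightarrow> real ^ 'n) \<Rightarrow> ennreal) \<Rightarrow> nat \<Rightarrow> (nat \<Rightarrow> real ^ 'n) \<Rightarrow> ennreal" where
 "G \<phi> 0 = \<phi>"
| "G \<phi> (Suc k) = (\<lambda>x. \<integral>\<^sup>+y. G \<phi> k (x(N - Suc k := y)) \<partial>gauss h)"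

lemma fun_upd_measurable:
 "(\<lambda>(x, y). x(k := y)) \<in> measurable (seq_space \<Otimes>\<^sub>M borel) (PiM UNIV (\<lambda>_. borel :: (real ^ 'n) measure))"
proof (rule measurable_PiM_single')
 fix i :: nat
 show "(\<lambda>\<omega>. (case \<omega> of (x, y) \<Rightarrow> x(k := y)) i) \<in> borel_measurable (seq_space \<Otimes>\<^sub>M (borel :: (real ^ 'n) measure))"
  by (cases "i = k") (auto simp: case_prod_beta')
qed auto

lemma G_measurable: "\<phi> \<in> borel_measurable seq_space \<Longrightarrow> G \<phi> k \<in> borel_measurable seq_space"
proof (induction k)
 case (Suc k)
 interpret g: prob_space "gauss h :: (real ^ 'n) measure" by (rule prob_space_gauss[OF h_pos])
 have "(\<lambda>z. G \<phi> k (case z of (x, y) \<Rightarrow> x(N - Suc k := y))) \<in> borel_measurable (seq_space \<Otimes>\<^sub>M borel)"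
  by (rule measurable_compose[OF fun_upd_measurable]) (rule Suc.IH[OF Suc.prems])
 then have "(\<lambda>(x, y). G \<phi> k (x(N - Suc k := y))) \<in> borel_measurable (seq_space \<Otimes>\<^sub>M gauss h)"
  by (subst measurable_cong_sets[OF sets_pair_measure_cong[OF refl sets_gauss] refl]) (simp add: case_prod_beta')
 then show ?case by (simp add: g.borel_measurable_nn_integral)
qed simp

text \<open>The shifted increments up to step \<open>i\<close>. The zeros beyond are placeholders
  for the coordinates that \<open>G\<close> overwrites.\<close>

definition Y :: "nat \<Rightarrow> 'a \<Rightarrow> nat \<Rightarrow> real ^ 'n" where
 "Y i w s = (if s < i then D s w + h *\<^sub>R \<xi> s w else 0)"

lemma Y_measurable: "i \<le> N \<Longrightarrow> Y i \<in> measurable (FB (real i / real N)) seq_space"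
proof -
 assume i: "i \<le> N"
 have "(\<lambda>w s. Y i w s) \<in> measurable (FB (real i / real N)) seq_space"
 proof (rule measurable_PiM_single')
  fix s :: nat
  show "(\<lambda>w. Y i w s) \<in> borel_measurable (FB (real i / real N))"
  proof (cases "s < i")
   case True
   then have [measurable]: "\<xi> s \<in> borel_measurable (FB (real i / real N))" "D s \<in> borel_measurable (FB (real i / real N))"
    using \<xi>_measurable'[of s i] D_measurable[of s i] i by auto
   show ?thesis using True by (simp add: Y_def)
  qed (simp add: Y_def)
 qed auto
 then show ?thesis by simp
qed

text \<open>Backward in time: the increment of index \<open>N - Suc k\<close> is integrated with the
  past frozen, and the one-step shift formula removes both its weight and its shift.\<close>

lemma girsanov_aux:
 assumes \<phi>: "\<phi> \<in> borel_measurable seq_space" and "k \<le> N"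
 shows "(\<integral>\<^sup>+w. ennreal (exp (- A N w)) * \<phi> (Y N w) \<partial>M)
   = (\<integral>\<^sup>+w. ennreal (exp (- A (N - k) w)) * G \<phi> k (Y (N - k) w) \<partial>M)"
 using assms(2)
proof (induction k)
 case (Suc k)
 define i where "i = N - Suc k"
 have i: "i < N" "N - k = Suc i" using Suc by (auto simp: i_def)
 have [measurable]: "A i \<in> borel_measurable (FB (real i / real N))" "\<xi> i \<in> borel_measurable (FB (real i / real N))"
  using A_measurable[of i] \<xi>_measurable[of i] i by auto
 let ?e = "\<lambda>w y. exp (- (\<xi> i w \<bullet> y) - h * (\<xi> i w \<bullet> \<xi> i w) / 2)"
 let ?\<phi> = "\<lambda>w y. ennreal (exp (- A i w)) * (ennreal (?e w y) * G \<phi> k ((Y i w)(i := y + h *\<^sub>R \<xi> i w)))"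
 have upd: "Y (Suc i) w = (Y i w)(i := D i w + h *\<^sub>R \<xi> i w)" for w
  by (auto simp: Y_def fun_eq_iff)
 have m: "(\<lambda>(w, y). G \<phi> k ((Y i w)(i := y + h *\<^sub>R \<xi> i w))) \<in> borel_measurable (FB (real i / real N) \<Otimes>\<^sub>M borel)"
 proof -
  have [measurable]: "Y i \<in> measurable (FB (real i / real N)) seq_space"
   using Y_measurable[of i] i by simp
  have "(\<lambda>(w, y). (Y i w, y + h *\<^sub>R \<xi> i w)) \<in> measurable (FB (real i / real N) \<Otimes>\<^sub>M borel) (seq_space \<Otimes>\<^sub>M borel)"
   by measurable
  from measurable_compose[OF measurable_compose[OF this fun_upd_measurable] G_measurable[OF \<phi>], of k i]
  show ?thesis by (simp add: case_prod_beta')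
 qed
 have "(\<integral>\<^sup>+w. ennreal (exp (- A N w)) * \<phi> (Y N w) \<partial>M) = (\<integral>\<^sup>+w. ?\<phi> w (D i w) \<partial>M)"
 proof -
  have "exp (- A (Suc i) w) = exp (- A i w) * ?e w (D i w)" for w
   unfolding A_Suc exp_add[symmetric] by (simp add: algebra_simps)
  then show ?thesis
   using Suc by (simp only: Suc_leD i upd ennreal_mult'[OF exp_ge_zero] mult.assoc)
 qed
 also have "\<dots> = (\<integral>\<^sup>+w. (\<integral>\<^sup>+y. ?\<phi> w y \<partial>gauss h) \<partial>M)"
  by (rule nn_step[OF i(1)]) (use m in measurable)
 also have "\<dots> = (\<integral>\<^sup>+w. ennreal (exp (- A i w)) * G \<phi> (Suc k) (Y i w) \<partial>M)"
 proof (rule nn_integral_cong)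
  fix w
  have m2: "(\<lambda>y. G \<phi> k ((Y i w)(i := y))) \<in> borel_measurable borel"
  proof -
   have "(\<lambda>y. (Y i w, y)) \<in> measurable borel (seq_space \<Otimes>\<^sub>M borel)"
    by (intro measurable_Pair measurable_const) (auto simp: space_PiM)
   from measurable_compose[OF measurable_compose[OF this fun_upd_measurable] G_measurable[OF \<phi>], of k i]
   show ?thesis by simp
  qed
  have "(\<integral>\<^sup>+y. ?\<phi> w y \<partial>gauss h)
   = ennreal (exp (- A i w)) * (\<integral>\<^sup>+y. ennreal (?e w y) * G \<phi> k ((Y i w)(i := y + h *\<^sub>R \<xi> i w)) \<partial>gauss h)"
   by (intro nn_integral_cmult) (use m2 in measurable)
  also have "(\<integral>\<^sup>+y. ennreal (?e w y) * G \<phi> k ((Y i w)(i := y + h *\<^sub>R \<xi> i w)) \<partial>gauss h) = (\<integral>\<^sup>+y. G \<phi> k ((Y i w)(i := y)) \<partial>gauss h)"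
   by (rule nn_integral_gauss_shift[OF h_pos m2])
  finally show "(\<integral>\<^sup>+y. ?\<phi> w y \<partial>gauss h) = ennreal (exp (- A i w)) * G \<phi> (Suc k) (Y i w)"
   by (simp only: G.simps i_def[symmetric])
 qed
 finally show ?case by (simp add: i_def)
qed simp

lemma girsanov_base:
 assumes \<phi>: "\<phi> \<in> borel_measurable seq_space"
 shows "(\<integral>\<^sup>+w. ennreal (exp (- A N w)) * \<phi> (Y N w) \<partial>M) = G \<phi> N (\<lambda>_. 0)"
 using girsanov_aux[OF \<phi> order_refl] by (simp add: A_def Y_def[abs_def] emeasure_space_1)

end

text \<open>The left side depends on the drift only through the final value of \<open>G\<close>,
  which is free of it. For zero drift the same value is the right side, since then the weight is 1
  and nothing is shifted.\<close>

lemma (in grid_drift) girsanov: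
 assumes \<phi>: "\<phi> \<in> borel_measurable seq_space"
 shows "(\<integral>\<^sup>+w. ennreal (exp (- A N w)) * \<phi> (Y N w) \<partial>M) = (\<integral>\<^sup>+w. \<phi> (inc N (B w)) \<partial>M)"
proof -
 interpret Z: grid_drift M B N "\<lambda>_ _. 0" 0
  by unfold_locales (use N in auto)
 have "G \<phi> k = Z.G \<phi> k" for k by (induction k) auto
 moreover have "Z.Y N w = inc N (B w)" "Z.A N w = 0" for w
  by (auto simp: Z.Y_def Z.A_def Z.D_def fun_eq_iff inc_def)
 ultimately show ?thesis using girsanov_base[OF \<phi>] Z.girsanov_base[OF \<phi>] by simp
qed

section \<open>Paths of finite energy\<close>

lemma space_leb01 [simp]: "space leb01 = {0..1}"
 by (simp add: space_restrict_space)

lemma unit_sets_leb01 [simp]: "{0..1} \<in> sets leb01"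
 using sets.top[of leb01] by simp

lemma finite_leb01: "finite_measure leb01"
 by (rule finite_measureI) (simp add: emeasure_restrict_space space_restrict_space)

lemma measurable_leb01: "f \<in> borel_measurable borel \<Longrightarrow> f \<in> borel_measurable leb01"
 by (intro measurable_restrict_space1) simp

text \<open>Positive and negative part are densities of two finite measures with equal distribution
  functions, hence of equal measures.\<close>

lemma AE_zero_if_integrals_zero:
 fixes f :: "real \<Rightarrow> real"
 assumes f: "integrable leb01 f" and z: "\<And>t. t \<in> {0..1} \<Longrightarrow> (\<integral>s. indicator {0..t} s * f s \<partial>leb01) = 0"
 shows "AE s in leb01. f s = 0"
proof -
 interpret L: finite_measure leb01 by (rule finite_leb01)
 define P where "P s = max 0 (f s)" for s
 define Q where "Q s = max 0 (- f s)" for s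
 have fm [measurable]: "f \<in> borel_measurable leb01" using f by (rule borel_measurable_integrable)
 have i: "integrable leb01 P" "integrable leb01 Q"
  unfolding P_def Q_def using f by auto
 have [measurable]: "P \<in> borel_measurable leb01" "Q \<in> borel_measurable leb01"
  unfolding P_def Q_def by measurable
 have ind [measurable]: "{0..1} \<inter> {..x} \<in> sets leb01" for x :: real
  by (auto simp: sets_restrict_space)
 have ii: "integrable leb01 (\<lambda>s. indicator ({0..1} \<inter> {..x}) s * g s)" if "integrable leb01 g" for x and g :: "real \<Rightarrow> real"
  using integrable_mult_indicator[OF ind that] by simp
 have eq: "(\<integral>s. indicator ({0..1} \<inter> {..x}) s * P s \<partial>leb01) = (\<integral>s. indicator ({0..1} \<inter> {..x}) s * Q s \<partial>leb01)" for x :: real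
 proof -
  have "(\<integral>s. indicator ({0..1} \<inter> {..x}) s * P s \<partial>leb01) - (\<integral>s. indicator ({0..1} \<inter> {..x}) s * Q s \<partial>leb01)
   = (\<integral>s. indicator ({0..1} \<inter> {..x}) s * f s \<partial>leb01)"
   unfolding Bochner_Integration.integral_diff[OF ii[OF i(1)] ii[OF i(2)], symmetric]
   by (intro Bochner_Integration.integral_cong) (auto simp: P_def Q_def indicator_def)
  also have "\<dots> = 0"
  proof (cases "x < 0")
   case True
   then have "{0..1} \<inter> {..x} = {}" by auto
   then show ?thesis by simp
  next
   case False
   then have "{0..1} \<inter> {..x} = {0..min 1 x}" "min 1 x \<in> {0..1}" by auto
   then show ?thesis using z[of "min 1 x"] by (simp only:)
  qed
  finally show ?thesis by simp
 qed
 let ?M = "\<lambda>g. distr (density leb01 (\<lambda>s. ennreal (g s))) borel (\<lambda>s. s)"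
 have idm: "(\<lambda>s. s) \<in> measurable (density leb01 (\<lambda>s. ennreal (g s))) borel" for g :: "real \<Rightarrow> real"
  by (simp add: measurable_leb01)
 have fb: "finite_borel_measure (?M g)" if [measurable]: "g \<in> borel_measurable leb01" and "integrable leb01 g" "\<And>s. 0 \<le> g s" for g
 proof -
  have "emeasure (density leb01 (\<lambda>s. ennreal (g s))) (space (density leb01 (\<lambda>s. ennreal (g s)))) = (\<integral>\<^sup>+s. ennreal (g s) \<partial>leb01)"
   by (subst emeasure_density) (auto intro!: nn_integral_cong)
  also have "\<dots> = ennreal (\<integral>s. g s \<partial>leb01)" by (rule nn_integral_eq_integral) (use that in auto)
  finally have "finite_measure (density leb01 (\<lambda>s. ennreal (g s)))" by (intro finite_measureI) simp
  then have "finite_measure (?M g)" by (rule finite_measure.finite_measure_distr) (rule idm)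
  then show ?thesis by (simp add: finite_borel_measure_def finite_borel_measure_axioms_def)
 qed
 have cd: "cdf (?M g) x = (\<integral>s. indicator ({0..1} \<inter> {..x}) s * g s \<partial>leb01)"
  if [measurable]: "g \<in> borel_measurable leb01" and g: "integrable leb01 g" "\<And>s. 0 \<le> g s" for g x
 proof -
  have "emeasure (?M g) {..x} = emeasure (density leb01 (\<lambda>s. ennreal (g s))) ({0..1} \<inter> {..x})"
   by (subst emeasure_distr[OF idm]) (auto intro!: arg_cong2[where f = emeasure])
  also have "\<dots> = (\<integral>\<^sup>+s. ennreal (indicator ({0..1} \<inter> {..x}) s * g s) \<partial>leb01)"
   by (subst emeasure_density[OF _ ind[of x]]) (auto intro!: nn_integral_cong simp: indicator_def)
  also have "\<dots> = ennreal (\<integral>s. indicator ({0..1} \<inter> {..x}) s * g s \<partial>leb01)"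
   using g by (intro nn_integral_eq_integral ii) auto
  finally show ?thesis
   unfolding cdf_def measure_def using g(2) by (simp add: integral_nonneg)
 qed
 have "cdf (?M P) = cdf (?M Q)"
  using cd[of P] cd[of Q] i eq by (auto simp: fun_eq_iff P_def Q_def)
 then have MM: "?M P = ?M Q"
  by (intro cdf_unique' fb i) (auto simp: P_def Q_def)
 have "density leb01 (\<lambda>s. ennreal (P s)) = density leb01 (\<lambda>s. ennreal (Q s))"
 proof (rule measure_eqI)
  fix A assume "A \<in> sets (density leb01 (\<lambda>s. ennreal (P s)))"
  then have A: "A \<in> sets leb01" by simp
  then have A': "A \<in> sets borel" "A \<subseteq> {0..1}" by (auto simp: sets_restrict_space)
  have *: "emeasure (density leb01 (\<lambda>s. ennreal (g s))) A = emeasure (?M g) A" for g :: "real \<Rightarrow> real"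
   using A' by (subst emeasure_distr[OF idm]) (auto intro!: arg_cong2[where f = emeasure])
  show "emeasure (density leb01 (\<lambda>s. ennreal (P s))) A = emeasure (density leb01 (\<lambda>s. ennreal (Q s))) A"
   unfolding * MM ..
 qed simp
 then have "AE s in leb01. ennreal (P s) = ennreal (Q s)"
  by (intro L.density_unique) auto
 then show ?thesis
  by eventually_elim (auto simp: P_def Q_def max_def split: if_splits)
qed

lemma cm_density_integrable:
 assumes "cm_density k g" shows "integrable leb01 g"
proof -
 interpret L: finite_measure leb01 by (rule finite_leb01)
 have "integrable leb01 (\<lambda>s. 1 + (norm (g s))\<^sup>2)"
  using assms by (intro Bochner_Integration.integrable_add) (auto simp: cm_density_def)
 then show ?thesis
 proof (rule Bochner_Integration.integrable_bound)
  show "AE s in leb01. norm (g s) \<le> norm (1 + (norm (g s))\<^sup>2)"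
  proof (rule AE_I2)
   fix s
   have "0 \<le> (norm (g s) - 1 / 2)\<^sup>2" by simp
   then show "norm (g s) \<le> norm (1 + (norm (g s))\<^sup>2)" by (simp add: power2_eq_square algebra_simps)
  qed
 qed (use assms in \<open>auto simp: cm_density_def\<close>)
qed

lemma cm_density_unique:
 fixes g g' :: "real \<Rightarrow> real ^ 'n"
 assumes g: "cm_density k g" and g': "cm_density k g'"
 shows "AE s in leb01. g s = g' s"
proof -
 have i: "integrable leb01 g" "integrable leb01 g'" using g g' cm_density_integrable by auto
 have "AE s in leb01. (g s - g' s) \<bullet> e = 0" for e :: "real ^ 'n"
 proof (rule AE_zero_if_integrals_zero)
  show "integrable leb01 (\<lambda>s. (g s - g' s) \<bullet> e)" using i by auto
  fix t :: real assume t: "t \<in> {0..1}"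
  have S: "{0..t} \<in> sets leb01" using t by (auto simp: sets_restrict_space intro!: image_eqI[of _ _ "{0..t}"])
  have ii: "integrable leb01 (\<lambda>s. indicator {0..t} s *\<^sub>R g s)" "integrable leb01 (\<lambda>s. indicator {0..t} s *\<^sub>R g' s)"
   using integrable_mult_indicator[OF S i(1)] integrable_mult_indicator[OF S i(2)] by auto
  have "(\<integral>s. indicator {0..t} s * ((g s - g' s) \<bullet> e) \<partial>leb01)
   = (\<integral>s. (indicator {0..t} s *\<^sub>R g s - indicator {0..t} s *\<^sub>R g' s) \<bullet> e \<partial>leb01)"
   by (intro Bochner_Integration.integral_cong) (auto simp: inner_diff_left algebra_simps)
  also have "\<dots> = ((\<integral>s. indicator {0..t} s *\<^sub>R g s \<partial>leb01) - (\<integral>s. indicator {0..t} s *\<^sub>R g' s \<partial>leb01)) \<bullet> e"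
   using ii by simp
  also have "(\<integral>s. indicator {0..t} s *\<^sub>R g s \<partial>leb01) = k t"
   using g t by (simp add: cm_density_def set_lebesgue_integral_def)
  also have "(\<integral>s. indicator {0..t} s *\<^sub>R g' s \<partial>leb01) = k t"
   using g' t by (simp add: cm_density_def set_lebesgue_integral_def)
  finally show "(\<integral>s. indicator {0..t} s * ((g s - g' s) \<bullet> e) \<partial>leb01) = 0" by simp
 qed
 then have "AE s in leb01. \<forall>e\<in>Basis. (g s - g' s) \<bullet> e = 0" by (intro AE_finite_allI) auto
 then show ?thesis
  by eventually_elim (simp add: euclidean_eq_iff[of "g _" "g' _"] inner_diff_left)
qed

text \<open>Frees the norm from the choice in its definition, since two densities of one path agree
  almost everywhere.\<close>

lemma cm_norm_sq_eq:
 assumes g: "cm_density k g"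
 shows "cm_norm_sq k = (\<integral>s. (norm (g s))\<^sup>2 \<partial>leb01)"
proof -
 have s: "cm_density k (SOME g. cm_density k g)" using someI[of "\<lambda>g. cm_density k g", OF g] .
 have m: "(\<lambda>s. (norm (g s))\<^sup>2) \<in> borel_measurable leb01" if "cm_density k g" for g
  using that unfolding cm_density_def by auto
 show ?thesis
  unfolding cm_norm_sq_def
 proof (rule integral_cong_AE)
  show "AE x in leb01. (norm ((SOME g. cm_density k g) x))\<^sup>2 = (norm (g x))\<^sup>2"
   using cm_density_unique[OF s g] by eventually_elim simp
 qed (rule m[OF s], rule m[OF g])
qed

text \<open>The polygon with slope \<open>v i\<close> on cell \<open>i\<close>: the difference of
  minima is the length of that cell passed by time \<open>t\<close>.\<close>

definition grid_path :: "nat \<Rightarrow> (nat \<Rightarrow> real ^ 'n) \<Rightarrow> real \<Rightarrow> real ^ 'n" where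
 "grid_path N v = (\<lambda>t\<in>{0..1}. \<Sum>i<N. (min t (real (Suc i) / real N) - min t (real i / real N)) *\<^sub>R v i)"

definition grid_density :: "nat \<Rightarrow> (nat \<Rightarrow> real ^ 'n) \<Rightarrow> real \<Rightarrow> real ^ 'n" where
 "grid_density N v t = (\<Sum>i<N. indicator {real i / real N<..real (Suc i) / real N} t *\<^sub>R v i)"

lemma grid_density_cell:
 assumes "i < N" "t \<in> {real i / real N<..real (Suc i) / real N}"
 shows "grid_density N v t = v i"
proof -
 have "indicator {real j / real N<..real (Suc j) / real N} t = (if j = i then 1 else 0 :: real)" if "j < N" for j
 proof (cases "j = i")
  case False
  then have "j < i \<or> i < j" by auto
  then have "t \<notin> {real j / real N<..real (Suc j) / real N}"
  proof
   assume "j < i"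
   then have "real (Suc j) / real N \<le> real i / real N" by (intro divide_right_mono) auto
   then show ?thesis using assms by auto
  next
   assume "i < j"
   then have "real (Suc i) / real N \<le> real j / real N" by (intro divide_right_mono) auto
   then show ?thesis using assms by auto
  qed
  then show ?thesis using False by simp
 qed (use assms in auto)
 then have "grid_density N v t = (\<Sum>j<N. (if j = i then 1 else 0 :: real) *\<^sub>R v j)"
  unfolding grid_density_def by (intro sum.cong) auto
 also have "\<dots> = v i" using assms(1) by (simp add: if_distrib[of "\<lambda>x. x *\<^sub>R _"] cong: if_cong)
 finally show ?thesis .
qed

lemma grid_density_zero:
 assumes "\<And>i. i < N \<Longrightarrow> t \<notin> {real i / real N<..real (Suc i) / real N}"
 shows "grid_density N v t = 0"
 unfolding grid_density_def using assms by (intro sum.neutral) auto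

lemma grid_density_norm:
 "(norm (grid_density N v t))\<^sup>2 = (\<Sum>i<N. indicator {real i / real N<..real (Suc i) / real N} t * (norm (v i))\<^sup>2)"
proof (cases "\<exists>i<N. t \<in> {real i / real N<..real (Suc i) / real N}")
 case True
 then obtain i where i: "i < N" "t \<in> {real i / real N<..real (Suc i) / real N}" by auto
 \<comment> \<open>The squares are viewed as vectors of dimension one, so that
   \<open>grid_density_cell\<close> also evaluates the right-hand sum.\<close>
 define w :: "nat \<Rightarrow> real ^ 1" where "w j = vec ((norm (v j))\<^sup>2)" for j
 have "grid_density N w t = w i" by (rule grid_density_cell[OF i])
 then have "grid_density N w t $ 1 = w i $ 1" by simp
 then have "(\<Sum>i<N. indicator {real i / real N<..real (Suc i) / real N} t * (norm (v i))\<^sup>2) = (norm (v i))\<^sup>2"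
  by (simp add: grid_density_def w_def)
 then show ?thesis using grid_density_cell[OF i, of v] by simp
next
 case False
 then show ?thesis using grid_density_zero[of N t v] by (auto intro!: sum.neutral[symmetric])
qed

lemma grid_density_bound:
 assumes "C \<ge> 0" "\<And>i. i < N \<Longrightarrow> norm (v i) \<le> C"
 shows "norm (grid_density N v t) \<le> C"
 using grid_density_cell[of _ N t v] grid_density_zero[of N t v] assms by (metis norm_zero)

lemma measure_leb01_Ioc:
 assumes "0 \<le> a" "a \<le> b" "b \<le> 1"
 shows "{a<..b} \<in> sets leb01" "measure leb01 {a<..b} = b - a"
proof -
 show "{a<..b} \<in> sets leb01" using assms by (auto simp: sets_restrict_space intro!: image_eqI[of _ _ "{a<..b}"])
 show "measure leb01 {a<..b} = b - a" using assms
  by (subst measure_restrict_space) auto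
qed

lemma cm_density_grid:
 fixes v :: "nat \<Rightarrow> real ^ 'n"
 assumes N: "N > 0"
 shows "cm_density (grid_path N v) (grid_density N v)"
proof -
 interpret L: finite_measure leb01 by (rule finite_leb01)
 have m: "grid_density N v \<in> borel_measurable leb01"
  unfolding grid_density_def by (intro measurable_leb01) measurable
 define C where "C = (\<Sum>i<N. norm (v i))"
 have C: "C \<ge> 0" "\<And>i. i < N \<Longrightarrow> norm (v i) \<le> C"
  unfolding C_def by (auto intro!: sum_nonneg member_le_sum[of _ "{..<N}" "\<lambda>i. norm (v i)"])
 have "integrable leb01 (\<lambda>s. (norm (grid_density N v s))\<^sup>2)"
  using m grid_density_bound[OF C] C by (intro L.integrable_const_bound[of _ "C\<^sup>2"]) (auto intro!: power_mono)
 moreover have "grid_path N v t = (LINT s:{0..t}|leb01. grid_density N v s)" if t: "t \<in> {0..1}" for t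
 proof -
  let ?a = "\<lambda>i. real i / real N" and ?b = "\<lambda>i. real (Suc i) / real N"
  have ab: "0 \<le> ?a i" "?a i \<le> ?b i" "?b i \<le> 1" if "i < N" for i
   using that N by (auto intro!: divide_right_mono)
  have c: "(\<integral>s. (indicator {0..t} s * indicator {?a i<..?b i} s) *\<^sub>R v i \<partial>leb01) = (min t (?b i) - min t (?a i)) *\<^sub>R v i"
   and ci: "integrable leb01 (\<lambda>s. (indicator {0..t} s * indicator {?a i<..?b i} s :: real) *\<^sub>R v i)" if i: "i < N" for i
  proof -
   have e: "indicator {0..t} s * indicator {?a i<..?b i} s = (indicator {min t (?a i)<..min t (?b i)} s :: real)" for s
   proof -
    have "indicator {0..t} s * indicator {a<..b} s = (indicator {min t a<..min t b} s :: real)" if "0 \<le> a" for a b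
     using that by (auto simp: indicator_def)
    then show ?thesis using ab(1)[OF i] by blast
   qed
   note mm = measure_leb01_Ioc[of "min t (?a i)" "min t (?b i)"]
   have mi: "{min t (?a i)<..min t (?b i)} \<in> sets leb01" "measure leb01 {min t (?a i)<..min t (?b i)} = min t (?b i) - min t (?a i)"
    using ab[OF i] t by (intro mm; simp)+
   show "(\<integral>s. (indicator {0..t} s * indicator {?a i<..?b i} s) *\<^sub>R v i \<partial>leb01) = (min t (?b i) - min t (?a i)) *\<^sub>R v i"
   proof -
    have "integrable leb01 (indicator {min t (?a i)<..min t (?b i)} :: _ \<Rightarrow> real)"
     using mi(1) by (intro integrable_real_indicator) (auto simp: L.emeasure_finite less_top[symmetric])
    moreover have "{min t (?a i)<..min t (?b i)} \<inter> space leb01 = {min t (?a i)<..min t (?b i)}"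
     by (rule Int_absorb2[OF sets.sets_into_space[OF mi(1)]])
    ultimately show ?thesis
     unfolding e by (subst integral_scaleR_left) (simp_all only: Bochner_Integration.integral_indicator mi(2))
   qed
   show "integrable leb01 (\<lambda>s. (indicator {0..t} s * indicator {?a i<..?b i} s :: real) *\<^sub>R v i)"
    unfolding e using mi by (intro integrable_scaleR_left integrable_real_indicator) (auto simp: L.emeasure_finite less_top[symmetric])
  qed
  have "(LINT s:{0..t}|leb01. grid_density N v s)
    = (\<integral>s. (\<Sum>i<N. (indicator {0..t} s * indicator {?a i<..?b i} s) *\<^sub>R v i) \<partial>leb01)"
   unfolding set_lebesgue_integral_def grid_density_def by (simp only: scaleR_sum_right scaleR_scaleR)
  also have "\<dots> = (\<Sum>i<N. \<integral>s. (indicator {0..t} s * indicator {?a i<..?b i} s) *\<^sub>R v i \<partial>leb01)"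
   by (rule Bochner_Integration.integral_sum) (use ci in auto)
  also have "\<dots> = grid_path N v t"
   unfolding grid_path_def using t by (simp add: c del: of_nat_Suc)
  finally show ?thesis ..
 qed
 ultimately show ?thesis using m unfolding cm_density_def by blast
qed

lemma grid_path_space: "grid_path N v \<in> space path_space"
proof -
 have "continuous_on {0..1} (\<lambda>t. \<Sum>i<N. (min t (real (Suc i) / real N) - min t (real i / real N)) *\<^sub>R v i)"
  by (intro continuous_intros)
 then have "continuous_on {0..1} (grid_path N v)"
  by (rule continuous_on_eq) (simp add: grid_path_def)
 then show ?thesis
  by (simp add: path_space_def space_restrict_space space_PiM grid_path_def)
qed

lemma cm_norm_sq_grid:
 assumes N: "N > 0"
 shows "cm_norm_sq (grid_path N v) = (\<Sum>i<N. (1 / real N) * (v i \<bullet> v i))"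
proof -
 interpret L: finite_measure leb01 by (rule finite_leb01)
 let ?S = "\<lambda>i. {real i / real N<..real (Suc i) / real N}"
 have ab: "0 \<le> real i / real N" "real i / real N \<le> real (Suc i) / real N" "real (Suc i) / real N \<le> 1" if "i < N" for i
  using that N by (auto intro!: divide_right_mono)
 have S: "?S i \<in> sets leb01" "measure leb01 (?S i) = 1 / real N" if "i < N" for i
  using measure_leb01_Ioc[OF ab[OF that]] N by (auto simp: diff_divide_distrib[symmetric])
 have ii: "integrable leb01 (\<lambda>s. indicator (?S i) s * (norm (v i))\<^sup>2 :: real)" if "i < N" for i
  using S(1)[OF that] by (intro integrable_mult_left integrable_real_indicator) (auto simp: L.emeasure_finite less_top[symmetric])
 have "cm_norm_sq (grid_path N v) = (\<integral>s. (\<Sum>i<N. indicator (?S i) s * (norm (v i))\<^sup>2) \<partial>leb01)"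
  unfolding cm_norm_sq_eq[OF cm_density_grid[OF N]] grid_density_norm ..
 also have "\<dots> = (\<Sum>i<N. \<integral>s. indicator (?S i) s * (norm (v i))\<^sup>2 \<partial>leb01)"
  by (rule Bochner_Integration.integral_sum) (use ii in auto)
 also have "\<dots> = (\<Sum>i<N. (1 / real N) * (v i \<bullet> v i))"
 proof (rule sum.cong)
  fix i assume "i \<in> {..<N}"
  then have i: "i < N" by simp
  have SI: "?S i \<inter> space leb01 = ?S i"
   by (rule Int_absorb2[OF sets.sets_into_space[OF S(1)[OF i]]])
  have "(\<integral>s. indicator (?S i) s * (norm (v i))\<^sup>2 \<partial>leb01) = measure leb01 (?S i) * (norm (v i))\<^sup>2"
   by (simp only: integral_mult_left_zero Bochner_Integration.integral_indicator SI)
  then show "(\<integral>s. indicator (?S i) s * (norm (v i))\<^sup>2 \<partial>leb01) = (1 / real N) * (v i \<bullet> v i)"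
   by (simp only: S(2)[OF i] power2_norm_eq_inner)
 qed simp
 finally show ?thesis .
qed

lemma inc_grid_path:
 assumes N: "N > 0" and s: "s < N"
 shows "inc N (grid_path N v) s = (1 / real N) *\<^sub>R v s"
proof -
 have t01: "real k / real N \<in> {0..1}" if "k \<le> N" for k using that N by auto
 have val: "grid_path N v (real k / real N) = (\<Sum>i<k. (1 / real N) *\<^sub>R v i)" if k: "k \<le> N" for k
 proof -
  have "grid_path N v (real k / real N) = (\<Sum>i<N. (if i < k then 1 / real N else 0) *\<^sub>R v i)"
   unfolding grid_path_def using t01[OF k]
  proof (simp del: of_nat_Suc, intro sum.cong refl arg_cong2[where f = scaleR])
   fix i
   show "min (real k / real N) (real (Suc i) / real N) - min (real k / real N) (real i / real N) = (if i < k then 1 / real N else 0)"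
   proof (cases "i < k")
    case True
    then have "real (Suc i) / real N \<le> real k / real N" "real i / real N \<le> real k / real N"
     by (auto intro!: divide_right_mono)
    then show ?thesis using True by (simp add: diff_divide_distrib[symmetric] min_absorb2)
   next
    case False
    then have "real k / real N \<le> real (Suc i) / real N" "real k / real N \<le> real i / real N"
     by (auto intro!: divide_right_mono)
    then show ?thesis using False by (simp add: min_absorb1)
   qed
  qed
  also have "\<dots> = (\<Sum>i\<in>{..<N}. if i \<in> {..<k} then (1 / real N) *\<^sub>R v i else 0)"
   by (intro sum.cong) auto
  also have "\<dots> = (\<Sum>i\<in>{..<N} \<inter> {..<k}. (1 / real N) *\<^sub>R v i)"
   by (rule sum.inter_restrict[symmetric]) simp
  also have "{..<N} \<inter> {..<k} = {..<k}" using k by auto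
  finally show ?thesis .
 qed
 have "inc N (grid_path N v) s = grid_path N v (real (Suc s) / real N) - grid_path N v (real s / real N)"
  using s by (simp add: inc_def add.commute)
 then show ?thesis using s by (simp only: val Suc_leI less_imp_le) simp
qed

lemma grid_path_refine:
 assumes "N > 0" "K > 0"
 shows "grid_path (N * K) (\<lambda>s. v (s div K)) = grid_path N v"
proof
 fix t :: real
 show "grid_path (N * K) (\<lambda>s. v (s div K)) t = grid_path N v t"
 proof (cases "t \<in> {0..1}")
  case True
  \<comment> \<open>For fixed \<open>t\<close>, each summand is an increment of \<open>?b\<close> in
    its variable \<open>r\<close>, so \<open>sum_inc_refine\<close> applies to it as if it were a
    path.\<close>
  let ?b = "\<lambda>k r. min t r *\<^sub>R v k"
  have "grid_path (N * K) (\<lambda>s. v (s div K)) t = (\<Sum>s<N * K. inc (N * K) (?b (s div K)) s)"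
   unfolding grid_path_def using True by (auto intro!: sum.cong simp: inc_def scaleR_diff_left add.commute)
  also have "\<dots> = (\<Sum>k<N. \<Sum>s = k * K..<k * K + K. inc (N * K) (?b (s div K)) s)"
   by (rule sum.nat_group[symmetric])
  also have "\<dots> = (\<Sum>k<N. \<Sum>s = k * K..<k * K + K. inc (N * K) (?b k) s)"
  proof (intro sum.cong refl)
   fix k s assume "s \<in> {k * K..<k * K + K}"
   then have "s div K = k" by (intro div_nat_eqI) (auto simp: mult.commute)
   then show "inc (N * K) (?b (s div K)) s = inc (N * K) (?b k) s" by simp
  qed
  also have "\<dots> = (\<Sum>k<N. inc N (?b k) k)"
   using assms by (intro sum.cong refl sum_inc_refine) auto
  also have "\<dots> = grid_path N v t"
   unfolding grid_path_def using True by (auto intro!: sum.cong simp: inc_def scaleR_diff_left add.commute)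
  finally show ?thesis .
 qed (auto simp: grid_path_def)
qed

lemma inc_path_add:
 assumes "N > 0"
 shows "inc N (path_add a b) s = inc N a s + inc N b s"
proof (cases "s < N")
 case True
 then have "(real s + 1) / real N \<in> {0..1}" "real s / real N \<in> {0..1}" using assms by auto
 then show ?thesis using True by (simp add: inc_def path_add_def)
qed (simp add: inc_def)

section \<open>Controls from predictable grid drifts\<close>

text \<open>A drift as a functional of the increments: the entry \<open>s\<close> sees only
  coordinates below \<open>s\<close>. The value 0 from \<open>N\<close> on keeps the placeholder
  coordinates fixed under the shift.\<close>

definition predictable :: "nat \<Rightarrow> real \<Rightarrow> ((nat \<Rightarrow> real ^ 'n) \<Rightarrow> nat \<Rightarrow> real ^ 'n) \<Rightarrow> bool" where
 "predictable N C \<eta> \<longleftrightarrow> 0 < N \<and> 0 \<le> C \<and>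
   (\<forall>x y s. (\<forall>i<s. x i = y i) \<longrightarrow> \<eta> x s = \<eta> y s) \<and>
   (\<forall>s. (\<lambda>x. \<eta> x s) \<in> borel_measurable seq_space) \<and>
   (\<forall>x s. norm (\<eta> x s) \<le> C) \<and> (\<forall>x s. N \<le> s \<longrightarrow> \<eta> x s = 0)"

lemma predictableD:
 assumes "predictable N C \<eta>"
 shows "0 < N" "0 \<le> C" "\<And>x y s. (\<And>i. i < s \<Longrightarrow> x i = y i) \<Longrightarrow> \<eta> x s = \<eta> y s"
  "\<And>s. (\<lambda>x. \<eta> x s) \<in> borel_measurable seq_space"
  "\<And>x s. norm (\<eta> x s) \<le> C" "\<And>x s. N \<le> s \<Longrightarrow> \<eta> x s = 0"
 using assms unfolding predictable_def by blast+

text \<open>Solves \<open>y s + (1 / real N) *\<^sub>R \<xi> y s = x s\<close> for \<open>y\<close>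
  one coordinate at a time: predictability means that \<open>\<xi> y k\<close> needs only the
  coordinates already found. Stage \<open>k\<close> holds the first \<open>k\<close> of
  them.\<close>

fun unshift_upto :: "nat \<Rightarrow> ((nat \<Rightarrow> real ^ 'n) \<Rightarrow> nat \<Rightarrow> real ^ 'n) \<Rightarrow> (nat \<Rightarrow> real ^ 'n) \<Rightarrow> nat \<Rightarrow> nat \<Rightarrow> real ^ 'n" where
 "unshift_upto N \<xi> x 0 = (\<lambda>_. 0)"
| "unshift_upto N \<xi> x (Suc k) = (unshift_upto N \<xi> x k)(k := x k - (1 / real N) *\<^sub>R \<xi> (unshift_upto N \<xi> x k) k)"

definition unshift :: "nat \<Rightarrow> ((nat \<Rightarrow> real ^ 'n) \<Rightarrow> nat \<Rightarrow> real ^ 'n) \<Rightarrow> (nat \<Rightarrow> real ^ 'n) \<Rightarrow> nat \<Rightarrow> real ^ 'n" where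
 "unshift N \<xi> x s = unshift_upto N \<xi> x (Suc s) s"

text \<open>The drift whose shift undoes the shift by \<open>\<xi>\<close>: the same drift with
  opposite sign, evaluated at the unshifted sequence.\<close>

definition inverse_drift :: "nat \<Rightarrow> ((nat \<Rightarrow> real ^ 'n) \<Rightarrow> nat \<Rightarrow> real ^ 'n) \<Rightarrow> (nat \<Rightarrow> real ^ 'n) \<Rightarrow> nat \<Rightarrow> real ^ 'n" where
 "inverse_drift N \<xi> x s = - \<xi> (unshift N \<xi> x) s"

lemma unshift_upto_stable: "i < k \<Longrightarrow> unshift_upto N \<xi> x k i = unshift N \<xi> x i"
 by (induction k) (auto simp: unshift_def less_Suc_eq)

lemma unshift_drift:
 assumes "predictable N C \<xi>"
 shows "\<xi> (unshift N \<xi> x) s = \<xi> (unshift_upto N \<xi> x s) s"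
 by (rule predictableD(3)[OF assms]) (simp add: unshift_upto_stable)

lemma unshift_eq:
 assumes "predictable N C \<xi>"
 shows "unshift N \<xi> x s = x s - (1 / real N) *\<^sub>R \<xi> (unshift N \<xi> x) s"
 unfolding unshift_drift[OF assms] by (simp add: unshift_def)

lemma unshift_upto_cong: "(\<And>i. i < k \<Longrightarrow> x i = y i) \<Longrightarrow> unshift_upto N \<xi> x k = unshift_upto N \<xi> y k"
 by (induction k) auto

lemma unshift_shift:
 assumes p: "predictable N C \<xi>"
 shows "unshift N \<xi> (\<lambda>s. x s + (1 / real N) *\<^sub>R \<xi> x s) = x"
proof
 fix s
 show "unshift N \<xi> (\<lambda>s. x s + (1 / real N) *\<^sub>R \<xi> x s) s = x s"
 proof (induction s rule: less_induct)
  case (less s)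
  then have "\<xi> (unshift N \<xi> (\<lambda>s. x s + (1 / real N) *\<^sub>R \<xi> x s)) s = \<xi> x s"
   by (intro predictableD(3)[OF p])
  then show ?case by (subst unshift_eq[OF p]) simp
 qed
qed

lemma fun_upd_seq_measurable:
 assumes f: "f \<in> measurable M seq_space" and g: "g \<in> borel_measurable M"
 shows "(\<lambda>w. (f w)(k := g w)) \<in> measurable M seq_space"
proof (rule measurable_PiM_single')
 fix i :: nat
 show "(\<lambda>w. ((f w)(k := g w)) i) \<in> borel_measurable M"
  using g measurable_compose[OF f measurable_component_singleton[of i UNIV "\<lambda>_. borel"]] by (cases "i = k") auto
qed auto

lemma unshift_upto_measurable:
 assumes p: "predictable N C \<xi>"
 shows "(\<lambda>x. unshift_upto N \<xi> x k) \<in> measurable seq_space seq_space"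
proof (induction k)
 case 0
 show ?case by (simp add: space_PiM)
next
 case (Suc k)
 have "(\<lambda>x. \<xi> (unshift_upto N \<xi> x k) k) \<in> borel_measurable seq_space"
  by (rule measurable_compose[OF Suc predictableD(4)[OF p]])
 moreover have "(\<lambda>x. x k) \<in> borel_measurable seq_space"
  by (rule measurable_component_singleton) simp
 ultimately have "(\<lambda>x. x k - (1 / real N) *\<^sub>R \<xi> (unshift_upto N \<xi> x k) k) \<in> borel_measurable seq_space"
  by measurable
 from fun_upd_seq_measurable[OF Suc this] show ?case by (simp only: unshift_upto.simps)
qed

lemma predictable_inverse_drift:
 assumes p: "predictable N C \<xi>"
 shows "predictable N C (inverse_drift N \<xi>)"
 unfolding predictable_def
proof (intro conjI allI impI)
 fix x y :: "nat \<Rightarrow> real ^ 'a" and s assume "\<forall>i<s. x i = y i"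
 then have "unshift_upto N \<xi> x s = unshift_upto N \<xi> y s" by (intro unshift_upto_cong) auto
 then show "inverse_drift N \<xi> x s = inverse_drift N \<xi> y s"
  unfolding inverse_drift_def unshift_drift[OF p] by simp
next
 fix s
 show "(\<lambda>x. inverse_drift N \<xi> x s) \<in> borel_measurable seq_space"
  unfolding inverse_drift_def unshift_drift[OF p]
  by (rule borel_measurable_uminus) (rule measurable_compose[OF unshift_upto_measurable[OF p] predictableD(4)[OF p]])
qed (simp_all add: inverse_drift_def predictableD(1,2,5,6)[OF p])

text \<open>Equals \<open>- A N\<close> of the corresponding grid drift, written as a function of
  the sequence of increments so that it can be evaluated after a shift.\<close>

definition log_density :: "nat \<Rightarrow> ((nat \<Rightarrow> real ^ 'n) \<Rightarrow> nat \<Rightarrow> real ^ 'n) \<Rightarrow> (nat \<Rightarrow> real ^ 'n) \<Rightarrow> real" where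
 "log_density N \<xi> x = - (\<Sum>s<N. \<xi> x s \<bullet> x s + 1 / real N * (\<xi> x s \<bullet> \<xi> x s) / 2)"

definition half_energy :: "nat \<Rightarrow> ((nat \<Rightarrow> real ^ 'n) \<Rightarrow> nat \<Rightarrow> real ^ 'n) \<Rightarrow> (nat \<Rightarrow> real ^ 'n) \<Rightarrow> real" where
 "half_energy N \<xi> x = (\<Sum>s<N. 1 / real N * (\<xi> x s \<bullet> \<xi> x s) / 2)"

lemma seq_component_measurable: "(\<lambda>x. x s) \<in> borel_measurable seq_space"
 by (rule measurable_component_singleton) simp

lemma log_density_measurable:
 assumes "predictable N C \<xi>" shows "log_density N \<xi> \<in> borel_measurable seq_space"
proof -
 note [measurable] = predictableD(4)[OF assms] seq_component_measurable
 show ?thesis unfolding log_density_def by measurable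
qed

lemma half_energy_measurable:
 assumes "predictable N C \<xi>" shows "half_energy N \<xi> \<in> borel_measurable seq_space"
proof -
 note [measurable] = predictableD(4)[OF assms]
 show ?thesis unfolding half_energy_def by measurable
qed

section \<open>Grid controls as bounded adapted drifts\<close>

context path_brownian
begin

definition control :: "nat \<Rightarrow> ((nat \<Rightarrow> real ^ 'n) \<Rightarrow> nat \<Rightarrow> real ^ 'n) \<Rightarrow> (real \<Rightarrow> real ^ 'n) \<Rightarrow> real \<Rightarrow> real ^ 'n" where
 "control N \<eta> w = grid_path N (\<eta> (inc N (\<beta> w)))"

lemma inc_beta_measurable: "(\<lambda>w. inc N (\<beta> w)) \<in> measurable \<nu> seq_space"
proof -
 have "(\<lambda>w s. inc N (\<beta> w) s) \<in> measurable \<nu> seq_space"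
  by (rule measurable_PiM_single') (auto intro: inc_measurable B_measurable)
 then show ?thesis by simp
qed

lemma predictable_FB:
 assumes p: "predictable N C \<eta>" and s: "s < N"
 shows "(\<lambda>w. \<eta> (inc N (\<beta> w)) s) \<in> borel_measurable (FB (real s / real N))"
proof -
 \<comment> \<open>Coordinates from \<open>s\<close> on are set to 0. Predictability makes
   \<open>\<eta>\<close> blind to this, while the truncated sequence is known at time
   \<open>s / N\<close>.\<close>
 let ?x = "\<lambda>w i. if i < s then inc N (\<beta> w) i else 0"
 have "?x \<in> measurable (FB (real s / real N)) seq_space"
 proof (rule measurable_PiM_single')
  fix i :: nat
  show "(\<lambda>w. ?x w i) \<in> borel_measurable (FB (real s / real N))"
  proof (cases "i < s")
   case True
   then have "real (Suc i) / real N \<le> real s / real N" "real i / real N \<le> real s / real N"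
    by (auto intro!: divide_right_mono)
   then have "(\<lambda>w. \<beta> w (real (Suc i) / real N) - \<beta> w (real i / real N)) \<in> borel_measurable (FB (real s / real N))"
    by (intro borel_measurable_diff B_FB) auto
   then show ?thesis using True s by (simp add: inc_def add.commute)
  qed simp
 qed auto
 from measurable_compose[OF this predictableD(4)[OF p]]
 have "(\<lambda>w. \<eta> (?x w) s) \<in> borel_measurable (FB (real s / real N))" .
 moreover have "\<eta> (?x w) s = \<eta> (inc N (\<beta> w)) s" for w
  by (rule predictableD(3)[OF p]) simp
 ultimately show ?thesis by simp
qed

lemma predictable_nu:
 assumes p: "predictable N C \<eta>"
 shows "(\<lambda>w. \<eta> (inc N (\<beta> w)) s) \<in> borel_measurable \<nu>"
 by (rule measurable_compose[OF inc_beta_measurable predictableD(4)[OF p]])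

lemma control_measurable:
 assumes p: "predictable N C \<eta>"
 shows "control N \<eta> \<in> measurable \<nu> path_space"
proof (rule path_measurableI)
 note [measurable] = predictable_nu[OF p]
 fix t :: real assume "t \<in> {0..1}"
 then show "(\<lambda>w. control N \<eta> w t) \<in> borel_measurable \<nu>"
  unfolding control_def grid_path_def by simp
qed (simp add: control_def grid_path_space)

lemma control_adapted:
 assumes p: "predictable N C \<eta>"
 shows "adapted_density \<nu> (control N \<eta>) (\<lambda>t w. grid_density N (\<eta> (inc N (\<beta> w))) t)"
 unfolding adapted_density_def
proof (intro conjI ballI)
 have [measurable]: "(\<lambda>w. \<eta> (inc N (\<beta> w)) s) \<in> borel_measurable \<nu>" for s by (rule predictable_nu[OF p])
 have [measurable]: "(\<lambda>t. indicator {a<..b} t :: real) \<in> borel_measurable leb01" for a b :: real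
  by (rule measurable_leb01) simp
 show "(\<lambda>(t, w). grid_density N (\<eta> (inc N (\<beta> w))) t) \<in> borel_measurable (leb01 \<Otimes>\<^sub>M \<nu>)"
  unfolding grid_density_def by measurable
 show "cm_density (control N \<eta> w) (\<lambda>t. grid_density N (\<eta> (inc N (\<beta> w))) t)" for w
  unfolding control_def using cm_density_grid[OF predictableD(1)[OF p]] .
 fix t :: real assume t: "t \<in> {0..1}"
 have "(\<lambda>w. grid_density N (\<eta> (inc N (\<beta> w))) t) \<in> borel_measurable (FB t)"
  unfolding grid_density_def
 proof (intro borel_measurable_sum)
  fix s assume "s \<in> {..<N}"
  then have s: "s < N" by simp
  show "(\<lambda>w. indicator {real s / real N<..real (Suc s) / real N} t *\<^sub>R \<eta> (inc N (\<beta> w)) s) \<in> borel_measurable (FB t)"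
  proof (cases "real s / real N < t")
   case True
   then have "(\<lambda>w. \<eta> (inc N (\<beta> w)) s) \<in> borel_measurable (FB t)"
    using measurable_filtration_mono[OF _ predictable_FB[OF p s], of t] by simp
   then show ?thesis by measurable
  qed simp
 qed
 then show "(\<lambda>w. grid_density N (\<eta> (inc N (\<beta> w))) t) \<in> borel_measurable (coord_filtration \<nu> t)"
  using coord_filtration_measurable_eq[OF t, of borel] by blast
qed

lemma control_bounded_drift:
 assumes p: "predictable N C \<eta>"
 shows "control N \<eta> \<in> bounded_drifts \<nu>"
proof -
 have cm: "control N \<eta> w \<in> cameron_martin" for w
  unfolding cameron_martin_def control_def
  using grid_path_space cm_density_grid[OF predictableD(1)[OF p]] by blast
 have "AE (t, w) in leb01 \<Otimes>\<^sub>M \<nu>. norm (grid_density N (\<eta> (inc N (\<beta> w))) t) \<le> C"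
  by (intro AE_I2) (auto intro!: grid_density_bound predictableD[OF p])
 then show ?thesis
  unfolding bounded_drifts_def L0_adapted_def
  using control_measurable[OF p] cm control_adapted[OF p] by blast
qed

text \<open>\<open>wiener_div\<close> is a choice among Ito integrals and inherits measurability
  once one exists. The density of a grid control is itself a simple process, so a constant
  approximating sequence is a witness.\<close>

lemma control_wiener_div_measurable:
 assumes p: "predictable N C \<eta>"
 shows "wiener_div \<nu> \<beta> (control N \<eta>) \<in> borel_measurable \<nu>"
proof -
 let ?\<tau> = "\<lambda>i. real i / real N" and ?\<xi> = "\<lambda>i w. \<eta> (inc N (\<beta> w)) i"
 let ?d = "\<lambda>t w. grid_density N (\<eta> (inc N (\<beta> w))) t"
 let ?X = "simple_ito \<beta> N ?\<tau> ?\<xi>"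
 have N: "N > 0" by (rule predictableD(1)[OF p])
 have Xm: "?X \<in> borel_measurable \<nu>"
  unfolding simple_ito_def
  by (intro borel_measurable_sum borel_measurable_inner predictable_nu[OF p] borel_measurable_diff B_measurable)
 have sp: "simple_process \<nu> (coord_filtration \<nu>) N ?\<tau> ?\<xi>"
  unfolding simple_process_def
 proof (intro conjI allI impI)
  fix i assume i: "i < N"
  show "real i / real N \<le> real (Suc i) / real N" by (intro divide_right_mono) auto
  show "?\<xi> i \<in> borel_measurable (coord_filtration \<nu> (real i / real N))"
   using predictable_FB[OF p i] coord_filtration_measurable_eq[of "real i / real N" borel] i by auto
  show "\<exists>C. \<forall>w\<in>space \<nu>. norm (?\<xi> i w) \<le> C" using predictableD(5)[OF p] by blast
 qed (use N in auto)
 have sv: "simple_value N ?\<tau> ?\<xi> t w = ?d t w" for t w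
  by (simp add: simple_value_def grid_density_def)
 have "has_ito_integral \<nu> (coord_filtration \<nu>) \<beta> ?d ?X"
  unfolding has_ito_integral_def
  by (intro conjI Xm exI[of _ "\<lambda>_. N"] exI[of _ "\<lambda>_. ?\<tau>"] exI[of _ "\<lambda>_. ?\<xi>"] allI sp)
    (simp_all add: sv case_prod_beta')
 then have "\<exists>X d. adapted_density \<nu> (control N \<eta>) d \<and> has_ito_integral \<nu> (coord_filtration \<nu>) \<beta> d X"
  using control_adapted[OF p] by blast
 from someI_ex[OF this] show ?thesis
  unfolding wiener_div_def[symmetric] by (auto simp: has_ito_integral_def)
qed

lemma control_norm_sq:
 assumes p: "predictable N C \<eta>"
 shows "cm_norm_sq (control N \<eta> w) / 2 = half_energy N \<eta> (inc N (\<beta> w))"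
 unfolding control_def cm_norm_sq_grid[OF predictableD(1)[OF p]] half_energy_def
 by (simp add: sum_divide_distrib)

lemma control_girsanov_measurable:
 assumes p: "predictable N C \<eta>"
 shows "girsanov_density \<nu> \<beta> (control N \<eta>) \<in> borel_measurable \<nu>"
proof -
 have [measurable]: "(\<lambda>w. half_energy N \<eta> (inc N (\<beta> w))) \<in> borel_measurable \<nu>"
  by (rule measurable_compose[OF inc_beta_measurable half_energy_measurable[OF p]])
 have [measurable]: "wiener_div \<nu> \<beta> (control N \<eta>) \<in> borel_measurable \<nu>"
  by (rule control_wiener_div_measurable[OF p])
 have "(\<lambda>w. exp (- wiener_div \<nu> \<beta> (control N \<eta>) w - half_energy N \<eta> (inc N (\<beta> w)))) \<in> borel_measurable \<nu>"
  by measurable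
 then show ?thesis
  unfolding girsanov_density_def[abs_def] control_norm_sq[OF p] .
qed

lemma inc_shift_control:
 assumes p: "predictable N C \<eta>" and b: "b = path_add (\<beta> w) (control N \<eta> w)"
 shows "inc N b = (\<lambda>s. inc N (\<beta> w) s + (1 / real N) *\<^sub>R \<eta> (inc N (\<beta> w)) s)"
proof
 fix s
 note N = predictableD(1)[OF p]
 show "inc N b s = inc N (\<beta> w) s + (1 / real N) *\<^sub>R \<eta> (inc N (\<beta> w)) s"
 proof (cases "s < N")
  case True
  then show ?thesis unfolding b inc_path_add[OF N] control_def by (simp add: inc_grid_path[OF N])
 next
  case False
  then show ?thesis using predictableD(6)[OF p] by (simp add: inc_def)
 qed
qed

end

section \<open>Laws, inverses and costs of the controlled maps\<close>

locale controlled = path_brownian \<nu> \<beta>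
 for \<nu> :: "(real \<Rightarrow> real ^ 'n) measure" and \<beta> :: "(real \<Rightarrow> real ^ 'n) \<Rightarrow> real \<Rightarrow> real ^ 'n" +
 fixes W :: "((real \<Rightarrow> real ^ 'n) \<Rightarrow> real \<Rightarrow> real ^ 'n) \<Rightarrow> (real \<Rightarrow> real ^ 'n) \<Rightarrow> real \<Rightarrow> real ^ 'n"
 assumes W_measurable: "\<And>u. u \<in> bounded_drifts \<nu> \<Longrightarrow> W u \<in> measurable \<nu> path_space"
  and W_law: "\<And>u. u \<in> bounded_drifts \<nu> \<Longrightarrow>
      distr (density \<nu> (\<lambda>w. ennreal (girsanov_density \<nu> \<beta> u w))) path_space (W u)
       = distr \<nu> path_space (\<lambda>w. w)"
  and W_shift: "\<And>u. u \<in> bounded_drifts \<nu> \<Longrightarrow> AE w in \<nu>. \<beta> (W u w) = path_add (\<beta> w) (u w)"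
begin

text \<open>The Girsanov density is an exponential, hence positive, so reweighting by it does not
  change the null sets; \<open>W_law\<close> then compares the null sets of \<nu> with those of the
  image.\<close>

lemma W_equivalent:
 assumes u: "u \<in> bounded_drifts \<nu>" and g: "girsanov_density \<nu> \<beta> u \<in> borel_measurable \<nu>"
 shows "absolutely_continuous \<nu> (distr \<nu> path_space (W u))"
  "absolutely_continuous (distr \<nu> path_space (W u)) \<nu>"
proof -
 let ?\<rho> = "\<lambda>w. ennreal (girsanov_density \<nu> \<beta> u w)"
 have [measurable]: "W u \<in> measurable \<nu> path_space" by (rule W_measurable[OF u])
 have gm: "?\<rho> \<in> borel_measurable \<nu>" using g by measurable
 have id: "(\<lambda>w. w) \<in> measurable \<nu> path_space" using path_measurable_nu by simp
 have pos: "0 < ?\<rho> w" for w by (simp add: girsanov_density_def)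
 have key: "emeasure (distr \<nu> path_space (W u)) A = 0 \<longleftrightarrow> emeasure \<nu> A = 0" if A: "A \<in> sets path_space" for A
 proof -
  have pre: "W u -` A \<inter> space \<nu> \<in> sets \<nu>" by (rule measurable_sets[OF W_measurable[OF u] A])
  have "emeasure \<nu> A = emeasure (distr \<nu> path_space (\<lambda>w. w)) A"
   using A sets.sets_into_space[OF A] space_nu by (subst emeasure_distr[OF id A]) (simp add: Int_absorb2)
  also have "\<dots> = emeasure (density \<nu> ?\<rho>) (W u -` A \<inter> space \<nu>)"
   unfolding W_law[OF u, symmetric] using A W_measurable[OF u] by (subst emeasure_distr) auto
  finally have "emeasure \<nu> A = 0 \<longleftrightarrow> W u -` A \<inter> space \<nu> \<in> null_sets (density \<nu> ?\<rho>)"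
   using pre by (simp add: null_sets_def)
  also have "\<dots> \<longleftrightarrow> (AE w in \<nu>. w \<notin> W u -` A \<inter> space \<nu>)"
   using pos pre by (subst null_sets_density_iff[OF gm]) (auto simp: zero_less_iff_neq_zero)
  also have "\<dots> \<longleftrightarrow> emeasure \<nu> (W u -` A \<inter> space \<nu>) = 0"
   using AE_iff_null_sets[OF pre] pre by (simp add: null_sets_def)
  also have "emeasure \<nu> (W u -` A \<inter> space \<nu>) = emeasure (distr \<nu> path_space (W u)) A"
   using A by (subst emeasure_distr) auto
  finally show ?thesis by simp
 qed
 then show "absolutely_continuous \<nu> (distr \<nu> path_space (W u))"
  "absolutely_continuous (distr \<nu> path_space (W u)) \<nu>"
  unfolding absolutely_continuous_def null_sets_def using sets_nu by auto
qed

lemma W_control: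
 assumes p: "predictable N C \<eta>"
 shows "W (control N \<eta>) \<in> measurable \<nu> path_space" "W (control N \<eta>) \<in> measurable \<nu> \<nu>"
  "AE w in \<nu>. \<beta> (W (control N \<eta>) w) = path_add (\<beta> w) (control N \<eta> w)"
  "absolutely_continuous \<nu> (distr \<nu> path_space (W (control N \<eta>)))"
  "absolutely_continuous (distr \<nu> path_space (W (control N \<eta>))) \<nu>"
 using W_measurable W_shift W_equivalent control_bounded_drift[OF p] control_girsanov_measurable[OF p] path_measurable_nu
 by blast+

lemma AE_W:
 assumes X: "X \<in> measurable \<nu> path_space" "absolutely_continuous \<nu> (distr \<nu> path_space X)" and P: "AE w in \<nu>. P w"
 shows "AE w in \<nu>. P (X w)"
proof -
 have "AE w in distr \<nu> path_space X. P w" by (rule absolutely_continuous_AE[OF _ X(2) P]) (simp add: sets_nu)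
 then show ?thesis by (rule AE_distrD[OF X(1)])
qed

text \<open>The outer drift is evaluated at increments already shifted by the inner one, where by
  \<open>cancel\<close> it is the opposite of the inner drift. The composition therefore fixes
  \<open>\<beta>\<close>, and \<open>identity_of_beta_fixed\<close> concludes.\<close>

lemma W_compose_identity:
 assumes p: "predictable N C \<xi>" and q: "predictable N C \<eta>"
  and cancel: "\<And>x s. \<xi> (\<lambda>s. x s + (1 / real N) *\<^sub>R \<eta> x s) s = - \<eta> x s"
 shows "AE w in \<nu>. W (control N \<xi>) (W (control N \<eta>) w) = w"
proof (rule identity_of_beta_fixed)
 let ?V = "W (control N \<xi>)" and ?U = "W (control N \<eta>)"
 note V = W_control[OF p] and U = W_control[OF q]
 show m: "(\<lambda>w. ?V (?U w)) \<in> measurable \<nu> path_space" by (rule measurable_compose[OF U(2) V(1)])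
 show "absolutely_continuous \<nu> (distr \<nu> path_space (\<lambda>w. ?V (?U w)))"
  unfolding absolutely_continuous_def
 proof
  fix A assume A: "A \<in> null_sets \<nu>"
  then have "AE w in \<nu>. w \<notin> A" by (rule AE_not_in)
  then have "AE w in \<nu>. ?V (?U w) \<notin> A" by (intro AE_W[OF U(1,4)] AE_W[OF V(1,4)])
  moreover have "(\<lambda>w. ?V (?U w)) -` A \<inter> space \<nu> \<in> sets \<nu>"
   using A sets_nu by (intro measurable_sets[OF m]) auto
  ultimately have "emeasure \<nu> ((\<lambda>w. ?V (?U w)) -` A \<inter> space \<nu>) = 0"
   using AE_iff_null_sets[of "(\<lambda>w. ?V (?U w)) -` A \<inter> space \<nu>" \<nu>] by (auto simp: null_sets_def)
  then show "A \<in> null_sets (distr \<nu> path_space (\<lambda>w. ?V (?U w)))"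
   using A sets_nu by (auto simp: null_sets_def emeasure_distr[OF m])
 qed
 have "AE w in \<nu>. \<beta> (?V (?U w)) = path_add (\<beta> (?U w)) (control N \<xi> (?U w))"
  by (rule AE_W[OF U(1,4) V(3)])
 then show "AE w in \<nu>. \<beta> (?V (?U w)) = \<beta> w"
  using U(3) AE_space
 proof eventually_elim
  case (elim w)
  have i: "inc N (\<beta> (?U w)) = (\<lambda>s. inc N (\<beta> w) s + (1 / real N) *\<^sub>R \<eta> (inc N (\<beta> w)) s)"
   by (rule inc_shift_control[OF q elim(2)])
  have "control N \<xi> (?U w) = grid_path N (\<lambda>s. - \<eta> (inc N (\<beta> w)) s)"
   unfolding control_def i by (simp add: cancel[abs_def])
  also have "\<dots> = (\<lambda>t\<in>{0..1}. - control N \<eta> w t)"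
   by (auto simp: grid_path_def control_def fun_eq_iff sum_negf)
  finally have c: "control N \<xi> (?U w) = (\<lambda>t\<in>{0..1}. - control N \<eta> w t)" .
  show ?case
  proof (rule extensionalityI)
   show "\<beta> (?V (?U w)) \<in> extensional {0..1}" unfolding elim(1) by (simp add: path_add_def)
   show "\<beta> w \<in> extensional {0..1}" using path_spaceD(2)[OF B_space[OF elim(3)]] .
   show "\<beta> (?V (?U w)) t = \<beta> w t" if "t \<in> {0..1}" for t
    unfolding elim(1) elim(2) c using that by (simp add: path_add_def)
  qed
 qed
qed

lemma W_inverse:
 assumes p: "predictable N C \<xi>"
 shows "AE w in \<nu>. W (control N \<xi>) (W (control N (inverse_drift N \<xi>)) w) = w"
  "AE w in \<nu>. W (control N (inverse_drift N \<xi>)) (W (control N \<xi>) w) = w"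
proof -
 show "AE w in \<nu>. W (control N \<xi>) (W (control N (inverse_drift N \<xi>)) w) = w"
 proof (rule W_compose_identity[OF p predictable_inverse_drift[OF p]])
  fix x s
  have "(\<lambda>s. x s + (1 / real N) *\<^sub>R inverse_drift N \<xi> x s) = unshift N \<xi> x"
   by (rule ext) (subst unshift_eq[OF p], simp add: inverse_drift_def)
  then show "\<xi> (\<lambda>s. x s + (1 / real N) *\<^sub>R inverse_drift N \<xi> x s) s = - inverse_drift N \<xi> x s"
   by (simp only:) (simp add: inverse_drift_def)
 qed
 show "AE w in \<nu>. W (control N (inverse_drift N \<xi>)) (W (control N \<xi>) w) = w"
 proof (rule W_compose_identity[OF predictable_inverse_drift[OF p] p])
  fix x s
  show "inverse_drift N \<xi> (\<lambda>s. x s + (1 / real N) *\<^sub>R \<xi> x s) s = - \<xi> x s"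
   unfolding inverse_drift_def unshift_shift[OF p] ..
 qed
qed

text \<open>The control is built from the inverse drift on purpose: its map carries \<nu> to the
  measure with density \<open>rho N \<xi>\<close>, while \<open>W (control N \<xi>)\<close> goes the
  other way and serves as the inverse.\<close>

lemma inverse_control_invertible:
 assumes p: "predictable N C \<xi>"
 shows "control N (inverse_drift N \<xi>) \<in> invertible_drifts \<nu> W"
proof -
 note U = W_control[OF predictable_inverse_drift[OF p]] and V = W_control[OF p]
 have "as_invertible \<nu> (W (control N (inverse_drift N \<xi>)))"
  unfolding as_invertible_def
  by (intro conjI U(1,4,5) bexI[of _ "W (control N \<xi>)"] V(1,4) W_inverse(1)[OF p])
 then show ?thesis
  using control_bounded_drift[OF predictable_inverse_drift[OF p]] by (simp add: invertible_drifts_def)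
qed

definition rho :: "nat \<Rightarrow> ((nat \<Rightarrow> real ^ 'n) \<Rightarrow> nat \<Rightarrow> real ^ 'n) \<Rightarrow> (real \<Rightarrow> real ^ 'n) \<Rightarrow> real" where
 "rho N \<xi> w = exp (log_density N \<xi> (inc N (\<beta> w)))"

lemma rho_measurable: "predictable N C \<xi> \<Longrightarrow> rho N \<xi> \<in> borel_measurable \<nu>"
 unfolding rho_def[abs_def]
 using measurable_compose[OF inc_beta_measurable log_density_measurable] by measurable

lemma theta_measurable: "theta N l \<in> borel_measurable seq_space"
proof -
 note [measurable] = seq_component_measurable
 show ?thesis unfolding theta_def[abs_def] by measurable
qed

lemma trig_as_inc:
 assumes "g \<in> trig" "N > 0"
 shows "\<exists>K G. K > 0 \<and> G \<in> borel_measurable seq_space \<and> g = (\<lambda>b. G (inc (N * K) b))"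
proof -
 from trig_rep[OF assms(1)]
 obtain K xs where K: "K > 0" and g: "\<forall>b. g b = (\<Sum>(c, l)\<leftarrow>xs. Re (c * cis (theta K l (inc K b))))"
  by blast
 let ?G = "\<lambda>x. (\<Sum>(c, l)\<leftarrow>xs. Re (c * cis (theta (K * N) (\<lambda>s. l (s div N)) x)))"
 have "?G \<in> borel_measurable seq_space"
 proof (induction xs)
  case (Cons a xs)
  have [measurable]: "theta (K * N) (\<lambda>s. snd a (s div N)) \<in> borel_measurable seq_space"
   by (rule theta_measurable)
  have "(\<lambda>x. Re (fst a * cis (theta (K * N) (\<lambda>s. snd a (s div N)) x))) \<in> borel_measurable seq_space"
   by measurable
  from borel_measurable_add[OF this Cons] show ?case by (simp add: case_prod_beta')
 qed simp
 moreover have "g = (\<lambda>b. ?G (inc (N * K) b))"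
  unfolding fun_eq_iff g[rule_format] mult.commute[of N K] theta_refine[OF K assms(2)] by blast
 ultimately show ?thesis using K by (intro exI[of _ K] exI[of _ ?G] conjI)
qed

text \<open>The function \<open>g\<close> may live on a finer grid than \<open>\<xi>\<close>, so the
  drift is reread on the common grid \<open>N * K\<close>, where neither the density nor the control
  path changes. The constant \<open>c\<close> serves to make \<open>g + c\<close>
  non-negative.\<close>

lemma girsanov_trig:
 assumes p: "predictable N C \<xi>" and g: "g \<in> trig"
 shows "(\<integral>\<^sup>+w. ennreal (rho N \<xi> w) * ennreal (g (\<beta> (W (control N \<xi>) w)) + c) \<partial>\<nu>)
    = (\<integral>\<^sup>+w. ennreal (g (\<beta> w) + c) \<partial>\<nu>)"
proof -
 note N = predictableD(1)[OF p]
 obtain K G where K: "K > 0" and G1: "G \<in> borel_measurable seq_space"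
  and G2: "g = (\<lambda>b. G (inc (N * K) b))"
  using trig_as_inc[OF g N] by (elim exE conjE)
 have G: "G \<in> borel_measurable seq_space" "g b = G (inc (N * K) b)" for b
  using G1 G2 by auto
 have NK: "N * K > 0" using N K by simp
 let ?\<xi> = "\<lambda>s w. \<xi> (inc N (\<beta> w)) (s div K)"
 have div: "s div K < N" if "s < N * K" for s using that by (simp add: less_mult_imp_div_less)
 interpret D: grid_drift \<nu> \<beta> "N * K" ?\<xi> C
 proof
  fix s assume s: "s < N * K"
  have "real (s div K) / real N \<le> real s / real (N * K)"
  proof -
   have "real (s div K) * real K \<le> real s"
    by (metis of_nat_le_iff of_nat_mult div_times_less_eq_dividend)
   then show ?thesis using N K by (simp add: field_simps)
  qed
  then show "?\<xi> s \<in> borel_measurable (FB (real s / real (N * K)))"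
   by (rule measurable_filtration_mono[OF _ predictable_FB[OF p div[OF s]]])
 qed (use NK predictableD(2,5)[OF p] in auto)
 have A: "D.A (N * K) w = - log_density N \<xi> (inc N (\<beta> w))" for w
 proof -
  have "D.A (N * K) w = (\<Sum>k<N. \<Sum>s = k * K..<k * K + K. ?\<xi> s w \<bullet> inc (N * K) (\<beta> w) s + 1 / real (N * K) * (?\<xi> s w \<bullet> ?\<xi> s w) / 2)"
   unfolding D.A_def D.D_def by (rule sum.nat_group[symmetric])
  also have "\<dots> = (\<Sum>k<N. \<Sum>s = k * K..<k * K + K. \<xi> (inc N (\<beta> w)) k \<bullet> inc (N * K) (\<beta> w) s
     + 1 / real (N * K) * (\<xi> (inc N (\<beta> w)) k \<bullet> \<xi> (inc N (\<beta> w)) k) / 2)"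
  proof (intro sum.cong refl)
   fix k s assume "s \<in> {k * K..<k * K + K}"
   then have "s div K = k" by (intro div_nat_eqI) (auto simp: mult.commute)
   then show "?\<xi> s w \<bullet> inc (N * K) (\<beta> w) s + 1 / real (N * K) * (?\<xi> s w \<bullet> ?\<xi> s w) / 2
    = \<xi> (inc N (\<beta> w)) k \<bullet> inc (N * K) (\<beta> w) s + 1 / real (N * K) * (\<xi> (inc N (\<beta> w)) k \<bullet> \<xi> (inc N (\<beta> w)) k) / 2" by simp
  qed
  also have "\<dots> = (\<Sum>k<N. \<xi> (inc N (\<beta> w)) k \<bullet> inc N (\<beta> w) k + 1 / real N * (\<xi> (inc N (\<beta> w)) k \<bullet> \<xi> (inc N (\<beta> w)) k) / 2)"
   using N K by (intro sum.cong refl) (simp add: sum.distrib inner_sum_right[symmetric] sum_inc_refine)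
  finally show ?thesis by (simp add: log_density_def)
 qed
 have Yeq: "D.Y (N * K) w = inc (N * K) (path_add (\<beta> w) (control N \<xi> w))" for w
 proof
  fix s
  have "control N \<xi> w = grid_path (N * K) (\<lambda>s. ?\<xi> s w)"
   unfolding control_def by (rule grid_path_refine[OF N K, symmetric])
  then have "inc (N * K) (control N \<xi> w) s = (1 / real (N * K)) *\<^sub>R ?\<xi> s w" if "s < N * K"
   by (simp only: inc_grid_path[OF NK that])
  moreover have "inc (N * K) (control N \<xi> w) s = 0" if "\<not> s < N * K"
   using that by (simp add: inc_def)
  moreover have "inc (N * K) (\<beta> w) s = 0" if "\<not> s < N * K"
   using that by (simp add: inc_def)
  ultimately show "D.Y (N * K) w s = inc (N * K) (path_add (\<beta> w) (control N \<xi> w)) s"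
   unfolding inc_path_add[OF NK] D.Y_def D.D_def by auto
 qed
 have "(\<integral>\<^sup>+w. ennreal (rho N \<xi> w) * ennreal (g (\<beta> (W (control N \<xi>) w)) + c) \<partial>\<nu>)
   = (\<integral>\<^sup>+w. ennreal (exp (- D.A (N * K) w)) * ennreal (G (D.Y (N * K) w) + c) \<partial>\<nu>)"
  by (rule nn_integral_cong_AE) (use W_control(3)[OF p] in eventually_elim, simp add: A rho_def Yeq G(2))
 also have "\<dots> = (\<integral>\<^sup>+w. ennreal (G (inc (N * K) (\<beta> w)) + c) \<partial>\<nu>)"
  by (rule D.girsanov) (use G(1) in measurable)
 finally show ?thesis by (simp add: G(2))
qed

lemma nn_integral_rho:
 assumes p: "predictable N C \<xi>" shows "(\<integral>\<^sup>+w. ennreal (rho N \<xi> w) \<partial>\<nu>) = 1"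
 using girsanov_trig[OF p trig_const[of 0], of 1] by (simp add: emeasure_space_1)

text \<open>The image is absolutely continuous because null sets are preserved, and its
  trigonometric integrals are those of \<nu> by the grid formula; \<open>law_eqI\<close> identifies
  it.\<close>

lemma distr_control:
 assumes p: "predictable N C \<xi>"
 shows "distr (density \<nu> (\<lambda>w. ennreal (rho N \<xi> w))) path_space (W (control N \<xi>)) = \<nu>"
proof (rule law_eqI)
 let ?R = "density \<nu> (\<lambda>w. ennreal (rho N \<xi> w))" and ?V = "W (control N \<xi>)"
 have [measurable]: "rho N \<xi> \<in> borel_measurable \<nu>" by (rule rho_measurable[OF p])
 note V = W_control[OF p]
 have Vm: "?V \<in> measurable ?R path_space" using V(1) by simp
 have "emeasure ?R (space ?R) = 1"
  using nn_integral_rho[OF p] by (subst emeasure_density) (auto cong: nn_integral_cong)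
 then interpret R: prob_space ?R by (intro prob_spaceI)
 interpret m: prob_space "distr ?R path_space ?V" by (rule R.prob_space_distr[OF Vm])
 show "finite_measure (distr ?R path_space ?V)" by (rule m.finite_measure_axioms)
 show "sets (distr ?R path_space ?V) = sets \<nu>" by (simp add: sets_nu)
 show "absolutely_continuous \<nu> (distr ?R path_space ?V)"
  unfolding absolutely_continuous_def
 proof
  fix A assume A: "A \<in> null_sets \<nu>"
  then have "AE w in \<nu>. ?V w \<notin> A" by (intro AE_W[OF V(1,4)] AE_not_in)
  then have "AE w in ?R. w \<notin> ?V -` A \<inter> space ?R"
   by (subst AE_density) auto
  moreover have "?V -` A \<inter> space ?R \<in> sets ?R"
   using A sets_nu by (intro measurable_sets[OF Vm]) auto
  ultimately have "?V -` A \<inter> space ?R \<in> null_sets ?R" using AE_iff_null_sets by blast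
  then show "A \<in> null_sets (distr ?R path_space ?V)"
   using A sets_nu by (auto simp: null_sets_def emeasure_distr[OF Vm])
 qed
 fix g :: "(real \<Rightarrow> real ^ 'n) \<Rightarrow> real" assume g: "g \<in> trig"
 obtain c where c: "\<And>b. \<bar>g b\<bar> \<le> c" using trig_bounded[OF g] by blast
 have c0: "0 \<le> g b + c" for b using c[of b] by linarith
 have gm: "(\<lambda>w. g (\<beta> w)) \<in> borel_measurable \<nu>" by (rule trig_beta_measurable[OF g])
 then have gm': "(\<lambda>w. g (\<beta> w)) \<in> borel_measurable path_space" using sets_nu by (simp cong: measurable_cong_sets)
 have ig: "integrable \<nu> (\<lambda>w. g (\<beta> w))" using c gm by (intro integrable_const_bound[of _ c]) auto
 have igm: "integrable (distr ?R path_space ?V) (\<lambda>w. g (\<beta> w))"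
  using c gm' by (intro m.integrable_const_bound[of _ c]) auto
 have "ennreal (\<integral>w. g (\<beta> w) + c \<partial>distr ?R path_space ?V) = (\<integral>\<^sup>+w. ennreal (g (\<beta> w) + c) \<partial>distr ?R path_space ?V)"
  using igm c0 by (intro nn_integral_eq_integral[symmetric]) auto
 also have "\<dots> = (\<integral>\<^sup>+w. ennreal (g (\<beta> (?V w)) + c) \<partial>?R)"
  using gm' by (intro nn_integral_distr[OF Vm]) auto
 also have "\<dots> = (\<integral>\<^sup>+w. ennreal (rho N \<xi> w) * ennreal (g (\<beta> (?V w)) + c) \<partial>\<nu>)"
  using measurable_compose[OF V(1) gm'] by (intro nn_integral_density) auto
 also have "\<dots> = (\<integral>\<^sup>+w. ennreal (g (\<beta> w) + c) \<partial>\<nu>)" by (rule girsanov_trig[OF p g])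
 also have "\<dots> = ennreal (\<integral>w. g (\<beta> w) + c \<partial>\<nu>)"
  using ig c0 by (intro nn_integral_eq_integral) auto
 finally have "(\<integral>w. g (\<beta> w) + c \<partial>distr ?R path_space ?V) = (\<integral>w. g (\<beta> w) + c \<partial>\<nu>)"
  using c0 by (subst (asm) ennreal_inj) (auto intro!: integral_nonneg)
 then show "(\<integral>w. g (\<beta> w) \<partial>distr ?R path_space ?V) = (\<integral>w. g (\<beta> w) \<partial>\<nu>)"
  using ig igm m.prob_space prob_space by simp
qed

text \<open>Write \<nu> as the image of \<open>rho N \<xi>\<close> times \<nu> under
  \<open>W (control N \<xi>)\<close> and push both sides forward by the inverse map.\<close>

lemma distr_inverse_control:
 assumes p: "predictable N C \<xi>"
 shows "distr \<nu> \<nu> (W (control N (inverse_drift N \<xi>))) = density \<nu> (\<lambda>w. ennreal (rho N \<xi> w))"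
proof -
 let ?R = "density \<nu> (\<lambda>w. ennreal (rho N \<xi> w))" and ?V = "W (control N \<xi>)" and ?U = "W (control N (inverse_drift N \<xi>))"
 have [measurable]: "rho N \<xi> \<in> borel_measurable \<nu>" by (rule rho_measurable[OF p])
 note V = W_control[OF p] and U = W_control[OF predictable_inverse_drift[OF p]]
 have Vm: "?V \<in> measurable ?R \<nu>" using V(2) by simp
 have "distr ?R \<nu> ?V = distr ?R path_space ?V" by (rule distr_cong) (auto simp: sets_nu)
 then have \<nu>: "\<nu> = distr ?R \<nu> ?V" using distr_control[OF p] by simp
 have "distr \<nu> \<nu> ?U = distr (distr ?R \<nu> ?V) \<nu> ?U" using \<nu> by simp
 also have "\<dots> = distr ?R \<nu> (?U \<circ> ?V)" by (rule distr_distr[OF U(2) Vm])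
 also have "\<dots> = distr ?R ?R (\<lambda>w. w)"
 proof (rule distr_cong_AE)
  have "AE w in ?R. ?U (?V w) = w" using W_inverse(2)[OF p] by (subst AE_density) auto
  then show "AE w in ?R. (?U \<circ> ?V) w = w" by simp
  show "?U \<circ> ?V \<in> measurable ?R \<nu>" by (rule measurable_comp[OF Vm U(2)])
 qed auto
 also have "\<dots> = ?R" by (rule distr_id)
 finally show ?thesis .
qed

text \<open>The inverse drift at \<open>w\<close> is the opposite of \<open>\<xi>\<close> at the
  increments of \<open>\<beta> (W u w)\<close>, so its energy at \<open>w\<close> equals the energy
  of \<open>\<xi>\<close> at \<open>W u w\<close>. The whole integrand is thus a function of
  \<open>W u w\<close>, whose law has density \<open>rho N \<xi>\<close>.\<close>

lemma inverse_control_cost: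
 assumes p: "predictable N C \<xi>" and f: "f \<in> borel_measurable \<nu>"
 defines "u \<equiv> control N (inverse_drift N \<xi>)"
 shows "(\<integral>w. f (W u w) + cm_norm_sq (u w) / 2 \<partial>\<nu>)
    = (\<integral>w. rho N \<xi> w * (f w + half_energy N \<xi> (inc N (\<beta> w))) \<partial>\<nu>)"
proof -
 have [measurable]: "rho N \<xi> \<in> borel_measurable \<nu>" by (rule rho_measurable[OF p])
 note q = predictable_inverse_drift[OF p]
 note U = W_control[OF q, folded u_def]
 let ?F = "\<lambda>w. f w + half_energy N \<xi> (inc N (\<beta> w))"
 have Fm: "?F \<in> borel_measurable \<nu>"
  using f measurable_compose[OF inc_beta_measurable half_energy_measurable[OF p]] by measurable
 have hm: "(\<lambda>w. f (W u w) + cm_norm_sq (u w) / 2) \<in> borel_measurable \<nu>"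
  unfolding u_def control_norm_sq[OF q]
  using measurable_compose[OF U(2) f, unfolded u_def] measurable_compose[OF inc_beta_measurable half_energy_measurable[OF q]] by measurable
 have "(\<integral>w. f (W u w) + cm_norm_sq (u w) / 2 \<partial>\<nu>) = (\<integral>w. ?F (W u w) \<partial>\<nu>)"
 proof (rule integral_cong_AE[OF hm measurable_compose[OF U(2) Fm]])
  show "AE w in \<nu>. f (W u w) + cm_norm_sq (u w) / 2 = ?F (W u w)"
   using U(3)
  proof eventually_elim
   case (elim w)
   have "inc N (\<beta> (W u w)) = (\<lambda>s. inc N (\<beta> w) s + (1 / real N) *\<^sub>R inverse_drift N \<xi> (inc N (\<beta> w)) s)"
    using inc_shift_control[OF q] elim unfolding u_def by blast
   also have "\<dots> = unshift N \<xi> (inc N (\<beta> w))"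
    by (rule ext) (subst unshift_eq[OF p], simp add: inverse_drift_def)
   finally have i: "inc N (\<beta> (W u w)) = unshift N \<xi> (inc N (\<beta> w))" .
   show ?case
    unfolding i unfolding u_def control_norm_sq[OF q] by (simp add: half_energy_def inverse_drift_def)
  qed
 qed
 also have "\<dots> = (\<integral>w. ?F w \<partial>distr \<nu> \<nu> (W u))"
  by (rule integral_distr[OF U(2) Fm, symmetric])
 also have "\<dots> = (\<integral>w. rho N \<xi> w * ?F w \<partial>\<nu>)"
  unfolding u_def distr_inverse_control[OF p]
  using Fm by (subst integral_density) (auto simp: rho_def)
 finally show ?thesis .
qed

end

section \<open>Approximation by Girsanov densities\<close>

lemma exp_remainder_le: "0 \<le> t \<Longrightarrow> exp t - 1 - t \<le> t\<^sup>2 * exp t / 2" for t :: real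
proof -
 assume t: "0 \<le> t"
 obtain u where u: "\<bar>u\<bar> \<le> \<bar>t\<bar>" "exp t = (\<Sum>m<2. t ^ m / fact m) + exp u / fact 2 * t ^ 2"
  using Maclaurin_exp_le[of t 2] by auto
 have "exp u \<le> exp t" using u(1) t by simp
 then have "t\<^sup>2 * exp u \<le> t\<^sup>2 * exp t" by (intro mult_left_mono) auto
 then have "exp u * t\<^sup>2 \<le> t\<^sup>2 * exp t" by (simp only: mult.commute)
 moreover have "exp t = 1 + t + (exp u * t\<^sup>2) / 2"
  using u(2) by (simp add: numeral_2_eq_2 lessThan_Suc)
 ultimately show ?thesis by linarith
qed

lemma exp_minus_one_le: "0 \<le> t \<Longrightarrow> exp t - 1 \<le> t * exp t" for t :: real
 using exp_ge_add_one_self[of "-t"] mult_right_mono[of "1 - t" "exp (-t)" "exp t"]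
 by (simp add: exp_minus field_simps)

text \<open>Replaces the square of a Gaussian variable by exponentials with exactly known means. The
  two sides agree up to fourth order in \<open>s\<close>, so no power of \<open>h\<close> is
  lost.\<close>

lemma square_le_cosh: "s\<^sup>2 \<le> exp s + exp (- s) - 2" for s :: real
proof -
 have "(s / 2)\<^sup>2 \<le> (sinh (s / 2))\<^sup>2"
 proof -
  have "\<bar>x\<bar> \<le> \<bar>sinh x\<bar>" for x :: real
  proof -
   have *: "x \<le> sinh x" if "0 \<le> x" for x :: real
   proof -
    have "(\<lambda>x. sinh x - x) 0 \<le> (\<lambda>x. sinh x - x) x"
    proof (rule DERIV_nonneg_imp_nondecreasing[OF that])
     fix y :: real
     have "((\<lambda>x. sinh x - x) has_real_derivative cosh y - 1) (at y)"
      by (auto intro!: derivative_eq_intros)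
     then show "\<exists>z. ((\<lambda>x. sinh x - x) has_real_derivative z) (at y) \<and> 0 \<le> z"
      using cosh_real_ge_1[of y] by (intro exI[of _ "cosh y - 1"]) auto
    qed
    then show ?thesis by simp
   qed
   show ?thesis using *[of x] *[of "-x"] by (cases "0 \<le> x") auto
  qed
  from power_mono[OF this abs_ge_zero] have "\<bar>s / 2\<bar>\<^sup>2 \<le> \<bar>sinh (s / 2)\<bar>\<^sup>2" .
  then show ?thesis by (simp only: power2_abs)
 qed
 also have "(sinh (s / 2))\<^sup>2 = (exp s + exp (- s) - 2) / 4"
  by (simp add: sinh_def power2_eq_square field_simps exp_add[symmetric])
 finally show ?thesis by (simp add: power_divide)
qed

text \<open>After expanding the square all means are explicit and sum to
  \<open>exp \<tau> + 2 * exp (\<tau> / 2) - 3 - 2 * \<tau>\<close>. The terms of order 0 and 1 in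
  \<open>\<tau>\<close> cancel, which leaves order \<open>\<tau>\<^sup>2\<close>, that is
  \<open>h\<^sup>2\<close>.\<close>

lemma integral_gauss_exp_remainder:
 fixes c :: "real ^ 'n"
 assumes h: "h > 0"
 defines "\<tau> \<equiv> h * (c \<bullet> c)"
 shows "integrable (gauss h) (\<lambda>y. (exp (c \<bullet> y - \<tau> / 2) - 1 - c \<bullet> y)\<^sup>2)"
  "(\<integral>y. (exp (c \<bullet> y - \<tau> / 2) - 1 - c \<bullet> y)\<^sup>2 \<partial>gauss h) \<le> \<tau>\<^sup>2 * exp \<tau>"
proof -
 interpret prob_space "gauss h :: (real ^ 'n) measure" by (rule prob_space_gauss[OF h])
 have t0: "0 \<le> \<tau>" using h by (simp add: \<tau>_def)
 let ?e = "\<lambda>y. exp (c \<bullet> y - \<tau> / 2)"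
 let ?B = "\<lambda>y. exp (- \<tau>) * exp ((2 *\<^sub>R c) \<bullet> y) + 1 + (exp (c \<bullet> y) + exp ((- c) \<bullet> y) - 2) - 2 * ?e y - 2 * (?e y * (c \<bullet> y)) + 2 * (c \<bullet> y)"
 have pt: "(?e y - 1 - c \<bullet> y)\<^sup>2 \<le> ?B y" for y
 proof -
  have "(?e y - 1 - c \<bullet> y)\<^sup>2 = (?e y)\<^sup>2 + 1 + (c \<bullet> y)\<^sup>2 - 2 * ?e y - 2 * (?e y * (c \<bullet> y)) + 2 * (c \<bullet> y)"
   by (simp add: power2_eq_square algebra_simps)
  also have "(?e y)\<^sup>2 = exp (- \<tau>) * exp ((2 *\<^sub>R c) \<bullet> y)"
   by (simp add: power2_eq_square exp_add[symmetric] algebra_simps)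
  finally show ?thesis using square_le_cosh[of "c \<bullet> y"] by simp
 qed
 have ew: "?e y = exp (- ((- c) \<bullet> y) - h * ((- c) \<bullet> (- c)) / 2)" for y by (simp add: \<tau>_def)
 have e1: "has_bochner_integral (gauss h) ?e 1"
  unfolding ew by (rule gauss_exp_weight(1)[OF h])
 have e2: "has_bochner_integral (gauss h) (\<lambda>y. ?e y * (c \<bullet> y)) \<tau>"
 proof -
  have "has_bochner_integral (gauss h) (\<lambda>y. - (?e y * ((- c) \<bullet> y))) (- (- h * ((- c) \<bullet> (- c))))"
   unfolding ew by (intro has_bochner_integral_minus gauss_exp_weight(2)[OF h])
  then show ?thesis by (simp add: \<tau>_def)
 qed
 have e3: "has_bochner_integral (gauss h) (\<lambda>y. c \<bullet> y) 0"
  using gauss_linear[OF h, of c] by (simp add: has_bochner_integral_iff)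
 have const: "has_bochner_integral (gauss h) (\<lambda>y :: real ^ 'n. k) k" for k :: real
  using prob_space by (simp add: has_bochner_integral_iff)
 have B: "has_bochner_integral (gauss h) ?B
   (exp (- \<tau>) * exp (h * ((2 *\<^sub>R c) \<bullet> (2 *\<^sub>R c)) / 2) + 1
    + (exp (h * (c \<bullet> c) / 2) + exp (h * ((- c) \<bullet> (- c)) / 2) - 2) - 2 * 1 - 2 * \<tau> + 2 * 0)"
  by (intro has_bochner_integral_add has_bochner_integral_diff has_bochner_integral_mult_right
    has_bochner_integral_gauss_exp[OF h] const e1 e2 e3)
 then have B': "has_bochner_integral (gauss h) ?B (exp \<tau> + 2 * exp (\<tau> / 2) - 3 - 2 * \<tau>)"
  by (simp add: \<tau>_def exp_add[symmetric] algebra_simps)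
 have [measurable]: "(\<lambda>y. (?e y - 1 - c \<bullet> y)\<^sup>2) \<in> borel_measurable (gauss h)" by measurable
 show i: "integrable (gauss h) (\<lambda>y. (?e y - 1 - c \<bullet> y)\<^sup>2)"
 proof (rule Bochner_Integration.integrable_bound[of _ ?B])
  show "integrable (gauss h) ?B" using B' by (simp add: has_bochner_integral_iff)
  show "AE y in gauss h. norm ((?e y - 1 - c \<bullet> y)\<^sup>2) \<le> norm (?B y)"
  proof (rule AE_I2)
   fix y
   have "norm ((?e y - 1 - c \<bullet> y)\<^sup>2) = (?e y - 1 - c \<bullet> y)\<^sup>2" by simp
   also have "\<dots> \<le> ?B y" by (rule pt)
   also have "\<dots> \<le> norm (?B y)" by simp
   finally show "norm ((?e y - 1 - c \<bullet> y)\<^sup>2) \<le> norm (?B y)" .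
  qed
 qed measurable
 have "(\<integral>y. (?e y - 1 - c \<bullet> y)\<^sup>2 \<partial>gauss h) \<le> (\<integral>y. ?B y \<partial>gauss h)"
  using B' by (intro integral_mono i pt) (simp add: has_bochner_integral_iff)
 also have "\<dots> = exp \<tau> + 2 * exp (\<tau> / 2) - 3 - 2 * \<tau>" using B' by (simp add: has_bochner_integral_iff)
 also have "\<dots> = (exp \<tau> - 1 - \<tau>) + 2 * (exp (\<tau> / 2) - 1 - \<tau> / 2)" by simp
 also have "\<dots> \<le> \<tau>\<^sup>2 * exp \<tau> / 2 + 2 * ((\<tau> / 2)\<^sup>2 * exp (\<tau> / 2) / 2)"
  using t0 by (intro add_mono mult_left_mono exp_remainder_le) auto
 also have "(\<tau> / 2)\<^sup>2 * exp (\<tau> / 2) \<le> \<tau>\<^sup>2 / 4 * exp \<tau>"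
  using t0 by (intro mult_mono) (auto simp: power_divide)
 finally have "(\<integral>y. (?e y - 1 - c \<bullet> y)\<^sup>2 \<partial>gauss h) \<le> \<tau>\<^sup>2 * exp \<tau> / 2 + 2 * (\<tau>\<^sup>2 / 4 * exp \<tau> / 2)" by simp
 moreover have "0 \<le> \<tau>\<^sup>2 * exp \<tau>" by simp
 ultimately show "(\<integral>y. (?e y - 1 - c \<bullet> y)\<^sup>2 \<partial>gauss h) \<le> \<tau>\<^sup>2 * exp \<tau>" by linarith
qed

lemma gauss_norm4:
 assumes h: "h > 0"
 shows "integrable (gauss h :: (real ^ 'n) measure) (\<lambda>y. norm y ^ 4)"
  "(\<integral>y. norm y ^ 4 \<partial>(gauss h :: (real ^ 'n) measure)) \<le> 96 * real CARD('n) ^ 2 * h\<^sup>2"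
proof -
 show i: "integrable (gauss h :: (real ^ 'n) measure) (\<lambda>y. norm y ^ 4)"
  by (rule integrableI_nonneg) (auto intro: order_le_less_trans[OF nn_integral_gauss_norm4[OF h]])
 have "ennreal (\<integral>y. norm y ^ 4 \<partial>(gauss h :: (real ^ 'n) measure)) \<le> ennreal (96 * real CARD('n) ^ 2 * h\<^sup>2)"
  using nn_integral_gauss_norm4[OF h] by (subst nn_integral_eq_integral[symmetric]) (auto intro: i)
 then show "(\<integral>y. norm y ^ 4 \<partial>(gauss h :: (real ^ 'n) measure)) \<le> 96 * real CARD('n) ^ 2 * h\<^sup>2"
  by (subst (asm) ennreal_le_iff) auto
qed

lemma gauss_norm2:
 assumes h: "h > 0"
 shows "integrable (gauss h :: (real ^ 'n) measure) (\<lambda>y. norm y ^ 2)"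
  "(\<integral>y. norm y ^ 2 \<partial>(gauss h :: (real ^ 'n) measure)) \<le> h * (1 + 96 * real CARD('n) ^ 2)"
proof -
 interpret prob_space "gauss h :: (real ^ 'n) measure" by (rule prob_space_gauss[OF h])
 have P: "prob UNIV = 1" using prob_space by simp
 \<comment> \<open>Deduces the second moment from the fourth, with the weight \<open>h\<close>
   chosen so that both terms have order \<open>h\<close> after integration.\<close>
 have pt: "norm y ^ 2 \<le> h + norm y ^ 4 / h" for y :: "real ^ 'n"
 proof -
  have "(a / h - 1 / 2)\<^sup>2 * h = a\<^sup>2 / h - a + h / 4" for a
   using h by (simp add: power2_eq_square field_simps)
  from this[of "norm y ^ 2"] have "0 \<le> (norm y ^ 2)\<^sup>2 / h - norm y ^ 2 + h / 4"
   using h by (metis mult_nonneg_nonneg zero_le_power2 less_imp_le)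
  moreover have "(norm y ^ 2)\<^sup>2 = norm y ^ 4" by simp
  ultimately have "0 \<le> norm y ^ 4 / h - norm y ^ 2 + h / 4" by (simp only:)
  then show ?thesis using h by linarith
 qed
 have i: "integrable (gauss h :: (real ^ 'n) measure) (\<lambda>y. h + norm y ^ 4 / h)"
  using gauss_norm4(1)[OF h] by auto
 show i2: "integrable (gauss h :: (real ^ 'n) measure) (\<lambda>y. norm y ^ 2)"
 proof (rule Bochner_Integration.integrable_bound[OF i])
  show "AE y in (gauss h :: (real ^ 'n) measure). norm (norm y ^ 2) \<le> norm (h + norm y ^ 4 / h)"
  proof (rule AE_I2)
   fix y :: "real ^ 'n"
   have "norm (norm y ^ 2) = norm y ^ 2" by simp
   also have "\<dots> \<le> h + norm y ^ 4 / h" by (rule pt)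
   also have "\<dots> \<le> norm (h + norm y ^ 4 / h)" by simp
   finally show "norm (norm y ^ 2) \<le> norm (h + norm y ^ 4 / h)" .
  qed
 qed measurable
 have "(\<integral>y. norm y ^ 2 \<partial>(gauss h :: (real ^ 'n) measure)) \<le> (\<integral>y. h + norm y ^ 4 / h \<partial>(gauss h :: (real ^ 'n) measure))"
  by (intro integral_mono i i2 pt)
 also have "\<dots> = h + (\<integral>y. norm y ^ 4 \<partial>(gauss h :: (real ^ 'n) measure)) / h"
  using gauss_norm4(1)[OF h] P by (subst Bochner_Integration.integral_add) auto
 also have "\<dots> \<le> h + (96 * real CARD('n) ^ 2 * h\<^sup>2) / h"
  using gauss_norm4(2)[OF h] h by (intro add_left_mono divide_right_mono) auto
 also have "\<dots> = h * (1 + 96 * real CARD('n) ^ 2)" using h by (simp add: power2_eq_square field_simps)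
 finally show "(\<integral>y. norm y ^ 2 \<partial>(gauss h :: (real ^ 'n) measure)) \<le> h * (1 + 96 * real CARD('n) ^ 2)" .
qed

lemma sq_add_le: "(a + b)\<^sup>2 \<le> 2 * a\<^sup>2 + 2 * (b::real)\<^sup>2"
proof -
 have "0 \<le> (a - b)\<^sup>2" by simp
 then show ?thesis by (simp add: power2_eq_square algebra_simps)
qed

text \<open>\<open>m\<close> and \<open>e\<close> are two densities over one time step that agree to first order. The cross terms
 with \<open>m - 1\<close> and \<open>m - e\<close> have mean zero, so the error \<open>D\<close> grows only by a factor \<open>1 + O(h)\<close> plus
 a term of order \<open>h powr (3/2)\<close>, which remains small after \<open>1 / h\<close> steps.\<close>

lemma one_step_error:
 fixes B C :: real
 assumes B: "0 \<le> B" and C: "0 \<le> C"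
 shows "\<exists>k\<ge>0. \<forall>h (\<kappa> :: real ^ 'n) m d r. 0 < h \<longrightarrow> h \<le> 1 \<longrightarrow> norm \<kappa> \<le> C \<longrightarrow>
   m \<in> borel_measurable borel \<longrightarrow> (\<exists>b. \<forall>y. \<bar>m y\<bar> \<le> b) \<longrightarrow>
   (\<forall>y. \<bar>m y - 1 - \<kappa> \<bullet> y\<bar> \<le> B * (h + (norm y)\<^sup>2)) \<longrightarrow> (\<integral>y. m y \<partial>gauss h) = 1 \<longrightarrow>
   (\<integral>\<^sup>+y. ennreal ((d * m y + r * (m y - exp (\<kappa> \<bullet> y - h * (\<kappa> \<bullet> \<kappa>) / 2)))\<^sup>2) \<partial>gauss h)
    \<le> ennreal ((1 + k * h) * d\<^sup>2 + k * (h * sqrt h) * r\<^sup>2)"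
proof -
 define K where "K = 1 + 96 * real CARD('n) ^ 2"
 have K: "K \<ge> 1" by (simp add: K_def)
 \<comment> \<open>These bound the mean squares of the two parts of a step: \<open>c1 * h\<close>
   for \<open>p\<close>, the deviation of \<open>m\<close> from 1, and \<open>c2 * h\<^sup>2\<close>
   for \<open>q\<close>, the deviation of \<open>m\<close> from \<open>e\<close>.\<close>
 define c1 where "c1 = 2 * C\<^sup>2 * K + 4 * B\<^sup>2 * K"
 define c2 where "c2 = 8 * B\<^sup>2 * K + 2 * (C ^ 4 * exp (C\<^sup>2))"
 have c: "0 \<le> c1" "0 \<le> c2" using K C by (auto simp: c1_def c2_def)
 show ?thesis
 proof (rule exI[of _ "2 * c1 + 2 * c2"], intro conjI allI impI)
  show "0 \<le> 2 * c1 + 2 * c2" using c by simp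
  fix h :: real and \<kappa> :: "real ^ 'n" and m d r
  assume h: "0 < h" "h \<le> 1" and \<kappa>: "norm \<kappa> \<le> C" and m [measurable]: "m \<in> borel_measurable borel"
   and mb: "\<exists>b. \<forall>y. \<bar>m y\<bar> \<le> b" and rem: "\<forall>y. \<bar>m y - 1 - \<kappa> \<bullet> y\<bar> \<le> B * (h + (norm y)\<^sup>2)"
   and m1: "(\<integral>y. m y \<partial>gauss h) = 1"
  interpret prob_space "gauss h :: (real ^ 'n) measure" by (rule prob_space_gauss[OF h(1)])
  have P: "prob UNIV = 1" using prob_space by simp
  define \<tau> where "\<tau> = h * (\<kappa> \<bullet> \<kappa>)"
  define e where "e y = exp (\<kappa> \<bullet> y - \<tau> / 2)" for y
  define p where "p y = m y - 1" for y
  define q where "q y = m y - e y" for y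
  have [measurable]: "e \<in> borel_measurable borel" "p \<in> borel_measurable borel" "q \<in> borel_measurable borel"
   unfolding e_def p_def q_def by measurable
  have \<kappa>2: "\<kappa> \<bullet> \<kappa> \<le> C\<^sup>2" using \<kappa> by (auto simp: power2_norm_eq_inner[symmetric] intro!: power_mono)
  have \<tau>: "0 \<le> \<tau>" "\<tau> \<le> h * C\<^sup>2" "\<tau> \<le> C\<^sup>2"
  proof -
   show "0 \<le> \<tau>" using h by (simp add: \<tau>_def)
   show "\<tau> \<le> h * C\<^sup>2" unfolding \<tau>_def using \<kappa>2 h by (intro mult_left_mono) auto
   also have "\<dots> \<le> 1 * C\<^sup>2" using h by (intro mult_right_mono) auto
   finally show "\<tau> \<le> C\<^sup>2" by simp
  qed
  have h2: "h\<^sup>2 \<le> h" using h by (simp add: power2_eq_square mult_le_one)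
  define y2 where "y2 y = B * (h + (norm y)\<^sup>2)" for y :: "real ^ 'n"
  have y2: "(y2 y)\<^sup>2 \<le> 2 * B\<^sup>2 * h\<^sup>2 + 2 * B\<^sup>2 * norm y ^ 4" for y
  proof -
   have "(y2 y)\<^sup>2 = B\<^sup>2 * (h + (norm y)\<^sup>2)\<^sup>2" by (simp add: y2_def power_mult_distrib)
   also have "\<dots> \<le> B\<^sup>2 * (2 * h\<^sup>2 + 2 * ((norm y)\<^sup>2)\<^sup>2)" by (intro mult_left_mono sq_add_le) simp
   finally show ?thesis by (simp add: algebra_simps)
  qed
  have rem2: "(m y - 1 - \<kappa> \<bullet> y)\<^sup>2 \<le> (y2 y)\<^sup>2" for y
   using rem B h by (intro abs_le_square_iff[THEN iffD1]) (auto simp: y2_def abs_mult)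
  have int4: "integrable (gauss h :: (real ^ 'n) measure) (\<lambda>y. norm y ^ 4)"
   and int2: "integrable (gauss h :: (real ^ 'n) measure) (\<lambda>y. (norm y)\<^sup>2)"
   using gauss_norm4(1)[OF h(1)] gauss_norm2(1)[OF h(1)] by auto
  have I4: "(\<integral>y. norm y ^ 4 \<partial>(gauss h :: (real ^ 'n) measure)) \<le> (K - 1) * h\<^sup>2"
   using gauss_norm4(2)[OF h(1), where 'n = 'n] by (simp add: K_def)
  have I2: "(\<integral>y. (norm y)\<^sup>2 \<partial>(gauss h :: (real ^ 'n) measure)) \<le> K * h"
   using gauss_norm2(2)[OF h(1), where 'n = 'n] by (simp add: K_def mult.commute)
  have ptp: "(p y)\<^sup>2 \<le> 2 * C\<^sup>2 * (norm y)\<^sup>2 + (4 * B\<^sup>2 * h\<^sup>2 + 4 * B\<^sup>2 * norm y ^ 4)" for y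
  proof -
   have "(p y)\<^sup>2 = (\<kappa> \<bullet> y + (m y - 1 - \<kappa> \<bullet> y))\<^sup>2" by (simp add: p_def)
   also have "\<dots> \<le> 2 * (\<kappa> \<bullet> y)\<^sup>2 + 2 * (m y - 1 - \<kappa> \<bullet> y)\<^sup>2" by (rule sq_add_le)
   also have "(\<kappa> \<bullet> y)\<^sup>2 \<le> C\<^sup>2 * (norm y)\<^sup>2"
   proof -
    have "\<bar>\<kappa> \<bullet> y\<bar> \<le> C * norm y"
     using Cauchy_Schwarz_ineq2[of \<kappa> y] mult_right_mono[OF \<kappa>, of "norm y"] by simp
    then have "\<bar>\<kappa> \<bullet> y\<bar>\<^sup>2 \<le> (C * norm y)\<^sup>2" by (intro power_mono) auto
    then show ?thesis by (simp add: power_mult_distrib)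
   qed
   finally show ?thesis using rem2[of y] y2[of y] by linarith
  qed
  have ip: "integrable (gauss h) (\<lambda>y. (p y)\<^sup>2)" "(\<integral>y. (p y)\<^sup>2 \<partial>gauss h) \<le> c1 * h"
  proof -
   let ?b = "\<lambda>y :: real ^ 'n. 2 * C\<^sup>2 * (norm y)\<^sup>2 + (4 * B\<^sup>2 * h\<^sup>2 + 4 * B\<^sup>2 * norm y ^ 4)"
   have ib: "integrable (gauss h) ?b" using int2 int4 by auto
   show i: "integrable (gauss h) (\<lambda>y. (p y)\<^sup>2)"
   proof (rule Bochner_Integration.integrable_bound[OF ib])
    show "AE y in gauss h. norm ((p y)\<^sup>2) \<le> norm (?b y)"
     using ptp by (intro AE_I2) (auto intro: order_trans[OF _ abs_ge_self])
   qed measurable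
   have "(\<integral>y. (p y)\<^sup>2 \<partial>gauss h) \<le> (\<integral>y. ?b y \<partial>gauss h)" by (intro integral_mono i ib ptp)
   also have "\<dots> = 2 * C\<^sup>2 * (\<integral>y. (norm y)\<^sup>2 \<partial>(gauss h :: (real ^ 'n) measure)) + (4 * B\<^sup>2 * h\<^sup>2 + 4 * B\<^sup>2 * (\<integral>y. norm y ^ 4 \<partial>(gauss h :: (real ^ 'n) measure)))"
    using int2 int4 P by simp
   also have "\<dots> \<le> 2 * C\<^sup>2 * (K * h) + (4 * B\<^sup>2 * h\<^sup>2 + 4 * B\<^sup>2 * ((K - 1) * h\<^sup>2))"
    by (intro add_mono mult_left_mono I2 I4 order_refl) auto
   also have "\<dots> = 2 * C\<^sup>2 * K * h + 4 * B\<^sup>2 * K * h\<^sup>2" by (simp add: algebra_simps)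
   also have "\<dots> \<le> 2 * C\<^sup>2 * K * h + 4 * B\<^sup>2 * K * h"
    using h2 K by (intro add_left_mono mult_left_mono) auto
   finally show "(\<integral>y. (p y)\<^sup>2 \<partial>gauss h) \<le> c1 * h" by (simp add: c1_def algebra_simps)
  qed
  have ptq: "(q y)\<^sup>2 \<le> (4 * B\<^sup>2 * h\<^sup>2 + 4 * B\<^sup>2 * norm y ^ 4) + 2 * (e y - 1 - \<kappa> \<bullet> y)\<^sup>2" for y
  proof -
   have "(q y)\<^sup>2 = ((m y - 1 - \<kappa> \<bullet> y) + (- (e y - 1 - \<kappa> \<bullet> y)))\<^sup>2" by (simp add: q_def)
   also have "\<dots> \<le> 2 * (m y - 1 - \<kappa> \<bullet> y)\<^sup>2 + 2 * (- (e y - 1 - \<kappa> \<bullet> y))\<^sup>2" by (rule sq_add_le)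
   also have "(- (e y - 1 - \<kappa> \<bullet> y))\<^sup>2 = (e y - 1 - \<kappa> \<bullet> y)\<^sup>2" by (rule power2_minus)
   finally show ?thesis using rem2[of y] y2[of y] by linarith
  qed
  note er = integral_gauss_exp_remainder[OF h(1), of \<kappa>, folded \<tau>_def, folded e_def]
  have iq: "integrable (gauss h) (\<lambda>y. (q y)\<^sup>2)" "(\<integral>y. (q y)\<^sup>2 \<partial>gauss h) \<le> c2 * h\<^sup>2"
  proof -
   let ?b = "\<lambda>y :: real ^ 'n. (4 * B\<^sup>2 * h\<^sup>2 + 4 * B\<^sup>2 * norm y ^ 4) + 2 * (e y - 1 - \<kappa> \<bullet> y)\<^sup>2"
   have ib1: "integrable (gauss h) (\<lambda>y :: real ^ 'n. 4 * B\<^sup>2 * h\<^sup>2 + 4 * B\<^sup>2 * norm y ^ 4)" using int4 by auto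
   have ib2: "integrable (gauss h) (\<lambda>y. 2 * (e y - 1 - \<kappa> \<bullet> y)\<^sup>2)" using er(1) by auto
   have ib: "integrable (gauss h) ?b" by (rule Bochner_Integration.integrable_add[OF ib1 ib2])
   show i: "integrable (gauss h) (\<lambda>y. (q y)\<^sup>2)"
   proof (rule Bochner_Integration.integrable_bound[OF ib])
    show "AE y in gauss h. norm ((q y)\<^sup>2) \<le> norm (?b y)"
    proof (rule AE_I2)
     fix y show "norm ((q y)\<^sup>2) \<le> norm (?b y)"
      using ptq[of y] abs_ge_self[of "?b y"] by (simp only: real_norm_def abs_power2)
    qed
   qed measurable
   have "(\<integral>y. (q y)\<^sup>2 \<partial>gauss h) \<le> (\<integral>y. ?b y \<partial>gauss h)" by (intro integral_mono i ib ptq)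
   also have "\<dots> = (\<integral>y. 4 * B\<^sup>2 * h\<^sup>2 + 4 * B\<^sup>2 * norm y ^ 4 \<partial>(gauss h :: (real ^ 'n) measure)) + (\<integral>y. 2 * (e y - 1 - \<kappa> \<bullet> y)\<^sup>2 \<partial>gauss h)"
    by (rule Bochner_Integration.integral_add[OF ib1 ib2])
   also have "\<dots> = (4 * B\<^sup>2 * h\<^sup>2 + 4 * B\<^sup>2 * (\<integral>y. norm y ^ 4 \<partial>(gauss h :: (real ^ 'n) measure))) + 2 * (\<integral>y. (e y - 1 - \<kappa> \<bullet> y)\<^sup>2 \<partial>gauss h)"
    using int4 P by simp
   also have "\<dots> \<le> (4 * B\<^sup>2 * h\<^sup>2 + 4 * B\<^sup>2 * ((K - 1) * h\<^sup>2)) + 2 * (\<tau>\<^sup>2 * exp \<tau>)"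
    by (intro add_mono mult_left_mono I4 er(2) order_refl) auto
   also have "\<dots> \<le> (4 * B\<^sup>2 * h\<^sup>2 + 4 * B\<^sup>2 * ((K - 1) * h\<^sup>2)) + 2 * ((h * C\<^sup>2)\<^sup>2 * exp (C\<^sup>2))"
    using \<tau> by (intro add_left_mono mult_left_mono mult_mono power_mono) auto
   also have "\<dots> = (4 * B\<^sup>2 * K + 2 * (C ^ 4 * exp (C\<^sup>2))) * h\<^sup>2"
    by (simp add: power_mult_distrib algebra_simps)
   also have "\<dots> \<le> c2 * h\<^sup>2"
    unfolding c2_def using K by (intro mult_right_mono add_right_mono) auto
   finally show "(\<integral>y. (q y)\<^sup>2 \<partial>gauss h) \<le> c2 * h\<^sup>2" .
  qed
  obtain b where b: "\<And>y. \<bar>m y\<bar> \<le> b" using mb by blast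
  have im: "integrable (gauss h) m" using b by (intro integrable_const_bound[of _ b]) auto
  have ie: "has_bochner_integral (gauss h) e 1"
  proof -
   have "e = (\<lambda>y. exp (- ((- \<kappa>) \<bullet> y) - h * ((- \<kappa>) \<bullet> (- \<kappa>)) / 2))" by (simp add: e_def \<tau>_def fun_eq_iff)
   then show ?thesis using gauss_exp_weight(1)[OF h(1), of "- \<kappa>"] by simp
  qed
  have p0: "integrable (gauss h) p" "(\<integral>y. p y \<partial>gauss h) = 0"
   unfolding p_def using im m1 P by auto
  have q0: "integrable (gauss h) q" "(\<integral>y. q y \<partial>gauss h) = 0"
   unfolding q_def using im m1 ie by (auto simp: has_bochner_integral_iff)
  \<comment> \<open>The weight in Young's inequality for the mixed term of \<open>p\<close> and
    \<open>q\<close>. The part with \<open>q\<close> has mean square of order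
    \<open>h\<^sup>2\<close> and can afford the factor \<open>1 / sh\<close>; the part with
    \<open>p\<close> keeps order \<open>h\<close>.\<close>
  define sh where "sh = sqrt h"
  have sh: "0 < sh" "sh \<le> 1" "sh * sh = h" using h by (auto simp: sh_def)
  let ?b = "\<lambda>y. d\<^sup>2 + 2 * d * (d * p y + r * q y) + ((1 + sh) * d\<^sup>2 * (p y)\<^sup>2 + (1 + 1 / sh) * r\<^sup>2 * (q y)\<^sup>2)"
  have pt: "(d * m y + r * (m y - e y))\<^sup>2 \<le> ?b y" for y
  proof -
   have "(d * m y + r * (m y - e y))\<^sup>2 = (d + (d * p y + r * q y))\<^sup>2"
    by (simp add: p_def q_def algebra_simps)
   also have "\<dots> = d\<^sup>2 + 2 * d * (d * p y + r * q y) + (d * p y + r * q y)\<^sup>2"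
    by (simp add: power2_eq_square algebra_simps)
   also have "(d * p y + r * q y)\<^sup>2 \<le> (1 + sh) * (d * p y)\<^sup>2 + (1 + 1 / sh) * (r * q y)\<^sup>2"
   proof -
    have "0 \<le> (sh * (d * p y) - r * q y)\<^sup>2 / sh" using sh by simp
    also have "(sh * (d * p y) - r * q y)\<^sup>2 / sh = sh * (d * p y)\<^sup>2 - 2 * (d * p y) * (r * q y) + (r * q y)\<^sup>2 / sh"
     using sh by (simp add: power2_eq_square field_simps)
    finally show ?thesis by (simp add: power2_eq_square algebra_simps)
   qed
   finally show ?thesis by (simp add: power_mult_distrib mult.assoc)
  qed
  have ib: "integrable (gauss h) ?b" using p0(1) q0(1) ip(1) iq(1) by auto
  have "(\<integral>\<^sup>+y. ennreal ((d * m y + r * (m y - exp (\<kappa> \<bullet> y - h * (\<kappa> \<bullet> \<kappa>) / 2)))\<^sup>2) \<partial>gauss h)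
    \<le> (\<integral>\<^sup>+y. ennreal (?b y) \<partial>gauss h)"
   using pt unfolding e_def \<tau>_def by (intro nn_integral_mono ennreal_leI) auto
  also have "\<dots> = ennreal (\<integral>y. ?b y \<partial>gauss h)"
   using pt by (intro nn_integral_eq_integral ib AE_I2) (auto intro: order_trans[OF zero_le_power2])
  also have "(\<integral>y. ?b y \<partial>gauss h) = d\<^sup>2 + ((1 + sh) * d\<^sup>2 * (\<integral>y. (p y)\<^sup>2 \<partial>gauss h) + (1 + 1 / sh) * r\<^sup>2 * (\<integral>y. (q y)\<^sup>2 \<partial>gauss h))"
   using p0 q0 ip(1) iq(1) P by simp
  also have "\<dots> \<le> d\<^sup>2 + ((1 + sh) * d\<^sup>2 * (c1 * h) + (1 + 1 / sh) * r\<^sup>2 * (c2 * h\<^sup>2))"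
   using ip(2) iq(2) sh by (intro add_left_mono add_mono mult_left_mono) auto
  also have "\<dots> \<le> d\<^sup>2 + (2 * d\<^sup>2 * (c1 * h) + 2 * r\<^sup>2 * (c2 * (h * sh)))"
  proof (intro add_left_mono add_mono)
   show "(1 + sh) * d\<^sup>2 * (c1 * h) \<le> 2 * d\<^sup>2 * (c1 * h)" using sh c h by (intro mult_right_mono) auto
   have "(1 + 1 / sh) * h\<^sup>2 \<le> 2 * (h * sh)"
   proof -
    have "(1 + 1 / sh) * h\<^sup>2 = (sh + 1) * (h * sh)"
     using sh by (simp add: power2_eq_square field_simps flip: sh(3))
    also have "\<dots> \<le> 2 * (h * sh)" using sh h by (intro mult_right_mono) auto
    finally show ?thesis .
   qed
   then have "r\<^sup>2 * c2 * ((1 + 1 / sh) * h\<^sup>2) \<le> r\<^sup>2 * c2 * (2 * (h * sh))" using c by (intro mult_left_mono) auto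
   then show "(1 + 1 / sh) * r\<^sup>2 * (c2 * h\<^sup>2) \<le> 2 * r\<^sup>2 * (c2 * (h * sh))" by (simp add: mult_ac)
  qed
  also have "\<dots> \<le> (1 + (2 * c1 + 2 * c2) * h) * d\<^sup>2 + (2 * c1 + 2 * c2) * (h * sqrt h) * r\<^sup>2"
   using c h sh unfolding sh_def by (simp add: algebra_simps)
  finally show "(\<integral>\<^sup>+y. ennreal ((d * m y + r * (m y - exp (\<kappa> \<bullet> y - h * (\<kappa> \<bullet> \<kappa>) / 2)))\<^sup>2) \<partial>gauss h)
    \<le> ennreal ((1 + (2 * c1 + 2 * c2) * h) * d\<^sup>2 + (2 * c1 + 2 * c2) * (h * sqrt h) * r\<^sup>2)"
   by (simp add: ennreal_leI)
 qed
qed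

lemma has_bochner_integral_sum_list:
 assumes "\<And>a. a \<in> set zs \<Longrightarrow> has_bochner_integral M (\<lambda>y. F a y :: real) (G a)"
 shows "has_bochner_integral M (\<lambda>y. \<Sum>a\<leftarrow>zs. F a y) (\<Sum>a\<leftarrow>zs. G a)"
 using assms by (induction zs) (auto intro: has_bochner_integral_zero has_bochner_integral_add)

lemma norm_sum_list_le:
 fixes F :: "'b \<Rightarrow> 'c :: real_normed_vector"
 assumes "\<And>a. a \<in> set zs \<Longrightarrow> norm (F a) \<le> G a"
 shows "norm (\<Sum>a\<leftarrow>zs. F a) \<le> (\<Sum>a\<leftarrow>zs. G a)"
 using assms by (induction zs) (auto intro: order_trans[OF norm_triangle_ineq] add_mono)

lemma Re_expand: "Re (k * z) - Re k - Re (\<i> * k) * s = Re (k * (z - 1 - \<i> * complex_of_real s))"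
 by (simp add: algebra_simps)

lemma cis_remainder: "norm (cis s - 1 - \<i> * complex_of_real s) \<le> s\<^sup>2 / 2"
proof -
 have "cmod (iexp s - (\<Sum>k\<le>1. (\<i> * s) ^ k / fact k)) \<le> \<bar>s\<bar> ^ Suc 1 / fact (Suc 1)"
  by (rule iexp_approx1)
 then show ?thesis by (simp add: cis_conv_exp diff_diff_add power2_eq_square)
qed

section \<open>The martingale of a positive trigonometric function\<close>

locale trig_martingale =
 fixes N :: nat and ys :: "(complex \<times> (nat \<Rightarrow> real ^ 'n)) list" and a0 \<Lambda> :: real
 assumes N: "N > 0" and a0: "a0 > 0" and \<Lambda>: "\<Lambda> \<ge> 0"
  and L_bound: "\<And>c L s. (c, L) \<in> set ys \<Longrightarrow> s < N \<Longrightarrow> norm (L s) \<le> \<Lambda>"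
  and pos: "\<And>b. a0 \<le> (\<Sum>(c, L)\<leftarrow>ys. Re (c * cis (theta N L (inc N b))))"
begin

abbreviation h :: real where "h \<equiv> 1 / real N"

definition Asum :: real where "Asum = (\<Sum>(c, L)\<leftarrow>ys. norm c)"

text \<open>The Gaussian mean of the characters of all increments from \<open>i\<close> on, a
  product of the values in \<open>integral_gauss_cis\<close>.\<close>

definition dec :: "(nat \<Rightarrow> real ^ 'n) \<Rightarrow> nat \<Rightarrow> real" where
 "dec L i = exp (- (h / 2) * (\<Sum>s = i..<N. L s \<bullet> L s))"

text \<open>The conditional expectation, given the first \<open>i\<close> increments, of the
  trigonometric function with coefficients \<open>ys\<close>; at \<open>i = N\<close> the factor
  \<open>dec\<close> is 1.\<close>

definition Mf :: "nat \<Rightarrow> (nat \<Rightarrow> real ^ 'n) \<Rightarrow> real" where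
 "Mf i x = (\<Sum>(c, L)\<leftarrow>ys. Re (c * complex_of_real (dec L i) * cis (theta i L x)))"

text \<open>To leading order, the coefficient of the next increment in the step from
  \<open>Mf i\<close> to \<open>Mf (Suc i)\<close>: the discrete form of the integrand in the
  martingale representation.\<close>

definition al :: "nat \<Rightarrow> (nat \<Rightarrow> real ^ 'n) \<Rightarrow> real ^ 'n" where
 "al i x = (\<Sum>(c, L)\<leftarrow>ys. Re (\<i> * c * complex_of_real (dec L i) * cis (theta i L x)) *\<^sub>R L i)"

text \<open>The logarithmic derivative, that is the drift of the exponential martingale whose
  relative increments agree to first order with those of \<open>Mf\<close>. The division is harmless
  because \<open>Mf\<close> stays above \<open>a0\<close>.\<close>

definition kap :: "(nat \<Rightarrow> real ^ 'n) \<Rightarrow> nat \<Rightarrow> real ^ 'n" where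
 "kap x i = (if i < N then (1 / Mf i x) *\<^sub>R al i x else 0)"

lemma h: "0 < h" "h \<le> 1" using N by auto

lemma sum_coeff_mult: "(\<Sum>(c, L)\<leftarrow>ys. norm c * b) = Asum * b"
 unfolding Asum_def by (induction ys) (auto simp: distrib_right)

lemma dec_bounds: "0 < dec L i" "dec L i \<le> 1"
proof -
 show "0 < dec L i" by (simp add: dec_def)
 have "0 \<le> h / 2 * (\<Sum>s = i..<N. L s \<bullet> L s)" by (intro mult_nonneg_nonneg sum_nonneg) auto
 then show "dec L i \<le> 1" unfolding dec_def by simp
qed

lemma dec_Suc: "i < N \<Longrightarrow> dec L i = dec L (Suc i) * exp (- h * (L i \<bullet> L i) / 2)"
 unfolding dec_def exp_add[symmetric] by (simp add: sum.atLeast_Suc_lessThan algebra_simps)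

lemma theta_Suc: "theta (Suc i) L (x(i := y)) = theta i L x + L i \<bullet> y"
 by (simp add: theta_def)

lemma Asum_nonneg: "0 \<le> Asum"
 unfolding Asum_def by (intro sum_list_nonneg) auto

lemma Mf_mean:
 assumes i: "i < N"
 shows "has_bochner_integral (gauss h) (\<lambda>y. Mf (Suc i) (x(i := y))) (Mf i x)"
 unfolding Mf_def
proof (rule has_bochner_integral_sum_list, clarify)
 fix c and L :: "nat \<Rightarrow> real ^ 'n"
 interpret g: prob_space "gauss h :: (real ^ 'n) measure" by (rule prob_space_gauss[OF h(1)])
 let ?k = "c * complex_of_real (dec L (Suc i)) * cis (theta i L x)"
 have ic: "integrable (gauss h) (\<lambda>y. cis (L i \<bullet> y))"
  by (intro g.integrable_const_bound[of _ 1]) auto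
 have "has_bochner_integral (gauss h) (\<lambda>y. cis (L i \<bullet> y)) (complex_of_real (exp (- h * (L i \<bullet> L i) / 2)))"
  using ic integral_gauss_cis[OF h(1), of "L i"] by (simp add: has_bochner_integral_iff)
 then have "has_bochner_integral (gauss h) (\<lambda>y. Re (?k * cis (L i \<bullet> y))) (Re (?k * complex_of_real (exp (- h * (L i \<bullet> L i) / 2))))"
  by (intro has_bochner_integral_bounded_linear[OF bounded_linear_Re] has_bochner_integral_mult_right)
 moreover have "?k * complex_of_real (exp (- h * (L i \<bullet> L i) / 2)) = c * complex_of_real (dec L i) * cis (theta i L x)"
  unfolding dec_Suc[OF i] by simp
 moreover have "?k * cis (L i \<bullet> y) = c * complex_of_real (dec L (Suc i)) * cis (theta (Suc i) L (x(i := y)))" for y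
  unfolding theta_Suc cis_mult[symmetric] by (simp only: mult.assoc)
 ultimately show "has_bochner_integral (gauss h) (\<lambda>y. Re (c * complex_of_real (dec L (Suc i)) * cis (theta (Suc i) L (x(i := y)))))
   (Re (c * complex_of_real (dec L i) * cis (theta i L x)))" by (simp only:)
qed

lemma Mf_N_lower: "a0 \<le> Mf N x"
proof -
 \<comment> \<open>A step function whose values at grid points are the partial sums of
   \<open>x\<close>. The bound \<open>pos\<close> holds for arbitrary functions on the reals, so
   continuity is not an issue.\<close>
 define b where "b r = (\<Sum>s<nat \<lfloor>r * real N\<rfloor>. x s)" for r :: real
 have bk: "b (real k / real N) = (\<Sum>s<k. x s)" for k
 proof -
  have "real k / real N * real N = real k" using N by simp
  then show ?thesis unfolding b_def by (simp only:) simp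
 qed
 have "inc N b s = x s" if "s < N" for s
  using that bk[of "Suc s"] bk[of s] by (simp add: inc_def add.commute)
 then have "theta N L (inc N b) = theta N L x" for L :: "nat \<Rightarrow> real ^ 'n"
  unfolding theta_def by (intro sum.cong) auto
 moreover have "dec L N = 1" for L by (simp add: dec_def)
 ultimately show ?thesis using pos[of b] by (simp add: Mf_def)
qed

text \<open>Averaging over the next Gaussian increment preserves a lower bound, so the bound
  descends from \<open>i = N\<close>.\<close>

lemma Mf_lower: "i \<le> N \<Longrightarrow> a0 \<le> Mf i x"
proof (induction i arbitrary: x rule: inc_induct)
 case base
 show ?case by (rule Mf_N_lower)
next
 case (step i)
 interpret g: prob_space "gauss h :: (real ^ 'n) measure" by (rule prob_space_gauss[OF h(1)])
 have P: "g.prob UNIV = 1" using g.prob_space by simp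
 have "(\<integral>y. a0 \<partial>(gauss h :: (real ^ 'n) measure)) \<le> (\<integral>y. Mf (Suc i) (x(i := y)) \<partial>gauss h)"
  using Mf_mean[of i x] step by (intro integral_mono) (auto simp: has_bochner_integral_iff)
 then show ?case using Mf_mean[of i x] step P by (simp add: has_bochner_integral_iff)
qed

lemma term_bound: "norm (c * complex_of_real (dec L i) * cis t) \<le> norm c"
 using dec_bounds[of L i] by (simp add: norm_mult mult_left_le)

lemma Mf_upper: "\<bar>Mf i x\<bar> \<le> Asum"
proof -
 have "norm (Mf i x) \<le> Asum"
  unfolding Mf_def Asum_def
 proof (rule norm_sum_list_le, clarify)
  fix c and L :: "nat \<Rightarrow> real ^ 'n"
  show "norm (Re (c * complex_of_real (dec L i) * cis (theta i L x))) \<le> norm c"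
   unfolding real_norm_def by (rule order_trans[OF abs_Re_le_cmod term_bound])
 qed
 then show ?thesis by simp
qed

lemma al_bound: "i < N \<Longrightarrow> norm (al i x) \<le> Asum * \<Lambda>"
proof -
 assume i: "i < N"
 have "norm (al i x) \<le> (\<Sum>(c, L)\<leftarrow>ys. norm c * \<Lambda>)"
  unfolding al_def
 proof (rule norm_sum_list_le, clarify)
  fix c L assume cL: "(c, L) \<in> set ys"
  have "\<bar>Re (\<i> * c * complex_of_real (dec L i) * cis (theta i L x))\<bar> \<le> norm c"
   using order_trans[OF abs_Re_le_cmod term_bound[of "\<i> * c" L i "theta i L x"]] by (simp add: norm_mult)
  then show "norm (Re (\<i> * c * complex_of_real (dec L i) * cis (theta i L x)) *\<^sub>R L i) \<le> norm c * \<Lambda>"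
   unfolding norm_scaleR using L_bound[OF cL i] by (intro mult_mono) auto
 qed
 also have "\<dots> = Asum * \<Lambda>" by (rule sum_coeff_mult)
 finally show ?thesis .
qed

text \<open>The bound for \<open>kap\<close>. It involves only the coefficients, the frequency bound
  and the lower bound, none of which changes when a fixed function is rewritten on a finer
  grid.\<close>

definition Ck :: real where "Ck = Asum * \<Lambda> / a0"

lemma Ck_nonneg: "0 \<le> Ck" using Asum_nonneg \<Lambda> a0 by (simp add: Ck_def)

lemma kap_bound: "norm (kap x i) \<le> Ck"
proof (cases "i < N")
 case True
 have M: "a0 \<le> Mf i x" by (rule Mf_lower) (use True in simp)
 then have "norm (kap x i) = norm (al i x) / Mf i x" using True a0 by (simp add: kap_def)
 also have "\<dots> \<le> Asum * \<Lambda> / a0" using M a0 al_bound[OF True] Asum_nonneg \<Lambda> by (intro frac_le) auto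
 finally show ?thesis by (simp add: Ck_def)
qed (use Ck_nonneg in \<open>simp add: kap_def\<close>)

text \<open>The constant of \<open>Mf_expansion\<close> divided by the lower bound \<open>a0\<close>
  of \<open>Mf\<close>; like \<open>Ck\<close> it is free of \<open>N\<close>.\<close>

definition Bk :: real where "Bk = Asum / a0 * (\<Lambda>\<^sup>2 / 2) * exp (\<Lambda>\<^sup>2 / 2)"

text \<open>In one step a monomial is multiplied by \<open>exp t * cis s\<close> with
  \<open>t = h * (L i \<bullet> L i) / 2\<close> and \<open>s = L i \<bullet> y\<close>. The
  deviation from \<open>1 + \<i> * s\<close> splits into \<open>exp t - 1\<close>, of order
  \<open>h\<close>, and the quadratic remainder of \<open>cis\<close>; the linear parts add up to
  \<open>al\<close>.\<close>

lemma Mf_expansion: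
 assumes i: "i < N"
 shows "\<bar>Mf (Suc i) (x(i := y)) - Mf i x - al i x \<bullet> y\<bar> \<le> Asum * ((\<Lambda>\<^sup>2 / 2) * exp (\<Lambda>\<^sup>2 / 2) * (h + (norm y)\<^sup>2))"
proof -
 let ?b = "(\<Lambda>\<^sup>2 / 2) * exp (\<Lambda>\<^sup>2 / 2) * (h + (norm y)\<^sup>2)"
 let ?F = "\<lambda>(c, L). Re (c * complex_of_real (dec L (Suc i)) * cis (theta (Suc i) L (x(i := y))))
   - Re (c * complex_of_real (dec L i) * cis (theta i L x))
   - (Re (\<i> * c * complex_of_real (dec L i) * cis (theta i L x)) *\<^sub>R L i) \<bullet> y"
 have "Mf (Suc i) (x(i := y)) - Mf i x - al i x \<bullet> y = (\<Sum>a\<leftarrow>ys. ?F a)"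
  unfolding Mf_def al_def by (induction ys) (auto simp: inner_add_left algebra_simps)
 moreover have "norm (\<Sum>a\<leftarrow>ys. ?F a) \<le> (\<Sum>(c, L)\<leftarrow>ys. norm c * ?b)"
 proof (rule norm_sum_list_le)
  fix a assume "a \<in> set ys"
  moreover obtain c L where a: "a = (c, L)" by (cases a)
  ultimately have cL: "(c, L) \<in> set ys" by simp
  let ?t = "h * (L i \<bullet> L i) / 2" and ?s = "L i \<bullet> y"
  let ?k = "c * complex_of_real (dec L i) * cis (theta i L x)"
  have Li: "norm (L i) \<le> \<Lambda>" by (rule L_bound[OF cL i])
  have L2: "L i \<bullet> L i \<le> \<Lambda>\<^sup>2" using Li by (auto simp: power2_norm_eq_inner[symmetric] intro!: power_mono)
  have t: "0 \<le> ?t" "?t \<le> h * (\<Lambda>\<^sup>2 / 2)" "?t \<le> \<Lambda>\<^sup>2 / 2"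
  proof -
   show "0 \<le> ?t" by simp
   show 1: "?t \<le> h * (\<Lambda>\<^sup>2 / 2)"
   proof -
    have "h * (L i \<bullet> L i / 2) \<le> h * (\<Lambda>\<^sup>2 / 2)" using L2 h by (intro mult_left_mono) auto
    then show ?thesis by (simp only: times_divide_eq_right)
   qed
   have "h * (\<Lambda>\<^sup>2 / 2) \<le> 1 * (\<Lambda>\<^sup>2 / 2)" using h by (intro mult_right_mono) auto
   then show "?t \<le> \<Lambda>\<^sup>2 / 2" using 1 by linarith
  qed
  have decS: "dec L (Suc i) = dec L i * exp ?t"
   unfolding dec_Suc[OF i] by (simp add: mult.assoc exp_add[symmetric])
  have "c * complex_of_real (dec L (Suc i)) * cis (theta (Suc i) L (x(i := y))) = ?k * (complex_of_real (exp ?t) * cis ?s)"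
   unfolding theta_Suc cis_mult[symmetric] decS of_real_mult by (simp only: mult_ac)
  then have "?F (c, L) = Re (?k * (complex_of_real (exp ?t) * cis ?s)) - Re ?k - Re (\<i> * ?k) * ?s"
   by (simp only: prod.case inner_scaleR_left mult.assoc)
  also have "\<dots> = Re (?k * (complex_of_real (exp ?t) * cis ?s - 1 - \<i> * complex_of_real ?s))"
   by (rule Re_expand)
  finally have F: "?F (c, L) = Re (?k * (complex_of_real (exp ?t) * cis ?s - 1 - \<i> * complex_of_real ?s))" .
  have "complex_of_real (exp ?t) * cis ?s - 1 - \<i> * complex_of_real ?s
    = complex_of_real (exp ?t - 1) * cis ?s + (cis ?s - 1 - \<i> * complex_of_real ?s)"
   by (simp add: algebra_simps)
  then have "norm (complex_of_real (exp ?t) * cis ?s - 1 - \<i> * complex_of_real ?s)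
    \<le> norm (complex_of_real (exp ?t - 1) * cis ?s) + norm (cis ?s - 1 - \<i> * complex_of_real ?s)"
   by (simp only: norm_triangle_ineq)
  also have "norm (complex_of_real (exp ?t - 1) * cis ?s) = exp ?t - 1"
   using t(1) by (simp add: norm_mult del: of_real_diff)
  also have "exp ?t - 1 + norm (cis ?s - 1 - \<i> * complex_of_real ?s) \<le> ?t * exp ?t + ?s\<^sup>2 / 2"
   by (intro add_mono exp_minus_one_le t cis_remainder)
  also have "\<dots> \<le> h * (\<Lambda>\<^sup>2 / 2) * exp (\<Lambda>\<^sup>2 / 2) + \<Lambda>\<^sup>2 / 2 * exp (\<Lambda>\<^sup>2 / 2) * (norm y)\<^sup>2"
  proof (intro add_mono)
   show "?t * exp ?t \<le> h * (\<Lambda>\<^sup>2 / 2) * exp (\<Lambda>\<^sup>2 / 2)" using t by (intro mult_mono) auto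
   have "\<bar>?s\<bar> \<le> \<Lambda> * norm y"
    using Cauchy_Schwarz_ineq2[of "L i" y] mult_right_mono[OF Li, of "norm y"] by simp
   then have "\<bar>?s\<bar>\<^sup>2 \<le> (\<Lambda> * norm y)\<^sup>2" by (intro power_mono) auto
   then have "?s\<^sup>2 / 2 \<le> \<Lambda>\<^sup>2 / 2 * 1 * (norm y)\<^sup>2" by (simp add: power_mult_distrib)
   also have "\<dots> \<le> \<Lambda>\<^sup>2 / 2 * exp (\<Lambda>\<^sup>2 / 2) * (norm y)\<^sup>2" by (intro mult_right_mono mult_left_mono) auto
   finally show "?s\<^sup>2 / 2 \<le> \<Lambda>\<^sup>2 / 2 * exp (\<Lambda>\<^sup>2 / 2) * (norm y)\<^sup>2" .
  qed
  also have "\<dots> = ?b" by (simp add: algebra_simps)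
  finally have r: "norm (complex_of_real (exp ?t) * cis ?s - 1 - \<i> * complex_of_real ?s) \<le> ?b" .
  have "norm (?F (c, L)) \<le> norm (?k * (complex_of_real (exp ?t) * cis ?s - 1 - \<i> * complex_of_real ?s))"
   unfolding F real_norm_def by (rule abs_Re_le_cmod)
  also have "\<dots> \<le> norm c * ?b"
   unfolding norm_mult[of ?k] by (intro mult_mono term_bound r) auto
  finally have "norm (?F (c, L)) \<le> norm c * ?b" .
  then show "norm (?F a) \<le> (case a of (c, L) \<Rightarrow> norm c * ?b)" by (simp only: a prod.case)
 qed
 ultimately show ?thesis by (simp only: sum_coeff_mult real_norm_def)
qed

lemma Mf_ratio:
 assumes i: "i < N"
 shows "\<bar>Mf (Suc i) (x(i := y)) / Mf i x - 1 - kap x i \<bullet> y\<bar> \<le> Bk * (h + (norm y)\<^sup>2)"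
proof -
 have M: "a0 \<le> Mf i x" by (rule Mf_lower) (use i in simp)
 have "Mf (Suc i) (x(i := y)) / Mf i x - 1 - kap x i \<bullet> y = (Mf (Suc i) (x(i := y)) - Mf i x - al i x \<bullet> y) / Mf i x"
  using M a0 i by (simp add: kap_def field_simps)
 then have "\<bar>Mf (Suc i) (x(i := y)) / Mf i x - 1 - kap x i \<bullet> y\<bar> = \<bar>Mf (Suc i) (x(i := y)) - Mf i x - al i x \<bullet> y\<bar> / Mf i x"
  using M a0 by simp
 also have "\<dots> \<le> Asum * ((\<Lambda>\<^sup>2 / 2) * exp (\<Lambda>\<^sup>2 / 2) * (h + (norm y)\<^sup>2)) / a0"
  using M a0 h Asum_nonneg by (intro frac_le Mf_expansion i mult_nonneg_nonneg add_nonneg_nonneg) auto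
 also have "\<dots> = Bk * (h + (norm y)\<^sup>2)" by (simp add: Bk_def mult_ac)
 finally show ?thesis .
qed

lemma theta_cong: "(\<And>s. s < i \<Longrightarrow> x s = y s) \<Longrightarrow> theta i L x = theta i L y"
 unfolding theta_def by (intro sum.cong) auto

lemma Mf_cong: "(\<And>s. s < i \<Longrightarrow> x s = y s) \<Longrightarrow> Mf i x = Mf i y"
 unfolding Mf_def by (simp only: theta_cong[of i x y])

lemma Mf_measurable: "Mf i \<in> borel_measurable seq_space"
proof -
 have [measurable]: "theta i L \<in> borel_measurable seq_space" for L :: "nat \<Rightarrow> real ^ 'n"
  unfolding theta_def[abs_def]
  by (intro borel_measurable_sum borel_measurable_inner borel_measurable_const seq_component_measurable)
 show ?thesis unfolding Mf_def[abs_def]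
 proof (induction ys)
  case (Cons a zs)
  have "(\<lambda>x. Re (fst a * complex_of_real (dec (snd a) i) * cis (theta i (snd a) x))) \<in> borel_measurable seq_space"
   by measurable
  from borel_measurable_add[OF this Cons] show ?case by (simp add: case_prod_beta')
 qed simp
qed

lemma al_measurable: "al i \<in> borel_measurable seq_space"
proof -
 have [measurable]: "theta i L \<in> borel_measurable seq_space" for L :: "nat \<Rightarrow> real ^ 'n"
  unfolding theta_def[abs_def]
  by (intro borel_measurable_sum borel_measurable_inner borel_measurable_const seq_component_measurable)
 show ?thesis unfolding al_def[abs_def]
 proof (induction ys)
  case (Cons a zs)
  have "(\<lambda>x. Re (\<i> * fst a * complex_of_real (dec (snd a) i) * cis (theta i (snd a) x)) *\<^sub>R snd a i) \<in> borel_measurable seq_space"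
   by measurable
  from borel_measurable_add[OF this Cons] show ?case by (simp add: case_prod_beta')
 qed simp
qed

text \<open>The sign follows the convention of \<open>A\<close>: a drift \<open>\<xi>\<close> gives
  a weight with exponent \<open>- (\<xi> s w \<bullet> D s w)\<close>, whereas the wanted exponent
  is plus \<open>kap\<close> times the increment.\<close>

definition drift :: "(nat \<Rightarrow> real ^ 'n) \<Rightarrow> nat \<Rightarrow> real ^ 'n" where "drift x s = - kap x s"

lemma predictable_drift: "predictable N Ck drift"
 unfolding predictable_def
proof (intro conjI allI impI)
 fix x y :: "nat \<Rightarrow> real ^ 'n" and s assume "\<forall>i<s. x i = y i"
 then have "theta s L x = theta s L y" for L :: "nat \<Rightarrow> real ^ 'n" by (intro theta_cong) auto
 then show "drift x s = drift y s" by (simp add: drift_def kap_def Mf_def al_def)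
next
 fix s
 have [measurable]: "Mf s \<in> borel_measurable seq_space" "al s \<in> borel_measurable seq_space"
  by (rule Mf_measurable al_measurable)+
 show "(\<lambda>x. drift x s) \<in> borel_measurable seq_space"
  unfolding drift_def kap_def by measurable
qed (use N Ck_nonneg kap_bound in \<open>auto simp: drift_def kap_def[of _ "_ :: nat"]\<close>)

end

lemma (in path_brownian) truncated_inc_measurable:
 assumes "i \<le> N"
 shows "(\<lambda>w s. if s < i then inc N (\<beta> w) s else 0) \<in> measurable (FB (real i / real N)) seq_space"
proof (rule measurable_PiM_single')
 fix s :: nat
 show "(\<lambda>w. if s < i then inc N (\<beta> w) s else 0) \<in> borel_measurable (FB (real i / real N))"
 proof (cases "s < i")
  case True
  then have "real (Suc s) / real N \<le> real i / real N" "real s / real N \<le> real i / real N"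
   by (auto intro!: divide_right_mono)
  then have "(\<lambda>w. \<beta> w (real (Suc s) / real N) - \<beta> w (real s / real N)) \<in> borel_measurable (FB (real i / real N))"
   by (intro borel_measurable_diff B_FB) auto
  then show ?thesis using True assms by (simp add: inc_def add.commute)
 qed simp
qed auto

text \<open>The conclusion of \<open>one_step_error\<close> enters as an assumption with a parameter
  \<open>k\<close>, so that one value of \<open>k\<close> can serve for all refinements of the
  grid.\<close>

locale trig_approx = controlled \<nu> \<beta> W + trig_martingale N ys a0 \<Lambda>
 for \<nu> :: "(real \<Rightarrow> real ^ 'n) measure" and \<beta> :: "(real \<Rightarrow> real ^ 'n) \<Rightarrow> real \<Rightarrow> real ^ 'n"
  and W :: "((real \<Rightarrow> real ^ 'n) \<Rightarrow> real \<Rightarrow> real ^ 'n) \<Rightarrow> (real \<Rightarrow> real ^ 'n) \<Rightarrow> real \<Rightarrow> real ^ 'n"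
  and N and ys :: "(complex \<times> (nat \<Rightarrow> real ^ 'n)) list" and a0 \<Lambda> +
 fixes k :: real
 assumes k0: "0 \<le> k" and
  k: "\<And>\<kappa> m d r. norm \<kappa> \<le> Ck \<Longrightarrow>
   m \<in> borel_measurable borel \<Longrightarrow> (\<exists>b. \<forall>y. \<bar>m y\<bar> \<le> b) \<Longrightarrow>
   (\<forall>y. \<bar>m y - 1 - \<kappa> \<bullet> (y :: real ^ 'n)\<bar> \<le> Bk * (h + (norm y)\<^sup>2)) \<Longrightarrow> (\<integral>y. m y \<partial>gauss h) = 1 \<Longrightarrow>
   (\<integral>\<^sup>+y. ennreal ((d * m y + r * (m y - exp (\<kappa> \<bullet> y - h * (\<kappa> \<bullet> \<kappa>) / 2)))\<^sup>2) \<partial>gauss h)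
    \<le> ennreal ((1 + k * h) * d\<^sup>2 + k * (h * sqrt h) * r\<^sup>2)"
begin

sublocale D: grid_drift \<nu> \<beta> N "\<lambda>s w. drift (inc N (\<beta> w)) s" Ck
proof
 fix s assume "s < N"
 then show "(\<lambda>w. drift (inc N (\<beta> w)) s) \<in> borel_measurable (FB (real s / real N))"
  by (rule predictable_FB[OF predictable_drift])
qed (use N Ck_nonneg predictableD(5)[OF predictable_drift] in auto)

abbreviation X :: "(real \<Rightarrow> real ^ 'n) \<Rightarrow> nat \<Rightarrow> real ^ 'n" where "X w \<equiv> inc N (\<beta> w)"

definition M0 :: real where "M0 = Mf 0 (\<lambda>_. 0)"

definition Err :: "nat \<Rightarrow> (real \<Rightarrow> real ^ 'n) \<Rightarrow> real" where
 "Err i w = Mf i (X w) - M0 * exp (- D.A i w)"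

lemma M0: "a0 \<le> M0" "M0 \<le> Asum"
 using Mf_lower[of 0 "\<lambda>_. 0"] Mf_upper[of 0 "\<lambda>_. 0"] by (auto simp: M0_def)

lemma Mf_FB: "i \<le> N \<Longrightarrow> (\<lambda>w. Mf i (X w)) \<in> borel_measurable (FB (real i / real N))"
proof -
 assume i: "i \<le> N"
 have "(\<lambda>w. Mf i (\<lambda>s. if s < i then X w s else 0)) \<in> borel_measurable (FB (real i / real N))"
  by (rule measurable_compose[OF truncated_inc_measurable[OF i] Mf_measurable])
 moreover have "Mf i (\<lambda>s. if s < i then X w s else 0) = Mf i (X w)" for w by (rule Mf_cong) simp
 ultimately show ?thesis by simp
qed

lemma Mf_FB_pair:
 assumes i: "i < N"
 shows "(\<lambda>(w, y). Mf (Suc i) ((X w)(i := y))) \<in> borel_measurable (FB (real i / real N) \<Otimes>\<^sub>M borel)"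
proof -
 let ?Z = "\<lambda>w s. if s < i then X w s else 0"
 have Z: "?Z \<in> measurable (FB (real i / real N)) seq_space"
  by (rule truncated_inc_measurable) (use i in simp)
 have "(\<lambda>p. (?Z (fst p))(i := snd p)) \<in> measurable (FB (real i / real N) \<Otimes>\<^sub>M borel) seq_space"
  by (rule fun_upd_seq_measurable[OF measurable_compose[OF measurable_fst Z] measurable_snd])
 from measurable_compose[OF this Mf_measurable, of "Suc i"]
 have "(\<lambda>p. Mf (Suc i) ((?Z (fst p))(i := snd p))) \<in> borel_measurable (FB (real i / real N) \<Otimes>\<^sub>M borel)" .
 moreover have "Mf (Suc i) ((?Z w)(i := y)) = Mf (Suc i) ((X w)(i := y))" for w y
  by (rule Mf_cong) auto
 ultimately show ?thesis by (simp only: case_prod_beta')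
qed

text \<open>The error added by one step, of order \<open>h * sqrt h\<close>. The factor
  \<open>exp (3 * Ck\<^sup>2)\<close> is the second moment bound from
  \<open>nn_integral_exp_A\<close> with exponent 2, as (4 + 2) / 2 = 3.\<close>

definition q :: real where "q = k * (h * sqrt h) * (M0\<^sup>2 * exp (3 * Ck\<^sup>2))"

lemma q_nonneg: "0 \<le> q" using k0 h by (simp add: q_def)

text \<open>With \<open>m\<close> the relative step of \<open>Mf\<close> and \<open>e\<close> that
  of the exponential martingale, the new error is \<open>Err i w * m + r * (m - e)\<close>, where
  \<open>r\<close> is the scaled Girsanov density. The one-step bound turns this into a linear
  recursion for the mean square.\<close>

lemma nn_Err: "i \<le> N \<Longrightarrow> (\<integral>\<^sup>+w. ennreal ((Err i w)\<^sup>2) \<partial>\<nu>) \<le> ennreal (real i * q * (1 + k * h) ^ i)"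
proof (induction i)
 case 0
 have "Mf 0 (X w) = M0" for w unfolding M0_def by (rule Mf_cong) simp
 then have "Err 0 w = 0" for w by (simp add: Err_def D.A_def)
 then show ?case by simp
next
 case (Suc i)
 then have i: "i < N" by simp
 define m where "m w y = Mf (Suc i) ((X w)(i := y)) / Mf i (X w)" for w y
 define \<kappa> where "\<kappa> w = kap (X w) i" for w
 define e where "e w y = exp (\<kappa> w \<bullet> y - h * (\<kappa> w \<bullet> \<kappa> w) / 2)" for w y
 have Mpos: "0 < Mf i (X w)" for w using Mf_lower[of i "X w"] a0 i by simp
 have [measurable]: "(\<lambda>w. Mf i (X w)) \<in> borel_measurable (FB (real i / real N))" by (rule Mf_FB) (use i in simp)
 have [measurable]: "D.A i \<in> borel_measurable (FB (real i / real N))" by (rule D.A_measurable) (use i in simp)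
 have [measurable]: "\<kappa> \<in> borel_measurable (FB (real i / real N))"
  using borel_measurable_uminus[OF D.\<xi>_measurable[OF i]] by (simp add: \<kappa>_def[abs_def] drift_def)
 have [measurable]: "Err i \<in> borel_measurable (FB (real i / real N))" unfolding Err_def[abs_def] by measurable
 have [measurable]: "(\<lambda>(w, y). Mf (Suc i) ((X w)(i := y))) \<in> borel_measurable (FB (real i / real N) \<Otimes>\<^sub>M borel)"
  by (rule Mf_FB_pair[OF i])
 define q' where "q' = k * (h * sqrt h) * M0\<^sup>2"
 have q0: "0 \<le> q'" using k0 h by (simp add: q'_def)
 let ?r = "\<lambda>w. M0 * exp (- D.A i w)"
 let ?\<phi> = "\<lambda>w y. ennreal ((Err i w * m w y + ?r w * (m w y - e w y))\<^sup>2)"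
 have E: "Err (Suc i) w = Err i w * m w (D.D i w) + ?r w * (m w (D.D i w) - e w (D.D i w))" for w
 proof -
  have "Mf (Suc i) (X w) = Mf i (X w) * m w (D.D i w)"
   using Mpos[of w] by (simp add: m_def D.D_def fun_upd_idem)
  moreover have "exp (- D.A (Suc i) w) = exp (- D.A i w) * e w (D.D i w)"
  proof -
   have dr: "drift (X w) i = - kap (X w) i" by (simp add: drift_def)
   show ?thesis
    unfolding D.A_Suc e_def \<kappa>_def dr exp_add[symmetric] by (simp add: algebra_simps)
  qed
  ultimately show ?thesis unfolding Err_def by (simp add: algebra_simps)
 qed
 have "(\<integral>\<^sup>+w. ennreal ((Err (Suc i) w)\<^sup>2) \<partial>\<nu>) = (\<integral>\<^sup>+w. ?\<phi> w (D.D i w) \<partial>\<nu>)" by (simp only: E)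
 also have "\<dots> = (\<integral>\<^sup>+w. (\<integral>\<^sup>+y. ?\<phi> w y \<partial>gauss h) \<partial>\<nu>)"
  by (rule D.nn_step[OF i]) (unfold m_def e_def, measurable)
 also have "\<dots> \<le> (\<integral>\<^sup>+w. ennreal (1 + k * h) * ennreal ((Err i w)\<^sup>2) + ennreal q' * ennreal (exp (- 2 * D.A i w)) \<partial>\<nu>)"
 proof (rule nn_integral_mono)
  fix w
  have mm: "m w \<in> borel_measurable borel"
  proof -
   have "(\<lambda>y. (X w)(i := y)) \<in> measurable borel seq_space"
    by (rule fun_upd_seq_measurable) (auto simp: space_PiM)
   from measurable_compose[OF this Mf_measurable] show ?thesis
    unfolding m_def[abs_def] by measurable
  qed
  have mb: "\<bar>m w y\<bar> \<le> Asum / a0" for y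
   unfolding m_def abs_divide using Mf_upper Mf_lower[of i "X w"] a0 i Asum_nonneg by (intro frac_le) auto
  have m1: "(\<integral>y. m w y \<partial>gauss h) = 1"
   using Mf_mean[OF i, of "X w"] Mpos[of w] unfolding m_def by (simp add: has_bochner_integral_iff)
  have "(\<integral>\<^sup>+y. ?\<phi> w y \<partial>gauss h) \<le> ennreal ((1 + k * h) * (Err i w)\<^sup>2 + k * (h * sqrt h) * (?r w)\<^sup>2)"
   unfolding e_def
  proof (rule k[OF _ mm _ _ m1])
   show "norm (\<kappa> w) \<le> Ck" unfolding \<kappa>_def by (rule kap_bound)
   show "\<forall>y. \<bar>m w y - 1 - \<kappa> w \<bullet> y\<bar> \<le> Bk * (h + (norm y)\<^sup>2)"
    unfolding m_def \<kappa>_def using Mf_ratio[OF i] by blast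
  qed (use mb in blast)
  also have "\<dots> = ennreal (1 + k * h) * ennreal ((Err i w)\<^sup>2) + ennreal q' * ennreal (exp (- 2 * D.A i w))"
  proof -
   have "(?r w)\<^sup>2 = M0\<^sup>2 * exp (- 2 * D.A i w)" by (simp add: power2_eq_square exp_add[symmetric] algebra_simps)
   then show ?thesis
    using k0 h q0 by (simp add: q'_def ennreal_mult'[symmetric] ennreal_plus[symmetric] mult.assoc del: ennreal_plus)
  qed
  finally show "(\<integral>\<^sup>+y. ?\<phi> w y \<partial>gauss h) \<le> ennreal (1 + k * h) * ennreal ((Err i w)\<^sup>2) + ennreal q' * ennreal (exp (- 2 * D.A i w))" .
 qed
 also have "(\<integral>\<^sup>+w. ennreal (1 + k * h) * ennreal ((Err i w)\<^sup>2) + ennreal q' * ennreal (exp (- 2 * D.A i w)) \<partial>\<nu>)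
   \<le> ennreal ((1 + k * h) * (real i * q * (1 + k * h) ^ i) + q)"
 proof -
  have m1: "Err i \<in> borel_measurable (completion \<nu>)" "D.A i \<in> borel_measurable (completion \<nu>)"
   by (rule measurable_FB_completion[of _ "real i / real N"]; measurable)+
  have "(\<integral>\<^sup>+w. ennreal (1 + k * h) * ennreal ((Err i w)\<^sup>2) + ennreal q' * ennreal (exp (- 2 * D.A i w)) \<partial>\<nu>)
    = (\<integral>\<^sup>+w. ennreal (1 + k * h) * ennreal ((Err i w)\<^sup>2) + ennreal q' * ennreal (exp (- 2 * D.A i w)) \<partial>completion \<nu>)"
   by (rule nn_integral_completion[symmetric])
  also have "\<dots> = ennreal (1 + k * h) * (\<integral>\<^sup>+w. ennreal ((Err i w)\<^sup>2) \<partial>completion \<nu>) + ennreal q' * (\<integral>\<^sup>+w. ennreal (exp (- 2 * D.A i w)) \<partial>completion \<nu>)"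
   using m1 by (simp add: nn_integral_add nn_integral_cmult)
  also have "\<dots> \<le> ennreal (1 + k * h) * ennreal (real i * q * (1 + k * h) ^ i) + ennreal q' * ennreal (exp (3 * Ck\<^sup>2))"
   unfolding nn_integral_completion
  proof (intro add_mono mult_left_mono)
   show "(\<integral>\<^sup>+w. ennreal ((Err i w)\<^sup>2) \<partial>\<nu>) \<le> ennreal (real i * q * (1 + k * h) ^ i)" using Suc by simp
   have "(\<integral>\<^sup>+w. ennreal (exp (- 2 * D.A i w)) \<partial>\<nu>) \<le> ennreal (exp (real i * h * (2\<^sup>2 + \<bar>2\<bar>) * Ck\<^sup>2 / 2))"
    by (rule D.nn_integral_exp_A) (use i in simp)
   also have "\<dots> \<le> ennreal (exp (3 * Ck\<^sup>2))"
   proof (intro ennreal_leI iffD2[OF exp_le_cancel_iff])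
    have "real i * h * (3 * Ck\<^sup>2) \<le> 1 * (3 * Ck\<^sup>2)" using i N by (intro mult_right_mono) auto
    then show "real i * h * (2\<^sup>2 + \<bar>2\<bar>) * Ck\<^sup>2 / 2 \<le> 3 * Ck\<^sup>2" by (simp add: mult_ac)
   qed
   finally show "(\<integral>\<^sup>+w. ennreal (exp (- 2 * D.A i w)) \<partial>\<nu>) \<le> ennreal (exp (3 * Ck\<^sup>2))" .
  qed auto
  also have "\<dots> = ennreal ((1 + k * h) * (real i * q * (1 + k * h) ^ i) + q)"
   using k0 h q_nonneg q0 by (simp add: q'_def ennreal_mult'[symmetric] ennreal_plus[symmetric] q_def mult.assoc del: ennreal_plus)
  finally show ?thesis .
 qed
 finally have "(\<integral>\<^sup>+w. ennreal ((Err (Suc i) w)\<^sup>2) \<partial>\<nu>) \<le> ennreal ((1 + k * h) * (real i * q * (1 + k * h) ^ i) + q)" .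
 also have "\<dots> \<le> ennreal (real (Suc i) * q * (1 + k * h) ^ Suc i)"
 proof (rule ennreal_leI)
  have "1 \<le> (1 + k * h) ^ Suc i" using k0 h by (intro one_le_power) simp
  then have "q * 1 \<le> q * (1 + k * h) ^ Suc i" using q_nonneg by (rule mult_left_mono)
  then show "(1 + k * h) * (real i * q * (1 + k * h) ^ i) + q \<le> real (Suc i) * q * (1 + k * h) ^ Suc i"
   by (simp add: algebra_simps)
 qed
 finally show ?case .
qed

lemma rho_drift: "rho N drift w = exp (- D.A N w)"
 by (simp add: rho_def log_density_def D.A_def D.D_def)

text \<open>Over \<open>N = 1 / h\<close> steps the added errors sum to order \<open>sqrt h\<close>,
  while the growth factor \<open>(1 + k * h) ^ N\<close> stays below \<open>exp k\<close>.\<close>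

lemma approx:
 "(\<integral>\<^sup>+w. ennreal (((\<Sum>(c, L)\<leftarrow>ys. Re (c * cis (theta N L (X w)))) - M0 * rho N drift w)\<^sup>2) \<partial>\<nu>)
   \<le> ennreal (k * exp k * Asum\<^sup>2 * exp (3 * Ck\<^sup>2) * sqrt h)"
proof -
 have "dec L N = 1" for L by (simp add: dec_def)
 then have "(\<Sum>(c, L)\<leftarrow>ys. Re (c * cis (theta N L x))) = Mf N x" for x by (simp add: Mf_def)
 then have "(\<integral>\<^sup>+w. ennreal (((\<Sum>(c, L)\<leftarrow>ys. Re (c * cis (theta N L (X w)))) - M0 * rho N drift w)\<^sup>2) \<partial>\<nu>)
   = (\<integral>\<^sup>+w. ennreal ((Err N w)\<^sup>2) \<partial>\<nu>)" by (simp add: Err_def rho_drift)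
 also have "\<dots> \<le> ennreal (real N * q * (1 + k * h) ^ N)" by (rule nn_Err) simp
 also have "\<dots> \<le> ennreal (k * exp k * Asum\<^sup>2 * exp (3 * Ck\<^sup>2) * sqrt h)"
 proof (rule ennreal_leI)
  have 1: "(1 + k * h) ^ N \<le> exp k"
   using exp_ge_one_plus_x_over_n_power_n[of N k] k0 N by simp
  have "real N * q = k * sqrt h * (M0\<^sup>2 * exp (3 * Ck\<^sup>2))" using N by (simp add: q_def)
  also have "\<dots> \<le> k * sqrt h * (Asum\<^sup>2 * exp (3 * Ck\<^sup>2))"
   using M0 a0 k0 h by (intro mult_left_mono mult_right_mono power_mono) auto
  finally have "real N * q * (1 + k * h) ^ N \<le> k * sqrt h * (Asum\<^sup>2 * exp (3 * Ck\<^sup>2)) * exp k"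
   by (rule mult_mono[OF _ 1]) (use k0 h in auto)
  then show "real N * q * (1 + k * h) ^ N \<le> k * exp k * Asum\<^sup>2 * exp (3 * Ck\<^sup>2) * sqrt h" by (simp add: mult_ac)
 qed
 finally show ?thesis .
qed

end

text \<open>Young's inequality with a small weight on the power of \<open>x\<close>, and with the
  conjugate exponent \<open>q\<close> raised to an integer \<open>r\<close>. Small \<open>y\<close>
  spoil the raised power; they are absorbed by the constant \<open>\<theta>\<close>.\<close>

lemma young_power:
 assumes p: "p > 1" and r: "real r \<ge> p / (p - 1)" and \<theta>: "\<theta> > 0"
 shows "\<exists>C\<ge>0. \<forall>x\<ge>0. \<forall>y\<ge>0. x * y \<le> \<theta> * (1 + x powr p) + C * y ^ r"
proof -
 define q where "q = p / (p - 1)"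
 have q: "q > 1" "q - 1 = 1 / (p - 1)" using p by (auto simp: q_def field_simps)
 \<comment> \<open>If \<open>y > \<theta> * x powr (p - 1)\<close>, then
   \<open>x \<le> (y / \<theta>) powr (q - 1)\<close>, and \<open>x * y\<close> is at most
   \<open>c * y powr q\<close>; otherwise \<open>x * y\<close> is below
   \<open>\<theta> * x powr p\<close>.\<close>
 define c where "c = \<theta> powr (1 - q)"
 have c: "c > 0" using \<theta> by (simp add: c_def)
 \<comment> \<open>The threshold at which \<open>c * y powr q\<close> equals
   \<open>\<theta>\<close>. Above it, \<open>y powr q\<close> is at most
   \<open>y ^ r * y0 powr (q - real r)\<close>, because \<open>q - r\<close> is not
   positive.\<close>
 define y0 where "y0 = (\<theta> / c) powr (1 / q)"
 have y0: "y0 > 0" using \<theta> c by (simp add: y0_def)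
 define C where "C = c * y0 powr (q - real r)"
 have C: "C \<ge> 0" using c by (simp add: C_def)
 have "x * y \<le> \<theta> * (1 + x powr p) + C * y ^ r" if x: "x \<ge> 0" and y: "y \<ge> 0" for x y
 proof (cases "x = 0 \<or> y = 0")
  case True
  then show ?thesis using \<theta> C x y by auto
 next
  case False
  then have x: "x > 0" and y: "y > 0" using x y by auto
  have R: "0 \<le> C * y ^ r" "0 \<le> \<theta> * x powr p" using C y \<theta> by auto
  show ?thesis
  proof (cases "y \<le> \<theta> * x powr (p - 1)")
   case True
   then have "x * y \<le> x * (\<theta> * x powr (p - 1))" using x by (intro mult_left_mono) auto
   also have "\<dots> = \<theta> * x powr p" using x by (simp add: powr_diff)
   finally show ?thesis using R \<theta> by (simp add: distrib_left)
  next
   case False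
   then have "x powr (p - 1) \<le> y / \<theta>" using \<theta> by (simp add: field_simps)
   then have "(x powr (p - 1)) powr (1 / (p - 1)) \<le> (y / \<theta>) powr (1 / (p - 1))"
    using p by (intro powr_mono2) auto
   then have "x \<le> (y / \<theta>) powr (q - 1)" using p x by (simp add: powr_powr q(2))
   then have "x * y \<le> (y / \<theta>) powr (q - 1) * y" using y by (intro mult_right_mono) auto
   also have "\<dots> = c * y powr q"
    using y \<theta> by (simp add: powr_divide c_def powr_diff powr_minus field_simps)
   finally have 1: "x * y \<le> c * y powr q" .
   show ?thesis
   proof (cases "c * y powr q \<le> \<theta>")
    case True
    then show ?thesis using 1 R by (simp add: distrib_left)
   next
    case False
    then have "\<theta> / c \<le> y powr q" using c by (simp add: field_simps)
    then have "(\<theta> / c) powr (1 / q) \<le> (y powr q) powr (1 / q)"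
     using \<theta> c q by (intro powr_mono2) auto
    then have y0y: "y0 \<le> y" using y q by (simp add: y0_def powr_powr)
    have "y powr q = y powr real r * y powr (q - real r)" by (simp add: powr_add[symmetric])
    also have "\<dots> \<le> y powr real r * y0 powr (q - real r)"
     using y0y y0 r by (intro mult_left_mono powr_mono2') (auto simp: q_def)
    also have "y powr real r = y ^ r" using y by (simp add: powr_realpow)
    finally have "c * y powr q \<le> c * (y ^ r * y0 powr (q - real r))" using c by (intro mult_left_mono) auto
    then have "c * y powr q \<le> C * y ^ r" by (simp add: C_def mult_ac)
    moreover have "\<theta> * (1 + x powr p) = \<theta> + \<theta> * x powr p" by (simp only: distrib_left mult_1_right)
    ultimately show ?thesis using 1 R \<theta> by linarith
   qed
  qed
 qed
 then show ?thesis using C by blast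
qed

text \<open>If the left side exceeds \<open>\<theta>\<close>, then \<open>d\<close> itself is at
  least \<open>\<theta>\<close>, and the missing \<open>r - j\<close> factors \<open>d\<close> are
  bought at the price of \<open>1 / \<theta>\<close> each.\<close>

lemma power_interpolate:
 assumes j: "j \<le> r" and \<theta>: "0 < \<theta>" "\<theta> \<le> (1::real)" and d: "0 \<le> d" and "0 < j"
 shows "d ^ j \<le> \<theta> + d ^ r / \<theta> ^ r"
proof (cases "d ^ j \<le> \<theta>")
 case True
 then show ?thesis using d \<theta> by (simp add: add_increasing2)
next
 case False
 have "\<theta> \<le> d"
 proof (rule ccontr)
  assume "\<not> \<theta> \<le> d"
  then have "d ^ j \<le> \<theta> ^ j" using d by (intro power_mono) auto
  also have "\<dots> \<le> \<theta> ^ 1" using \<theta> \<open>0 < j\<close> by (intro power_decreasing) auto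
  finally show False using False by simp
 qed
 have "d ^ j * \<theta> ^ r \<le> d ^ j * \<theta> ^ (r - j)"
  using \<theta> d by (intro mult_left_mono power_decreasing) auto
 also have "\<dots> \<le> d ^ j * d ^ (r - j)" using \<open>\<theta> \<le> d\<close> \<theta> d by (intro mult_left_mono power_mono) auto
 also have "\<dots> = d ^ r" using j by (simp add: power_add[symmetric])
 finally have "d ^ j \<le> d ^ r / \<theta> ^ r" using \<theta> by (simp add: field_simps)
 then show ?thesis using \<theta> by simp
qed

text \<open>The logarithm lies below its tangent at \<open>L\<close>. Written this way, the excess
  over \<open>x * ln L\<close> is linear plus quadratic in \<open>x - L\<close>.\<close>

lemma xlnx_le:
 assumes "0 < x" "0 < (L::real)"
 shows "x * ln x \<le> x * ln L + (x - L) + (x - L)\<^sup>2 / L"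
proof -
 have "ln (x / L) \<le> x / L - 1" using assms by (intro ln_le_minus_one) auto
 then have "ln x \<le> ln L + (x / L - 1)" using assms by (simp add: ln_div)
 then have "x * ln x \<le> x * (ln L + (x / L - 1))" using assms by (intro mult_left_mono) auto
 also have "\<dots> = x * ln L + (x - L) + (x - L)\<^sup>2 / L" using assms by (simp add: power2_eq_square field_simps)
 finally show ?thesis .
qed

section \<open>Approximation of bounded positive functions in L^r\<close>

context controlled
begin

lemma grid_drift_predictable:
 assumes p: "predictable N C \<xi>"
 shows "grid_drift \<nu> \<beta> N (\<lambda>s w. \<xi> (inc N (\<beta> w)) s) C"
proof
 fix s assume "s < N"
 then show "(\<lambda>w. \<xi> (inc N (\<beta> w)) s) \<in> borel_measurable (FB (real s / real N))"
  by (rule predictable_FB[OF p])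
qed (use predictableD(1,2,5)[OF p] in auto)

text \<open>The bound depends on the size \<open>C\<close> of the drift but not on the grid, so that
  moments stay controlled while the grid is refined.\<close>

lemma rho_power:
 assumes p: "predictable N C \<xi>"
 shows "integrable \<nu> (\<lambda>w. rho N \<xi> w ^ j)" "(\<integral>w. rho N \<xi> w ^ j \<partial>\<nu>) \<le> exp (((real j)\<^sup>2 + real j) * C\<^sup>2 / 2)"
proof -
 interpret D: grid_drift \<nu> \<beta> N "\<lambda>s w. \<xi> (inc N (\<beta> w)) s" C by (rule grid_drift_predictable[OF p])
 have N: "N > 0" by (rule predictableD(1)[OF p])
 have [measurable]: "rho N \<xi> \<in> borel_measurable \<nu>" by (rule rho_measurable[OF p])
 have eq: "rho N \<xi> w ^ j = exp (- real j * D.A N w)" for w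
  by (simp add: rho_def log_density_def D.A_def D.D_def exp_of_nat_mult[symmetric])
 have b: "(\<integral>\<^sup>+w. ennreal (rho N \<xi> w ^ j) \<partial>\<nu>) \<le> ennreal (exp (((real j)\<^sup>2 + real j) * C\<^sup>2 / 2))"
  unfolding eq using D.nn_integral_exp_A[of N "real j"] N by simp
 show i: "integrable \<nu> (\<lambda>w. rho N \<xi> w ^ j)"
 proof (rule integrableI_nonneg)
  show "AE w in \<nu>. 0 \<le> rho N \<xi> w ^ j" unfolding rho_def by (intro AE_I2 zero_le_power) simp
  show "(\<integral>\<^sup>+w. ennreal (rho N \<xi> w ^ j) \<partial>\<nu>) < \<infinity>" by (rule order_le_less_trans[OF b]) simp
 qed measurable
 have "ennreal (\<integral>w. rho N \<xi> w ^ j \<partial>\<nu>) \<le> ennreal (exp (((real j)\<^sup>2 + real j) * C\<^sup>2 / 2))"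
  using b i by (subst (asm) nn_integral_eq_integral) (auto simp: rho_def)
 then show "(\<integral>w. rho N \<xi> w ^ j \<partial>\<nu>) \<le> exp (((real j)\<^sup>2 + real j) * C\<^sup>2 / 2)"
  by (subst (asm) ennreal_le_iff) auto
qed

lemma rho_integral:
 assumes p: "predictable N C \<xi>" shows "(\<integral>w. rho N \<xi> w \<partial>\<nu>) = 1"
proof -
 have "ennreal (\<integral>w. rho N \<xi> w \<partial>\<nu>) = (\<integral>\<^sup>+w. ennreal (rho N \<xi> w) \<partial>\<nu>)"
  using rho_power(1)[OF p, of 1] by (intro nn_integral_eq_integral[symmetric]) (auto simp: rho_def)
 then show ?thesis
  unfolding nn_integral_rho[OF p] by (simp add: rho_def)
qed

lemma rho_entropy:
 assumes p: "predictable N C \<xi>"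
 shows "integrable \<nu> (\<lambda>w. rho N \<xi> w * log_density N \<xi> (inc N (\<beta> w)))"
  "integrable \<nu> (\<lambda>w. rho N \<xi> w * half_energy N \<xi> (inc N (\<beta> w)))"
  "(\<integral>w. rho N \<xi> w * log_density N \<xi> (inc N (\<beta> w)) \<partial>\<nu>) = (\<integral>w. rho N \<xi> w * half_energy N \<xi> (inc N (\<beta> w)) \<partial>\<nu>)"
proof -
 interpret D: grid_drift \<nu> \<beta> N "\<lambda>s w. \<xi> (inc N (\<beta> w)) s" C by (rule grid_drift_predictable[OF p])
 have [measurable]: "rho N \<xi> \<in> borel_measurable \<nu>" by (rule rho_measurable[OF p])
 have [measurable]: "(\<lambda>w. log_density N \<xi> (inc N (\<beta> w))) \<in> borel_measurable \<nu>"
  "(\<lambda>w. half_energy N \<xi> (inc N (\<beta> w))) \<in> borel_measurable \<nu>"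
  using measurable_compose[OF inc_beta_measurable log_density_measurable[OF p]]
   measurable_compose[OF inc_beta_measurable half_energy_measurable[OF p]] by auto
 have eA: "log_density N \<xi> (inc N (\<beta> w)) = - D.A N w" "rho N \<xi> w = exp (- D.A N w)"
  and eQ: "half_energy N \<xi> (inc N (\<beta> w)) = D.Q N w" for w
  by (simp_all add: rho_def log_density_def half_energy_def D.A_def D.D_def D.Q_def)
 have m: "(\<lambda>w. rho N \<xi> w * log_density N \<xi> (inc N (\<beta> w))) \<in> borel_measurable \<nu>"
  "(\<lambda>w. rho N \<xi> w * half_energy N \<xi> (inc N (\<beta> w))) \<in> borel_measurable \<nu>" by measurable
 have "integrable (completion \<nu>) (\<lambda>w. rho N \<xi> w * log_density N \<xi> (inc N (\<beta> w)))"
  unfolding eA using D.integrable_exp_A_times_A[of N] by simp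
 then show "integrable \<nu> (\<lambda>w. rho N \<xi> w * log_density N \<xi> (inc N (\<beta> w)))"
  by (subst (asm) integrable_completion[OF m(1)])
 have "integrable (completion \<nu>) (\<lambda>w. rho N \<xi> w * half_energy N \<xi> (inc N (\<beta> w)))"
  unfolding eA eQ using D.integrable_Q(2)[of N] by simp
 then show "integrable \<nu> (\<lambda>w. rho N \<xi> w * half_energy N \<xi> (inc N (\<beta> w)))"
  by (subst (asm) integrable_completion[OF m(2)])
 have "(\<integral>w. rho N \<xi> w * log_density N \<xi> (inc N (\<beta> w)) \<partial>completion \<nu>)
   = (\<integral>w. rho N \<xi> w * half_energy N \<xi> (inc N (\<beta> w)) \<partial>completion \<nu>)"
  unfolding eA eQ using D.entropy_A[of N] by simp
 then show "(\<integral>w. rho N \<xi> w * log_density N \<xi> (inc N (\<beta> w)) \<partial>\<nu>)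
   = (\<integral>w. rho N \<xi> w * half_energy N \<xi> (inc N (\<beta> w)) \<partial>\<nu>)"
  by (simp only: integral_completion[OF m(1)] integral_completion[OF m(2)])
qed

text \<open>Refining the grid of \<open>G\<close> leaves its coefficients, and hence all constants
  of the martingale, unchanged; only the step shrinks. Therefore \<open>C\<close> and
  \<open>A\<close> come before \<open>\<eta>\<close>, and the moment bounds used in
  \<open>approx_density\<close> are uniform in \<open>\<eta>\<close>.\<close>

lemma approx_trig_density:
 assumes G: "G \<in> trig" and a0: "a0 > 0" and low: "\<And>b. a0 \<le> G b"
 shows "\<exists>C A. \<forall>\<eta>>0. \<exists>N \<xi> M0. predictable N C \<xi> \<and> a0 \<le> M0 \<and> M0 \<le> A \<and>
  (\<integral>\<^sup>+w. ennreal ((G (\<beta> w) - M0 * rho N \<xi> w)\<^sup>2) \<partial>\<nu>) \<le> ennreal \<eta>"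
proof -
 obtain K xs where K: "K > 0"
  and rep: "\<forall>b. G b = (\<Sum>(c, l)\<leftarrow>xs. Re (c * cis (theta K l (inc K b))))"
  using trig_rep[OF G] by (elim exE conjE)
 define \<Lambda> where "\<Lambda> = (\<Sum>(c, l)\<leftarrow>xs. \<Sum>s<K. norm (l s))"
 have \<Lambda>0: "0 \<le> \<Lambda>" unfolding \<Lambda>_def by (intro sum_list_nonneg) (auto intro!: sum_nonneg)
 have \<Lambda>: "norm (l s) \<le> \<Lambda>" if "(c, l) \<in> set xs" "s < K" for c l s
 proof -
  have "norm (l s) \<le> (\<Sum>s<K. norm (l s))" using that(2) by (intro member_le_sum) auto
  also have "\<dots> \<le> \<Lambda>"
   unfolding \<Lambda>_def using that(1)
  proof (induction xs)
   case (Cons a xs)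
   have "0 \<le> (\<Sum>(c, l)\<leftarrow>xs. \<Sum>s<K. norm (l s))" by (intro sum_list_nonneg) (auto intro!: sum_nonneg)
   moreover have "0 \<le> (case a of (c, l) \<Rightarrow> \<Sum>s<K. norm (l s))" by (auto split: prod.split intro!: sum_nonneg)
   ultimately show ?case using Cons by auto
  qed simp
  finally show ?thesis .
 qed
 define As where "As = (\<Sum>(c, l)\<leftarrow>xs. norm c)"
 have As0: "0 \<le> As" unfolding As_def by (intro sum_list_nonneg) auto
 define Ck where "Ck = As * \<Lambda> / a0"
 define Bk where "Bk = As / a0 * (\<Lambda>\<^sup>2 / 2) * exp (\<Lambda>\<^sup>2 / 2)"
 have Ck0: "0 \<le> Ck" "0 \<le> Bk" using As0 \<Lambda>0 a0 by (auto simp: Ck_def Bk_def)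
 obtain k where k0: "k \<ge> 0" and k: "\<forall>h (\<kappa> :: real ^ 'n) m d r. 0 < h \<longrightarrow> h \<le> 1 \<longrightarrow> norm \<kappa> \<le> Ck \<longrightarrow>
   m \<in> borel_measurable borel \<longrightarrow> (\<exists>b. \<forall>y. \<bar>m y\<bar> \<le> b) \<longrightarrow>
   (\<forall>y. \<bar>m y - 1 - \<kappa> \<bullet> y\<bar> \<le> Bk * (h + (norm y)\<^sup>2)) \<longrightarrow> (\<integral>y. m y \<partial>gauss h) = 1 \<longrightarrow>
   (\<integral>\<^sup>+y. ennreal ((d * m y + r * (m y - exp (\<kappa> \<bullet> y - h * (\<kappa> \<bullet> \<kappa>) / 2)))\<^sup>2) \<partial>gauss h)
    \<le> ennreal ((1 + k * h) * d\<^sup>2 + k * (h * sqrt h) * r\<^sup>2)"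
  using one_step_error[OF Ck0(2) Ck0(1)] by blast
 have "\<exists>N \<xi> M0. predictable N Ck \<xi> \<and> a0 \<le> M0 \<and> M0 \<le> As \<and>
  (\<integral>\<^sup>+w. ennreal ((G (\<beta> w) - M0 * rho N \<xi> w)\<^sup>2) \<partial>\<nu>) \<le> ennreal \<eta>" if \<eta>: "\<eta> > 0" for \<eta>
 proof -
  \<comment> \<open>The constant in front of \<open>sqrt h\<close> in the mean square error; the
    refinement factor \<open>m\<close> is taken above \<open>(Z / \<eta>)\<^sup>2\<close> so that
    \<open>Z / sqrt m\<close> is below \<open>\<eta>\<close>.\<close>
  define Z where "Z = k * exp k * As\<^sup>2 * exp (3 * Ck\<^sup>2)"
  have Z: "0 \<le> Z" using k0 by (simp add: Z_def)
  obtain m :: nat where m: "real m > (Z / \<eta>)\<^sup>2" using reals_Archimedean2 by blast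
  then have m0: "m > 0" using zero_le_power2[of "Z / \<eta>"] by (metis of_nat_0_less_iff order_le_less_trans)
  define ys where "ys = map (\<lambda>(c, l). (c, \<lambda>s. l (s div m))) xs"
  define N where "N = K * m"
  have N: "N > 0" using K m0 by (simp add: N_def)
  have repN: "(\<Sum>(c, L)\<leftarrow>ys. Re (c * cis (theta N L (inc N b)))) = G b" for b
   unfolding ys_def N_def rep[rule_format]
   by (simp add: o_def case_prod_beta' theta_refine[OF K m0])
  interpret T0: trig_martingale N ys a0 \<Lambda>
  proof
   fix c and L :: "nat \<Rightarrow> real ^ 'n" and s assume "(c, L) \<in> set ys" "s < N"
   then show "norm (L s) \<le> \<Lambda>"
    using \<Lambda> by (auto simp: ys_def N_def less_mult_imp_div_less)
  qed (use N a0 \<Lambda>0 repN low in auto)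
  have TA: "T0.Asum = As"
  proof -
   have "T0.Asum = (\<Sum>(c, L)\<leftarrow>ys. norm c)" by (rule T0.Asum_def)
   also have "\<dots> = As" unfolding ys_def As_def by (simp add: o_def case_prod_beta')
   finally show ?thesis .
  qed
  have TC: "T0.Ck = Ck" "T0.Bk = Bk"
   unfolding T0.Ck_def T0.Bk_def Ck_def Bk_def TA by simp_all
  interpret T: trig_approx \<nu> \<beta> W N ys a0 \<Lambda> k
  proof (unfold_locales, rule k0)
   fix \<kappa> :: "real ^ 'n" and m d r
   assume a: "norm \<kappa> \<le> T0.Ck" "m \<in> borel_measurable borel" "\<exists>b. \<forall>y. \<bar>m y\<bar> \<le> b"
    "\<forall>y. \<bar>m y - 1 - \<kappa> \<bullet> y\<bar> \<le> T0.Bk * (T0.h + (norm y)\<^sup>2)" "(\<integral>y. m y \<partial>gauss T0.h) = 1"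
   show "(\<integral>\<^sup>+y. ennreal ((d * m y + r * (m y - exp (\<kappa> \<bullet> y - T0.h * (\<kappa> \<bullet> \<kappa>) / 2)))\<^sup>2) \<partial>gauss T0.h)
    \<le> ennreal ((1 + k * T0.h) * d\<^sup>2 + k * (T0.h * sqrt T0.h) * r\<^sup>2)"
    by (rule k[THEN spec, THEN spec, THEN spec, THEN spec, THEN spec, THEN mp, OF T0.h(1), THEN mp, OF T0.h(2),
     THEN mp, OF a(1)[unfolded TC], THEN mp, OF a(2), THEN mp, OF a(3), THEN mp, OF a(4)[unfolded TC], THEN mp, OF a(5)])
  qed
  have "(\<integral>\<^sup>+w. ennreal ((G (\<beta> w) - T.M0 * rho N T0.drift w)\<^sup>2) \<partial>\<nu>) \<le> ennreal (Z * sqrt (1 / real N))"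
   using T.approx unfolding repN TA TC Z_def .
  also have "\<dots> \<le> ennreal \<eta>"
  proof (rule ennreal_leI)
   have "real m \<le> real N" using K by (intro of_nat_mono) (simp add: N_def)
   then have "sqrt (1 / real N) \<le> sqrt (1 / real m)" using m0 by (intro real_sqrt_le_mono divide_left_mono) auto
   then have "Z * sqrt (1 / real N) \<le> Z * sqrt (1 / real m)" using Z by (rule mult_left_mono)
   also have "\<dots> \<le> \<eta>"
   proof -
    have "Z / \<eta> \<le> sqrt (real m)" using m by (intro real_le_rsqrt) simp
    then show ?thesis using m0 \<eta> by (simp add: real_sqrt_divide field_simps)
   qed
   finally show "Z * sqrt (1 / real N) \<le> \<eta>" .
  qed
  finally have "(\<integral>\<^sup>+w. ennreal ((G (\<beta> w) - T.M0 * rho N T0.drift w)\<^sup>2) \<partial>\<nu>) \<le> ennreal \<eta>" .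
  moreover have "predictable N Ck T0.drift" using T0.predictable_drift unfolding TC .
  moreover have "a0 \<le> T.M0" "T.M0 \<le> As" using T.M0 unfolding TA .
  ultimately show ?thesis by blast
 qed
 then show ?thesis by blast
qed

text \<open>Two approximations are chained: \<open>L\<close> by a positive function of
  \<open>trig\<close>, then that function by a scaled Girsanov density in L^2. The second is lifted
  to L^r by interpolation with the uniformly bounded moment of order \<open>2 * r\<close>.\<close>

lemma approx_density:
 assumes L: "L \<in> borel_measurable \<nu>" and a: "0 < a" and ab: "\<And>w. w \<in> space \<nu> \<Longrightarrow> a \<le> L w \<and> L w \<le> b"
  and r: "2 \<le> r" and \<eta>: "\<eta> > 0"
 shows "\<exists>N C \<xi> M0. predictable N C \<xi> \<and> M0 > 0 \<and> integrable \<nu> (\<lambda>w. \<bar>M0 * rho N \<xi> w - L w\<bar> ^ r) \<and>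
  (\<integral>w. \<bar>M0 * rho N \<xi> w - L w\<bar> ^ r \<partial>\<nu>) \<le> \<eta>"
proof -
 obtain w0 where "w0 \<in> space \<nu>" using not_empty by (meson all_not_in_conv)
 then have b: "0 < b" using ab[of w0] a by linarith
 define B where "B = sqrt b"
 have B: "0 < B" using b by (simp add: B_def)
 \<comment> \<open>The square root is approximated instead of \<open>L\<close>, since
   \<open>a / 2\<close> plus a square of a trigonometric function is bounded below everywhere, and
   \<open>trig\<close> is closed under squares. Factoring a difference of squares is why the error
   of \<open>q\<close> is measured with exponent \<open>2 * r\<close>.\<close>
 define q where "q w = sqrt (L w - a / 2)" for w
 have qm [measurable]: "q \<in> borel_measurable \<nu>" unfolding q_def using L by measurable
 have qb: "0 \<le> q w" "q w \<le> B" "(q w)\<^sup>2 = L w - a / 2" if "w \<in> space \<nu>" for w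
  using ab[OF that] a by (auto simp: q_def B_def)
 define e1 where "e1 = \<eta> / (2 * 2 ^ r)"
 have e1: "e1 > 0" using \<eta> by (simp add: e1_def)
 define D where "D = 2 ^ r * ((2 * B) ^ r + 1)"
 have D: "D > 0" "2 ^ r * (2 * B) ^ r \<le> D" "2 ^ r \<le> D"
  using B by (auto simp: D_def distrib_left add_nonneg_pos)
 \<comment> \<open>\<open>D\<close> dominates both constants of the estimate for
   \<open>G - L\<close>, and \<open>\<epsilon>\<close> and \<open>\<epsilon> / \<theta>\<close> are
   at most \<open>\<theta>\<close>; the total is then \<open>3 * D * \<theta> = e1\<close>.\<close>
 define \<theta> where "\<theta> = e1 / (3 * D)"
 have \<theta>: "\<theta> > 0" using e1 D by (simp add: \<theta>_def)
 define \<epsilon> where "\<epsilon> = min \<theta> (\<theta> * \<theta>)"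
 have \<epsilon>: "\<epsilon> > 0" "\<epsilon> \<le> \<theta>" "\<epsilon> / \<theta> \<le> \<theta>" using \<theta> by (auto simp: \<epsilon>_def field_simps min_def)
 have qb': "\<bar>q w\<bar> \<le> B" if "w \<in> space \<nu>" for w using qb[OF that] by simp
 have ac: "absolutely_continuous \<nu> \<nu>" by (simp add: absolutely_continuous_def)
 have "\<exists>P\<in>trig. (\<integral>w. \<bar>q w - P (\<beta> w)\<bar> ^ (2 * r) \<partial>\<nu>) < \<epsilon> \<and> (\<integral>w. \<bar>q w - P (\<beta> w)\<bar> ^ (2 * r) \<partial>\<nu>) < \<epsilon>"
  by (rule trig_dense[OF finite_measure_axioms refl ac finite_measure_axioms refl ac qm qb' _ \<epsilon>(1)]) (use r in simp_all)
 then obtain P where P: "P \<in> trig" "(\<integral>w. \<bar>q w - P (\<beta> w)\<bar> ^ (2 * r) \<partial>\<nu>) < \<epsilon>"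
  by (elim bexE conjE)
 define G where "G b = a / 2 + P b * P b" for b
 have G: "G \<in> trig" unfolding G_def[abs_def] by (rule trig.add[OF trig_const trig_mult[OF P(1) P(1)]])
 have Gl: "a / 2 \<le> G b" for b by (simp add: G_def)
 obtain CP where CP: "\<And>b. \<bar>P b\<bar> \<le> CP" using trig_bounded[OF P(1)] by blast
 obtain CG where CG: "0 \<le> CG" "\<And>b. \<bar>G b\<bar> \<le> CG" using trig_bounded[OF G] by blast
 have [measurable]: "(\<lambda>w. P (\<beta> w)) \<in> borel_measurable \<nu>" "(\<lambda>w. G (\<beta> w)) \<in> borel_measurable \<nu>"
  by (rule trig_beta_measurable[OF P(1)], rule trig_beta_measurable[OF G])
 let ?d = "\<lambda>w. \<bar>q w - P (\<beta> w)\<bar>"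
 have db: "?d w \<le> B + CP" if "w \<in> space \<nu>" for w
  using qb'[OF that] CP[of "\<beta> w"] by linarith
 have intd: "integrable \<nu> (\<lambda>w. ?d w ^ j)" for j
  using db by (intro integrable_const_bound[of _ "(B + CP) ^ j"] AE_I2) (auto simp: power_abs intro!: power_mono)
 have GL: "\<bar>G (\<beta> w) - L w\<bar> ^ r \<le> 2 ^ r * ?d w ^ (2 * r) + 2 ^ r * (2 * B) ^ r * (\<theta> + ?d w ^ (2 * r) / \<theta>)"
  if w: "w \<in> space \<nu>" for w
 proof -
  have "G (\<beta> w) - L w = (P (\<beta> w) - q w) * (P (\<beta> w) + q w)"
   using qb(3)[OF w] by (simp add: G_def power2_eq_square algebra_simps)
  then have "\<bar>G (\<beta> w) - L w\<bar> = ?d w * \<bar>P (\<beta> w) + q w\<bar>"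
   by (simp add: abs_mult abs_minus_commute)
  also have "\<dots> \<le> ?d w * (?d w + 2 * B)" using qb[OF w] by (intro mult_left_mono) auto
  finally have "\<bar>G (\<beta> w) - L w\<bar> ^ r \<le> (?d w * ?d w + 2 * B * ?d w) ^ r"
   by (intro power_mono) (auto simp: algebra_simps)
  also have "\<dots> = \<bar>?d w * ?d w + 2 * B * ?d w\<bar> ^ r" using B by simp
  also have "\<dots> \<le> 2 ^ r * (\<bar>?d w * ?d w\<bar> ^ r + \<bar>2 * B * ?d w\<bar> ^ r)" by (rule abs_add_power_le)
  also have "\<dots> = 2 ^ r * ?d w ^ (2 * r) + 2 ^ r * (2 * B) ^ r * ?d w ^ r"
  proof -
   have "\<bar>?d w * ?d w\<bar> ^ r = ?d w ^ (2 * r)" by (simp only: power_mult power2_eq_square abs_mult abs_idempotent)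
   moreover have "\<bar>2 * B * ?d w\<bar> ^ r = (2 * B) ^ r * ?d w ^ r"
    using B by (simp only: power_mult_distrib[symmetric] abs_mult abs_idempotent abs_numeral abs_of_pos)
   ultimately show ?thesis by (simp only: distrib_left mult.assoc)
  qed
  also have "?d w ^ r \<le> \<theta> + ?d w ^ (2 * r) / \<theta>"
  proof (cases "?d w ^ r \<le> \<theta>")
   case True
   then show ?thesis using \<theta> by (simp add: add_increasing2)
  next
   case False
   then have "?d w ^ r * \<theta> \<le> ?d w ^ r * ?d w ^ r" by (intro mult_left_mono) auto
   also have "\<dots> = ?d w ^ (2 * r)" by (simp only: power_add[symmetric] mult_2)
   finally show ?thesis using \<theta> by (simp add: field_simps add_increasing)
  qed
  finally show ?thesis using B by simp
 qed
 have intGL: "integrable \<nu> (\<lambda>w. \<bar>G (\<beta> w) - L w\<bar> ^ r)"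
 proof (rule integrable_const_bound[of _ "(CG + b) ^ r"])
  show "AE w in \<nu>. norm (\<bar>G (\<beta> w) - L w\<bar> ^ r) \<le> (CG + b) ^ r"
  proof (rule AE_I2)
   fix w assume w: "w \<in> space \<nu>"
   have "\<bar>G (\<beta> w) - L w\<bar> \<le> CG + b" using CG(2)[of "\<beta> w"] ab[OF w] a by linarith
   then show "norm (\<bar>G (\<beta> w) - L w\<bar> ^ r) \<le> (CG + b) ^ r" by (simp add: power_abs power_mono)
  qed
 qed (use L in measurable)
 have IGL: "(\<integral>w. \<bar>G (\<beta> w) - L w\<bar> ^ r \<partial>\<nu>) \<le> e1"
 proof -
  have "(\<integral>w. \<bar>G (\<beta> w) - L w\<bar> ^ r \<partial>\<nu>)
    \<le> (\<integral>w. 2 ^ r * ?d w ^ (2 * r) + 2 ^ r * (2 * B) ^ r * (\<theta> + ?d w ^ (2 * r) / \<theta>) \<partial>\<nu>)"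
   using intd by (intro integral_mono intGL GL) auto
  also have "\<dots> = 2 ^ r * (\<integral>w. ?d w ^ (2 * r) \<partial>\<nu>) + 2 ^ r * (2 * B) ^ r * (\<theta> + (\<integral>w. ?d w ^ (2 * r) \<partial>\<nu>) / \<theta>)"
   using intd[of "2 * r"] prob_space by simp
  also have "\<dots> \<le> 2 ^ r * \<epsilon> + 2 ^ r * (2 * B) ^ r * (\<theta> + \<epsilon> / \<theta>)"
   using P(2) B \<theta> by (intro add_mono mult_left_mono divide_right_mono) auto
  also have "\<dots> \<le> D * \<theta> + D * (\<theta> + \<theta>)"
   using D \<epsilon> \<theta> B by (intro add_mono mult_mono) auto
  also have "\<dots> = e1" using D by (simp add: \<theta>_def field_simps)
  finally show ?thesis .
 qed
 have a2: "0 < a / 2" using a by simp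
 obtain C A where
  CA: "\<forall>\<eta>>0. \<exists>N \<xi> M0. predictable N C \<xi> \<and> a / 2 \<le> M0 \<and> M0 \<le> A \<and>
  (\<integral>\<^sup>+w. ennreal ((G (\<beta> w) - M0 * rho N \<xi> w)\<^sup>2) \<partial>\<nu>) \<le> ennreal \<eta>"
  using approx_trig_density[OF G a2 Gl] by (elim exE)
 \<comment> \<open>Bounds the moment of order \<open>2 * r\<close> of the error \<open>?E\<close>,
   from the bound of \<open>G\<close> and the moments of the Girsanov density.\<close>
 define B4 where "B4 = 2 ^ (2 * r) * (CG ^ (2 * r) + \<bar>A\<bar> ^ (2 * r) * exp (((real (2 * r))\<^sup>2 + real (2 * r)) * C\<^sup>2 / 2))"
 have B4: "0 \<le> B4" using CG by (simp add: B4_def)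
 \<comment> \<open>The truncation level of the interpolation: above \<open>Kc\<close> the moment of
   order \<open>2 * r\<close> contributes at most \<open>B4 / Kc \<le> e1 / 2\<close>, and below it
   \<open>\<bar>?E w\<bar> ^ r\<close> is at most \<open>Kc ^ (r - 2)\<close> times the square,
   which fixes \<open>e2\<close>.\<close>
 define Kc where "Kc = 1 + 2 * B4 / e1"
 have Kc: "1 \<le> Kc" using B4 e1 by (simp add: Kc_def)
 define e2 where "e2 = e1 / (2 * Kc ^ (r - 2))"
 have e2: "e2 > 0" using e1 Kc by (simp add: e2_def)
 obtain N \<xi> M0 where p: "predictable N C \<xi>" and M0: "a / 2 \<le> M0" "M0 \<le> A"
  and E2: "(\<integral>\<^sup>+w. ennreal ((G (\<beta> w) - M0 * rho N \<xi> w)\<^sup>2) \<partial>\<nu>) \<le> ennreal e2"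
  using CA[rule_format, OF e2] by (elim exE conjE)
 have M0p: "0 < M0" using M0 a by linarith
 have [measurable]: "rho N \<xi> \<in> borel_measurable \<nu>" by (rule rho_measurable[OF p])
 let ?E = "\<lambda>w. G (\<beta> w) - M0 * rho N \<xi> w"
 have rp: "0 < rho N \<xi> w" for w by (simp add: rho_def)
 have Ej: "\<bar>?E w\<bar> ^ j \<le> 2 ^ j * (CG ^ j + \<bar>A\<bar> ^ j * rho N \<xi> w ^ j)" for w j
 proof -
  have "\<bar>?E w\<bar> ^ j = \<bar>G (\<beta> w) + (- (M0 * rho N \<xi> w))\<bar> ^ j" by simp
  also have "\<dots> \<le> 2 ^ j * (\<bar>G (\<beta> w)\<bar> ^ j + \<bar>- (M0 * rho N \<xi> w)\<bar> ^ j)" by (rule abs_add_power_le)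
  also have "\<bar>- (M0 * rho N \<xi> w)\<bar> ^ j = M0 ^ j * rho N \<xi> w ^ j"
   using M0p rp[of w] by (simp add: abs_mult power_mult_distrib)
  also have "2 ^ j * (\<bar>G (\<beta> w)\<bar> ^ j + M0 ^ j * rho N \<xi> w ^ j) \<le> 2 ^ j * (CG ^ j + \<bar>A\<bar> ^ j * rho N \<xi> w ^ j)"
   using CG M0 M0p rp[of w] by (intro mult_left_mono add_mono mult_right_mono power_mono) auto
  finally show ?thesis .
 qed
 have intEb: "integrable \<nu> (\<lambda>w. 2 ^ j * (CG ^ j + \<bar>A\<bar> ^ j * rho N \<xi> w ^ j))" for j
  using rho_power(1)[OF p, of j] by auto
 have intE: "integrable \<nu> (\<lambda>w. \<bar>?E w\<bar> ^ j)" for j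
 proof (rule Bochner_Integration.integrable_bound[OF intEb[of j]])
  show "AE w in \<nu>. norm (\<bar>?E w\<bar> ^ j) \<le> norm (2 ^ j * (CG ^ j + \<bar>A\<bar> ^ j * rho N \<xi> w ^ j))"
  proof (rule AE_I2)
   fix w
   have "norm (\<bar>?E w\<bar> ^ j) = \<bar>?E w\<bar> ^ j" by simp
   also note Ej[of w j]
   finally show "norm (\<bar>?E w\<bar> ^ j) \<le> norm (2 ^ j * (CG ^ j + \<bar>A\<bar> ^ j * rho N \<xi> w ^ j))"
    unfolding real_norm_def by (rule order_trans[OF _ abs_ge_self])
  qed
 qed measurable
 have IE4: "(\<integral>w. \<bar>?E w\<bar> ^ (2 * r) \<partial>\<nu>) \<le> B4"
 proof -
  have "(\<integral>w. \<bar>?E w\<bar> ^ (2 * r) \<partial>\<nu>) \<le> (\<integral>w. 2 ^ (2 * r) * (CG ^ (2 * r) + \<bar>A\<bar> ^ (2 * r) * rho N \<xi> w ^ (2 * r)) \<partial>\<nu>)"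
   by (intro integral_mono intE intEb Ej)
  also have "\<dots> = 2 ^ (2 * r) * (CG ^ (2 * r) + \<bar>A\<bar> ^ (2 * r) * (\<integral>w. rho N \<xi> w ^ (2 * r) \<partial>\<nu>))"
   using rho_power(1)[OF p, of "2 * r"] prob_space by simp
  also have "\<dots> \<le> B4"
   unfolding B4_def using rho_power(2)[OF p, of "2 * r"] by (intro mult_left_mono add_left_mono) auto
  finally show ?thesis .
 qed
 have IE2: "(\<integral>w. (?E w)\<^sup>2 \<partial>\<nu>) \<le> e2"
 proof -
  have i: "integrable \<nu> (\<lambda>w. (?E w)\<^sup>2)" using intE[of 2] by simp
  have "ennreal (\<integral>w. (?E w)\<^sup>2 \<partial>\<nu>) \<le> ennreal e2"
   using E2 by (subst (asm) nn_integral_eq_integral[OF i]) auto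
  then show ?thesis using e2 by (subst (asm) ennreal_le_iff) auto
 qed
 have Er: "\<bar>?E w\<bar> ^ r \<le> Kc ^ (r - 2) * (?E w)\<^sup>2 + \<bar>?E w\<bar> ^ (2 * r) / Kc" for w
 proof (cases "\<bar>?E w\<bar> \<le> Kc")
  case True
  have "\<bar>?E w\<bar> ^ r = \<bar>?E w\<bar> ^ (r - 2) * \<bar>?E w\<bar>\<^sup>2"
   unfolding power_add[symmetric] le_add_diff_inverse2[OF r] ..
  also have "\<dots> \<le> Kc ^ (r - 2) * \<bar>?E w\<bar>\<^sup>2" using True by (intro mult_right_mono power_mono) auto
  finally show ?thesis using Kc by (simp add: add_increasing2)
 next
  case False
  then have "1 \<le> \<bar>?E w\<bar>" using Kc by linarith
  then have "\<bar>?E w\<bar> ^ 1 \<le> \<bar>?E w\<bar> ^ r" using r by (intro power_increasing) auto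
  then have "Kc \<le> \<bar>?E w\<bar> ^ r" using False by simp
  then have "\<bar>?E w\<bar> ^ r * Kc \<le> \<bar>?E w\<bar> ^ r * \<bar>?E w\<bar> ^ r" by (intro mult_left_mono) auto
  also have "\<dots> = \<bar>?E w\<bar> ^ (2 * r)" by (simp only: power_add[symmetric] mult_2)
  finally have "\<bar>?E w\<bar> ^ r \<le> \<bar>?E w\<bar> ^ (2 * r) / Kc" using Kc by (subst pos_le_divide_eq) auto
  then show ?thesis using Kc by (intro add_increasing) auto
 qed
 have IEr: "(\<integral>w. \<bar>?E w\<bar> ^ r \<partial>\<nu>) \<le> e1"
 proof -
  have i2: "integrable \<nu> (\<lambda>w. (?E w)\<^sup>2)" using intE[of 2] by simp
  have i: "integrable \<nu> (\<lambda>w. Kc ^ (r - 2) * (?E w)\<^sup>2)" "integrable \<nu> (\<lambda>w. \<bar>?E w\<bar> ^ (2 * r) / Kc)"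
   using i2 intE[of "2 * r"] by auto
  have "(\<integral>w. \<bar>?E w\<bar> ^ r \<partial>\<nu>) \<le> (\<integral>w. Kc ^ (r - 2) * (?E w)\<^sup>2 + \<bar>?E w\<bar> ^ (2 * r) / Kc \<partial>\<nu>)"
   by (intro integral_mono intE Er Bochner_Integration.integrable_add i)
  also have "\<dots> = Kc ^ (r - 2) * (\<integral>w. (?E w)\<^sup>2 \<partial>\<nu>) + (\<integral>w. \<bar>?E w\<bar> ^ (2 * r) \<partial>\<nu>) / Kc"
   by (subst Bochner_Integration.integral_add[OF i]) simp
  also have "\<dots> \<le> Kc ^ (r - 2) * e2 + B4 / Kc"
   using Kc IE2 IE4 by (intro add_mono mult_left_mono divide_right_mono) auto
  also have "Kc ^ (r - 2) * e2 = e1 / 2" using Kc by (simp add: e2_def)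
  also have "B4 / Kc \<le> e1 / 2"
  proof -
   have "B4 \<le> e1 / 2 * Kc" using e1 B4 by (simp add: Kc_def field_simps)
   then show ?thesis using Kc by (simp add: pos_divide_le_eq)
  qed
  finally show ?thesis by simp
 qed
 let ?F = "\<lambda>w. M0 * rho N \<xi> w - L w"
 have Fb: "\<bar>?F w\<bar> ^ r \<le> 2 ^ r * (\<bar>?E w\<bar> ^ r + \<bar>G (\<beta> w) - L w\<bar> ^ r)" for w
 proof -
  have "\<bar>?F w\<bar> ^ r = \<bar>(- ?E w) + (G (\<beta> w) - L w)\<bar> ^ r" by simp
  also have "\<dots> \<le> 2 ^ r * (\<bar>- ?E w\<bar> ^ r + \<bar>G (\<beta> w) - L w\<bar> ^ r)" by (rule abs_add_power_le)
  finally show ?thesis by (simp only: abs_minus_cancel)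
 qed
 have ib: "integrable \<nu> (\<lambda>w. 2 ^ r * (\<bar>?E w\<bar> ^ r + \<bar>G (\<beta> w) - L w\<bar> ^ r))"
  by (intro integrable_mult_right Bochner_Integration.integrable_add intE intGL)
 have iF: "integrable \<nu> (\<lambda>w. \<bar>?F w\<bar> ^ r)"
 proof (rule Bochner_Integration.integrable_bound[OF ib])
  show "AE w in \<nu>. norm (\<bar>?F w\<bar> ^ r) \<le> norm (2 ^ r * (\<bar>?E w\<bar> ^ r + \<bar>G (\<beta> w) - L w\<bar> ^ r))"
  proof (rule AE_I2)
   fix w
   have "norm (\<bar>?F w\<bar> ^ r) = \<bar>?F w\<bar> ^ r" by simp
   also note Fb[of w]
   finally show "norm (\<bar>?F w\<bar> ^ r) \<le> norm (2 ^ r * (\<bar>?E w\<bar> ^ r + \<bar>G (\<beta> w) - L w\<bar> ^ r))"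
    unfolding real_norm_def by (rule order_trans[OF _ abs_ge_self])
  qed
 qed (use L in measurable)
 have "(\<integral>w. \<bar>?F w\<bar> ^ r \<partial>\<nu>) \<le> (\<integral>w. 2 ^ r * (\<bar>?E w\<bar> ^ r + \<bar>G (\<beta> w) - L w\<bar> ^ r) \<partial>\<nu>)"
  by (intro integral_mono iF ib Fb)
 also have "\<dots> = 2 ^ r * ((\<integral>w. \<bar>?E w\<bar> ^ r \<partial>\<nu>) + (\<integral>w. \<bar>G (\<beta> w) - L w\<bar> ^ r \<partial>\<nu>))"
  by (subst integral_mult_right_zero) (simp add: Bochner_Integration.integral_add[OF intE intGL])
 also have "\<dots> \<le> 2 ^ r * (e1 + e1)" using IEr IGL by (intro mult_left_mono add_mono) auto
 also have "\<dots> = \<eta>" by (simp add: e1_def)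
 finally have "(\<integral>w. \<bar>?F w\<bar> ^ r \<partial>\<nu>) \<le> \<eta>" .
 from conjI[OF p conjI[OF M0p conjI[OF iF this]]] show ?thesis by (intro exI)
qed

end

section \<open>Upper bound\<close>

text \<open>The second bound is the essential one. For \<open>a > R\<close> the weight is exactly
  \<open>exp (- R)\<close>; for \<open>a < - R\<close> the left side is negative, so clamping from
  below costs nothing, although \<open>exp (- a)\<close> may be huge there.\<close>

lemma clamp_error:
 fixes a R :: real
 assumes "R \<ge> 0"
 defines "g \<equiv> max (- R) (min a R)"
 shows "\<bar>a - g\<bar> \<le> \<bar>a\<bar>" "(a - g) * exp (- g) \<le> exp (- R) * \<bar>a\<bar>" "exp (- g) \<le> exp R" "exp (- R) \<le> exp (- g)"
  "\<bar>g\<bar> \<le> R"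
proof -
 show "\<bar>a - g\<bar> \<le> \<bar>a\<bar>" "exp (- g) \<le> exp R" "exp (- R) \<le> exp (- g)" "\<bar>g\<bar> \<le> R" using assms by (auto simp: g_def)
 consider "a > R" | "\<bar>a\<bar> \<le> R" | "a < - R" by linarith
 then show "(a - g) * exp (- g) \<le> exp (- R) * \<bar>a\<bar>"
 proof cases
  case 1
  then show ?thesis using assms by (simp add: g_def mult.commute)
 next
  case 2
  then have "g = a" by (auto simp: g_def)
  then show ?thesis by simp
 next
  case 3
  then have "(a - g) * exp (- g) \<le> 0" using assms by (intro mult_nonpos_nonneg) (auto simp: g_def)
  also have "0 \<le> exp (- R) * \<bar>a\<bar>" by simp
  finally show ?thesis .
 qed
qed

lemma (in prob_space) exp_clamp_integral:
 assumes f: "f \<in> borel_measurable M" and e1: "integrable M (\<lambda>w. exp (- f w))"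
 shows "0 < (\<integral>w. exp (- f w) \<partial>M)"
  "(\<lambda>n. \<integral>w. exp (- max (- real n) (min (f w) (real n))) \<partial>M) \<longlonglongrightarrow> (\<integral>w. exp (- f w) \<partial>M)"
proof -
 note [measurable] = f
 let ?Z = "\<integral>w. exp (- f w) \<partial>M"
 show "0 < (\<integral>w. exp (- f w) \<partial>M)"
 proof -
  have "0 \<le> ?Z" by (intro integral_nonneg_AE AE_I2) auto
  moreover have "?Z \<noteq> 0"
  proof
   assume "?Z = 0"
   then have "AE w in M. exp (- f w) = 0"
    using integral_nonneg_eq_0_iff_AE[OF e1] by simp
   then have "AE w in M. False" by simp
   then show False by simp
  qed
  ultimately show ?thesis by linarith
 qed
 show "(\<lambda>n. \<integral>w. exp (- max (- real n) (min (f w) (real n))) \<partial>M) \<longlonglongrightarrow> (\<integral>w. exp (- f w) \<partial>M)"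
 proof (rule integral_dominated_convergence)
  show "integrable M (\<lambda>w. 1 + exp (- f w))" using e1 by auto
  show "AE w in M. (\<lambda>n. exp (- max (- real n) (min (f w) (real n)))) \<longlonglongrightarrow> exp (- f w)"
  proof (rule AE_I2)
   fix w
   have "eventually (\<lambda>n. \<bar>f w\<bar> \<le> real n) sequentially"
    using real_arch_simple[of "\<bar>f w\<bar>"] eventually_sequentially by (meson of_nat_mono order_trans)
   then have "eventually (\<lambda>n. exp (- max (- real n) (min (f w) (real n))) = exp (- f w)) sequentially"
    by eventually_elim auto
   then show "(\<lambda>n. exp (- max (- real n) (min (f w) (real n)))) \<longlonglongrightarrow> exp (- f w)"
    by (rule tendsto_eventually)
  qed
  fix n
  show "AE w in M. norm (exp (- max (- real n) (min (f w) (real n)))) \<le> 1 + exp (- f w)"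
  proof (rule AE_I2)
   fix w
   have "- max (- real n) (min (f w) (real n)) \<le> max (- f w) 0" by auto
   then have "exp (- max (- real n) (min (f w) (real n))) \<le> exp (max (- f w) 0)" by simp
   also have "\<dots> \<le> 1 + exp (- f w)" by (auto simp: max_def)
   finally show "norm (exp (- max (- real n) (min (f w) (real n)))) \<le> 1 + exp (- f w)" by simp
  qed
 qed measurable
qed

context controlled
begin

text \<open>With \<open>x = M * rho\<close>, the cost is the mean of
  \<open>f * x + x * ln x\<close>, divided by \<open>M\<close>, minus \<open>ln M\<close>. At
  \<open>x = L = exp (- g)\<close> the integrand is \<open>(f - g) * L\<close>, which
  \<open>clamp_error\<close> bounds; the remaining terms are \<open>\<bar>f\<bar> * D\<close>,
  \<open>D\<close> and \<open>exp R * D\<^sup>2\<close> with \<open>D = \<bar>x - L\<bar>\<close>,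
  all controlled by the mean of \<open>D ^ r\<close>.\<close>

lemma cost_approx:
 assumes p: "p > 1" and f: "f \<in> borel_measurable \<nu>" and fp: "integrable \<nu> (\<lambda>w. \<bar>f w\<bar> powr p)"
  and f1: "integrable \<nu> (\<lambda>w. \<bar>f w\<bar>)" and R: "0 \<le> R" and \<theta>: "0 < \<theta>" "\<theta> \<le> 1"
 shows "\<exists>u\<in>invertible_drifts \<nu> W. \<exists>M>0.
  (\<integral>w. f (W u w) + cm_norm_sq (u w) / 2 \<partial>\<nu>)
   \<le> (exp (- R) * (\<integral>w. \<bar>f w\<bar> \<partial>\<nu>) + \<theta> * (4 + (\<integral>w. \<bar>f w\<bar> powr p \<partial>\<nu>))) / M - ln M \<and>
  \<bar>M - (\<integral>w. exp (- max (- R) (min (f w) R)) \<partial>\<nu>)\<bar> \<le> 2 * \<theta>"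
proof -
 note [measurable] = f
 define g where "g w = max (- R) (min (f w) R)" for w
 define L where "L w = exp (- g w)" for w
 have Lm [measurable]: "L \<in> borel_measurable \<nu>" unfolding L_def[abs_def] g_def by measurable
 note ce = clamp_error[OF R, of "f w" for w, folded g_def, folded L_def]
 have Lpos: "0 < L w" for w by (simp add: L_def)
 \<comment> \<open>At least the conjugate exponent of \<open>p\<close>, to pair \<open>D\<close>
   with \<open>f\<close>, and at least 2, to control the quadratic term.\<close>
 define r where "r = max 2 (nat \<lceil>p / (p - 1)\<rceil>)"
 have r: "2 \<le> r" "real r \<ge> p / (p - 1)" unfolding r_def by linarith+
 obtain Cy where Cy: "Cy \<ge> 0" "\<forall>x\<ge>0. \<forall>y\<ge>0. x * y \<le> \<theta> * (1 + x powr p) + Cy * y ^ r"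
  using young_power[OF p r(2) \<theta>(1)] by (elim exE conjE)
 \<comment> \<open>Compensates the factor \<open>exp R\<close>, which bounds \<open>1 / L\<close>,
   in front of the quadratic term.\<close>
 define \<theta>2 where "\<theta>2 = \<theta> * exp (- R)"
 have \<theta>2: "0 < \<theta>2" "\<theta>2 \<le> 1" using \<theta> R by (auto simp: \<theta>2_def intro!: mult_le_one)
 \<comment> \<open>Collects the coefficients of \<open>D ^ r\<close> from the three error terms;
   \<open>\<eta>\<close> is chosen so that \<open>C3 * \<eta>\<close> is at most
   \<open>\<theta>\<close>.\<close>
 define C3 where "C3 = Cy + 1 / \<theta> ^ r + exp R / \<theta>2 ^ r"
 have C3: "C3 > 0" using Cy \<theta> \<theta>2 by (auto simp: C3_def intro!: add_nonneg_pos)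
 define \<eta> where "\<eta> = min (\<theta> / C3) (\<theta> * \<theta> ^ r)"
 have \<eta>: "0 < \<eta>" "C3 * \<eta> \<le> \<theta>" "\<eta> / \<theta> ^ r \<le> \<theta>"
 proof -
  show "0 < \<eta>" using C3 \<theta> by (simp add: \<eta>_def)
  have "C3 * \<eta> \<le> C3 * (\<theta> / C3)" using C3 by (intro mult_left_mono) (auto simp: \<eta>_def)
  then show "C3 * \<eta> \<le> \<theta>" using C3 by simp
  have "\<eta> / \<theta> ^ r \<le> (\<theta> * \<theta> ^ r) / \<theta> ^ r" using \<theta> by (intro divide_right_mono) (auto simp: \<eta>_def)
  then show "\<eta> / \<theta> ^ r \<le> \<theta>" using \<theta> by simp
 qed
 have Lb: "exp (- R) \<le> L w \<and> L w \<le> exp R" for w using ce(3,4) by blast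
 have eR: "0 < exp (- R)" by simp
 obtain N C \<xi> M where pr: "predictable N C \<xi>" and M: "M > 0"
  and iD: "integrable \<nu> (\<lambda>w. \<bar>M * rho N \<xi> w - L w\<bar> ^ r)"
  and ID: "(\<integral>w. \<bar>M * rho N \<xi> w - L w\<bar> ^ r \<partial>\<nu>) \<le> \<eta>"
  using approx_density[OF Lm eR Lb r(1) \<eta>(1)] by (elim exE conjE)
 have [measurable]: "rho N \<xi> \<in> borel_measurable \<nu>" by (rule rho_measurable[OF pr])
 define u where "u = control N (inverse_drift N \<xi>)"
 define D where "D w = \<bar>M * rho N \<xi> w - L w\<bar>" for w
 have Dm [measurable]: "D \<in> borel_measurable \<nu>" unfolding D_def[abs_def] by measurable
 have iD: "integrable \<nu> (\<lambda>w. D w ^ r)" and ID: "(\<integral>w. D w ^ r \<partial>\<nu>) \<le> \<eta>"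
  using iD ID by (simp_all add: D_def)
 have D0: "0 \<le> D w" for w by (simp add: D_def)
 have D1: "D w \<le> \<theta> + D w ^ r / \<theta> ^ r" for w
  using power_interpolate[of 1 r \<theta> "D w"] r \<theta> D0 by simp
 have D2: "exp R * (D w)\<^sup>2 \<le> \<theta> + exp R * (D w ^ r / \<theta>2 ^ r)" for w
 proof -
  have "(D w)\<^sup>2 \<le> \<theta>2 + D w ^ r / \<theta>2 ^ r" using power_interpolate[of 2 r \<theta>2 "D w"] r \<theta>2 D0 by simp
  then have "exp R * (D w)\<^sup>2 \<le> exp R * (\<theta>2 + D w ^ r / \<theta>2 ^ r)" by (intro mult_left_mono) auto
  moreover have "exp R * \<theta>2 = \<theta>" by (simp add: \<theta>2_def exp_minus)
  ultimately show ?thesis by (simp only: distrib_left)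
 qed
 have fD: "\<bar>f w\<bar> * D w \<le> \<theta> * (1 + \<bar>f w\<bar> powr p) + Cy * D w ^ r" for w
  using Cy(2) D0 by (meson abs_ge_zero)
 let ?x = "\<lambda>w. M * rho N \<xi> w"
 let ?l = "\<lambda>w. log_density N \<xi> (inc N (\<beta> w))"
 have x0: "0 < ?x w" for w using M by (simp add: rho_def)
 have lnx: "ln (?x w) = ln M + ?l w" for w using M by (simp add: rho_def ln_mult)
 have key: "f w * ?x w + ?x w * ln (?x w) \<le> exp (- R) * \<bar>f w\<bar> + \<theta> * (3 + \<bar>f w\<bar> powr p) + C3 * D w ^ r" for w
 proof -
  have "?x w * ln (?x w) \<le> ?x w * ln (L w) + (?x w - L w) + (?x w - L w)\<^sup>2 / L w"
   by (rule xlnx_le[OF x0 Lpos])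
  moreover have "ln (L w) = - g w" by (simp add: L_def)
  ultimately have "f w * ?x w + ?x w * ln (?x w) \<le> (f w - g w) * L w + (f w - g w) * (?x w - L w) + (?x w - L w) + (?x w - L w)\<^sup>2 / L w"
   by (simp add: algebra_simps)
  also have "\<dots> \<le> exp (- R) * \<bar>f w\<bar> + \<bar>f w\<bar> * D w + D w + exp R * (D w)\<^sup>2"
  proof (intro add_mono)
   show "(f w - g w) * L w \<le> exp (- R) * \<bar>f w\<bar>" by (rule ce)
   have "(f w - g w) * (?x w - L w) \<le> \<bar>f w - g w\<bar> * D w" unfolding D_def abs_mult[symmetric] by (rule abs_ge_self)
   also have "\<dots> \<le> \<bar>f w\<bar> * D w" by (intro mult_right_mono ce D0)
   finally show "(f w - g w) * (?x w - L w) \<le> \<bar>f w\<bar> * D w" .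
   show "?x w - L w \<le> D w" by (simp add: D_def)
   have "inverse (L w) \<le> exp R" using ce(4)[of w] by (simp add: L_def exp_minus)
   then have "(D w)\<^sup>2 * inverse (L w) \<le> (D w)\<^sup>2 * exp R" by (intro mult_left_mono) auto
   then show "(?x w - L w)\<^sup>2 / L w \<le> exp R * (D w)\<^sup>2" by (simp add: D_def divide_inverse mult.commute)
  qed
  also have "\<dots> \<le> exp (- R) * \<bar>f w\<bar> + (\<theta> * (1 + \<bar>f w\<bar> powr p) + Cy * D w ^ r) + (\<theta> + D w ^ r / \<theta> ^ r)
    + (\<theta> + exp R * (D w ^ r / \<theta>2 ^ r))"
   by (intro add_mono order_refl fD D1 D2)
  also have "\<dots> = exp (- R) * \<bar>f w\<bar> + \<theta> * (3 + \<bar>f w\<bar> powr p) + C3 * D w ^ r"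
   by (simp add: C3_def algebra_simps)
  finally show ?thesis .
 qed
 have ib: "integrable \<nu> (\<lambda>w. exp (- R) * \<bar>f w\<bar> + \<theta> * (3 + \<bar>f w\<bar> powr p) + C3 * D w ^ r)"
  using f1 fp iD by auto
 have irho: "integrable \<nu> (rho N \<xi>)" using rho_power(1)[OF pr, of 1] by simp
 note ent = rho_entropy[OF pr]
 have ifx: "integrable \<nu> (\<lambda>w. f w * rho N \<xi> w)"
 proof (rule Bochner_Integration.integrable_bound)
  show "integrable \<nu> (\<lambda>w. (exp R * \<bar>f w\<bar> + (\<theta> * (1 + \<bar>f w\<bar> powr p) + Cy * D w ^ r)) / M)"
   using f1 fp iD by auto
  show "AE w in \<nu>. norm (f w * rho N \<xi> w) \<le> norm ((exp R * \<bar>f w\<bar> + (\<theta> * (1 + \<bar>f w\<bar> powr p) + Cy * D w ^ r)) / M)"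
  proof (rule AE_I2)
   fix w
   have "\<bar>f w\<bar> * ?x w \<le> \<bar>f w\<bar> * (L w + D w)" by (intro mult_left_mono) (auto simp: D_def)
   also have "\<dots> \<le> exp R * \<bar>f w\<bar> + (\<theta> * (1 + \<bar>f w\<bar> powr p) + Cy * D w ^ r)"
   proof -
    have "\<bar>f w\<bar> * L w \<le> \<bar>f w\<bar> * exp R" by (intro mult_left_mono ce) auto
    then show ?thesis using fD[of w] by (simp only: distrib_left mult.commute[of "exp R"])
   qed
   finally have b: "\<bar>f w\<bar> * rho N \<xi> w \<le> (exp R * \<bar>f w\<bar> + (\<theta> * (1 + \<bar>f w\<bar> powr p) + Cy * D w ^ r)) / M"
    using M by (simp add: pos_le_divide_eq mult_ac)
   have "norm (f w * rho N \<xi> w) = \<bar>f w\<bar> * rho N \<xi> w" by (simp add: abs_mult rho_def)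
   also note b
   finally show "norm (f w * rho N \<xi> w) \<le> norm ((exp R * \<bar>f w\<bar> + (\<theta> * (1 + \<bar>f w\<bar> powr p) + Cy * D w ^ r)) / M)"
    unfolding real_norm_def by (rule order_trans[OF _ abs_ge_self])
  qed
 qed measurable
 have xl: "f w * ?x w + ?x w * ln (?x w) = M * (f w * rho N \<xi> w) + M * ln M * rho N \<xi> w + M * (rho N \<xi> w * ?l w)" for w
  unfolding lnx by (simp add: algebra_simps)
 have i1: "integrable \<nu> (\<lambda>w. f w * ?x w + ?x w * ln (?x w))"
  unfolding xl by (intro Bochner_Integration.integrable_add integrable_mult_right ifx irho ent)
 have "(\<integral>w. f w * ?x w + ?x w * ln (?x w) \<partial>\<nu>)
   = M * (\<integral>w. f w * rho N \<xi> w \<partial>\<nu>) + M * ln M * (\<integral>w. rho N \<xi> w \<partial>\<nu>) + M * (\<integral>w. rho N \<xi> w * ?l w \<partial>\<nu>)"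
  unfolding xl using ifx irho ent(1) by simp
 then have I1: "(\<integral>w. f w * ?x w + ?x w * ln (?x w) \<partial>\<nu>)
   = M * ((\<integral>w. f w * rho N \<xi> w \<partial>\<nu>) + ln M + (\<integral>w. rho N \<xi> w * ?l w \<partial>\<nu>))"
  unfolding rho_integral[OF pr] by (simp add: algebra_simps)
 have "(\<integral>w. f (W u w) + cm_norm_sq (u w) / 2 \<partial>\<nu>) = (\<integral>w. rho N \<xi> w * (f w + half_energy N \<xi> (inc N (\<beta> w))) \<partial>\<nu>)"
  unfolding u_def by (rule inverse_control_cost[OF pr f])
 also have "\<dots> = (\<integral>w. f w * rho N \<xi> w + rho N \<xi> w * half_energy N \<xi> (inc N (\<beta> w)) \<partial>\<nu>)"
  by (intro Bochner_Integration.integral_cong refl) (simp add: algebra_simps)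
 also have "\<dots> = (\<integral>w. f w * rho N \<xi> w \<partial>\<nu>) + (\<integral>w. rho N \<xi> w * ?l w \<partial>\<nu>)"
  unfolding ent(3) by (rule Bochner_Integration.integral_add[OF ifx ent(2)])
 finally have cost: "(\<integral>w. f (W u w) + cm_norm_sq (u w) / 2 \<partial>\<nu>) = (\<integral>w. f w * ?x w + ?x w * ln (?x w) \<partial>\<nu>) / M - ln M"
  unfolding I1 using M by simp
 have "(\<integral>w. f w * ?x w + ?x w * ln (?x w) \<partial>\<nu>) \<le> (\<integral>w. exp (- R) * \<bar>f w\<bar> + \<theta> * (3 + \<bar>f w\<bar> powr p) + C3 * D w ^ r \<partial>\<nu>)"
  by (intro integral_mono i1 ib key)
 also have "\<dots> = exp (- R) * (\<integral>w. \<bar>f w\<bar> \<partial>\<nu>) + \<theta> * (3 + (\<integral>w. \<bar>f w\<bar> powr p \<partial>\<nu>)) + C3 * (\<integral>w. D w ^ r \<partial>\<nu>)"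
  using f1 fp iD prob_space by simp
 also have "\<dots> \<le> exp (- R) * (\<integral>w. \<bar>f w\<bar> \<partial>\<nu>) + \<theta> * (3 + (\<integral>w. \<bar>f w\<bar> powr p \<partial>\<nu>)) + \<theta>"
  using order_trans[OF mult_left_mono[OF ID, of C3] \<eta>(2)] C3 by simp
 also have "\<dots> = exp (- R) * (\<integral>w. \<bar>f w\<bar> \<partial>\<nu>) + \<theta> * (4 + (\<integral>w. \<bar>f w\<bar> powr p \<partial>\<nu>))"
  by (simp add: algebra_simps)
 finally have "(\<integral>w. f (W u w) + cm_norm_sq (u w) / 2 \<partial>\<nu>)
   \<le> (exp (- R) * (\<integral>w. \<bar>f w\<bar> \<partial>\<nu>) + \<theta> * (4 + (\<integral>w. \<bar>f w\<bar> powr p \<partial>\<nu>))) / M - ln M"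
  unfolding cost using M by (intro diff_right_mono divide_right_mono) auto
 moreover have "\<bar>M - (\<integral>w. L w \<partial>\<nu>)\<bar> \<le> 2 * \<theta>"
 proof -
  have iL: "integrable \<nu> L" by (rule integrable_const_bound[of _ "exp R"]) (use ce(3) Lpos in \<open>auto intro!: AE_I2 simp: L_def\<close>)
  have ib2: "integrable \<nu> (\<lambda>w. \<theta> + D w ^ r / \<theta> ^ r)" using iD by auto
  have "M - (\<integral>w. L w \<partial>\<nu>) = (\<integral>w. ?x w - L w \<partial>\<nu>)"
   using irho iL rho_integral[OF pr] by simp
  also have "\<bar>\<dots>\<bar> \<le> (\<integral>w. D w \<partial>\<nu>)" unfolding D_def by (rule integral_abs_bound)
  also have "\<dots> \<le> (\<integral>w. \<theta> + D w ^ r / \<theta> ^ r \<partial>\<nu>)"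
   using irho iL by (intro integral_mono ib2 D1) (auto simp: D_def[abs_def])
  also have "\<dots> = \<theta> + (\<integral>w. D w ^ r \<partial>\<nu>) / \<theta> ^ r" using iD prob_space by simp
  also have "\<dots> \<le> \<theta> + \<theta>"
   using order_trans[OF divide_right_mono[OF ID, of "\<theta> ^ r"] \<eta>(3)] \<theta> by simp
  finally show ?thesis by simp
 qed
 moreover have "u \<in> invertible_drifts \<nu> W" unfolding u_def by (rule inverse_control_invertible[OF pr])
 ultimately show ?thesis using M unfolding L_def g_def by blast
qed

text \<open>Level and accuracy are coupled: \<open>R = n\<close> and
  \<open>\<theta> = 1 / (n + 1)\<close>. The scaling constants \<open>M n\<close> are within
  \<open>2 * th n\<close> of the clamped integrals and hence converge to \<open>Z\<close>, so the
  bound of \<open>cost_approx\<close> tends to \<open>- ln Z\<close>.\<close>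

lemma upper_bound:
 assumes p: "p > 1" and f: "f \<in> borel_measurable \<nu>" and fp: "integrable \<nu> (\<lambda>w. \<bar>f w\<bar> powr p)"
  and fe: "integrable \<nu> (\<lambda>w. (\<bar>f w\<bar> + 1) * exp (- f w))" and \<delta>: "\<delta> > 0"
 shows "\<exists>u\<in>invertible_drifts \<nu> W.
  (\<integral>w. f (W u w) + cm_norm_sq (u w) / 2 \<partial>\<nu>) \<le> - ln (\<integral>w. exp (- f w) \<partial>\<nu>) + \<delta>"
proof -
 note [measurable] = f
 have f1: "integrable \<nu> (\<lambda>w. \<bar>f w\<bar>)"
 proof (rule Bochner_Integration.integrable_bound)
  show "integrable \<nu> (\<lambda>w. 1 + \<bar>f w\<bar> powr p)" using fp by auto
  show "AE w in \<nu>. norm \<bar>f w\<bar> \<le> norm (1 + \<bar>f w\<bar> powr p)"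
  proof (rule AE_I2)
   fix w
   have "\<bar>f w\<bar> \<le> 1 + \<bar>f w\<bar> powr p"
   proof (cases "\<bar>f w\<bar> \<le> 1")
    case True
    then show ?thesis by (simp add: add_increasing2)
   next
    case False
    then have "\<bar>f w\<bar> powr 1 \<le> \<bar>f w\<bar> powr p" using p by (intro powr_mono) auto
    then show ?thesis by simp
   qed
   then show "norm \<bar>f w\<bar> \<le> norm (1 + \<bar>f w\<bar> powr p)" by simp
  qed
 qed measurable
 have e1: "integrable \<nu> (\<lambda>w. exp (- f w))"
  by (rule Bochner_Integration.integrable_bound[OF fe]) (auto simp: abs_mult distrib_right)
 define Z where "Z = (\<integral>w. exp (- f w) \<partial>\<nu>)"
 define Zn where "Zn n = (\<integral>w. exp (- max (- real n) (min (f w) (real n))) \<partial>\<nu>)" for n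
 have Z: "Z > 0" and Zn: "Zn \<longlonglongrightarrow> Z"
  using exp_clamp_integral[OF f e1] by (simp_all add: Z_def Zn_def[abs_def])
 define F1 where "F1 = (\<integral>w. \<bar>f w\<bar> \<partial>\<nu>)"
 define Fp where "Fp = (\<integral>w. \<bar>f w\<bar> powr p \<partial>\<nu>)"
 define cost where "cost u = (\<integral>w. f (W u w) + cm_norm_sq (u w) / 2 \<partial>\<nu>)" for u
 define th where "th n = 1 / real (Suc n)" for n
 have th: "0 < th n" "th n \<le> 1" for n by (auto simp: th_def)
 have "\<exists>u M. u \<in> invertible_drifts \<nu> W \<and> M > 0 \<and>
   cost u \<le> (exp (- real n) * F1 + th n * (4 + Fp)) / M - ln M \<and> \<bar>M - Zn n\<bar> \<le> 2 * th n" for n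
  using cost_approx[OF p f fp f1 of_nat_0_le_iff[of n] th(1)[of n] th(2)[of n]]
  unfolding cost_def F1_def Fp_def Zn_def by (elim bexE exE conjE) (intro exI conjI)
 then obtain u M where uM: "\<And>n. u n \<in> invertible_drifts \<nu> W" "\<And>n. M n > 0"
  "\<And>n. cost (u n) \<le> (exp (- real n) * F1 + th n * (4 + Fp)) / M n - ln (M n)" "\<And>n. \<bar>M n - Zn n\<bar> \<le> 2 * th n"
  by metis
 have th0: "th \<longlonglongrightarrow> 0" unfolding th_def by (rule LIMSEQ_inverse_real_of_nat[unfolded inverse_eq_divide])
 have "(\<lambda>n. M n - Zn n) \<longlonglongrightarrow> 0"
 proof (rule Lim_null_comparison)
  show "\<forall>\<^sub>F n in sequentially. norm (M n - Zn n) \<le> 2 * th n" using uM(4) by simp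
  show "(\<lambda>n. 2 * th n) \<longlonglongrightarrow> 0" using tendsto_mult_left[OF th0, of 2] by simp
 qed
 from tendsto_add[OF this Zn] have M: "M \<longlonglongrightarrow> Z" by simp
 have e0: "(\<lambda>n. exp (- real n)) \<longlonglongrightarrow> 0"
  by (intro filterlim_compose[OF exp_at_bot] filterlim_compose[OF filterlim_uminus_at_bot_at_top] filterlim_real_sequentially)
 have "(\<lambda>n. (exp (- real n) * F1 + th n * (4 + Fp)) / M n - ln (M n)) \<longlonglongrightarrow> (0 * F1 + 0 * (4 + Fp)) / Z - ln Z"
  using Z by (intro tendsto_intros e0 th0 M) auto
 then have "(\<lambda>n. (exp (- real n) * F1 + th n * (4 + Fp)) / M n - ln (M n)) \<longlonglongrightarrow> - ln Z" by simp
 from order_tendstoD(2)[OF this, of "- ln Z + \<delta>"] \<delta>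
 obtain n where "(exp (- real n) * F1 + th n * (4 + Fp)) / M n - ln (M n) < - ln Z + \<delta>"
  by (auto simp: eventually_sequentially)
 then have "cost (u n) \<le> - ln Z + \<delta>" using uM(3)[of n] by linarith
 then show ?thesis using uM(1) unfolding cost_def Z_def by blast
qed

end

section \<open>Lower bound\<close>

context grid_drift
begin

text \<open>Apply Jensen's inequality to \<open>X = - A N - \<Phi> (Y N)\<close> under the original
  measure. Its mean contains the mean of \<open>Q\<close> by \<open>expectation_A\<close>, and the
  integral of \<open>exp X\<close> loses weight and shift by \<open>girsanov\<close>.\<close>

lemma entropy_bound:
 assumes \<Phi>: "\<Phi> \<in> borel_measurable seq_space" and b: "\<And>x. \<bar>\<Phi> x\<bar> \<le> R"
 shows "exp (- ((\<integral>w. \<Phi> (Y N w) \<partial>completion M) + (\<integral>w. Q N w \<partial>completion M)))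
  \<le> (\<integral>w. exp (- \<Phi> (inc N (B w))) \<partial>completion M)"
proof -
 interpret C: prob_space "completion M" by (rule prob_space_completion)
 have Ym: "Y N \<in> measurable (completion M) seq_space"
  by (rule measurable_FB_completion[OF Y_measurable]) simp
 have [measurable]: "(\<lambda>w. \<Phi> (Y N w)) \<in> borel_measurable (completion M)" by (rule measurable_compose[OF Ym \<Phi>])
 have [measurable]: "A N \<in> borel_measurable (completion M)" by (rule A_completion) simp
 have iG: "integrable (completion M) (\<lambda>w. \<Phi> (Y N w))"
  by (rule C.integrable_const_bound[of _ R]) (use b in auto)
 define X where "X w = - A N w + - \<Phi> (Y N w)" for w
 have iX: "integrable (completion M) X"
  unfolding X_def[abs_def] using integrable_A[of N] iG
  by (intro Bochner_Integration.integrable_add integrable_minus) auto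
 define c where "c = (\<integral>w. X w \<partial>completion M)"
 have c: "c = - ((\<integral>w. \<Phi> (Y N w) \<partial>completion M) + (\<integral>w. Q N w \<partial>completion M))"
  unfolding c_def X_def using integrable_A[of N] iG expectation_A[of N] by simp
 have nn: "(\<integral>\<^sup>+w. ennreal (exp (X w)) \<partial>completion M) = (\<integral>\<^sup>+w. ennreal (exp (- \<Phi> (inc N (B w)))) \<partial>completion M)"
 proof -
  have "(\<integral>\<^sup>+w. ennreal (exp (X w)) \<partial>completion M) = (\<integral>\<^sup>+w. ennreal (exp (- A N w)) * ennreal (exp (- \<Phi> (Y N w))) \<partial>M)"
   unfolding nn_integral_completion X_def exp_add by (simp add: ennreal_mult')
  also have "\<dots> = (\<integral>\<^sup>+w. ennreal (exp (- \<Phi> (inc N (B w)))) \<partial>M)"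
   by (rule girsanov) (use \<Phi> in measurable)
  finally show ?thesis unfolding nn_integral_completion .
 qed
 have "(\<integral>\<^sup>+w. ennreal (exp (- \<Phi> (inc N (B w)))) \<partial>completion M) \<le> (\<integral>\<^sup>+w. ennreal (exp R) \<partial>completion M)"
  using b by (intro nn_integral_mono ennreal_leI) (auto simp: abs_le_iff minus_le_iff)
 also have "\<dots> < \<infinity>" by (simp add: emeasure_space_1)
 finally have fin: "(\<integral>\<^sup>+w. ennreal (exp (X w)) \<partial>completion M) < \<infinity>" unfolding nn .
 have iE: "integrable (completion M) (\<lambda>w. exp (X w))"
  by (rule integrableI_nonneg) (use fin iX in auto)
 have Bm: "(\<lambda>w. inc N (B w)) \<in> measurable M seq_space"
 proof -
  have "(\<lambda>w s. inc N (B w) s) \<in> measurable M seq_space"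
   by (rule measurable_PiM_single') (auto intro: inc_measurable B_measurable)
  then show ?thesis by simp
 qed
 have Bm2: "(\<lambda>w. exp (- \<Phi> (inc N (B w)))) \<in> borel_measurable (completion M)"
  by (rule measurable_completion) (use measurable_compose[OF Bm \<Phi>] in measurable)
 \<comment> \<open>Jensen's inequality through the tangent of \<open>exp\<close> at the mean
   \<open>c\<close>.\<close>
 have "exp c = (\<integral>w. exp c * (1 + X w - c) \<partial>completion M)"
  using iX C.prob_space by (simp add: c_def[symmetric])
 also have "\<dots> \<le> (\<integral>w. exp (X w) \<partial>completion M)"
 proof (rule integral_mono[OF _ iE])
  show "integrable (completion M) (\<lambda>w. exp c * (1 + X w - c))" using iX by auto
  fix w
  have "exp c * (1 + (X w - c)) \<le> exp c * exp (X w - c)" by (intro mult_left_mono exp_ge_add_one_self) auto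
  then show "exp c * (1 + X w - c) \<le> exp (X w)" by (simp add: exp_add[symmetric] add_diff_eq)
 qed
 also have "\<dots> = (\<integral>w. exp (- \<Phi> (inc N (B w))) \<partial>completion M)"
  using iE Bm2 nn by (simp add: integral_eq_nn_integral)
 finally show ?thesis unfolding c .
qed

text \<open>In place of Hoelder's inequality, Young's inequality is applied pointwise with
  \<open>t = A N w\<close>: \<open>y \<le> exp (- t) * y powr p + exp (t / (p - 1))\<close>. The
  first term carries the Girsanov weight and is unshifted by \<open>girsanov\<close>; the second is
  an exponential moment of \<open>A\<close>, bounded independently of the grid.\<close>

lemma moment_bound:
 assumes \<Phi>: "\<Phi> \<in> borel_measurable seq_space" and p: "p > 1"
 shows "(\<integral>\<^sup>+w. ennreal \<bar>\<Phi> (Y N w)\<bar> \<partial>M)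
  \<le> (\<integral>\<^sup>+w. ennreal (\<bar>\<Phi> (inc N (B w))\<bar> powr p) \<partial>M) + ennreal (exp (((1 / (p - 1))\<^sup>2 + 1 / (p - 1)) * C\<^sup>2 / 2))"
proof -
 have Ym: "Y N \<in> measurable (completion M) seq_space"
  by (rule measurable_FB_completion[OF Y_measurable]) simp
 have [measurable]: "(\<lambda>w. \<Phi> (Y N w)) \<in> borel_measurable (completion M)" by (rule measurable_compose[OF Ym \<Phi>])
 have [measurable]: "A N \<in> borel_measurable (completion M)" by (rule A_completion) simp
 let ?a = "- (1 / (p - 1))"
 have young: "y \<le> exp (- t) * y powr p + exp (- ?a * t)" if y: "0 \<le> y" for y t :: real
 proof (cases "y \<le> exp (- ?a * t)")
  case True
  then show ?thesis by (simp add: add_increasing)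
 next
  case False
  then have y0: "0 < y" using exp_gt_zero[of "- ?a * t"] by linarith
  have "(exp (- ?a * t)) powr (p - 1) \<le> y powr (p - 1)" using False p by (intro powr_mono2) auto
  moreover have "(exp (- ?a * t)) powr (p - 1) = exp t" using p by (simp add: powr_def)
  ultimately have "1 \<le> exp (- t) * y powr (p - 1)" by (simp add: exp_minus field_simps)
  then have "y * 1 \<le> y * (exp (- t) * y powr (p - 1))" using y by (rule mult_left_mono)
  also have "\<dots> = exp (- t) * y powr p" using y0 by (simp add: powr_diff)
  finally show ?thesis using exp_gt_zero[of "- ?a * t"] by linarith
 qed
 have "(\<integral>\<^sup>+w. ennreal \<bar>\<Phi> (Y N w)\<bar> \<partial>M)
   \<le> (\<integral>\<^sup>+w. ennreal (exp (- A N w)) * ennreal (\<bar>\<Phi> (Y N w)\<bar> powr p) + ennreal (exp (- ?a * A N w)) \<partial>M)"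
 proof (rule nn_integral_mono)
  fix w
  have "ennreal \<bar>\<Phi> (Y N w)\<bar> \<le> ennreal (exp (- A N w) * \<bar>\<Phi> (Y N w)\<bar> powr p + exp (- ?a * A N w))"
   by (intro ennreal_leI young) simp
  also have "\<dots> = ennreal (exp (- A N w)) * ennreal (\<bar>\<Phi> (Y N w)\<bar> powr p) + ennreal (exp (- ?a * A N w))"
   by (simp add: ennreal_mult' ennreal_plus)
  finally show "ennreal \<bar>\<Phi> (Y N w)\<bar> \<le> ennreal (exp (- A N w)) * ennreal (\<bar>\<Phi> (Y N w)\<bar> powr p) + ennreal (exp (- ?a * A N w))" .
 qed
 also have "\<dots> = (\<integral>\<^sup>+w. ennreal (exp (- A N w)) * ennreal (\<bar>\<Phi> (Y N w)\<bar> powr p) \<partial>M) + (\<integral>\<^sup>+w. ennreal (exp (- ?a * A N w)) \<partial>M)"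
  unfolding nn_integral_completion[symmetric, of M] by (rule nn_integral_add) measurable
 also have "(\<integral>\<^sup>+w. ennreal (exp (- A N w)) * ennreal (\<bar>\<Phi> (Y N w)\<bar> powr p) \<partial>M)
   = (\<integral>\<^sup>+w. ennreal (\<bar>\<Phi> (inc N (B w))\<bar> powr p) \<partial>M)"
  by (rule girsanov) (use \<Phi> in measurable)
 also have "(\<integral>\<^sup>+w. ennreal (exp (- ?a * A N w)) \<partial>M) \<le> ennreal (exp (real N * h * (?a\<^sup>2 + \<bar>?a\<bar>) * C\<^sup>2 / 2))"
  by (rule nn_integral_exp_A) simp
 also have "real N * h * (?a\<^sup>2 + \<bar>?a\<bar>) * C\<^sup>2 / 2 = ((1 / (p - 1))\<^sup>2 + 1 / (p - 1)) * C\<^sup>2 / 2"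
  using N p by simp
 finally show ?thesis by (auto intro: add_mono)
qed

end

lemma cis_lipschitz: "norm (cis a - cis b) \<le> \<bar>a - b\<bar>"
proof -
 have "cmod (iexp (a - b) - (\<Sum>k\<le>0. (\<i> * (a - b)) ^ k / fact k)) \<le> \<bar>a - b\<bar> ^ Suc 0 / fact (Suc 0)"
  by (rule iexp_approx1)
 then have 1: "cmod (cis (a - b) - 1) \<le> \<bar>a - b\<bar>" by (simp add: cis_conv_exp)
 have "cis a - cis b = cis b * (cis (a - b) - 1)" by (simp add: algebra_simps cis_mult)
 then show ?thesis using 1 by (simp add: norm_mult)
qed

lemma theta_lipschitz:
 assumes "\<And>k. k \<le> K \<Longrightarrow> norm (b (real k / real K) - b' (real k / real K)) \<le> e"
 shows "\<bar>theta K l (inc K b) - theta K l (inc K b')\<bar> \<le> (\<Sum>k<K. 2 * norm (l k)) * e"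
proof -
 have "\<bar>theta K l (inc K b) - theta K l (inc K b')\<bar> = \<bar>\<Sum>k<K. l k \<bullet> (inc K b k - inc K b' k)\<bar>"
  by (simp add: theta_def sum_subtractf inner_diff_right)
 also have "\<dots> \<le> (\<Sum>k<K. \<bar>l k \<bullet> (inc K b k - inc K b' k)\<bar>)" by (rule sum_abs)
 also have "\<dots> \<le> (\<Sum>k<K. 2 * norm (l k) * e)"
 proof (rule sum_mono)
  fix k assume k: "k \<in> {..<K}"
  let ?d = "\<lambda>k. b (real k / real K) - b' (real k / real K)"
  have "inc K b k - inc K b' k = ?d (Suc k) - ?d k" using k by (simp add: inc_def add.commute algebra_simps)
  also have "norm \<dots> \<le> norm (?d (Suc k)) + norm (?d k)" by (rule norm_triangle_ineq4)
  also have "\<dots> \<le> e + e" using k by (intro add_mono assms) auto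
  finally have "norm (l k) * norm (inc K b k - inc K b' k) \<le> norm (l k) * (e + e)" by (intro mult_left_mono) auto
  then show "\<bar>l k \<bullet> (inc K b k - inc K b' k)\<bar> \<le> 2 * norm (l k) * e"
   using Cauchy_Schwarz_ineq2[of "l k" "inc K b k - inc K b' k"] by simp
 qed
 finally show ?thesis by (simp only: sum_distrib_right)
qed

text \<open>On every refinement the function is still a functional of the increments, and its
  Lipschitz constant for the maximum over grid points stays the same. The constant therefore
  survives the limit in which the delay of the drift disappears.\<close>

lemma trig_grid:
 fixes g :: "(real \<Rightarrow> real ^ 'n) \<Rightarrow> real"
 assumes g: "g \<in> trig"
 shows "\<exists>K>0. \<exists>L\<ge>0. \<forall>m>0.
  (\<exists>G\<in>borel_measurable seq_space. \<forall>b. g b = G (inc (K * m) b)) \<and>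
  (\<forall>b b' e. (\<forall>k\<le>K * m. norm (b (real k / real (K * m)) - b' (real k / real (K * m))) \<le> e) \<longrightarrow> \<bar>g b - g b'\<bar> \<le> L * e)"
proof -
 obtain K xs where K: "K > 0"
  and rep: "\<forall>b. g b = (\<Sum>(c, l)\<leftarrow>xs. Re (c * cis (theta K l (inc K b))))"
  using trig_rep[OF g] by (elim exE conjE)
 define L where "L = (\<Sum>(c, l)\<leftarrow>xs. norm c * (\<Sum>k<K. 2 * norm (l k)))"
 have L: "0 \<le> L" unfolding L_def by (intro sum_list_nonneg) (auto intro!: mult_nonneg_nonneg sum_nonneg)
 have G: "\<exists>G\<in>borel_measurable seq_space. \<forall>b. g b = G (inc (K * m) b)" if m: "m > 0" for m
 proof (intro bexI allI)
  let ?G = "\<lambda>x. \<Sum>(c, l)\<leftarrow>xs. Re (c * cis (theta (K * m) (\<lambda>s. l (s div m)) x))"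
  show "g b = ?G (inc (K * m) b)" for b
   unfolding rep[rule_format] theta_refine[OF K m] ..
  have [measurable]: "theta (K * m) l \<in> borel_measurable seq_space" for l :: "nat \<Rightarrow> real ^ 'n"
   unfolding theta_def[abs_def] by (intro borel_measurable_sum borel_measurable_inner seq_component_measurable) auto
  show "?G \<in> borel_measurable seq_space"
   by (induction xs) (auto split: prod.splits)
 qed
 have lip: "\<bar>g b - g b'\<bar> \<le> L * e"
  if m: "m > 0" and e: "\<forall>k\<le>K * m. norm (b (real k / real (K * m)) - b' (real k / real (K * m))) \<le> e" for m b b' e
 proof -
  have e': "norm (b (real k / real K) - b' (real k / real K)) \<le> e" if "k \<le> K" for k
   using e[rule_format, of "k * m"] m that by simp
  have "g b - g b' = (\<Sum>a\<leftarrow>xs. case a of (c, l) \<Rightarrow> Re (c * cis (theta K l (inc K b))) - Re (c * cis (theta K l (inc K b'))))"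
   unfolding rep[rule_format] by (induction xs) auto
  also have "norm \<dots> \<le> (\<Sum>a\<leftarrow>xs. case a of (c, l) \<Rightarrow> norm c * (\<Sum>k<K. 2 * norm (l k)) * e)"
  proof (rule norm_sum_list_le, clarify)
   fix c l
   let ?t = "theta K l (inc K b)" and ?t' = "theta K l (inc K b')"
   have "Re (c * cis ?t) - Re (c * cis ?t') = Re (c * (cis ?t - cis ?t'))" by (simp add: algebra_simps)
   also have "norm \<dots> \<le> norm (c * (cis ?t - cis ?t'))" unfolding real_norm_def by (rule abs_Re_le_cmod)
   also have "\<dots> \<le> norm c * ((\<Sum>k<K. 2 * norm (l k)) * e)"
    unfolding norm_mult by (intro mult_left_mono order_trans[OF cis_lipschitz theta_lipschitz] e') auto
   finally show "norm (Re (c * cis ?t) - Re (c * cis ?t')) \<le> norm c * (\<Sum>k<K. 2 * norm (l k)) * e"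
    by (simp only: mult.assoc)
  qed
  also have "\<dots> = L * e" unfolding L_def by (induction xs) (auto simp: distrib_right)
  finally show ?thesis by simp
 qed
 show ?thesis
  by (rule exI[of _ K], rule conjI[OF K], rule exI[of _ L], rule conjI[OF L], intro allI impI conjI)
   (rule G, assumption, rule lip)
qed

section \<open>Adaptedness of integrals and paths of finite energy\<close>

context brownian
begin

lemma filtration_AE_cong:
 fixes g :: "'a \<Rightarrow> 'b :: topological_space"
 assumes f: "f \<in> borel_measurable (FB t)" and eq: "AE w in M. f w = g w"
 shows "g \<in> borel_measurable (FB t)"
proof -
 have "AE w in completion M. f w = g w" using eq by (rule AE_completion)
 then obtain N where N: "N \<in> null_sets (completion M)" "{w \<in> space (completion M). f w \<noteq> g w} \<subseteq> N"
  by (rule AE_E3) (auto intro: that)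
 have null: "A \<in> sets (FB t)" if "A \<in> null_sets (completion M)" for A
  using that unfolding sets_completed_filtration by (intro sigma_sets.Basic UnI2)
 show ?thesis
 proof (rule measurableI)
  fix A :: "'b set" assume A: "A \<in> sets borel"
  have "g -` A \<inter> space M = (f -` A \<inter> space M - N) \<union> (N \<inter> (g -` A \<inter> space M))"
   using N(2) by auto
  moreover have "f -` A \<inter> space M \<in> sets (FB t)" using measurable_sets[OF f A] by simp
  moreover have "N \<inter> (g -` A \<inter> space M) \<in> sets (FB t)"
   by (intro null null_sets_completion_subset[OF _ N(1)]) auto
  moreover have "N \<in> sets (FB t)" by (rule null[OF N(1)])
  ultimately show "g -` A \<inter> space (FB t) \<in> sets (FB t)"
   unfolding space_completed_filtration by (metis sets.Diff sets.Un)
 qed simp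
qed

text \<open>The conditional expectation on \<open>FB t\<close> is orthogonal to \<open>X - E X\<close>, and so is \<open>X\<close> itself by Fubini.\<close>

lemma integral_adapted:
 fixes \<phi> :: "real \<Rightarrow> 'a \<Rightarrow> real"
 assumes m: "(\<lambda>(s, w). \<phi> s w) \<in> borel_measurable (leb01 \<Otimes>\<^sub>M M)"
  and ad: "\<And>s. s \<in> {0..t} \<Longrightarrow> \<phi> s \<in> borel_measurable (FB t)" and b: "\<And>s w. \<bar>\<phi> s w\<bar> \<le> C"
 shows "(\<lambda>w. \<integral>s. indicator {0..t} s * \<phi> s w \<partial>leb01) \<in> borel_measurable (FB t)"
proof -
 interpret L: finite_measure leb01 by (rule finite_leb01)
 interpret P: pair_sigma_finite leb01 M ..
 interpret PF: finite_measure "leb01 \<Otimes>\<^sub>M M"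
  by (rule finite_measure_pair_measure) (rule finite_measure_axioms, rule finite_leb01)
 interpret CM: prob_space "completion M" by (rule prob_space_completion)
 interpret S: finite_measure_subalgebra "completion M" "FB t"
  by unfold_locales (use FB_subset[of t] in \<open>auto simp: subalgebra_def\<close>)
 have C0: "0 \<le> C" using b[of 0 undefined] by linarith
 note [measurable] = m
 have [measurable]: "(\<lambda>(w, s). \<phi> s w) \<in> borel_measurable (M \<Otimes>\<^sub>M leb01)"
  using measurable_pair_swap[OF m] by simp
 have im: "(\<lambda>s. indicator {0..t} s :: real) \<in> borel_measurable leb01" by (rule measurable_leb01) simp
 note [measurable] = im
 define X where "X w = (\<integral>s. indicator {0..t} s * \<phi> s w \<partial>leb01)" for w
 have Xm [measurable]: "X \<in> borel_measurable M" unfolding X_def[abs_def] by measurable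
 define K where "K = C * measure leb01 {0..1}"
 have Xb: "\<bar>X w\<bar> \<le> K" if w: "w \<in> space M" for w
 proof -
  have "(\<lambda>s. \<phi> s w) \<in> borel_measurable leb01" using measurable_Pair1[OF m w] by simp
  then have "integrable leb01 (\<lambda>s. indicator {0..t} s * \<phi> s w)"
   using b[of _ w] C0 im by (intro L.integrable_const_bound[of _ C] AE_I2) (auto simp: indicator_def)
  then have "\<bar>X w\<bar> \<le> (\<integral>s. C \<partial>leb01)"
   unfolding X_def by (rule integral_abs_bound_integral) (use b[of _ w] C0 in \<open>auto simp: indicator_def\<close>)
  then show ?thesis by (simp add: K_def mult.commute)
 qed
 have XC [measurable]: "X \<in> borel_measurable (completion M)" by (rule measurable_completion[OF Xm])
 have iX: "integrable (completion M) X"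
  by (rule CM.integrable_const_bound[of _ K]) (use Xb in auto)
 define E where "E = real_cond_exp (completion M) (FB t) X"
 have EF: "E \<in> borel_measurable (FB t)" unfolding E_def by simp
 have Ecm [measurable]: "E \<in> borel_measurable (completion M)" by (rule measurable_FB_completion[OF EF])
 have XK: "AE w in completion M. X w \<le> K" "AE w in completion M. - K \<le> X w"
  using Xb by (auto intro!: AE_I2 simp: abs_le_iff minus_le_iff)
 have "AE w in completion M. E w \<le> K" "AE w in completion M. - K \<le> E w"
  unfolding E_def by (rule S.real_cond_exp_le_c[OF iX XK(1)], rule S.real_cond_exp_ge_c[OF iX XK(2)])
 then have Eb: "AE w in completion M. \<bar>E w\<bar> \<le> K" by eventually_elim auto
 \<comment> \<open>The conditional expectation is measurable only for the completion; its version
   \<open>E'\<close> is \<open>M\<close>-measurable, so that Fubini applies to the product with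
   \<open>leb01\<close>.\<close>
 obtain E' where E'm [measurable]: "E' \<in> borel_measurable M" and E': "AE w in M. E w = E' w"
  using completion_ex_borel_measurable_real[OF Ecm] by (elim bexE)
 have E'C: "AE w in completion M. E w = E' w" by (rule AE_completion[OF E'])
 define Z where "Z w = X w - E' w" for w
 have Zm [measurable]: "Z \<in> borel_measurable M" unfolding Z_def[abs_def] by measurable
 have Eb': "AE w in M. \<bar>E' w\<bar> \<le> K" using Eb[unfolded AE_completion_iff] E' by eventually_elim auto
 have Zb: "AE w in M. \<bar>Z w\<bar> \<le> 2 * K"
  using Eb' AE_space by eventually_elim (use Xb Z_def in fastforce)
 have orth: "(\<integral>w. f w * Z w \<partial>M) = 0"
  if f: "f \<in> borel_measurable (FB t)" and fm: "f \<in> borel_measurable M" and fb: "AE w in M. \<bar>f w\<bar> \<le> c" for f c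
 proof -
  have fC [measurable]: "f \<in> borel_measurable (completion M)" by (rule measurable_FB_completion[OF f])
  note fm [measurable]
  have i: "integrable (completion M) (\<lambda>w. f w * X w)"
  proof (rule CM.integrable_const_bound)
   show "AE w in completion M. norm (f w * X w) \<le> c * K"
    using AE_completion[OF fb] AE_space
    by eventually_elim (auto simp: abs_mult intro!: mult_mono Xb intro: order_trans[OF abs_ge_zero])
  qed measurable
  note ci = S.real_cond_exp_intg[OF i f XC, folded E_def]
  have "(\<integral>w. f w * Z w \<partial>M) = (\<integral>w. f w * Z w \<partial>completion M)"
   by (rule integral_completion[symmetric]) measurable
  also have "\<dots> = (\<integral>w. f w * X w - f w * E w \<partial>completion M)"
  proof (rule integral_cong_AE)
   show "AE w in completion M. f w * Z w = f w * X w - f w * E w"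
    using E'C by eventually_elim (simp add: Z_def algebra_simps)
  qed (use Zm[THEN measurable_completion] in measurable)
  also have "\<dots> = 0" using ci i by simp
  finally show ?thesis .
 qed
 have ZX: "(\<integral>w. X w * Z w \<partial>M) = 0"
 proof -
  let ?f = "\<lambda>s w. indicator {0..t} s * \<phi> s w * Z w"
  have i: "integrable (leb01 \<Otimes>\<^sub>M M) (case_prod ?f)"
  proof (rule PF.integrable_const_bound)
   have "AE x in leb01 \<Otimes>\<^sub>M M. \<bar>Z (snd x)\<bar> \<le> 2 * K"
   proof (rule P.AE_pair_measure)
    show "{x \<in> space (leb01 \<Otimes>\<^sub>M M). \<bar>Z (snd x)\<bar> \<le> 2 * K} \<in> sets (leb01 \<Otimes>\<^sub>M M)" by measurable
    show "AE s in leb01. AE w in M. \<bar>Z (snd (s, w))\<bar> \<le> 2 * K" using Zb by simp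
   qed
   then show "AE x in leb01 \<Otimes>\<^sub>M M. norm (case_prod ?f x) \<le> C * (2 * K)"
   proof eventually_elim
    case (elim x)
    have "\<bar>indicator {0..t} (fst x) * \<phi> (fst x) (snd x)\<bar> * \<bar>Z (snd x)\<bar> \<le> C * (2 * K)"
     using elim b[of "fst x" "snd x"] C0 by (intro mult_mono) (auto simp: indicator_def)
    then show ?case by (simp add: case_prod_beta abs_mult)
   qed
  qed measurable
  have "(\<integral>w. X w * Z w \<partial>M) = (\<integral>w. (\<integral>s. ?f s w \<partial>leb01) \<partial>M)"
   unfolding X_def by simp
  also have "\<dots> = (\<integral>s. (\<integral>w. ?f s w \<partial>M) \<partial>leb01)" by (rule P.Fubini_integral[OF i])
  also have "\<dots> = (\<integral>s. 0 \<partial>leb01)"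
  proof (rule Bochner_Integration.integral_cong[OF refl])
   fix s assume s: "s \<in> space leb01"
   show "(\<integral>w. ?f s w \<partial>M) = 0"
   proof (cases "s \<in> {0..t}")
    case True
    have "\<phi> s \<in> borel_measurable M" using measurable_Pair2[OF m s] by simp
    from orth[OF ad[OF True] this, of C] b True show ?thesis by simp
   qed simp
  qed
  finally show ?thesis by simp
 qed
 have ZE: "(\<integral>w. E' w * Z w \<partial>M) = 0"
  by (rule orth[OF filtration_AE_cong[OF EF E'] E'm Eb'])
 have iXZ: "integrable M (\<lambda>w. X w * Z w)" "integrable M (\<lambda>w. E' w * Z w)"
 proof -
  show "integrable M (\<lambda>w. X w * Z w)"
   by (rule integrable_const_bound[of _ "K * (2 * K)"])
    (use Zb AE_space in \<open>eventually_elim, auto simp: abs_mult intro!: mult_mono Xb intro: order_trans[OF abs_ge_zero]\<close>, measurable)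
  show "integrable M (\<lambda>w. E' w * Z w)"
   by (rule integrable_const_bound[of _ "K * (2 * K)"])
    (use Zb Eb' in \<open>eventually_elim, auto simp: abs_mult intro!: mult_mono intro: order_trans[OF abs_ge_zero]\<close>, measurable)
 qed
 have Z2: "(\<lambda>w. (Z w)\<^sup>2) = (\<lambda>w. X w * Z w - E' w * Z w)"
  by (auto simp: Z_def power2_eq_square algebra_simps)
 have "integrable M (\<lambda>w. (Z w)\<^sup>2)" unfolding Z2 using iXZ by simp
 moreover have "(\<integral>w. (Z w)\<^sup>2 \<partial>M) = 0" unfolding Z2 using iXZ ZX ZE by simp
 ultimately have "AE w in M. (Z w)\<^sup>2 = 0" by (subst (asm) integral_nonneg_eq_0_iff_AE) auto
 with E' have "AE w in M. E w = X w" by eventually_elim (simp add: Z_def)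
 from filtration_AE_cong[OF EF this] show ?thesis unfolding X_def .
qed

end

lemma Icc_sets_leb01: "t \<le> 1 \<Longrightarrow> {0..t} \<in> sets leb01"
 by (subst sets_restrict_space_iff) auto

lemma integrable_indicator_leb01:
 assumes "A \<in> sets leb01" shows "integrable leb01 (indicator A :: real \<Rightarrow> real)"
proof -
 interpret L: finite_measure leb01 by (rule finite_leb01)
 show ?thesis using assms by (intro L.integrable_const_bound[of _ 1] AE_I2) (auto simp: indicator_def)
qed

lemma integral_indicator_leb01:
 assumes "0 \<le> s" "s \<le> t" "t \<le> 1"
 shows "(\<integral>r. indicator {s<..t} r \<partial>leb01) = t - s"
proof -
 have "{s<..t} \<inter> {0..1} = {s<..t}" using assms by auto
 then have "measure leb01 ({s<..t} \<inter> space leb01) = t - s" using measure_leb01_Ioc[OF assms] by (simp only: space_leb01)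
 then show ?thesis by (simp only: Bochner_Integration.integral_indicator)
qed

lemma cm_increment:
 fixes g :: "real \<Rightarrow> real ^ 'n"
 assumes g: "cm_density k g" and st: "0 \<le> s" "s \<le> t" "t \<le> 1"
 shows "k t - k s = (\<integral>r. indicator {s<..t} r *\<^sub>R g r \<partial>leb01)"
proof -
 have i: "integrable leb01 (\<lambda>r. indicator {0..a} r *\<^sub>R g r)" if "a \<le> 1" for a
  by (intro integrable_mult_indicator Icc_sets_leb01 that cm_density_integrable[OF g])
 have k: "k a = (\<integral>r. indicator {0..a} r *\<^sub>R g r \<partial>leb01)" if "0 \<le> a" "a \<le> 1" for a
  using g that unfolding cm_density_def set_lebesgue_integral_def by auto
 have "k t - k s = (\<integral>r. indicator {0..t} r *\<^sub>R g r - indicator {0..s} r *\<^sub>R g r \<partial>leb01)"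
  using i[of t] i[of s] k[of t] k[of s] st by simp
 also have "\<dots> = (\<integral>r. indicator {s<..t} r *\<^sub>R g r \<partial>leb01)"
  using st by (intro Bochner_Integration.integral_cong refl) (auto simp: indicator_def)
 finally show ?thesis .
qed

text \<open>Cauchy-Schwarz in the form that the variance of \<open>g\<close> on the interval around
  its mean slope \<open>m\<close> is non-negative.\<close>

lemma cm_increment_sq:
 fixes g :: "real \<Rightarrow> real ^ 'n"
 assumes g: "cm_density k g" and st: "0 \<le> s" "s \<le> t" "t \<le> 1"
 shows "(norm (k t - k s))\<^sup>2 \<le> (t - s) * (\<integral>r. indicator {s<..t} r * (norm (g r))\<^sup>2 \<partial>leb01)"
proof (cases "s = t")
 case False
 interpret L: finite_measure leb01 by (rule finite_leb01)
 define h where "h = t - s"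
 have h: "h > 0" using False st by (simp add: h_def)
 let ?I = "\<lambda>r. indicator {s<..t} r :: real"
 define \<Delta> where "\<Delta> = k t - k s"
 define m where "m = (1 / h) *\<^sub>R \<Delta>"
 note J = measure_leb01_Ioc[OF st]
 have i1: "integrable leb01 (\<lambda>r. ?I r *\<^sub>R g r)" by (intro integrable_mult_indicator J cm_density_integrable[OF g])
 have i2: "integrable leb01 (\<lambda>r. ?I r * (norm (g r))\<^sup>2)"
  using integrable_mult_indicator[OF J(1), of "\<lambda>r. (norm (g r))\<^sup>2"] g by (simp add: cm_density_def)
 have i3: "integrable leb01 ?I" by (rule integrable_indicator_leb01[OF J(1)])
 have e: "?I r * (norm (g r - m))\<^sup>2 = ?I r * (norm (g r))\<^sup>2 - 2 * ((?I r *\<^sub>R g r) \<bullet> m) + ?I r * (m \<bullet> m)" for r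
  by (simp add: power2_norm_eq_inner inner_diff_left inner_diff_right inner_commute algebra_simps)
 have "0 \<le> (\<integral>r. ?I r * (norm (g r - m))\<^sup>2 \<partial>leb01)" by (intro integral_nonneg_AE AE_I2) auto
 also have "\<dots> = (\<integral>r. ?I r * (norm (g r))\<^sup>2 \<partial>leb01) - 2 * (\<Delta> \<bullet> m) + h * (m \<bullet> m)"
 proof -
  have i1m: "integrable leb01 (\<lambda>r. 2 * ((?I r *\<^sub>R g r) \<bullet> m))"
   by (intro integrable_mult_right integrable_inner_left i1)
  have i3m: "integrable leb01 (\<lambda>r. ?I r * (m \<bullet> m))" by (intro integrable_mult_left i3)
  have "(\<integral>r. 2 * ((?I r *\<^sub>R g r) \<bullet> m) \<partial>leb01) = 2 * (\<Delta> \<bullet> m)"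
   by (simp only: integral_mult_right_zero integral_inner_left[OF i1] \<Delta>_def cm_increment[OF g st])
  moreover have "(\<integral>r. ?I r * (m \<bullet> m) \<partial>leb01) = h * (m \<bullet> m)"
   by (simp only: integral_mult_left_zero integral_indicator_leb01[OF st] h_def)
  ultimately show ?thesis
   unfolding e Bochner_Integration.integral_add[OF Bochner_Integration.integrable_diff[OF i2 i1m] i3m]
    Bochner_Integration.integral_diff[OF i2 i1m] by (simp only:)
 qed
 also have "\<dots> = (\<integral>r. ?I r * (norm (g r))\<^sup>2 \<partial>leb01) - (\<Delta> \<bullet> \<Delta>) / h"
  using h by (simp add: m_def)
 finally show ?thesis
  using h by (simp add: \<Delta>_def[symmetric] h_def[symmetric] power2_norm_eq_inner field_simps)
qed simp

lemma cm_zero: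
 fixes g :: "real \<Rightarrow> real ^ 'n"
 assumes g: "cm_density k g"
 shows "k 0 = 0"
proof -
 have "AE r in leb01. r \<noteq> 0"
  by (subst AE_restrict_space_iff) (use AE_lborel_singleton[of "0::real"] in auto)
 then have "AE r in leb01. indicator {0..0} r *\<^sub>R g r = 0" by eventually_elim auto
 then have "(\<integral>r. indicator {0..0} r *\<^sub>R g r \<partial>leb01) = 0" by (rule integral_eq_zero_AE)
 then show ?thesis using g unfolding cm_density_def set_lebesgue_integral_def by auto
qed

section \<open>Delayed grid versions of a bounded drift\<close>

locale bounded_drift = path_brownian \<nu> \<beta>
 for \<nu> :: "(real \<Rightarrow> real ^ 'n) measure" and \<beta> :: "(real \<Rightarrow> real ^ 'n) \<Rightarrow> real \<Rightarrow> real ^ 'n" +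
 fixes u :: "(real \<Rightarrow> real ^ 'n) \<Rightarrow> real \<Rightarrow> real ^ 'n" and d :: "real \<Rightarrow> (real \<Rightarrow> real ^ 'n) \<Rightarrow> real ^ 'n" and C :: real
 assumes u_path: "u \<in> measurable \<nu> path_space" and adapted: "adapted_density \<nu> u d"
  and bounded: "AE (t, w) in leb01 \<Otimes>\<^sub>M \<nu>. norm (d t w) \<le> C" and C: "C \<ge> 0"
begin

lemma d_measurable: "(\<lambda>(t, w). d t w) \<in> borel_measurable (leb01 \<Otimes>\<^sub>M \<nu>)"
 using adapted by (simp add: adapted_density_def)

lemma d_density: "w \<in> space \<nu> \<Longrightarrow> cm_density (u w) (\<lambda>t. d t w)"
 using adapted by (simp add: adapted_density_def)

lemma u_measurable: "(\<lambda>w. u w t) \<in> borel_measurable \<nu>"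
proof (cases "t \<in> {0..1}")
 case True
 have "(\<lambda>b. b t) \<in> borel_measurable path_space"
  unfolding path_space_def by (intro measurable_restrict_space1 measurable_component_singleton True)
 with u_path show ?thesis by (rule measurable_compose)
next
 case False
 have "u w t = undefined" if "w \<in> space \<nu>" for w
  using path_spaceD(2)[OF measurable_space[OF u_path that]] False by (auto simp: extensional_def)
 then show ?thesis by (simp cong: measurable_cong)
qed

lemma AE_bounded: "AE w in \<nu>. AE t in leb01. norm (d t w) \<le> C"
proof -
 interpret L: finite_measure leb01 by (rule finite_leb01)
 interpret P: pair_sigma_finite leb01 \<nu> ..
 note [measurable] = d_measurable
 have "AE t in leb01. AE w in \<nu>. norm (d t w) \<le> C" using P.AE_pair[OF bounded] by simp
 moreover have "{x \<in> space (leb01 \<Otimes>\<^sub>M \<nu>). norm (d (fst x) (snd x)) \<le> C} \<in> sets (leb01 \<Otimes>\<^sub>M \<nu>)"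
  by measurable
 ultimately show ?thesis by (subst (asm) P.AE_commute)
qed

lemma energy_measurable: "(\<lambda>w. cm_norm_sq (u w)) \<in> borel_measurable \<nu>"
proof -
 interpret L: finite_measure leb01 by (rule finite_leb01)
 have [measurable]: "(\<lambda>(w, t). d t w) \<in> borel_measurable (\<nu> \<Otimes>\<^sub>M leb01)"
  using measurable_pair_swap[OF d_measurable] by simp
 have "(\<lambda>w. \<integral>t. (norm (d t w))\<^sup>2 \<partial>leb01) \<in> borel_measurable \<nu>" by measurable
 then show ?thesis by (subst measurable_cong[OF cm_norm_sq_eq[OF d_density]])
qed

lemma energy_nonneg: "0 \<le> cm_norm_sq (u w)"
 unfolding cm_norm_sq_def by (intro integral_nonneg_AE AE_I2) auto

lemma indicator_energy_le:
 assumes w: "w \<in> space \<nu>" "AE t in leb01. norm (d t w) \<le> C" and st: "0 \<le> s" "s \<le> t" "t \<le> 1"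
 shows "(\<integral>r. indicator {s<..t} r * (norm (d r w))\<^sup>2 \<partial>leb01) \<le> C\<^sup>2 * (t - s)"
proof -
 interpret L: finite_measure leb01 by (rule finite_leb01)
 note J = measure_leb01_Ioc[OF st]
 have "integrable leb01 (\<lambda>r. indicator {s<..t} r * (norm (d r w))\<^sup>2)"
  using integrable_mult_indicator[OF J(1), of "\<lambda>r. (norm (d r w))\<^sup>2"] d_density[OF w(1)] by (simp add: cm_density_def)
 moreover have "integrable leb01 (\<lambda>r. C\<^sup>2 * indicator {s<..t} r :: real)"
  by (intro integrable_mult_right integrable_indicator_leb01 J)
 ultimately have "(\<integral>r. indicator {s<..t} r * (norm (d r w))\<^sup>2 \<partial>leb01) \<le> (\<integral>r. C\<^sup>2 * indicator {s<..t} r \<partial>leb01)"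
 proof (rule integral_mono_AE)
  show "AE r in leb01. indicator {s<..t} r * (norm (d r w))\<^sup>2 \<le> C\<^sup>2 * indicator {s<..t} r"
   using w(2) by eventually_elim (auto simp: indicator_def intro!: power_mono)
 qed
 then show ?thesis by (simp only: integral_mult_right_zero integral_indicator_leb01[OF st])
qed

lemma energy_bound: "AE w in \<nu>. cm_norm_sq (u w) \<le> C\<^sup>2"
 using AE_bounded AE_space
proof eventually_elim
 case (elim w)
 have "cm_norm_sq (u w) = (\<integral>r. (norm (d r w))\<^sup>2 \<partial>leb01)" by (rule cm_norm_sq_eq[OF d_density[OF elim(2)]])
 also have "\<dots> \<le> (\<integral>r. C\<^sup>2 \<partial>leb01)"
 proof (rule integral_mono_AE)
  interpret L: finite_measure leb01 by (rule finite_leb01)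
  show "integrable leb01 (\<lambda>r. (norm (d r w))\<^sup>2)" using d_density[OF elim(2)] by (simp add: cm_density_def)
  show "integrable leb01 (\<lambda>r. C\<^sup>2)" by simp
  show "AE r in leb01. (norm (d r w))\<^sup>2 \<le> C\<^sup>2" using elim(1) by eventually_elim (auto intro: power_mono)
 qed
 also have "\<dots> = C\<^sup>2" by (simp add: measure_restrict_space)
 finally show ?case .
qed

lemma u_lipschitz: "AE w in \<nu>. \<forall>s t. 0 \<le> s \<longrightarrow> s \<le> t \<longrightarrow> t \<le> 1 \<longrightarrow> norm (u w t - u w s) \<le> C * (t - s)"
 using AE_bounded AE_space
proof (eventually_elim, intro allI impI)
 fix w s and t :: real assume w: "AE t in leb01. norm (d t w) \<le> C" "w \<in> space \<nu>" and st: "0 \<le> s" "s \<le> t" "t \<le> 1"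
 have "(norm (u w t - u w s))\<^sup>2 \<le> (t - s) * (\<integral>r. indicator {s<..t} r * (norm (d r w))\<^sup>2 \<partial>leb01)"
  by (rule cm_increment_sq[OF d_density[OF w(2)] st])
 also have "\<dots> \<le> (t - s) * (C\<^sup>2 * (t - s))"
  using st by (intro mult_left_mono indicator_energy_le w) auto
 also have "\<dots> = (C * (t - s))\<^sup>2" by (simp add: power2_eq_square)
 finally show "norm (u w t - u w s) \<le> C * (t - s)"
  by (rule power2_le_imp_le) (use C st in \<open>simp add: mult_nonneg_nonneg\<close>)
qed

text \<open>The density is bounded only almost everywhere, so its coordinates are first clamped to
  make \<open>integral_adapted\<close> applicable. The clamped integral agrees with the coordinate
  of \<open>u\<close> almost surely, and the filtration contains the null sets.\<close>

lemma u_FB: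
 assumes t: "t \<in> {0..1}"
 shows "(\<lambda>w. u w t) \<in> borel_measurable (FB t)"
 unfolding borel_measurable_euclidean_space[of "\<lambda>w. u w t"]
proof
 fix e :: "real ^ 'n" assume "e \<in> Basis"
 then have e: "norm e = 1" by simp
 define \<phi> where "\<phi> s w = max (- C) (min (d s w \<bullet> e) C)" for s w
 have "(\<lambda>w. \<integral>s. indicator {0..t} s * \<phi> s w \<partial>leb01) \<in> borel_measurable (FB t)"
 proof (rule integral_adapted)
  note [measurable] = d_measurable
  show "(\<lambda>(s, w). \<phi> s w) \<in> borel_measurable (leb01 \<Otimes>\<^sub>M \<nu>)" unfolding \<phi>_def by measurable
  show "\<phi> s \<in> borel_measurable (FB t)" if s: "s \<in> {0..t}" for s
  proof -
   have "d s \<in> borel_measurable (coord_filtration \<nu> s)" using adapted s t by (simp add: adapted_density_def)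
   then have "d s \<in> borel_measurable (FB s)" using coord_filtration_measurable_eq[of s] s t by auto
   then have [measurable]: "d s \<in> borel_measurable (FB t)" by (rule measurable_filtration_mono[rotated]) (use s in simp)
   show ?thesis unfolding \<phi>_def[abs_def] by measurable
  qed
  show "\<bar>\<phi> s w\<bar> \<le> C" for s w using C by (auto simp: \<phi>_def)
 qed
 moreover have "AE w in \<nu>. (\<integral>s. indicator {0..t} s * \<phi> s w \<partial>leb01) = u w t \<bullet> e"
  using AE_bounded AE_space
 proof eventually_elim
  case (elim w)
  note g = d_density[OF elim(2)]
  have i: "integrable leb01 (\<lambda>r. indicator {0..t} r *\<^sub>R d r w)"
   by (intro integrable_mult_indicator Icc_sets_leb01 cm_density_integrable[OF g]) (use t in simp)
  have "u w t = (\<integral>r. indicator {0..t} r *\<^sub>R d r w \<partial>leb01)"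
   using g t unfolding cm_density_def set_lebesgue_integral_def by auto
  then have "u w t \<bullet> e = (\<integral>r. (indicator {0..t} r *\<^sub>R d r w) \<bullet> e \<partial>leb01)"
   by (simp only: integral_inner_left[OF i])
  also have "\<dots> = (\<integral>s. indicator {0..t} s * \<phi> s w \<partial>leb01)"
  proof (rule integral_cong_AE)
   show "(\<lambda>r. indicator {0..t} r *\<^sub>R d r w \<bullet> e) \<in> borel_measurable leb01"
    using borel_measurable_integrable[OF i] by measurable
   have [measurable]: "(\<lambda>s. d s w) \<in> borel_measurable leb01" using measurable_Pair1[OF d_measurable elim(2)] by simp
   have [measurable]: "(\<lambda>s. indicator {0..t} s :: real) \<in> borel_measurable leb01" by (rule measurable_leb01) simp
   have "(\<lambda>s. \<phi> s w) \<in> borel_measurable leb01"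
    unfolding \<phi>_def by (intro borel_measurable_max borel_measurable_min borel_measurable_const borel_measurable_inner) simp_all
   then show "(\<lambda>s. indicator {0..t} s * \<phi> s w) \<in> borel_measurable leb01" by measurable
   show "AE r in leb01. indicator {0..t} r *\<^sub>R d r w \<bullet> e = indicator {0..t} r * \<phi> r w"
    using elim(1)
   proof eventually_elim
    case (elim r)
    then have "\<bar>d r w \<bullet> e\<bar> \<le> C" using Cauchy_Schwarz_ineq2[of "d r w" e] e by simp
    then show ?case by (simp add: \<phi>_def)
   qed
  qed
  finally show ?case by simp
 qed
 ultimately show "(\<lambda>w. u w t \<bullet> e) \<in> borel_measurable (FB t)" by (rule filtration_AE_cong)
qed

text \<open>Shifting the increments of \<open>u\<close> by one grid step makes the drift predictable.\<close>

definition xi :: "nat \<Rightarrow> nat \<Rightarrow> (real \<Rightarrow> real ^ 'n) \<Rightarrow> real ^ 'n" where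
 "xi N s w = (case s of 0 \<Rightarrow> 0 | Suc i \<Rightarrow>
   (let v = real N *\<^sub>R (u w (real (Suc i) / real N) - u w (real i / real N)) in if norm v \<le> C then v else 0))"

text \<open>The cut-off in \<open>xi\<close> gives the bound at every path and index; by
  \<open>u_lipschitz\<close> it acts only on a null set.\<close>

lemma xi_bound: "norm (xi N s w) \<le> C"
 unfolding xi_def Let_def using C by (cases s) simp_all

lemma xi_grid_drift:
 assumes N: "N > 0"
 shows "grid_drift \<nu> \<beta> N (xi N) C"
proof
 fix s assume s: "s < N"
 show "xi N s \<in> borel_measurable (FB (real s / real N))"
 proof (cases s)
  case (Suc i)
  have [measurable]: "(\<lambda>w. u w (real (Suc i) / real N)) \<in> borel_measurable (FB (real (Suc i) / real N))"
   using u_FB[of "real (Suc i) / real N"] s Suc by simp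
  have [measurable]: "(\<lambda>w. u w (real i / real N)) \<in> borel_measurable (FB (real (Suc i) / real N))"
   by (rule measurable_filtration_mono[OF _ u_FB]) (use s Suc in \<open>auto intro: divide_right_mono\<close>)
  show ?thesis unfolding xi_def[abs_def] Suc nat.case Let_def by measurable
 qed (simp add: xi_def[abs_def])
qed (use N C xi_bound in auto)

lemma xi_0: "xi N 0 w = 0" by (simp add: xi_def)

text \<open>Cauchy-Schwarz on each cell. Because of the delay, index \<open>s\<close> uses the cell
  before it: index 0 contributes nothing and only the first \<open>N - 1\<close> cells occur, while
  the cut-off can only lower the energy.\<close>

lemma xi_energy:
 assumes N: "N > 0" and w: "w \<in> space \<nu>"
 shows "(\<Sum>s<N. (1 / real N) * (xi N s w \<bullet> xi N s w)) \<le> cm_norm_sq (u w)"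
proof -
 note g = d_density[OF w]
 let ?E = "\<lambda>a b. (\<integral>r. indicator {a<..b} r * (norm (d r w))\<^sup>2 \<partial>leb01)"
 have sets: "{a<..b} \<in> sets leb01" if "0 \<le> a" "a \<le> b" "b \<le> 1" for a b :: real using measure_leb01_Ioc[OF that] by simp
 have i0: "integrable leb01 (\<lambda>r. (norm (d r w))\<^sup>2)" using g by (simp add: cm_density_def)
 have i: "integrable leb01 (\<lambda>r. indicator {a<..b} r * (norm (d r w))\<^sup>2)" if "0 \<le> a" "a \<le> b" "b \<le> 1" for a b :: real
  using integrable_mult_indicator[OF sets[OF that] i0] by simp
 have step: "(1 / real N) * (xi N (Suc k) w \<bullet> xi N (Suc k) w) \<le> ?E (real k / real N) (real (Suc k) / real N)"
  if k: "Suc k \<le> N" for k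
 proof -
  let ?v = "u w (real (Suc k) / real N) - u w (real k / real N)"
  have "xi N (Suc k) w \<bullet> xi N (Suc k) w \<le> (real N *\<^sub>R ?v) \<bullet> (real N *\<^sub>R ?v)"
   unfolding xi_def nat.case Let_def by simp
  then have "(1 / real N) * (xi N (Suc k) w \<bullet> xi N (Suc k) w) \<le> (1 / real N) * ((real N *\<^sub>R ?v) \<bullet> (real N *\<^sub>R ?v))"
   by (intro mult_left_mono) auto
  also have "\<dots> = real N * (norm ?v)\<^sup>2" using N by (simp add: power2_norm_eq_inner)
  also have "\<dots> \<le> real N * ((real (Suc k) / real N - real k / real N) * ?E (real k / real N) (real (Suc k) / real N))"
   using k N by (intro mult_left_mono cm_increment_sq[OF g]) (auto intro: divide_right_mono)
  also have "\<dots> = ?E (real k / real N) (real (Suc k) / real N)" using N by (simp add: field_simps)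
  finally show ?thesis .
 qed
 have sum: "(\<Sum>s<Suc k. (1 / real N) * (xi N s w \<bullet> xi N s w)) \<le> ?E 0 (real k / real N)" if "k \<le> N" for k
  using that
 proof (induction k)
  case 0
  then show ?case by (simp add: xi_0)
 next
  case (Suc k)
  let ?a = "real k / real N" and ?b = "real (Suc k) / real N"
  have ab: "0 \<le> ?a" "?a \<le> ?b" "?b \<le> 1" "?a \<le> 1" using Suc N by (auto intro: divide_right_mono)
  have "(\<Sum>s<Suc (Suc k). (1 / real N) * (xi N s w \<bullet> xi N s w)) \<le> ?E 0 ?a + ?E ?a ?b"
   unfolding sum.lessThan_Suc[of _ "Suc k"] using Suc by (intro add_mono step) auto
  also have "\<dots> = (\<integral>r. indicator {0<..?a} r * (norm (d r w))\<^sup>2 + indicator {?a<..?b} r * (norm (d r w))\<^sup>2 \<partial>leb01)"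
   using i[of 0 ?a] i[of ?a ?b] ab by simp
  also have "\<dots> = ?E 0 ?b"
   using ab by (intro Bochner_Integration.integral_cong refl) (auto simp: indicator_def divide_less_0_iff)
  finally show ?case .
 qed
 have "(\<Sum>s<N. (1 / real N) * (xi N s w \<bullet> xi N s w)) \<le> (\<Sum>s<Suc (N - 1). (1 / real N) * (xi N s w \<bullet> xi N s w))"
  using N by simp
 also have "\<dots> \<le> ?E 0 (real (N - 1) / real N)" by (rule sum) simp
 also have "\<dots> \<le> (\<integral>r. (norm (d r w))\<^sup>2 \<partial>leb01)"
 proof (rule integral_mono[OF i i0])
  show "real (N - 1) / real N \<le> 1" using N by (simp add: divide_le_eq_1)
  show "indicator {0<..real (N - 1) / real N} r * (norm (d r w))\<^sup>2 \<le> (norm (d r w))\<^sup>2" for r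
   by (cases "r \<in> {0<..real (N - 1) / real N}") simp_all
 qed simp_all
 finally show ?thesis unfolding cm_norm_sq_eq[OF g] .
qed

text \<open>The increments telescope, so the delayed polygon at a grid point equals \<open>u\<close>
  at the preceding one; the Lipschitz bound over one cell is \<open>C / real N\<close>.\<close>

lemma xi_path:
 assumes N: "N > 0"
 shows "AE w in \<nu>. \<forall>k\<le>N. norm (grid_path N (\<lambda>s. xi N s w) (real k / real N) - u w (real k / real N)) \<le> C / real N"
 using u_lipschitz AE_space
proof (eventually_elim, intro allI impI)
 fix w k assume lip: "\<forall>s t. 0 \<le> s \<longrightarrow> s \<le> t \<longrightarrow> t \<le> 1 \<longrightarrow> norm (u w t - u w s) \<le> C * (t - s)"
  and w: "w \<in> space \<nu>" and k: "k \<le> N"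
 let ?p = "grid_path N (\<lambda>s. xi N s w)"
 have u0: "u w 0 = 0" by (rule cm_zero[OF d_density[OF w]])
 have step: "norm (u w (real (Suc i) / real N) - u w (real i / real N)) \<le> C / real N" if "Suc i \<le> N" for i
 proof -
  have "norm (u w (real (Suc i) / real N) - u w (real i / real N)) \<le> C * (real (Suc i) / real N - real i / real N)"
   using lip[rule_format, of "real i / real N" "real (Suc i) / real N"] that N by (auto simp: divide_right_mono)
  then show ?thesis by (simp add: diff_divide_distrib[symmetric])
 qed
 have xiS: "(1 / real N) *\<^sub>R xi N (Suc i) w = u w (real (Suc i) / real N) - u w (real i / real N)" if "Suc i \<le> N" for i
 proof -
  have "norm (real N *\<^sub>R (u w (real (Suc i) / real N) - u w (real i / real N))) \<le> C"
   using mult_left_mono[OF step[OF that], of "real N"] N by simp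
  then show ?thesis using N unfolding xi_def nat.case Let_def by simp
 qed
 have pinc: "?p (real (Suc s) / real N) - ?p (real s / real N) = (1 / real N) *\<^sub>R xi N s w" if "s < N" for s
  using inc_grid_path[OF N that, of "\<lambda>s. xi N s w"] that by (simp add: inc_def add.commute)
 have p0: "?p 0 = 0"
 proof -
  have "min 0 (real (Suc i) / real N) - min 0 (real i / real N) = 0" for i by simp
  then have "(\<Sum>i<N. (min 0 (real (Suc i) / real N) - min 0 (real i / real N)) *\<^sub>R xi N i w) = 0"
   by (intro sum.neutral ballI) (simp only: scaleR_zero_left)
  then show ?thesis unfolding grid_path_def restrict_def by (simp only: atLeastAtMost_iff) simp
 qed
 have pS: "?p (real (Suc i) / real N) = u w (real i / real N)" if "Suc i \<le> N" for i
  using that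
 proof (induction i)
  case 0
  then show ?case using pinc[of 0] N by (simp add: p0 u0 xi_0)
 next
  case (Suc i)
  then have a: "Suc i < N" "Suc i \<le> N" by auto
  from pinc[OF a(1)] xiS[OF a(2)] have "?p (real (Suc (Suc i)) / real N) - ?p (real (Suc i) / real N)
   = u w (real (Suc i) / real N) - u w (real i / real N)" by (rule trans)
  then show ?case unfolding Suc.IH[OF a(2)] by (simp only: diff_eq_eq diff_add_cancel)
 qed
 show "norm (?p (real k / real N) - u w (real k / real N)) \<le> C / real N"
 proof (cases k)
  case 0
  then show ?thesis using C by (simp add: p0 u0)
 next
  case (Suc i)
  then show ?thesis using pS[of i] step[of i] k by (simp only: norm_minus_commute)
 qed
qed

end

lemma powr_lipschitz:
 fixes x y :: real
 assumes p: "p > 1" and x: "0 \<le> x" "x \<le> R" and y: "0 \<le> y"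
 shows "x powr p \<le> y powr p + p * R powr (p - 1) * \<bar>x - y\<bar>"
proof (cases "x \<le> y")
 case True
 then have "x powr p \<le> y powr p" using p x by (intro powr_mono2) auto
 then show ?thesis using p by (simp add: add_increasing2)
next
 case False
 then have x0: "0 < x" using y by simp
 show ?thesis
 \<comment> \<open>The mean value theorem needs a positive base for the derivative of
   \<open>powr\<close>, so the end point 0 is treated directly.\<close>
 proof (cases "y = 0")
  case True
  have "x powr p = x * x powr (p - 1)" using x0 by (simp add: powr_diff)
  also have "\<dots> \<le> x * R powr (p - 1)" using x p by (intro mult_left_mono powr_mono2) auto
  also have "\<dots> \<le> p * (x * R powr (p - 1))" using mult_right_mono[of 1 p "x * R powr (p - 1)"] p x by simp
  finally show ?thesis using True x0 p by (simp add: mult_ac)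
 next
  case False
  then have y0: "0 < y" using y by simp
  have "\<exists>z. y < z \<and> z < x \<and> x powr p - y powr p = (x - y) * (p * z powr (p - 1))"
  proof (rule MVT2)
   show "y < x" using \<open>\<not> x \<le> y\<close> by simp
   show "((\<lambda>x. x powr p) has_real_derivative p * z powr (p - 1)) (at z)" if "y \<le> z" "z \<le> x" for z
    using that y0 by (intro has_real_derivative_powr) simp
  qed
  then obtain z where z: "y < z" "z < x" "x powr p - y powr p = (x - y) * (p * z powr (p - 1))" by blast
  have "z powr (p - 1) \<le> R powr (p - 1)" using z y0 x p by (intro powr_mono2) auto
  then have "(x - y) * (p * z powr (p - 1)) \<le> (x - y) * (p * R powr (p - 1))"
   using p \<open>\<not> x \<le> y\<close> by (intro mult_left_mono) auto
  then show ?thesis using z(3) \<open>\<not> x \<le> y\<close> by (simp add: mult_ac)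
 qed
qed

context bounded_drift
begin

lemma energy_integrable: "integrable \<nu> (\<lambda>w. cm_norm_sq (u w) / 2)"
proof (rule integrable_const_bound)
 show "AE w in \<nu>. norm (cm_norm_sq (u w) / 2) \<le> C\<^sup>2"
  using energy_bound
 proof eventually_elim
  case (elim w)
  then show ?case using energy_nonneg[of w] by simp
 qed
qed (use energy_measurable in measurable)

lemma trig_shift_measurable:
 assumes "P \<in> trig" shows "(\<lambda>w. P (path_add (\<beta> w) (u w))) \<in> borel_measurable \<nu>"
proof (rule trig_measurable[OF assms])
 fix t :: real assume t: "t \<in> {0..1}"
 note [measurable] = u_measurable B_measurable
 show "(\<lambda>w. path_add (\<beta> w) (u w) t) \<in> borel_measurable \<nu>"
  using t by (simp add: path_add_def)
qed

definition moment_const :: "real \<Rightarrow> real" where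
 "moment_const p = exp (((1 / (p - 1))\<^sup>2 + 1 / (p - 1)) * C\<^sup>2 / 2)"

text \<open>The two inequalities that pass to limits: the variational bound for the lower estimate,
  and a moment bound that later gives integrability of unbounded functions along the shift. The
  slack \<epsilon> pays for the delay.\<close>

definition shift_bounds :: "((real \<Rightarrow> real ^ 'n) \<Rightarrow> real) \<Rightarrow> real \<Rightarrow> bool" where
 "shift_bounds g \<epsilon> \<longleftrightarrow>
   - ln (\<integral>w. exp (- g (\<beta> w)) \<partial>\<nu>)
    \<le> (\<integral>w. g (path_add (\<beta> w) (u w)) \<partial>\<nu>) + (\<integral>w. cm_norm_sq (u w) / 2 \<partial>\<nu>) + \<epsilon> \<and>
   (\<forall>p>1. (\<integral>\<^sup>+w. ennreal \<bar>g (path_add (\<beta> w) (u w))\<bar> \<partial>\<nu>)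
    \<le> (\<integral>\<^sup>+w. ennreal (\<bar>g (\<beta> w)\<bar> powr p) \<partial>\<nu>) + ennreal (moment_const p) + ennreal \<epsilon>)"

text \<open>The predictable drift \<open>xi N\<close> satisfies \<open>entropy_bound\<close> and
  \<open>moment_bound\<close> exactly. Its path differs from \<open>u\<close> by at most
  \<open>C / N\<close> at grid points, which the Lipschitz bound of \<open>g\<close> turns into
  \<epsilon>, and its energy does not exceed that of \<open>u\<close>.\<close>

lemma grid_comparison:
 assumes N: "N > 0" and \<Phi>: "\<Phi> \<in> borel_measurable seq_space" "\<And>x. \<bar>\<Phi> x\<bar> \<le> R"
  and g: "\<And>b. g b = \<Phi> (inc N b)"
  and lip: "\<And>b b' e. (\<forall>k\<le>N. norm (b (real k / real N) - b' (real k / real N)) \<le> e) \<Longrightarrow> \<bar>g b - g b'\<bar> \<le> L * e"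
  and gm: "(\<lambda>w. g (path_add (\<beta> w) (u w))) \<in> borel_measurable \<nu>"
  and \<epsilon>: "L * (C / real N) \<le> \<epsilon>" and \<epsilon>0: "0 \<le> \<epsilon>"
 shows "shift_bounds g \<epsilon>"
proof -
 interpret D: grid_drift \<nu> \<beta> N "xi N" C by (rule xi_grid_drift[OF N])
 interpret CM: prob_space "completion \<nu>" by (rule prob_space_completion)
 define Yp where "Yp w = path_add (\<beta> w) (grid_path N (\<lambda>s. xi N s w))" for w
 define X where "X w = g (path_add (\<beta> w) (u w))" for w
 have Xm [measurable]: "X \<in> borel_measurable \<nu>" using gm by (simp add: X_def[abs_def])
 have XC [measurable]: "X \<in> borel_measurable (completion \<nu>)" by (rule measurable_completion[OF Xm])
 have Y: "D.Y N w = inc N (Yp w)" for w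
 proof
  fix s
  show "D.Y N w s = inc N (Yp w) s"
  proof (cases "s < N")
   case True
   show ?thesis unfolding Yp_def inc_path_add[OF N] inc_grid_path[OF N True] using True by (simp add: D.Y_def D.D_def)
  next
   case False
   then show ?thesis by (simp add: D.Y_def inc_def)
  qed
 qed
 have gY: "\<Phi> (D.Y N w) = g (Yp w)" for w by (simp only: Y g)
 have Ym [measurable]: "(\<lambda>w. g (Yp w)) \<in> borel_measurable (completion \<nu>)"
  unfolding gY[symmetric]
  by (rule measurable_compose[OF measurable_FB_completion[OF D.Y_measurable[OF order_refl]] \<Phi>(1)])
 have gb: "\<bar>g b\<bar> \<le> R" for b unfolding g by (rule \<Phi>)
 have close: "AE w in \<nu>. \<bar>g (Yp w) - X w\<bar> \<le> \<epsilon>"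
  using xi_path[OF N]
 proof eventually_elim
  case (elim w)
  have "\<bar>g (Yp w) - X w\<bar> \<le> L * (C / real N)"
   unfolding X_def
  proof (rule lip, intro allI impI)
   fix k assume k: "k \<le> N"
   then have "real k / real N \<in> {0..1}" using N by (simp add: divide_le_eq_1)
   then show "norm (Yp w (real k / real N) - path_add (\<beta> w) (u w) (real k / real N)) \<le> C / real N"
    using elim[rule_format, OF k] by (simp add: Yp_def path_add_def)
  qed
  then show ?case using \<epsilon> by linarith
 qed
 have closeC: "AE w in completion \<nu>. \<bar>g (Yp w) - X w\<bar> \<le> \<epsilon>" by (rule AE_completion[OF close])
 have iX: "integrable (completion \<nu>) X" by (rule CM.integrable_const_bound[of _ R]) (use gb in \<open>auto simp: X_def\<close>)
 have iY: "integrable (completion \<nu>) (\<lambda>w. g (Yp w))" by (rule CM.integrable_const_bound[of _ R]) (use gb in auto)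
 have gB: "(\<lambda>w. g (\<beta> w)) \<in> borel_measurable \<nu>"
  unfolding g using measurable_compose[OF inc_beta_measurable \<Phi>(1)] .
 have eB: "(\<integral>w. exp (- g (\<beta> w)) \<partial>completion \<nu>) = (\<integral>w. exp (- g (\<beta> w)) \<partial>\<nu>)"
  by (rule integral_completion) (use gB in measurable)
 have "(\<integral>w. g (Yp w) \<partial>completion \<nu>) \<le> (\<integral>w. X w + \<epsilon> \<partial>completion \<nu>)"
  by (rule integral_mono_AE[OF iY]) (use iX closeC in \<open>auto elim!: eventually_mono\<close>)
 also have "\<dots> = (\<integral>w. X w \<partial>\<nu>) + \<epsilon>"
  using iX CM.prob_space integral_completion[OF Xm] by simp
 finally have 1: "(\<integral>w. g (Yp w) \<partial>completion \<nu>) \<le> (\<integral>w. X w \<partial>\<nu>) + \<epsilon>" .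
 have em: "(\<lambda>w. cm_norm_sq (u w) / 2) \<in> borel_measurable \<nu>" using energy_measurable by measurable
 have "(\<integral>w. D.Q N w \<partial>completion \<nu>) \<le> (\<integral>w. cm_norm_sq (u w) / 2 \<partial>completion \<nu>)"
 proof (rule integral_mono[OF D.integrable_Q(1)[OF order_refl]])
  show "integrable (completion \<nu>) (\<lambda>w. cm_norm_sq (u w) / 2)"
   using energy_integrable by (subst integrable_completion[OF em])
  fix w assume w: "w \<in> space (completion \<nu>)"
  have "D.Q N w = (\<Sum>s<N. (1 / real N) * (xi N s w \<bullet> xi N s w)) / 2"
   by (simp add: D.Q_def sum_divide_distrib)
  also have "\<dots> \<le> cm_norm_sq (u w) / 2" using xi_energy[OF N, of w] w by simp
  finally show "D.Q N w \<le> cm_norm_sq (u w) / 2" .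
 qed
 then have 2: "(\<integral>w. D.Q N w \<partial>completion \<nu>) \<le> (\<integral>w. cm_norm_sq (u w) / 2 \<partial>\<nu>)"
  unfolding integral_completion[OF em] .
 have E: "exp (- ((\<integral>w. g (Yp w) \<partial>completion \<nu>) + (\<integral>w. D.Q N w \<partial>completion \<nu>))) \<le> (\<integral>w. exp (- g (\<beta> w)) \<partial>\<nu>)"
  using D.entropy_bound[OF \<Phi>] unfolding gY g[symmetric] eB .
 then have "0 < (\<integral>w. exp (- g (\<beta> w)) \<partial>\<nu>)" using exp_gt_zero order_less_le_trans by blast
 with E have "- ((\<integral>w. g (Yp w) \<partial>completion \<nu>) + (\<integral>w. D.Q N w \<partial>completion \<nu>)) \<le> ln (\<integral>w. exp (- g (\<beta> w)) \<partial>\<nu>)"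
  by (simp add: ln_ge_iff)
 then have "- ln (\<integral>w. exp (- g (\<beta> w)) \<partial>\<nu>) \<le> (\<integral>w. X w \<partial>\<nu>) + (\<integral>w. cm_norm_sq (u w) / 2 \<partial>\<nu>) + \<epsilon>"
  using 1 2 by linarith
 moreover have "(\<integral>\<^sup>+w. ennreal \<bar>X w\<bar> \<partial>\<nu>) \<le> (\<integral>\<^sup>+w. ennreal (\<bar>g (\<beta> w)\<bar> powr p) \<partial>\<nu>) + ennreal (moment_const p) + ennreal \<epsilon>"
  if p: "p > 1" for p
 proof -
  have "(\<integral>\<^sup>+w. ennreal \<bar>X w\<bar> \<partial>\<nu>) = (\<integral>\<^sup>+w. ennreal \<bar>X w\<bar> \<partial>completion \<nu>)"
   by (rule nn_integral_completion[symmetric])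
  also have "\<dots> \<le> (\<integral>\<^sup>+w. ennreal \<bar>g (Yp w)\<bar> + ennreal \<epsilon> \<partial>completion \<nu>)"
   using closeC \<epsilon>0 by (intro nn_integral_mono_AE)
    (auto elim!: eventually_mono simp: ennreal_plus[symmetric] simp del: ennreal_plus intro!: ennreal_leI)
  also have "\<dots> = (\<integral>\<^sup>+w. ennreal \<bar>g (Yp w)\<bar> \<partial>\<nu>) + ennreal \<epsilon>"
   by (subst nn_integral_add) (simp_all add: nn_integral_completion emeasure_space_1)
  also have "(\<integral>\<^sup>+w. ennreal \<bar>g (Yp w)\<bar> \<partial>\<nu>)
    \<le> (\<integral>\<^sup>+w. ennreal (\<bar>g (\<beta> w)\<bar> powr p) \<partial>\<nu>) + ennreal (moment_const p)"
   using D.moment_bound[OF \<Phi>(1) p] unfolding gY g[symmetric] moment_const_def .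
  finally show ?thesis by (simp add: add_right_mono)
 qed
 ultimately show ?thesis unfolding shift_bounds_def X_def by blast
qed

text \<open>Clamping is a contraction, so it keeps the Lipschitz bound of \<open>P\<close> and the
  dependence on grid increments; the grid is then refined until
  \<open>L * (C / real (K * m)) \<le> \<epsilon>\<close>.\<close>

lemma clamped_trig_bounds:
 assumes P: "P \<in> trig" and R: "0 \<le> R" and \<epsilon>: "\<epsilon> > 0"
 defines "g \<equiv> \<lambda>b. max (- R) (min (P b) R)"
 shows "shift_bounds g \<epsilon>"
proof -
 obtain K L where K: "K > 0" and L: "L \<ge> 0" and KL: "\<forall>m>0.
  (\<exists>G\<in>borel_measurable seq_space. \<forall>b. P b = G (inc (K * m) b)) \<and>
  (\<forall>b b' e. (\<forall>k\<le>K * m. norm (b (real k / real (K * m)) - b' (real k / real (K * m))) \<le> e) \<longrightarrow> \<bar>P b - P b'\<bar> \<le> L * e)"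
  using trig_grid[OF P] by (elim exE conjE)
 obtain m :: nat where m: "L * C / \<epsilon> < real m" using reals_Archimedean2 by blast
 have "0 \<le> L * C / \<epsilon>" using L C \<epsilon> by simp
 then have m0: "m > 0" using m by (cases m) auto
 have N: "K * m > 0" using K m0 by simp
 obtain G where G: "G \<in> borel_measurable seq_space" and PG: "\<forall>b. P b = G (inc (K * m) b)"
  using conjunct1[OF KL[THEN spec, THEN mp, OF m0]] by (elim bexE)
 note lipP = conjunct2[OF KL[THEN spec, THEN mp, OF m0], THEN spec, THEN spec, THEN spec, THEN mp]
 have small: "L * (C / real (K * m)) \<le> \<epsilon>"
 proof -
  have "real m \<le> real (K * m)" using K by (intro of_nat_mono) simp
  then have "real m * \<epsilon> \<le> real (K * m) * \<epsilon>" using \<epsilon> by (intro mult_right_mono) auto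
  moreover have "L * C < real m * \<epsilon>" using m \<epsilon> by (simp add: pos_divide_less_eq)
  ultimately have "L * C \<le> \<epsilon> * real (K * m)" by (simp only: mult.commute[of \<epsilon>])
  moreover have "0 < real (K * m)" using N by (simp only: of_nat_0_less_iff)
  ultimately show ?thesis by (simp only: times_divide_eq_right pos_divide_le_eq)
 qed
 note [measurable] = G trig_shift_measurable[OF P]
 have Gm: "(\<lambda>x. max (- R) (min (G x) R)) \<in> borel_measurable seq_space" by measurable
 have Gb: "\<bar>max (- R) (min (G x) R)\<bar> \<le> R" for x using R by auto
 have gG: "g b = max (- R) (min (G (inc (K * m) b)) R)" for b unfolding g_def PG[rule_format] ..
 have glip: "\<bar>g b - g b'\<bar> \<le> L * e"
  if "\<forall>k\<le>K * m. norm (b (real k / real (K * m)) - b' (real k / real (K * m))) \<le> e" for b b' e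
 proof -
  have "\<bar>g b - g b'\<bar> \<le> \<bar>P b - P b'\<bar>" by (auto simp: g_def max_def min_def)
  then show ?thesis using lipP[OF that] by linarith
 qed
 have gm: "(\<lambda>w. g (path_add (\<beta> w) (u w))) \<in> borel_measurable \<nu>" unfolding g_def by measurable
 show ?thesis by (rule grid_comparison[OF N Gm Gb gG glip gm small less_imp_le[OF \<epsilon>]])
qed

end

lemma exp_diff_le:
 fixes a b :: real
 assumes "\<bar>a\<bar> \<le> R"
 shows "exp (- a) \<le> exp (- b) + exp R * \<bar>b - a\<bar>"
proof -
 have "1 + (a - b) \<le> exp (a - b)" by (rule exp_ge_add_one_self)
 then have "exp (- a) * (1 + (a - b)) \<le> exp (- a) * exp (a - b)" by (intro mult_left_mono) auto
 then have "exp (- a) + exp (- a) * (a - b) \<le> exp (- b)" by (simp add: exp_add[symmetric] distrib_left)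
 moreover have "exp (- a) * (b - a) \<le> exp R * \<bar>b - a\<bar>"
  using assms by (intro order_trans[OF mult_left_mono[OF abs_ge_self] mult_right_mono]) auto
 ultimately show ?thesis by (simp add: algebra_simps)
qed

context bounded_drift
begin

text \<open>One trigonometric function is taken close to \<open>F\<close> both under \<nu> and under
  the image by \<open>U\<close>. Since \<open>\<beta> (U w)\<close> is the shifted path, it is then
  close to \<open>F (U w)\<close> along the shift as well. Clamping at \<open>R\<close> does not
  increase the distance to \<open>F\<close>.\<close>

lemma bounded_function_bounds:
 assumes U: "U \<in> measurable \<nu> path_space" and ac: "absolutely_continuous \<nu> (distr \<nu> path_space U)"
  and shift: "AE w in \<nu>. \<beta> (U w) = path_add (\<beta> w) (u w)"
  and F: "F \<in> borel_measurable \<nu>" and FR: "\<And>w. w \<in> space \<nu> \<Longrightarrow> \<bar>F w\<bar> \<le> R" and R: "0 \<le> R"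
 shows "- ln (\<integral>w. exp (- F w) \<partial>\<nu>) \<le> (\<integral>w. F (U w) \<partial>\<nu>) + (\<integral>w. cm_norm_sq (u w) / 2 \<partial>\<nu>)"
  "p > 1 \<Longrightarrow> (\<integral>\<^sup>+w. ennreal \<bar>F (U w)\<bar> \<partial>\<nu>)
   \<le> (\<integral>\<^sup>+w. ennreal (\<bar>F w\<bar> powr p) \<partial>\<nu>) + ennreal (moment_const p)"
proof -
 have UN: "U \<in> measurable \<nu> \<nu>" using U path_measurable_nu by blast
 note [measurable] = F
 have FU [measurable]: "(\<lambda>w. F (U w)) \<in> borel_measurable \<nu>" by (rule measurable_compose[OF UN F])
 have FUR: "\<bar>F (U w)\<bar> \<le> R" if "w \<in> space \<nu>" for w using FR measurable_space[OF UN that] by blast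
 have approx: "\<exists>g. (\<lambda>w. g (\<beta> w)) \<in> borel_measurable \<nu> \<and> (\<lambda>w. g (path_add (\<beta> w) (u w))) \<in> borel_measurable \<nu> \<and>
   (\<forall>b. \<bar>g b\<bar> \<le> R) \<and> (\<integral>w. \<bar>F w - g (\<beta> w)\<bar> \<partial>\<nu>) \<le> \<delta> \<and>
   (\<integral>w. \<bar>F (U w) - g (path_add (\<beta> w) (u w))\<bar> \<partial>\<nu>) \<le> \<delta> \<and>
   shift_bounds g \<delta>"
  if \<delta>: "\<delta> > 0" for \<delta>
 proof -
  interpret m2: prob_space "distr \<nu> path_space U" by (rule prob_space_distr[OF U])
  have s2: "sets (distr \<nu> path_space U) = sets \<nu>" using sets_nu by simp
  have ac0: "absolutely_continuous \<nu> \<nu>" by (simp add: absolutely_continuous_def)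
  have "\<exists>P\<in>trig. (\<integral>w. \<bar>F w - P (\<beta> w)\<bar> ^ 1 \<partial>\<nu>) < \<delta> \<and> (\<integral>w. \<bar>F w - P (\<beta> w)\<bar> ^ 1 \<partial>distr \<nu> path_space U) < \<delta>"
   by (rule trig_dense[OF finite_measure_axioms refl ac0 m2.finite_measure_axioms s2 ac F FR zero_less_one \<delta>])
  then obtain P where P: "P \<in> trig" and P1: "(\<integral>w. \<bar>F w - P (\<beta> w)\<bar> ^ 1 \<partial>\<nu>) < \<delta>"
   and P2: "(\<integral>w. \<bar>F w - P (\<beta> w)\<bar> ^ 1 \<partial>distr \<nu> path_space U) < \<delta>"
   by (elim bexE conjE)
  obtain CP where CP: "\<forall>b. \<bar>P b\<bar> \<le> CP" using trig_bounded[OF P] by blast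
  have Pm [measurable]: "(\<lambda>w. P (\<beta> w)) \<in> borel_measurable \<nu>" by (rule trig_beta_measurable[OF P])
  have PU [measurable]: "(\<lambda>w. P (\<beta> (U w))) \<in> borel_measurable \<nu>" by (rule measurable_compose[OF UN Pm])
  note [measurable] = trig_shift_measurable[OF P]
  define g where "g b = max (- R) (min (P b) R)" for b
  have le: "\<bar>a - g b\<bar> \<le> \<bar>a - P b\<bar>" if "\<bar>a\<bar> \<le> R" for a b using that by (auto simp: g_def max_def min_def)
  have gm: "(\<lambda>w. g (\<beta> w)) \<in> borel_measurable \<nu>" "(\<lambda>w. g (path_add (\<beta> w) (u w))) \<in> borel_measurable \<nu>"
   "(\<lambda>w. g (\<beta> (U w))) \<in> borel_measurable \<nu>"
   unfolding g_def by measurable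
  note [measurable] = gm
  have gb: "\<bar>g b\<bar> \<le> R" for b using R by (auto simp: g_def)
  have i: "integrable \<nu> F" "integrable \<nu> (\<lambda>w. F (U w))"
   by (rule integrable_const_bound[of _ R]; auto intro!: AE_I2 FR FUR)+
  have ig: "integrable \<nu> (\<lambda>w. g (\<beta> w))" "integrable \<nu> (\<lambda>w. g (\<beta> (U w)))"
   by (rule integrable_const_bound[of _ R]; auto intro!: AE_I2 gb)+
  have iP: "integrable \<nu> (\<lambda>w. P (\<beta> w))" "integrable \<nu> (\<lambda>w. P (\<beta> (U w)))"
   by (rule integrable_const_bound[of _ CP]; auto intro!: AE_I2 CP[rule_format])+
  have "(\<integral>w. \<bar>F w - g (\<beta> w)\<bar> \<partial>\<nu>) \<le> (\<integral>w. \<bar>F w - P (\<beta> w)\<bar> ^ 1 \<partial>\<nu>)"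
  proof (rule integral_mono)
   show "integrable \<nu> (\<lambda>w. \<bar>F w - g (\<beta> w)\<bar>)"
    using i ig by auto
   show "integrable \<nu> (\<lambda>w. \<bar>F w - P (\<beta> w)\<bar> ^ 1)"
    using i iP by auto
  qed (use le FR in auto)
  with P1 have 1: "(\<integral>w. \<bar>F w - g (\<beta> w)\<bar> \<partial>\<nu>) \<le> \<delta>" by linarith
  have "(\<integral>w. \<bar>F (U w) - g (path_add (\<beta> w) (u w))\<bar> \<partial>\<nu>) = (\<integral>w. \<bar>F (U w) - g (\<beta> (U w))\<bar> \<partial>\<nu>)"
  proof (rule integral_cong_AE)
   show "AE w in \<nu>. \<bar>F (U w) - g (path_add (\<beta> w) (u w))\<bar> = \<bar>F (U w) - g (\<beta> (U w))\<bar>"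
    using shift by eventually_elim simp
  qed measurable
  also have "\<dots> \<le> (\<integral>w. \<bar>F (U w) - P (\<beta> (U w))\<bar> ^ 1 \<partial>\<nu>)"
  proof (rule integral_mono)
   show "integrable \<nu> (\<lambda>w. \<bar>F (U w) - g (\<beta> (U w))\<bar>)"
    using i ig by auto
   show "integrable \<nu> (\<lambda>w. \<bar>F (U w) - P (\<beta> (U w))\<bar> ^ 1)"
    using i iP by auto
  qed (use le FUR in auto)
  also have "\<dots> = (\<integral>w. \<bar>F w - P (\<beta> w)\<bar> ^ 1 \<partial>distr \<nu> path_space U)"
  proof (rule integral_distr[OF U, symmetric])
   have "(\<lambda>w. \<bar>F w - P (\<beta> w)\<bar> ^ 1) \<in> borel_measurable \<nu>" by measurable
   then show "(\<lambda>w. \<bar>F w - P (\<beta> w)\<bar> ^ 1) \<in> borel_measurable path_space"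
    by (subst (asm) measurable_cong_sets[OF sets_nu refl])
  qed
  finally have 2: "(\<integral>w. \<bar>F (U w) - g (path_add (\<beta> w) (u w))\<bar> \<partial>\<nu>) \<le> \<delta>" using P2 by linarith
  note B = clamped_trig_bounds[OF P R \<delta>, folded g_def]
  show ?thesis
   by (rule exI[of _ g], intro conjI allI impI) (rule gm gb 1 2 B, assumption?)+
 qed
 define S where "S = (\<integral>w. cm_norm_sq (u w) / 2 \<partial>\<nu>)"
 have iFU: "integrable \<nu> (\<lambda>w. F (U w))" by (rule integrable_const_bound[of _ R]) (auto intro!: AE_I2 FUR)
 show "- ln (\<integral>w. exp (- F w) \<partial>\<nu>) \<le> (\<integral>w. F (U w) \<partial>\<nu>) + (\<integral>w. cm_norm_sq (u w) / 2 \<partial>\<nu>)"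
  unfolding S_def[symmetric]
 proof (rule field_le_epsilon)
  fix e :: real assume e: "e > 0"
  \<comment> \<open>One \<open>\<delta>\<close> is the slack of \<open>shift_bounds\<close>, one the
    error along the shift. The factor \<open>exp R * exp R\<close> is from the logarithm:
    \<open>exp_diff_le\<close> gives \<open>exp R\<close>, and so does division by
    \<open>cF \<ge> exp (- R)\<close>.\<close>
  define \<delta> where "\<delta> = e / (2 + exp R * exp R)"
  have den: "0 < 2 + exp R * exp R" by (simp add: add_pos_pos)
  have \<delta>: "\<delta> > 0" using e den by (simp add: \<delta>_def)
  have \<delta>e: "\<delta> + \<delta> + exp R * exp R * \<delta> = e"
  proof -
   have "\<delta> * (2 + exp R * exp R) = e"
    unfolding \<delta>_def times_divide_eq_left using den by (intro nonzero_mult_div_cancel_right) simp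
   then have "\<delta> * 2 + \<delta> * (exp R * exp R) = e" by (simp only: distrib_left)
   then show ?thesis by (simp add: mult.commute)
  qed
  obtain g where [measurable]: "(\<lambda>w. g (\<beta> w)) \<in> borel_measurable \<nu>" "(\<lambda>w. g (path_add (\<beta> w) (u w))) \<in> borel_measurable \<nu>"
   and gb: "\<forall>b. \<bar>g b\<bar> \<le> R" and g1: "(\<integral>w. \<bar>F w - g (\<beta> w)\<bar> \<partial>\<nu>) \<le> \<delta>"
   and g2: "(\<integral>w. \<bar>F (U w) - g (path_add (\<beta> w) (u w))\<bar> \<partial>\<nu>) \<le> \<delta>"
   and sb: "shift_bounds g \<delta>"
   using approx[OF \<delta>] by (elim exE conjE)
  have g3: "- ln (\<integral>w. exp (- g (\<beta> w)) \<partial>\<nu>) \<le> (\<integral>w. g (path_add (\<beta> w) (u w)) \<partial>\<nu>) + S + \<delta>"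
   using sb unfolding shift_bounds_def S_def by blast
  define cF where "cF = (\<integral>w. exp (- F w) \<partial>\<nu>)"
  define cg where "cg = (\<integral>w. exp (- g (\<beta> w)) \<partial>\<nu>)"
  have ex: "exp (- R) \<le> exp (- y)" "exp (- y) \<le> exp R" if "\<bar>y\<bar> \<le> R" for y :: real using that by auto
  have iF: "integrable \<nu> (\<lambda>w. exp (- F w))"
   by (rule integrable_const_bound[of _ "exp R"]) (auto intro!: AE_I2 ex(2)[unfolded exp_le_cancel_iff] FR)
  have ig: "integrable \<nu> (\<lambda>w. exp (- g (\<beta> w)))"
   by (rule integrable_const_bound[of _ "exp R"]) (auto intro!: AE_I2 ex(2)[unfolded exp_le_cancel_iff] gb[rule_format])
  have iX: "integrable \<nu> (\<lambda>w. g (path_add (\<beta> w) (u w)))"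
   by (rule integrable_const_bound[of _ R]) (auto intro!: AE_I2 gb[rule_format])
  have igB: "integrable \<nu> (\<lambda>w. g (\<beta> w))"
   by (rule integrable_const_bound[of _ R]) (auto intro!: AE_I2 gb[rule_format])
  have iF0: "integrable \<nu> F" by (rule integrable_const_bound[of _ R]) (auto intro!: AE_I2 FR)
  have iD: "integrable \<nu> (\<lambda>w. \<bar>F w - g (\<beta> w)\<bar>)" using iF0 igB by auto
  have P1: "prob (space \<nu>) = 1" by (rule prob_space)
  have cFR: "exp (- R) \<le> cF"
  proof -
   have "(\<integral>w. exp (- R) \<partial>\<nu>) \<le> cF" unfolding cF_def by (rule integral_mono[OF _ iF]) (use ex(1) FR in auto)
   then show ?thesis using P1 by simp
  qed
  have cgR: "exp (- R) \<le> cg"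
  proof -
   have "(\<integral>w. exp (- R) \<partial>\<nu>) \<le> cg" unfolding cg_def by (rule integral_mono[OF _ ig]) (use ex(1) gb in auto)
   then show ?thesis using P1 by simp
  qed
  have pos: "0 < cF" "0 < cg" using cFR cgR exp_gt_zero[of "- R"] by linarith+
  have "cg \<le> (\<integral>w. exp (- F w) + exp R * \<bar>F w - g (\<beta> w)\<bar> \<partial>\<nu>)"
   unfolding cg_def by (rule integral_mono[OF ig]) (use iF iD gb exp_diff_le in auto)
  also have "\<dots> = cF + exp R * (\<integral>w. \<bar>F w - g (\<beta> w)\<bar> \<partial>\<nu>)" using iF iD by (simp add: cF_def)
  also have "\<dots> \<le> cF + exp R * \<delta>" using g1 by simp
  finally have "cg / cF \<le> (cF + exp R * \<delta>) / cF" using pos by (intro divide_right_mono) auto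
  also have "\<dots> = 1 + exp R * \<delta> / cF" using pos by (simp add: add_divide_distrib)
  finally have "cg / cF - 1 \<le> exp R * \<delta> / cF" by linarith
  also have "\<dots> \<le> exp R * \<delta> * exp R"
  proof -
   have "inverse cF \<le> inverse (exp (- R))" using cFR by (intro le_imp_inverse_le) auto
   then have "exp R * \<delta> * inverse cF \<le> exp R * \<delta> * exp R" using \<delta> by (intro mult_left_mono) (auto simp: exp_minus)
   then show ?thesis by (simp add: divide_inverse)
  qed
  finally have "ln (cg / cF) \<le> exp R * exp R * \<delta>"
   using ln_le_minus_one[of "cg / cF"] pos by (simp add: mult_ac)
  then have l: "ln cg \<le> ln cF + exp R * exp R * \<delta>" using pos by (simp add: ln_div)
  have "(\<integral>w. g (path_add (\<beta> w) (u w)) \<partial>\<nu>) - (\<integral>w. F (U w) \<partial>\<nu>) = - (\<integral>w. F (U w) - g (path_add (\<beta> w) (u w)) \<partial>\<nu>)"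
   using iX iFU by simp
  also have "\<dots> \<le> (\<integral>w. \<bar>F (U w) - g (path_add (\<beta> w) (u w))\<bar> \<partial>\<nu>)"
   using integral_abs_bound[of \<nu> "\<lambda>w. F (U w) - g (path_add (\<beta> w) (u w))"] by linarith
  finally have "(\<integral>w. g (path_add (\<beta> w) (u w)) \<partial>\<nu>) \<le> (\<integral>w. F (U w) \<partial>\<nu>) + \<delta>" using g2 by linarith
  then show "- ln (\<integral>w. exp (- F w) \<partial>\<nu>) \<le> (\<integral>w. F (U w) \<partial>\<nu>) + S + e"
   using g3 l \<delta>e unfolding cF_def cg_def by linarith
 qed
 assume p: "p > 1"
 define Kc where "Kc = moment_const p"
 have Kc: "0 \<le> Kc" by (simp add: Kc_def moment_const_def)
 define Lp where "Lp = p * R powr (p - 1)"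
 have Lp: "0 \<le> Lp" using p by (simp add: Lp_def)
 show "(\<integral>\<^sup>+w. ennreal \<bar>F (U w)\<bar> \<partial>\<nu>)
   \<le> (\<integral>\<^sup>+w. ennreal (\<bar>F w\<bar> powr p) \<partial>\<nu>) + ennreal (moment_const p)"
  unfolding Kc_def[symmetric]
 proof (rule ennreal_le_epsilon)
  fix e :: real assume e: "e > 0"
  \<comment> \<open>Again one \<open>\<delta>\<close> for the slack and one for the error along the
    shift; \<open>Lp\<close> is the Lipschitz constant of \<open>powr\<close> on
    \<open>{0..R}\<close>, which compares the moments of \<open>g\<close> and
    \<open>F\<close>.\<close>
  define \<delta> where "\<delta> = e / (2 + Lp)"
  have \<delta>: "\<delta> > 0" using e Lp by (simp add: \<delta>_def)
  have \<delta>e: "Lp * \<delta> + \<delta> + \<delta> = e"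
  proof -
   have "\<delta> * (2 + Lp) = e"
    unfolding \<delta>_def times_divide_eq_left using Lp by (intro nonzero_mult_div_cancel_right) simp
   then have "\<delta> * 2 + \<delta> * Lp = e" by (simp only: distrib_left)
   then show ?thesis by (simp add: mult.commute)
  qed
  obtain g where [measurable]: "(\<lambda>w. g (\<beta> w)) \<in> borel_measurable \<nu>" "(\<lambda>w. g (path_add (\<beta> w) (u w))) \<in> borel_measurable \<nu>"
   and gb: "\<forall>b. \<bar>g b\<bar> \<le> R" and g1: "(\<integral>w. \<bar>F w - g (\<beta> w)\<bar> \<partial>\<nu>) \<le> \<delta>"
   and g2: "(\<integral>w. \<bar>F (U w) - g (path_add (\<beta> w) (u w))\<bar> \<partial>\<nu>) \<le> \<delta>"
   and sb: "shift_bounds g \<delta>"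
   using approx[OF \<delta>] by (elim exE conjE)
  have g3: "(\<integral>\<^sup>+w. ennreal \<bar>g (path_add (\<beta> w) (u w))\<bar> \<partial>\<nu>)
    \<le> (\<integral>\<^sup>+w. ennreal (\<bar>g (\<beta> w)\<bar> powr p) \<partial>\<nu>) + ennreal Kc + ennreal \<delta>"
   using sb p unfolding shift_bounds_def Kc_def by blast
  have iX: "integrable \<nu> (\<lambda>w. g (path_add (\<beta> w) (u w)))"
   by (rule integrable_const_bound[of _ R]) (auto intro!: AE_I2 gb[rule_format])
  have igB: "integrable \<nu> (\<lambda>w. g (\<beta> w))"
   by (rule integrable_const_bound[of _ R]) (auto intro!: AE_I2 gb[rule_format])
  have iF0: "integrable \<nu> F" by (rule integrable_const_bound[of _ R]) (auto intro!: AE_I2 FR)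
  let ?X = "\<lambda>w. g (path_add (\<beta> w) (u w))"
  have "(\<integral>\<^sup>+w. ennreal \<bar>F (U w)\<bar> \<partial>\<nu>) \<le> (\<integral>\<^sup>+w. ennreal \<bar>?X w\<bar> + ennreal \<bar>F (U w) - ?X w\<bar> \<partial>\<nu>)"
   by (intro nn_integral_mono) (auto simp: ennreal_plus[symmetric] simp del: ennreal_plus intro!: ennreal_leI)
  also have "\<dots> = (\<integral>\<^sup>+w. ennreal \<bar>?X w\<bar> \<partial>\<nu>) + (\<integral>\<^sup>+w. ennreal \<bar>F (U w) - ?X w\<bar> \<partial>\<nu>)"
   by (rule nn_integral_add) measurable
  also have "(\<integral>\<^sup>+w. ennreal \<bar>F (U w) - ?X w\<bar> \<partial>\<nu>) = ennreal (\<integral>w. \<bar>F (U w) - ?X w\<bar> \<partial>\<nu>)"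
   using iFU iX by (intro nn_integral_eq_integral) auto
  also have "\<dots> \<le> ennreal \<delta>" by (rule ennreal_leI[OF g2])
  finally have "(\<integral>\<^sup>+w. ennreal \<bar>F (U w)\<bar> \<partial>\<nu>) \<le> (\<integral>\<^sup>+w. ennreal \<bar>?X w\<bar> \<partial>\<nu>) + ennreal \<delta>" by (simp add: add_left_mono)
  also have "\<dots> \<le> (\<integral>\<^sup>+w. ennreal (\<bar>g (\<beta> w)\<bar> powr p) \<partial>\<nu>) + ennreal Kc + ennreal \<delta> + ennreal \<delta>"
   by (intro add_right_mono g3)
  also have "(\<integral>\<^sup>+w. ennreal (\<bar>g (\<beta> w)\<bar> powr p) \<partial>\<nu>)
    \<le> (\<integral>\<^sup>+w. ennreal (\<bar>F w\<bar> powr p) + ennreal Lp * ennreal \<bar>F w - g (\<beta> w)\<bar> \<partial>\<nu>)"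
  proof (rule nn_integral_mono)
   fix w
   have "\<bar>g (\<beta> w)\<bar> powr p \<le> \<bar>F w\<bar> powr p + Lp * \<bar>\<bar>g (\<beta> w)\<bar> - \<bar>F w\<bar>\<bar>"
    unfolding Lp_def by (rule powr_lipschitz[OF p]) (use gb in auto)
   also have "\<dots> \<le> \<bar>F w\<bar> powr p + Lp * \<bar>F w - g (\<beta> w)\<bar>"
    using Lp by (intro add_left_mono mult_left_mono) auto
   finally show "ennreal (\<bar>g (\<beta> w)\<bar> powr p) \<le> ennreal (\<bar>F w\<bar> powr p) + ennreal Lp * ennreal \<bar>F w - g (\<beta> w)\<bar>"
    using Lp by (simp add: ennreal_mult'[symmetric] ennreal_plus[symmetric] ennreal_leI del: ennreal_plus)
  qed
  also have "\<dots> = (\<integral>\<^sup>+w. ennreal (\<bar>F w\<bar> powr p) \<partial>\<nu>) + ennreal Lp * (\<integral>\<^sup>+w. ennreal \<bar>F w - g (\<beta> w)\<bar> \<partial>\<nu>)"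
   by (simp add: nn_integral_add nn_integral_cmult)
  also have "(\<integral>\<^sup>+w. ennreal \<bar>F w - g (\<beta> w)\<bar> \<partial>\<nu>) = ennreal (\<integral>w. \<bar>F w - g (\<beta> w)\<bar> \<partial>\<nu>)"
   using iF0 igB by (intro nn_integral_eq_integral) auto
  also have "\<dots> \<le> ennreal \<delta>" by (rule ennreal_leI[OF g1])
  finally have "(\<integral>\<^sup>+w. ennreal \<bar>F (U w)\<bar> \<partial>\<nu>)
   \<le> (\<integral>\<^sup>+w. ennreal (\<bar>F w\<bar> powr p) \<partial>\<nu>) + ennreal Lp * ennreal \<delta> + ennreal Kc + ennreal \<delta> + ennreal \<delta>"
   by (simp add: add_left_mono add_right_mono mult_left_mono)
  also have "\<dots> = (\<integral>\<^sup>+w. ennreal (\<bar>F w\<bar> powr p) \<partial>\<nu>) + ennreal Kc + (ennreal Lp * ennreal \<delta> + ennreal \<delta> + ennreal \<delta>)"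
   by (simp add: add_ac)
  also have "ennreal Lp * ennreal \<delta> + ennreal \<delta> + ennreal \<delta> = ennreal e"
   unfolding \<delta>e[symmetric] using Lp \<delta> by (simp add: ennreal_mult'[symmetric] ennreal_plus[symmetric] del: ennreal_plus)
  finally show "(\<integral>\<^sup>+w. ennreal \<bar>F (U w)\<bar> \<partial>\<nu>) \<le> (\<integral>\<^sup>+w. ennreal (\<bar>F w\<bar> powr p) \<partial>\<nu>) + ennreal Kc + ennreal e" .
 qed
qed

text \<open>Clamping at level \<open>n\<close> reduces to bounded functions. The moment bound,
  uniform in \<open>n\<close>, shows by monotone convergence that \<open>f (U w)\<close> is
  integrable; it then dominates the clamped functions in the passage to the limit.\<close>

lemma lower_bound:
 assumes U: "U \<in> measurable \<nu> path_space" and ac: "absolutely_continuous \<nu> (distr \<nu> path_space U)"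
  and shift: "AE w in \<nu>. \<beta> (U w) = path_add (\<beta> w) (u w)"
  and p: "p > 1" and f: "f \<in> borel_measurable \<nu>" and fp: "integrable \<nu> (\<lambda>w. \<bar>f w\<bar> powr p)"
  and e1: "integrable \<nu> (\<lambda>w. exp (- f w))"
 shows "- ln (\<integral>w. exp (- f w) \<partial>\<nu>) \<le> (\<integral>w. f (U w) + cm_norm_sq (u w) / 2 \<partial>\<nu>)"
proof -
 have UN: "U \<in> measurable \<nu> \<nu>" using U path_measurable_nu by blast
 note [measurable] = f measurable_compose[OF UN f]
 define F where "F n w = max (- real n) (min (f w) (real n))" for n w
 have Fm [measurable]: "F n \<in> borel_measurable \<nu>" "(\<lambda>w. F n (U w)) \<in> borel_measurable \<nu>" for n
  unfolding F_def[abs_def] by measurable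
 have Fb: "\<bar>F n w\<bar> \<le> real n" for n w by (auto simp: F_def)
 have Ff: "\<bar>F n w\<bar> \<le> \<bar>f w\<bar>" for n w by (auto simp: F_def)
 have Flim: "(\<lambda>n. F n w) \<longlonglongrightarrow> f w" for w
 proof (rule tendsto_eventually)
  obtain k :: nat where k: "\<bar>f w\<bar> \<le> real k" using real_arch_simple by blast
  show "\<forall>\<^sub>F n in sequentially. F n w = f w"
   using eventually_ge_at_top[of k]
  proof eventually_elim
   case (elim n)
   then have "\<bar>f w\<bar> \<le> real n" using k by linarith
   then show ?case by (auto simp: F_def)
  qed
 qed
 note B = bounded_function_bounds[OF U ac shift Fm(1) Fb of_nat_0_le_iff]
 define Kc where "Kc = moment_const p"
 have "(\<integral>\<^sup>+w. ennreal \<bar>f (U w)\<bar> \<partial>\<nu>) \<le> (\<integral>\<^sup>+w. ennreal (\<bar>f w\<bar> powr p) \<partial>\<nu>) + ennreal Kc"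
 proof (rule LIMSEQ_le_const2)
  show "(\<lambda>n. \<integral>\<^sup>+w. ennreal \<bar>F n (U w)\<bar> \<partial>\<nu>) \<longlonglongrightarrow> (\<integral>\<^sup>+w. ennreal \<bar>f (U w)\<bar> \<partial>\<nu>)"
  proof (rule nn_integral_LIMSEQ)
   show "incseq (\<lambda>n w. ennreal \<bar>F n (U w)\<bar>)"
    by (intro incseq_SucI le_funI ennreal_leI) (auto simp: F_def)
   show "(\<lambda>n. ennreal \<bar>F n (U w)\<bar>) \<longlonglongrightarrow> ennreal \<bar>f (U w)\<bar>" for w
    by (intro tendsto_ennrealI tendsto_rabs Flim)
  qed measurable
  show "\<exists>N. \<forall>n\<ge>N. (\<integral>\<^sup>+w. ennreal \<bar>F n (U w)\<bar> \<partial>\<nu>) \<le> (\<integral>\<^sup>+w. ennreal (\<bar>f w\<bar> powr p) \<partial>\<nu>) + ennreal Kc"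
  proof (intro exI allI impI)
   fix n
   have "(\<integral>\<^sup>+w. ennreal \<bar>F n (U w)\<bar> \<partial>\<nu>) \<le> (\<integral>\<^sup>+w. ennreal (\<bar>F n w\<bar> powr p) \<partial>\<nu>) + ennreal Kc"
    unfolding Kc_def by (rule B(2)[OF p])
   also have "\<dots> \<le> (\<integral>\<^sup>+w. ennreal (\<bar>f w\<bar> powr p) \<partial>\<nu>) + ennreal Kc"
    using p Ff by (intro add_right_mono nn_integral_mono ennreal_leI powr_mono2) auto
   finally show "(\<integral>\<^sup>+w. ennreal \<bar>F n (U w)\<bar> \<partial>\<nu>) \<le> (\<integral>\<^sup>+w. ennreal (\<bar>f w\<bar> powr p) \<partial>\<nu>) + ennreal Kc" .
  qed
 qed
 also have "\<dots> < \<infinity>" using fp by (simp add: nn_integral_eq_integral)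
 finally have ifU: "integrable \<nu> (\<lambda>w. f (U w))" by (intro integrableI_bounded) auto
 have c: "(\<lambda>n. \<integral>w. exp (- F n w) \<partial>\<nu>) \<longlonglongrightarrow> (\<integral>w. exp (- f w) \<partial>\<nu>)" "0 < (\<integral>w. exp (- f w) \<partial>\<nu>)"
  using exp_clamp_integral[OF f e1] by (simp_all add: F_def)
 have "(\<lambda>n. \<integral>w. F n (U w) \<partial>\<nu>) \<longlonglongrightarrow> (\<integral>w. f (U w) \<partial>\<nu>)"
  by (rule integral_dominated_convergence[where w = "\<lambda>w. \<bar>f (U w)\<bar>"]) (use ifU Flim Ff in auto)
 then have r: "(\<lambda>n. (\<integral>w. F n (U w) \<partial>\<nu>) + (\<integral>w. cm_norm_sq (u w) / 2 \<partial>\<nu>))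
   \<longlonglongrightarrow> (\<integral>w. f (U w) \<partial>\<nu>) + (\<integral>w. cm_norm_sq (u w) / 2 \<partial>\<nu>)" by (intro tendsto_intros)
 have l: "(\<lambda>n. - ln (\<integral>w. exp (- F n w) \<partial>\<nu>)) \<longlonglongrightarrow> - ln (\<integral>w. exp (- f w) \<partial>\<nu>)"
  using c by (intro tendsto_minus tendsto_ln) auto
 have "- ln (\<integral>w. exp (- f w) \<partial>\<nu>) \<le> (\<integral>w. f (U w) \<partial>\<nu>) + (\<integral>w. cm_norm_sq (u w) / 2 \<partial>\<nu>)"
  by (rule LIMSEQ_le[OF l r]) (use B(1) in auto)
 also have "\<dots> = (\<integral>w. f (U w) + cm_norm_sq (u w) / 2 \<partial>\<nu>)"
  by (rule Bochner_Integration.integral_add[OF ifU energy_integrable, symmetric])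
 finally show ?thesis .
qed

end

theorem theorem5:
 fixes \<nu> :: "(real \<Rightarrow> real ^ 'n) measure"
  and \<beta> :: "(real \<Rightarrow> real ^ 'n) \<Rightarrow> real \<Rightarrow> real ^ 'n"
  and W :: "((real \<Rightarrow> real ^ 'n) \<Rightarrow> real \<Rightarrow> real ^ 'n) \<Rightarrow> (real \<Rightarrow> real ^ 'n) \<Rightarrow> real \<Rightarrow> real ^ 'n"
  and f :: "(real \<Rightarrow> real ^ 'n) \<Rightarrow> real"
  and p :: real
 assumes "prob_space \<nu>" and "sets \<nu> = sets path_space"
  and "brownian_motion \<nu> \<beta>"
  and "\<And>u. u \<in> bounded_drifts \<nu> \<Longrightarrow> W u \<in> measurable \<nu> path_space"
  and "\<And>t. t \<in> {0..1} \<Longrightarrow>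
      sets (completed_filtration \<nu> \<beta> t) = sets (completed_filtration \<nu> (\<lambda>w. w) t)"
  and "\<And>w. w \<in> space \<nu> \<Longrightarrow> W (\<lambda>_. path_zero) w = w"
  and "\<And>u. u \<in> bounded_drifts \<nu> \<Longrightarrow>
      distr (density \<nu> (\<lambda>w. ennreal (girsanov_density \<nu> \<beta> u w))) path_space (W u)
       = distr \<nu> path_space (\<lambda>w. w)"
  and "\<And>u. u \<in> bounded_drifts \<nu> \<Longrightarrow> AE w in \<nu>. \<beta> (W u w) = path_add (\<beta> w) (u w)"
  and "\<And>u v. u \<in> bounded_drifts \<nu> \<Longrightarrow> v \<in> bounded_drifts \<nu> \<Longrightarrow>
      AE w in \<nu>. W u (W v w) = W (\<lambda>x. path_add (v x) (u (W v x))) w"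
  and "p > 1"
  and "f \<in> borel_measurable \<nu>" and "integrable \<nu> (\<lambda>w. \<bar>f w\<bar> powr p)"
  and "integrable \<nu> (\<lambda>w. (\<bar>f w\<bar> + 1) * exp (- f w))"
 shows "ereal (- ln (\<integral>w. exp (- f w) \<partial>\<nu>))
     = (INF u \<in> invertible_drifts \<nu> W.
       ereal (\<integral>w. f (W u w) + cm_norm_sq (u w) / 2 \<partial>\<nu>))"
proof -
 interpret prob_space \<nu> by fact
 interpret controlled \<nu> \<beta> W
  by unfold_locales (use assms in auto)
 let ?Z = "\<integral>w. exp (- f w) \<partial>\<nu>"
 let ?cost = "\<lambda>u. \<integral>w. f (W u w) + cm_norm_sq (u w) / 2 \<partial>\<nu>"
 note f = \<open>p > 1\<close> \<open>f \<in> borel_measurable \<nu>\<close> \<open>integrable \<nu> (\<lambda>w. \<bar>f w\<bar> powr p)\<close>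
 note [measurable] = f(2)
 have e1: "integrable \<nu> (\<lambda>w. exp (- f w))"
  by (rule Bochner_Integration.integrable_bound[OF \<open>integrable \<nu> (\<lambda>w. (\<bar>f w\<bar> + 1) * exp (- f w))\<close>])
   (auto simp: abs_mult distrib_right)
 show ?thesis
 proof (rule antisym)
  show "ereal (- ln ?Z) \<le> (INF u \<in> invertible_drifts \<nu> W. ereal (?cost u))"
  proof (rule INF_greatest)
   fix u assume u: "u \<in> invertible_drifts \<nu> W"
   then have ub: "u \<in> bounded_drifts \<nu>" and inv: "as_invertible \<nu> (W u)" by (auto simp: invertible_drifts_def)
   from ub obtain d C where u_path: "u \<in> measurable \<nu> path_space" and d: "adapted_density \<nu> u d"
    and C: "AE (t, w) in leb01 \<Otimes>\<^sub>M \<nu>. norm (d t w) \<le> C"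
    unfolding bounded_drifts_def L0_adapted_def by blast
   \<comment> \<open>The maximum supplies the sign condition of the locale, as
     \<open>bounded_drifts\<close> fixes no sign for \<open>C\<close>.\<close>
   interpret bounded_drift \<nu> \<beta> u d "max 0 C"
   proof
    show "AE (t, w) in leb01 \<Otimes>\<^sub>M \<nu>. norm (d t w) \<le> max 0 C" using C by eventually_elim auto
   qed (use u_path d in auto)
   have "- ln ?Z \<le> ?cost u"
    by (rule lower_bound[OF W_measurable[OF ub] _ W_shift[OF ub] f e1]) (use inv in \<open>simp add: as_invertible_def\<close>)
   then show "ereal (- ln ?Z) \<le> ereal (?cost u)" by simp
  qed
  show "(INF u \<in> invertible_drifts \<nu> W. ereal (?cost u)) \<le> ereal (- ln ?Z)"
  proof (rule ereal_le_epsilon2)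
   fix e :: real assume "0 < e"
   from upper_bound[OF f \<open>integrable \<nu> (\<lambda>w. (\<bar>f w\<bar> + 1) * exp (- f w))\<close> this]
   obtain u where "u \<in> invertible_drifts \<nu> W" "?cost u \<le> - ln ?Z + e" by blast
   then show "(INF u \<in> invertible_drifts \<nu> W. ereal (?cost u)) \<le> ereal (- ln ?Z) + ereal e"
    by (intro INF_lower2) auto
  qed
 qed
qed

end
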